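(* Let $n\ge 2$, $\gamma>1$, and let $Cone_\Sigma\subset\mathbb{R}^n$ be a $C^{1,1}$ epigraphical cone with norms $(L,K)$ whose frequency $\phi=\phi_\Sigma$ satisfies $\phi=\frac{2}{1+\gamma}$. Put $\Omega=Cone_\Sigma\cap B_1$, let $U$ be the solution of $$-\Delta U=U^{-\gamma}\ \text{ in }\Omega,\qquad U=0\ \text{ on }\partial\Omega,$$ and fix a defining function $\eta$ of $Cone_\Sigma$. Then the following hold (with $\sim$ denoting two-sided comparability with constants depending only on $(n,\gamma,L,K)$). (1) If $1<\gamma<2$, then $$U(x)\sim\begin{cases}\left(\mathrm{dist}(x,\partial\Omega)\right)^{\frac{2}{1+\gamma}} & \text{in }\Omega\setminus B_{1/16},\\ |x|^{\frac{2}{1+\gamma}}\eta(x)^{\frac{2}{1+\gamma}}\sim\left(\mathrm{dist}(x,\partial\Omega)\right)^{\frac{2}{1+\gamma}} & \text{in }\Omega\cap B_{1/16}\cap\{\eta(x)\le(\ln\frac1{|x|})^{\frac{1}{1-\gamma}}\},\\ |x|^{\frac{2}{1+\gamma}}(\ln\frac{1}{|x|})^{\frac{1}{1+\gamma}}\eta(x) & \text{in }\Omega\cap B_{1/16}\cap\{\eta(x)\ge(\ln\frac1{|x|})^{\frac{1}{1-\gamma}}\}.\end{cases}$$ (2) If $\gamma=2$, then $$U(x)\sim\begin{cases}\left(\mathrm{dist}(x,\partial\Omega)\right)^{\frac{2}{3}} & \text{in }\Omega\setminus B_{1/16},\\ |x|^{\frac{2}{3}}\eta(x)^{\frac{2}{3}}\sim\left(\mathrm{dist}(x,\partial\Omega)\right)^{\frac{2}{3}}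 & \text{in }\Omega\cap B_{1/16}\cap\{\eta(x)\le[(\ln\frac1{|x|})(\ln\ln\frac{1}{|x|})]^{-1}\},\\ |x|^{\frac{2}{3}}[(\ln\frac{1}{|x|})(\ln\ln\frac1{|x|})]^{\frac13}\eta(x) & \text{in }\Omega\cap B_{1/16}\cap\{\eta(x)\ge[(\ln\frac1{|x|})(\ln\ln\frac{1}{|x|})]^{-1}\}.\end{cases}$$ (3) If $\gamma>2$, then $$U(x)\sim\begin{cases}\left(\mathrm{dist}(x,\partial\Omega)\right)^{\frac{2}{1+\gamma}} & \text{in }\Omega\setminus B_{1/16},\\ |x|^{\frac{2}{1+\gamma}}\eta(x)^{\frac{2}{1+\gamma}}\sim\left(\mathrm{dist}(x,\partial\Omega)\right)^{\frac{2}{1+\gamma}} & \text{in }\Omega\cap B_{1/16}\cap\{\eta(x)\le(\ln\frac1{|x|})^{-1}\},\\ |x|^{\frac{2}{1+\gamma}}(\ln\frac{1}{|x|})^{\frac{\gamma-1}{1+\gamma}}\eta(x) & \text{in }\Omega\cap B_{1/16}\cap\{\eta(x)\ge(\ln\frac1{|x|})^{-1}\}.\end{cases}$$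
   Context: $B_r$ is the open ball of radius $r$ centered at $0$ in $\mathbb{R}^n$; points are written $x=(x',x_n)$ and $B_r'$ is the ball in $\mathbb{R}^{n-1}$. Cones: for $\Sigma\subseteq\partial B_1=\mathbb{S}^{n-1}$, $Cone_\Sigma=\{x\in\mathbb{R}^n\setminus\{0\}: x/|x|\in\Sigma\}$. It is a $C^{1,1}$ epigraphical cone if $Cone_\Sigma=\{x_n>g(x')\}$ for some $g:\mathbb{R}^{n-1}\to\mathbb{R}$ with $g(\lambda x')=\lambda g(x')$ for all $\lambda\ge0$, and $g\in C^{1,1}(B_2'\setminus B_1')$. Its norms are $L=\|g\|_{C^{0,1}(B_2'\setminus B_1')}$ and $K=[g]_{C^{1,1}(B_2'\setminus B_1')}$. Frequency: let $\lambda_\Sigma$ be the first Dirichlet eigenvalue of the Laplace-Beltrami operator $-\Delta_\Sigma$ on $\Sigma$; the frequency $\phi_\Sigma$ is the positive solution of $\phi(\phi+n-2)=\lambda_\Sigma$. Uniform constants: a constant is uniform if it depends only on $(n,\gamma,L,K)$. For nonnegative quantities, $q_1\lesssim q_2$ means $q_1\le Cq_2$ with $C>0$ uniform, $q_1\gtrsim q_2$ means $q_2\lesssim q_1$, and $q_1\sim q_2$ means both. Defining function: $\eta(x)=\eta_\Sigma(x/|x|)$ for $x\in Cone_\Sigma$, where $\eta_\Sigma\in C^{1,1}(\Sigma)$ is a function satisfying, for some small uniform constants $d_0,h_0>0$: (a) $\eta_\Sigma>0$ in the interior of $\Sigma$, $\eta_\Sigma=0$ on $\partial\Sigma$; (b)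 $\eta_\Sigma(\vec\theta)\ge h_0$ whenever $\mathrm{dist}(\vec\theta,\partial\Sigma)\ge d_0$; (c) $\eta_\Sigma(\vec\theta)\sim\mathrm{dist}(\vec\theta,\partial\Sigma)$ whenever $\mathrm{dist}(\vec\theta,\partial\Sigma)\le d_0$; (d) $\|\eta_\Sigma\|_{C^{1,1}(\Sigma)}\sim1$ and $|\nabla\eta_\Sigma|\sim1$ on $\partial\Sigma$; (e) for $0\le h<h_0$, the level set $\eta_\Sigma^{-1}(h)$ is a $C^{1,1}$ hypersurface of $\partial B_1$ with $\mathcal{H}^{n-2}(\eta_\Sigma^{-1}(h))\sim\mathcal{H}^{n-2}(\partial\Sigma)$ and $|\nabla\eta_\Sigma|\sim1$ on it; (f) for $0\le h<h_0$, $\mathcal{H}^{n-1}(\eta_\Sigma^{-1}([0,h]))\sim h\cdot\mathcal{H}^{n-2}(\partial\Sigma)$. The solution $U$ is the unique positive function $U\in C^\infty(\Omega)\cap C(\overline\Omega)$ solving the stated Dirichlet problem. *)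

theory Defs
  imports "HOL-Analysis.Analysis"
begin

definition comparable :: "'a::{times,ord} \<Rightarrow> 'a \<Rightarrow> 'a \<Rightarrow> bool" where
  "comparable C q1 q2 \<longleftrightarrow> q1 \<le> C * q2 \<and> q2 \<le> C * q1"


section \<open>Differential operators and regularity classes\<close>

definition partial :: "'a::euclidean_space \<Rightarrow> ('a \<Rightarrow> real) \<Rightarrow> 'a \<Rightarrow> real" where
  "partial b f x = frechet_derivative f (at x) b"

text \<open>The class \<open>C\<^sup>k\<close> on an open set.\<close>

primrec Ck_on :: "nat \<Rightarrow> ('a::euclidean_space \<Rightarrow> real) \<Rightarrow> 'a set \<Rightarrow> bool" where
  "Ck_on 0 f S \<longleftrightarrow> continuous_on S f"
| "Ck_on (Suc k) f S \<longleftrightarrow>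
     (\<forall>x\<in>S. f differentiable (at x)) \<and> (\<forall>b\<in>Basis. Ck_on k (partial b f) S)"

definition Cinf_on :: "('a::euclidean_space \<Rightarrow> real) \<Rightarrow> 'a set \<Rightarrow> bool" where
  "Cinf_on f S \<longleftrightarrow> (\<forall>k. Ck_on k f S)"

definition laplacian :: "('a::euclidean_space \<Rightarrow> real) \<Rightarrow> 'a \<Rightarrow> real" where
  "laplacian f x = (\<Sum>b\<in>Basis. partial b (partial b f) x)"

definition grad :: "('a::euclidean_space \<Rightarrow> real) \<Rightarrow> 'a \<Rightarrow> 'a" where
  "grad f x = (THE D. GDERIV f x :> D)"

text \<open>The best Lipschitz constant; meaningful only if \<open>f\<close> is Lipschitz on \<open>A\<close>
  (\<open>lipschitz_on\<close> requires a nonnegative constant, so the set is bounded below).\<close>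

definition lip_seminorm :: "'a::metric_space set \<Rightarrow> ('a \<Rightarrow> 'b::metric_space) \<Rightarrow> real" where
  "lip_seminorm A f = Inf {M. M-lipschitz_on A f}"

text \<open>Derivatives are two-sided, also at points of \<open>A\<close> that are not interior.  Below this is
  applied to open sets, and to the half-open annulus \<open>1 \<le> |x'| < 2\<close> with positively homogeneous
  functions; the latter are differentiable at the points of \<open>|x'| = 1\<close> as soon as they are
  in the open annulus.\<close>

definition C11_on :: "'a::euclidean_space set \<Rightarrow> ('a \<Rightarrow> real) \<Rightarrow> bool" where
  "C11_on A f \<longleftrightarrow> (\<forall>x\<in>A. f differentiable (at x)) \<and> bounded (f ` A) \<and> bounded (grad f ` A)
     \<and> (\<exists>M. M-lipschitz_on A (grad f))"

definition C01_norm :: "'a::euclidean_space set \<Rightarrow> ('a \<Rightarrow> real) \<Rightarrow> real" where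
  "C01_norm A f = (SUP x\<in>A. \<bar>f x\<bar>) + lip_seminorm A f"

definition C11_seminorm :: "'a::euclidean_space set \<Rightarrow> ('a \<Rightarrow> real) \<Rightarrow> real" where
  "C11_seminorm A f = lip_seminorm A (grad f)"


section \<open>Cones\<close>

definition Cone :: "'a::euclidean_space set \<Rightarrow> 'a set" where
  "Cone S = {x. x \<noteq> 0 \<and> x /\<^sub>R norm x \<in> S}"

text \<open>\<open>\<real>\<^sup>n\<close> is \<open>\<real>\<^sup>n\<^sup>-\<^sup>1 \<times> \<real>\<close>, whose library norm is the Euclidean one;
  \<open>fst\<close> is \<open>x'\<close> and \<open>snd\<close> is \<open>x\<^sub>n\<close>.\<close>

abbreviation annulus :: "'b::euclidean_space set" where
  "annulus \<equiv> ball 0 2 - ball 0 1"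

definition C11_epigraphical_cone ::
    "('b::euclidean_space \<times> real) set \<Rightarrow> ('b \<Rightarrow> real) \<Rightarrow> bool" where
  "C11_epigraphical_cone S g \<longleftrightarrow>
     S \<subseteq> sphere 0 1 \<and> Cone S = {x. snd x > g (fst x)} \<and>
     (\<forall>l\<ge>0. \<forall>y. g (l *\<^sub>R y) = l * g y) \<and> C11_on annulus g"

definition cone_norms :: "('b::euclidean_space \<Rightarrow> real) \<Rightarrow> real \<Rightarrow> real \<Rightarrow> bool" where
  "cone_norms g L K \<longleftrightarrow> L = C01_norm annulus g \<and> K = C11_seminorm annulus g"


section \<open>Calculus on the unit sphere\<close>

abbreviation sph_frontier :: "'a::euclidean_space set \<Rightarrow> 'a set" where
  "sph_frontier S \<equiv> top_of_set (sphere 0 1) frontier_of S"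

abbreviation sph_interior :: "'a::euclidean_space set \<Rightarrow> 'a set" where
  "sph_interior S \<equiv> top_of_set (sphere 0 1) interior_of S"

definition extend0 :: "('a::euclidean_space \<Rightarrow> real) \<Rightarrow> 'a \<Rightarrow> real" where
  "extend0 v x = v (x /\<^sub>R norm x)"

text \<open>On the unit sphere the Laplace--Beltrami operator and the tangential gradient of \<open>v\<close> are
  the Euclidean ones of the extension of \<open>v\<close> that is homogeneous of degree 0.\<close>

definition sph_laplacian :: "('a::euclidean_space \<Rightarrow> real) \<Rightarrow> 'a \<Rightarrow> real" where
  "sph_laplacian v = laplacian (extend0 v)"

text \<open>For points of the relative boundary of \<open>S\<close> the derivative is taken from within \<open>S\<close>.\<close>

definition has_sph_grad ::
    "'a::euclidean_space set \<Rightarrow> ('a \<Rightarrow> real) \<Rightarrow> 'a \<Rightarrow> 'a \<Rightarrow> bool" where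
  "has_sph_grad S f p D \<longleftrightarrow> (extend0 f has_derivative (\<lambda>h. h \<bullet> D)) (at p within Cone S)"

definition sph_grad :: "'a::euclidean_space set \<Rightarrow> ('a \<Rightarrow> real) \<Rightarrow> 'a \<Rightarrow> 'a" where
  "sph_grad S f p = (THE D. has_sph_grad S f p D)"

text \<open>Regularity up to the boundary: the functions \<open>sph_C11\<close> and \<open>sph_C11_norm\<close> are used with a
  relatively closed \<open>S\<close>.\<close>

definition sph_C11 :: "'a::euclidean_space set \<Rightarrow> ('a \<Rightarrow> real) \<Rightarrow> bool" where
  "sph_C11 S f \<longleftrightarrow> (\<forall>p\<in>S. \<exists>D. has_sph_grad S f p D) \<and> bounded (f ` S) \<and>
     bounded (sph_grad S f ` S) \<and> (\<exists>M. M-lipschitz_on S (sph_grad S f))"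

definition sph_C11_norm :: "'a::euclidean_space set \<Rightarrow> ('a \<Rightarrow> real) \<Rightarrow> real" where
  "sph_C11_norm S f =
     (SUP p\<in>S. \<bar>f p\<bar>) + (SUP p\<in>S. norm (sph_grad S f p)) + lip_seminorm S (sph_grad S f)"

text \<open>A \<open>C\<^sup>1\<^sup>,\<^sup>1\<close> hypersurface of the unit sphere is locally a regular zero set of a \<open>C\<^sup>1\<^sup>,\<^sup>1\<close>
  function, regular meaning that the tangential part of the gradient does not vanish.\<close>

definition sph_C11_hypersurface :: "'a::euclidean_space set \<Rightarrow> bool" where
  "sph_C11_hypersurface M \<longleftrightarrow> M \<subseteq> sphere 0 1 \<and>
     (\<forall>p\<in>M. \<exists>V f. open V \<and> p \<in> V \<and> C11_on V f \<and>
        (\<forall>q\<in>V \<inter> sphere 0 1. grad f q - (grad f q \<bullet> q) *\<^sub>R q \<noteq> 0) \<and>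
        M \<inter> V = {q \<in> V \<inter> sphere 0 1. f q = 0})"


section \<open>Hausdorff measure\<close>

text \<open>Normalised so that the \<open>k\<close>-dimensional measure agrees with Lebesgue measure on \<open>\<real>\<^sup>k\<close>.
  The empty set has to be treated separately because \<open>0 ^ 0 = 1\<close>; for nonempty sets this
  convention makes the measure of dimension 0 the counting measure.\<close>

definition hausdorff_weight :: "nat \<Rightarrow> 'a::metric_space set \<Rightarrow> ennreal" where
  "hausdorff_weight k E =
     (if E = {} then 0 else ennreal (unit_ball_vol (real k) * (diameter E / 2) ^ k))"

definition hausdorff_content :: "nat \<Rightarrow> real \<Rightarrow> 'a::metric_space set \<Rightarrow> ennreal" where
  "hausdorff_content k \<delta> A =
     Inf {(\<Sum>i. hausdorff_weight k (E i)) | E :: nat \<Rightarrow> 'a set.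
            A \<subseteq> (\<Union>i. E i) \<and> (\<forall>i. bounded (E i) \<and> diameter (E i) \<le> \<delta>)}"

definition hausdorff_measure :: "nat \<Rightarrow> 'a::metric_space set \<Rightarrow> ennreal" where
  "hausdorff_measure k A = (SUP \<delta>\<in>{0<..}. hausdorff_content k \<delta> A)"


section \<open>Dirichlet eigenvalues and the frequency\<close>

text \<open>Eigenfunctions are classical: \<open>C\<^sup>2\<close> in \<open>S\<close> and continuous up to the boundary.  For the
  Lipschitz domains considered here these are the same as the weak (\<open>H\<^sup>1\<^sub>0\<close>) eigenfunctions.\<close>

definition dirichlet_eigenvalue :: "'a::euclidean_space set \<Rightarrow> real \<Rightarrow> bool" where
  "dirichlet_eigenvalue S lam \<longleftrightarrow>
     (\<exists>v. Ck_on 2 (extend0 v) (Cone S) \<and> continuous_on (closure S) v \<and>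
          (\<forall>p\<in>sph_frontier S. v p = 0) \<and> (\<exists>p\<in>S. v p \<noteq> 0) \<and>
          (\<forall>p\<in>S. - sph_laplacian v p = lam * v p))"

definition first_dirichlet_eigenvalue :: "'a::euclidean_space set \<Rightarrow> real \<Rightarrow> bool" where
  "first_dirichlet_eigenvalue S lam \<longleftrightarrow>
     dirichlet_eigenvalue S lam \<and> (\<forall>mu. dirichlet_eigenvalue S mu \<longrightarrow> lam \<le> mu)"

definition is_frequency :: "'a::euclidean_space set \<Rightarrow> real \<Rightarrow> bool" where
  "is_frequency S phi \<longleftrightarrow> phi > 0 \<and>
     (\<exists>lam. first_dirichlet_eigenvalue S lam \<and> phi * (phi + real DIM('a) - 2) = lam)"


section \<open>Defining functions\<close>

definition level_set :: "'a::euclidean_space set \<Rightarrow> ('a \<Rightarrow> real) \<Rightarrow> real set \<Rightarrow> 'a set" where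
  "level_set S eta T = {p \<in> closure S. eta p \<in> T}"

text \<open>\<open>C0\<close> is a common constant for all the comparabilities. The function \<open>eta\<close> is only relevant
  on the closure of \<open>S\<close>; on the cone it is used through \<open>extend0 eta\<close>.\<close>

definition defining_function ::
    "'a::euclidean_space set \<Rightarrow> real \<Rightarrow> real \<Rightarrow> real \<Rightarrow> ('a \<Rightarrow> real) \<Rightarrow> bool" where
  "defining_function S d0 h0 C0 eta \<longleftrightarrow>
     sph_C11 (closure S) eta \<and>
     (\<forall>p\<in>sph_interior S. eta p > 0) \<and> (\<forall>p\<in>sph_frontier S. eta p = 0) \<and>
     (\<forall>p\<in>closure S. infdist p (sph_frontier S) \<ge> d0 \<longrightarrow> eta p \<ge> h0) \<and>
     (\<forall>p\<in>closure S. infdist p (sph_frontier S) \<le> d0 \<longrightarrow>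
        comparable C0 (eta p) (infdist p (sph_frontier S))) \<and>
     comparable C0 (sph_C11_norm (closure S) eta) 1 \<and>
     (\<forall>p\<in>sph_frontier S. comparable C0 (norm (sph_grad (closure S) eta p)) 1) \<and>
     (\<forall>h. 0 \<le> h \<and> h < h0 \<longrightarrow>
        sph_C11_hypersurface (level_set S eta {h}) \<and>
        comparable (ennreal C0) (hausdorff_measure (DIM('a) - 2) (level_set S eta {h}))
          (hausdorff_measure (DIM('a) - 2) (sph_frontier S)) \<and>
        (\<forall>p\<in>level_set S eta {h}. comparable C0 (norm (sph_grad (closure S) eta p)) 1)) \<and>
     (\<forall>h. 0 \<le> h \<and> h < h0 \<longrightarrow>
        comparable (ennreal C0) (hausdorff_measure (DIM('a) - 1) (level_set S eta {0..h}))
          (ennreal h * hausdorff_measure (DIM('a) - 2) (sph_frontier S)))"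


section \<open>The singular Dirichlet problem\<close>

definition is_solution :: "real \<Rightarrow> 'a::euclidean_space set \<Rightarrow> ('a \<Rightarrow> real) \<Rightarrow> bool" where
  "is_solution \<gamma> \<Omega> U \<longleftrightarrow>
     Cinf_on U \<Omega> \<and> continuous_on (closure \<Omega>) U \<and> (\<forall>x\<in>\<Omega>. U x > 0) \<and>
     (\<forall>x\<in>\<Omega>. - laplacian U x = U x powr (- \<gamma>)) \<and> (\<forall>x\<in>frontier \<Omega>. U x = 0)"

end

theory Submission
  imports Defs "HOL-Complex_Analysis.Great_Picard"
begin

text \<open>The exponent \<open>2 / (1 + \<gamma>)\<close> forced by the equation near a smooth boundary equals the degree \<open>\<phi>\<close> of the positive
  homogeneous harmonic function \<open>H\<close> of the cone, so that \<open>U\<close> is in resonance with \<open>H\<close>. With \<open>t = ln (1 / |x|)\<close>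
  and \<open>e = H / |x| powr \<phi>\<close>, which is comparable to \<open>dist / |x|\<close>, one looks for
  \<open>U \<approx> |x| powr \<phi> * T powr (- \<phi>) * (T * e + G (T * e))\<close>, where \<open>G z\<close> behaves like \<open>z powr \<phi>\<close> for small \<open>z\<close> and
  \<open>- G''\<close> like \<open>(z + z powr \<phi>) powr (- \<gamma>)\<close>. The factor of \<open>H\<close> grows slowly in \<open>t\<close>; balancing its radial
  derivative against the error \<open>\<phi> (\<phi> + n - 2) (G - z G')\<close> gives \<open>T / t \<approx> Lam q (T powr \<phi>)\<close>, that is
  \<open>T = t powr (1 / (\<gamma> - 1))\<close>, \<open>t * ln t\<close> or \<open>t\<close> according as \<open>\<gamma>\<close> is less than,
  equal to or greater than 2. Freezing \<open>T\<close> makes this a subsolution and, with small changes, a supersolution.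
  The function \<open>H\<close> is extremal among the harmonic functions between 0 and \<open>U\<close>; Harnack chains and barriers make
  all constants uniform.\<close>

text \<open>The ansatz closes by scaling: with amplitude \<open>T powr (- phi)\<close>, both the
  singular term and the second angular derivative carry \<open>T^2 * T powr (- phi)\<close>, so a
  single profile \<open>G\<close> serves every \<open>T\<close>. Two obstacles shape the rest. Near
  the boundary of the cone, \<open>H\<close> is known to be comparable to the distance, but its
  gradient is bounded only from above. That suffices for the subsolution; the supersolution needs a
  nondegenerate gradient, so inside its profile \<open>e\<close> is replaced by the distance to the
  boundary divided by \<open>|x|\<close>, made smooth near one point by means of an exterior ball.
  Secondly, the frequency hypothesis supplies an eigenfunction of unknown sign. Positivity is
  produced by a Perron argument below \<open>U\<close> itself, where the lower bound of
  \<open>U\<close> by the distance to the power \<open>phi\<close> leaves room for a positive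
  harmonic function. Estimates rest on comparison of functions with explicit gradient fields, and
  the geometry enters through one number \<open>rho\<close> computed from \<open>L\<close> and
  \<open>K\<close>, so that all constants can be fixed before the cone.\<close>

notation scaleR (infixr "*R" 75)

section \<open>Gradient fields and Laplacians\<close>

text \<open>Gradient \<open>D\<close> and Laplacian \<open>l\<close> are explicit data, so that the
  rules below compute both from the shape of \<open>f\<close>. The value \<open>l x\<close> is the
  trace of the derivative of the field \<open>D\<close> at \<open>x\<close>; second derivatives
  exist pointwise, with no continuity built in.\<close>

definition has_lap :: "'a::euclidean_space set => ('a => real) => ('a => 'a) => ('a => real) => bool" where
 "has_lap V f D l \<longleftrightarrow> (ALL x:V. (f has_derivative (%h. D x \<bullet> h)) (at x) &
   (EX A. (D has_derivative A) (at x) & (SUM b:Basis. A b \<bullet> b) = l x))"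

lemma has_lap_subset: "has_lap V f D l ==> W <= V ==> has_lap W f D l"
 unfolding has_lap_def by blast

lemma has_lap_cong:
 assumes "has_lap V f D l" "open V" "!!x. x : V ==> f x = f' x" "!!x. x : V ==> D x = D' x"
  "!!x. x : V ==> l x = l' x"
 shows "has_lap V f' D' l'"
 unfolding has_lap_def
proof (intro ballI conjI)
 fix x assume x: "x : V"
 have e: "\<forall>\<^sub>F y in nhds x. y : V" using assms(2) x by (simp add: eventually_nhds_in_open)
 from assms(1) x obtain A where A: "(f has_derivative (%h. D x \<bullet> h)) (at x)"
  "(D has_derivative A) (at x)" "(SUM b:Basis. A b \<bullet> b) = l x" unfolding has_lap_def by blast
 show "(f' has_derivative (%h. D' x \<bullet> h)) (at x)"
  using has_derivative_transform_within_open[OF A(1) assms(2) x] assms(3) assms(4)[OF x] by auto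
 have "(D' has_derivative A) (at x)"
  using has_derivative_transform_within_open[OF A(2) assms(2) x] assms(4) by auto
 then show "EX A. (D' has_derivative A) (at x) & (SUM b:Basis. A b \<bullet> b) = l' x"
  using A(3) assms(5)[OF x] by auto
qed

lemma has_lap_continuous: "has_lap V f D l ==> continuous_on V f"
 unfolding has_lap_def by (meson continuous_at_imp_continuous_on has_derivative_continuous)

lemma has_lap_const: "has_lap V (%x. c) (%x. 0) (%x. 0)"
 unfolding has_lap_def
proof (intro ballI conjI)
 fix x :: 'a
 have "((%x::'a. c) has_derivative (%h. 0)) (at x)" by simp
 then show "((%x::'a. c) has_derivative (%h. 0 \<bullet> h)) (at x)" by (simp only: inner_zero_left)
qed (auto intro!: exI[of _ "%h. 0"])

lemma has_lap_inner: "has_lap V (%x. a \<bullet> x) (%x. a) (%x. 0)"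
 unfolding has_lap_def by (auto intro!: exI[of _ "%h. 0"] derivative_eq_intros)

lemma has_lap_add:
 assumes "has_lap V f D l" "has_lap V g E m"
 shows "has_lap V (%x. f x + g x) (%x. D x + E x) (%x. l x + m x)"
 unfolding has_lap_def
proof (intro ballI conjI)
 fix x assume x: "x : V"
 from assms(1) x obtain A where A: "(f has_derivative (%h. D x \<bullet> h)) (at x)"
  "(D has_derivative A) (at x)" "(SUM b:Basis. A b \<bullet> b) = l x" unfolding has_lap_def by blast
 from assms(2) x obtain B where B: "(g has_derivative (%h. E x \<bullet> h)) (at x)"
  "(E has_derivative B) (at x)" "(SUM b:Basis. B b \<bullet> b) = m x" unfolding has_lap_def by blast
 show "((%x. f x + g x) has_derivative (%h. (D x + E x) \<bullet> h)) (at x)"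
  using has_derivative_add[OF A(1) B(1)] by (simp add: inner_add_left)
 show "EX C. ((%x. D x + E x) has_derivative C) (at x) & (SUM b:Basis. C b \<bullet> b) = l x + m x"
  using has_derivative_add[OF A(2) B(2)] A(3) B(3)
  by (intro exI[of _ "%h. A h + B h"]) (simp add: inner_add_left sum.distrib)
qed

lemma has_lap_mult:
 assumes "has_lap V f D l" "has_lap V g E m"
 shows "has_lap V (%x. f x * g x) (%x. f x *R E x + g x *R D x)
  (%x. f x * m x + g x * l x + 2 * (D x \<bullet> E x))"
 unfolding has_lap_def
proof (intro ballI conjI)
 fix x assume x: "x : V"
 from assms(1) x obtain A where A: "(f has_derivative (%h. D x \<bullet> h)) (at x)"
  "(D has_derivative A) (at x)" "(SUM b:Basis. A b \<bullet> b) = l x" unfolding has_lap_def by blast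
 from assms(2) x obtain B where B: "(g has_derivative (%h. E x \<bullet> h)) (at x)"
  "(E has_derivative B) (at x)" "(SUM b:Basis. B b \<bullet> b) = m x" unfolding has_lap_def by blast
 show "((%x. f x * g x) has_derivative (%h. (f x *R E x + g x *R D x) \<bullet> h)) (at x)"
  using has_derivative_mult[OF A(1) B(1)] by (simp add: inner_add_left mult.commute)
 have 1: "((%x. f x *R E x + g x *R D x) has_derivative
   (%h. (f x *R B h + (D x \<bullet> h) *R E x) + (g x *R A h + (E x \<bullet> h) *R D x))) (at x)"
  by (intro has_derivative_add has_derivative_scaleR A B)
 have "(SUM b:Basis. ((f x *R B b + (D x \<bullet> b) *R E x) + (g x *R A b + (E x \<bullet> b) *R D x)) \<bullet> b)
   = f x * (SUM b:Basis. B b \<bullet> b) + g x * (SUM b:Basis. A b \<bullet> b)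
    + 2 * (SUM b:Basis. (D x \<bullet> b) * (E x \<bullet> b))"
  by (simp add: inner_add_left sum.distrib sum_distrib_left algebra_simps)
 also have "... = f x * m x + g x * l x + 2 * (D x \<bullet> E x)"
  using A(3) B(3) by (simp add: euclidean_inner[of "D x" "E x"])
 finally show "EX C. ((%x. f x *R E x + g x *R D x) has_derivative C) (at x) &
   (SUM b:Basis. C b \<bullet> b) = f x * m x + g x * l x + 2 * (D x \<bullet> E x)"
  using 1 by blast
qed

lemma has_lap_cmult:
 assumes "has_lap V f D l"
 shows "has_lap V (%x. c * f x) (%x. c *R D x) (%x. c * l x)"
 using has_lap_mult[OF has_lap_const[of V c] assms] by simp

lemma has_lap_minus:
 assumes "has_lap V f D l"
 shows "has_lap V (%x. - f x) (%x. - D x) (%x. - l x)"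
 using has_lap_cmult[OF assms, of "-1"] by simp

lemma has_lap_diff:
 assumes "has_lap V f D l" "has_lap V g E m"
 shows "has_lap V (%x. f x - g x) (%x. D x - E x) (%x. l x - m x)"
 using has_lap_add[OF assms(1) has_lap_minus[OF assms(2)]] by simp

lemma has_lap_sum:
 assumes "finite I" "!!i. i : I ==> has_lap V (f i) (D i) (l i)"
 shows "has_lap V (%x. SUM i:I. f i x) (%x. SUM i:I. D i x) (%x. SUM i:I. l i x)"
 using assms
proof (induction I rule: finite_induct)
 case empty
 then show ?case using has_lap_const[of V 0] by simp
next
 case (insert i I)
 then show ?case using has_lap_add[of V "f i" "D i" "l i"] by simp
qed

lemma has_lap_comp:
 assumes "has_lap V f D l"
  "!!x. x : V ==> (p has_real_derivative p' (f x)) (at (f x))"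
  "!!x. x : V ==> (p' has_real_derivative p'' (f x)) (at (f x))"
 shows "has_lap V (%x. p (f x)) (%x. p' (f x) *R D x)
  (%x. p'' (f x) * (norm (D x))^2 + p' (f x) * l x)"
 unfolding has_lap_def
proof (intro ballI conjI)
 fix x assume x: "x : V"
 from assms(1) x obtain A where A: "(f has_derivative (%h. D x \<bullet> h)) (at x)"
  "(D has_derivative A) (at x)" "(SUM b:Basis. A b \<bullet> b) = l x" unfolding has_lap_def by blast
 have p: "((%x. q (f x)) has_derivative (%h. (D x \<bullet> h) * d)) (at x)"
  if "(q has_real_derivative d) (at (f x))" for q d
  using has_derivative_compose[OF A(1), of q "(*) d"] that
  by (simp add: has_field_derivative_def mult.commute)
 show "((%x. p (f x)) has_derivative (%h. (p' (f x) *R D x) \<bullet> h)) (at x)"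
  using p[OF assms(2)[OF x]] by (simp add: mult.commute)
 have 1: "((%x. p' (f x) *R D x) has_derivative
   (%h. p' (f x) *R A h + ((D x \<bullet> h) * p'' (f x)) *R D x)) (at x)"
  by (intro has_derivative_scaleR A p[OF assms(3)[OF x]])
 have "(SUM b:Basis. (p' (f x) *R A b + ((D x \<bullet> b) * p'' (f x)) *R D x) \<bullet> b)
   = p'' (f x) * (SUM b:Basis. (D x \<bullet> b) * (D x \<bullet> b)) + p' (f x) * (SUM b:Basis. A b \<bullet> b)"
  by (simp add: inner_add_left sum.distrib sum_distrib_left algebra_simps)
 also have "... = p'' (f x) * (norm (D x))^2 + p' (f x) * l x"
  using A(3) by (simp add: euclidean_inner[of "D x" "D x", symmetric] power2_norm_eq_inner)
 finally show "EX C. ((%x. p' (f x) *R D x) has_derivative C) (at x) &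
   (SUM b:Basis. C b \<bullet> b) = p'' (f x) * (norm (D x))^2 + p' (f x) * l x"
  using 1 by blast
qed

lemma has_lap_normsq:
 fixes c :: "'a::euclidean_space"
 shows "has_lap V (%x. (norm (x - c))^2) (%x. 2 *R (x - c)) (%x. 2 * real DIM('a))"
 unfolding has_lap_def
proof (intro ballI conjI)
 fix x :: 'a
 show "((%x. (norm (x - c))^2) has_derivative (%h. (2 *R (x - c)) \<bullet> h)) (at x)"
  unfolding power2_norm_eq_inner
  by (auto intro!: derivative_eq_intros simp: inner_commute)
 show "EX A. ((%x. 2 *R (x - c)) has_derivative A) (at x) & (SUM b:Basis. A b \<bullet> b) = 2 * real DIM('a)"
  by (rule exI[of _ "%h. 2 *R h"]) (auto intro!: derivative_eq_intros simp: inner_Basis)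
qed

text \<open>The squared norm is smooth everywhere, so the power is taken of it with exponent
  \<open>a/2\<close>. For \<open>a = - DIM('a)\<close> the coefficient
  \<open>a * (a + DIM('a) - 2)\<close> is positive in every dimension; this exponent supplies the
  annular barriers.\<close>

lemma has_lap_norm_powr:
 fixes c :: "'a::euclidean_space"
 assumes "c ~: V"
 shows "has_lap V (%x. norm (x - c) powr a) (%x. (a * norm (x - c) powr (a - 2)) *R (x - c))
  (%x. a * (a + real DIM('a) - 2) * norm (x - c) powr (a - 2))"
proof -
 have q: "((norm (x - c))^2) powr b = norm (x - c) powr (2 * b)" if "x ~= c" for x b
  using that powr_powr[of "norm (x - c)" 2 b] by (simp add: powr_numeral)
 have d: "has_lap (- {c}) (%x. ((norm (x - c))^2) powr (a/2))
   (%x. (a/2 * ((norm (x - c))^2) powr (a/2 - 1)) *R (2 *R (x - c)))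
   (%x. (a/2 * ((a/2 - 1) * ((norm (x - c))^2) powr (a/2 - 1 - 1))) * (norm (2 *R (x - c)))^2
    + (a/2 * ((norm (x - c))^2) powr (a/2 - 1)) * (2 * real DIM('a)))"
  by (rule has_lap_comp[OF has_lap_normsq, where p="%y. y powr (a/2)" and p'="%y. a/2 * y powr (a/2 - 1)"
     and p''="%y. a/2 * ((a/2 - 1) * y powr (a/2 - 1 - 1))"])
   (rule has_real_derivative_powr, simp, intro DERIV_cmult has_real_derivative_powr, simp)
 have "has_lap (- {c}) (%x. norm (x - c) powr a) (%x. (a * norm (x - c) powr (a - 2)) *R (x - c))
  (%x. a * (a + real DIM('a) - 2) * norm (x - c) powr (a - 2))"
 proof (rule has_lap_cong[OF d])
  fix x assume "x : - {c}"
  then have x: "x ~= c" by simp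
  have "((norm (x - c))^2) powr (a/2 - 1 - 1) * (norm (x - c))^2 = ((norm (x - c))^2) powr (a/2 - 1)"
   using x powr_mult_base[of "(norm (x - c))^2" "a/2 - 1 - 1"] by (simp add: mult.commute)
  moreover have n2: "(norm (2 *R (x - c)))^2 = 4 * (norm (x - c))^2"
   unfolding norm_scaleR power_mult_distrib by simp
  ultimately show "(a/2 * ((a/2 - 1) * ((norm (x - c))^2) powr (a/2 - 1 - 1))) * (norm (2 *R (x - c)))^2
    + (a/2 * ((norm (x - c))^2) powr (a/2 - 1)) * (2 * real DIM('a))
   = a * (a + real DIM('a) - 2) * norm (x - c) powr (a - 2)"
   unfolding n2 using q[OF x, of "a/2 - 1"] by (simp add: algebra_simps)
 qed (auto simp: q)
 then show ?thesis by (rule has_lap_subset) (use assms in auto)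
qed

lemma has_lap_norm:
 fixes c :: "'a::euclidean_space"
 assumes "c ~: V"
 shows "has_lap V (%x. norm (x - c)) (%x. (x - c) /\<^sub>R norm (x - c))
  (%x. (real DIM('a) - 1) / norm (x - c))"
proof -
 have "has_lap (- {c}) (%x. norm (x - c)) (%x. (x - c) /\<^sub>R norm (x - c)) (%x. (real DIM('a) - 1) / norm (x - c))"
  by (rule has_lap_cong[OF has_lap_norm_powr[of c "- {c}" 1]]) (auto simp: powr_minus divide_inverse)
 then show ?thesis by (rule has_lap_subset) (use assms in auto)
qed

lemma has_lap_laplacian:
 assumes "has_lap V f D l" "open V" "x : V"
 shows "laplacian f x = l x"
proof -
 have p: "partial b f y = D y \<bullet> b" if "y : V" for b y
 proof -
  have "(f has_derivative (%h. D y \<bullet> h)) (at y)" using assms(1) that unfolding has_lap_def by blast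
  then show ?thesis unfolding partial_def using frechet_derivative_at by metis
 qed
 from assms(1,3) obtain A where A: "(D has_derivative A) (at x)" "(SUM b:Basis. A b \<bullet> b) = l x"
  unfolding has_lap_def by blast
 have "partial b (partial b f) x = A b \<bullet> b" for b
 proof -
  have "((%y. D y \<bullet> b) has_derivative (%h. A h \<bullet> b)) (at x)"
   using A(1) by (auto intro!: derivative_eq_intros)
  then have "(partial b f has_derivative (%h. A h \<bullet> b)) (at x)"
   by (rule has_derivative_transform_within_open[OF _ assms(2,3)]) (simp add: p)
  then show ?thesis unfolding partial_def[of b "partial b f"] using frechet_derivative_at by metis
 qed
 then show ?thesis using A(2) by (simp add: laplacian_def)
qed

lemma Ck_on_2_has_lap:
 assumes "Ck_on 2 f V"
 shows "has_lap V f (%x. SUM b:Basis. partial b f x *R b) (laplacian f)"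
  and "continuous_on V (laplacian f)"
proof -
 have c: "ALL x:V. f differentiable (at x)"
  "!!b. b : Basis ==> ALL x:V. partial b f differentiable (at x)"
  "!!b b'. b : Basis ==> b' : Basis ==> continuous_on V (partial b' (partial b f))"
  using assms unfolding numeral_2_eq_2 Ck_on.simps by auto
 show "continuous_on V (laplacian f)"
  unfolding laplacian_def by (intro continuous_on_sum c)
 show "has_lap V f (%x. SUM b:Basis. partial b f x *R b) (laplacian f)"
  unfolding has_lap_def
 proof (intro ballI conjI)
  fix x assume x: "x : V"
  have "(f has_derivative frechet_derivative f (at x)) (at x)"
   using c(1) x frechet_derivative_works by blast
  moreover have "frechet_derivative f (at x) h = (SUM b:Basis. partial b f x *R b) \<bullet> h" for h
  proof -
   have l: "linear (frechet_derivative f (at x))" using c(1) x linear_frechet_derivative by blast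
   have "frechet_derivative f (at x) h = frechet_derivative f (at x) (SUM b:Basis. (h \<bullet> b) *R b)"
    by (simp add: euclidean_representation)
   also have "... = (SUM b:Basis. (h \<bullet> b) * frechet_derivative f (at x) b)"
    using l by (simp add: linear_sum linear_scale)
   finally show ?thesis by (simp add: inner_sum_left partial_def inner_commute[of h] mult.commute)
  qed
  ultimately show "(f has_derivative (%h. (SUM b:Basis. partial b f x *R b) \<bullet> h)) (at x)"
   by (metis (no_types, lifting) ext)
  have "((%x. SUM b:Basis. partial b f x *R b) has_derivative
    (%h. SUM b:Basis. frechet_derivative (partial b f) (at x) h *R b)) (at x)"
   using c(2) x frechet_derivative_works
   by (intro has_derivative_sum has_derivative_scaleR_left) blast
  moreover have "(SUM b:Basis. (SUM b':Basis. frechet_derivative (partial b' f) (at x) b *R b') \<bullet> b)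
   = laplacian f x"
   unfolding laplacian_def
   by (intro sum.cong) (auto simp: inner_sum_left inner_Basis partial_def[of _ "partial _ _"]
      if_distrib cong: if_cong)
  ultimately show "EX A. ((%x. SUM b:Basis. partial b f x *R b) has_derivative A) (at x) &
    (SUM b:Basis. A b \<bullet> b) = laplacian f x" by blast
 qed
qed

text \<open>Second derivative test along each basis vector: \<open>G\<close> vanishes at 0, and if
  its derivative there were positive, \<open>G\<close> would be positive to the right and the mean
  value theorem would make \<open>F\<close> exceed its maximum. Only the derivative of the gradient
  at the point itself enters.\<close>

lemma has_lap_max:
 assumes h: "has_lap V f D l" and V: "open V" "x : V" and m: "!!z. z : V ==> f z <= f x"
 shows "l x <= 0"
proof -
 from h V obtain A where A: "(D has_derivative A) (at x)" "(SUM b:Basis. A b \<bullet> b) = l x"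
  unfolding has_lap_def by blast
 obtain e where e: "e > 0" "ball x e <= V" using V openE by blast
 have "A b \<bullet> b <= 0" if b: "b : Basis" for b
 proof (rule ccontr)
  assume "~ A b \<bullet> b <= 0"
  have inV: "x + s *R b : V" if "\<bar>s\<bar> < e" for s
   using e that b by (intro set_mp[OF e(2)]) (auto simp: dist_norm)
  define F where "F s = f (x + s *R b)" for s
  define G where "G s = D (x + s *R b) \<bullet> b" for s
  have F: "(F has_real_derivative G s) (at s)" if "\<bar>s\<bar> < e" for s
  proof -
   have 1: "(f has_derivative (%h. D (x + s *R b) \<bullet> h)) (at (x + s *R b))"
    using h inV[OF that] unfolding has_lap_def by blast
   have 2: "((%s. x + s *R b) has_derivative (%h. h *R b)) (at s)"
    by (auto intro!: derivative_eq_intros)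
   have "((%s. f (x + s *R b)) has_derivative (%h. D (x + s *R b) \<bullet> (h *R b))) (at s)"
    using has_derivative_compose[OF 2, of f "%h. D (x + s *R b) \<bullet> h"] 1 by simp
   then show ?thesis unfolding has_field_derivative_def F_def G_def by (simp add: mult_commute_abs)
  qed
  have "G 0 = 0"
   by (rule DERIV_local_max[OF F[of 0] e(1)]) (use e m inV in "auto simp: F_def")
  moreover have G: "(G has_real_derivative A b \<bullet> b) (at 0)"
  proof -
   have "((%s. D (x + s *R b)) has_derivative (%h. A (h *R b))) (at 0)"
    by (rule has_derivative_compose[of _ "%h. h *R b"]) (use A in "auto intro!: derivative_eq_intros")
   then have "((%s. D (x + s *R b) \<bullet> b) has_derivative (%h. A (h *R b) \<bullet> b)) (at 0)"
    by (auto intro!: derivative_eq_intros)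
   moreover have "A (h *R b) \<bullet> b = (A b \<bullet> b) * h" for h
    using linear_scale[OF has_derivative_linear[OF A(1)]] by simp
   ultimately show ?thesis unfolding has_field_derivative_def G_def by simp
  qed
  ultimately obtain d where d: "d > 0" "!!h. 0 < h ==> h < d ==> 0 < G h"
   using DERIV_pos_inc_right[OF G] `~ A b \<bullet> b <= 0` by auto
  define s where "s = min d e / 2"
  have s: "0 < s" "s < d" "s < e" using d e by (auto simp: s_def)
  obtain z where z: "0 < z" "z < s" "F s - F 0 = (s - 0) * G z"
   using MVT2[of 0 s F G] s F by auto
  have "s * G z > 0" using d(2)[of z] s z by (intro mult_pos_pos) auto
  then have "F s > F 0" using z by simp
  then show False using m[OF inV[of s]] s by (simp add: F_def)
 qed
 then have "(SUM b:Basis. A b \<bullet> b) <= 0" by (intro sum_nonpos)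
 then show ?thesis using A(2) by simp
qed

lemma has_lap_affine:
 assumes "has_lap V f D l"
 shows "has_lap {x. s *R (x - c) : V} (%x. f (s *R (x - c))) (%x. s *R D (s *R (x - c))) (%x. s^2 * l (s *R (x - c)))"
 unfolding has_lap_def
proof (intro ballI conjI)
 fix x assume "x : {x. s *R (x - c) : V}"
 then obtain A where A: "(f has_derivative (%h. D (s *R (x - c)) \<bullet> h)) (at (s *R (x - c)))"
  "(D has_derivative A) (at (s *R (x - c)))" "(SUM b:Basis. A b \<bullet> b) = l (s *R (x - c))"
  using assms unfolding has_lap_def by blast
 have s: "((%x. s *R (x - c)) has_derivative (%h. s *R h)) (at x)" by (auto intro!: derivative_eq_intros)
 show "((%x. f (s *R (x - c))) has_derivative (%h. (s *R D (s *R (x - c))) \<bullet> h)) (at x)"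
  using has_derivative_compose[OF s A(1)] by simp
 have "((%x. s *R D (s *R (x - c))) has_derivative (%h. s *R A (s *R h))) (at x)"
  by (intro has_derivative_scaleR_right has_derivative_compose[OF s A(2)])
 moreover have "(SUM b:Basis. (s *R A (s *R b)) \<bullet> b) = s^2 * l (s *R (x - c))"
  using A(3)[symmetric] linear_scale[OF has_derivative_linear[OF A(2)]]
  by (simp add: sum_distrib_left power2_eq_square mult.assoc)
 ultimately show "EX A. ((%x. s *R D (s *R (x - c))) has_derivative A) (at x) & (SUM b:Basis. A b \<bullet> b) = s^2 * l (s *R (x - c))"
  by blast
qed

lemma has_lap_scale:
 "has_lap V f D l ==> has_lap {x. s *R x : V} (%x. f (s *R x)) (%x. s *R D (s *R x)) (%x. s^2 * l (s *R x))"
 using has_lap_affine[of V f D l s 0] by simp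

section \<open>Maximum principles\<close>

text \<open>The boundary condition is an upper limit, since the functions compared need not extend
  continuously. It keeps the superlevel set \<open>K\<close> of a positive value away from the
  frontier; \<open>K\<close> is then compact and \<open>f\<close> attains a positive maximum in
  \<open>W\<close>, against \<open>nomax\<close>.\<close>

lemma no_interior_max_imp_nonpos:
 fixes f :: "'a::euclidean_space => real"
 assumes "bounded W" "continuous_on W f"
  and bd: "!!xi e. xi : frontier W ==> 0 < e ==> \<forall>\<^sub>F x in at xi within W. f x < e"
  and W: "open W"
  and nomax: "!!x. x : W ==> f x > 0 ==> EX z:W. f z > f x"
  and x: "x : W"
 shows "f x <= 0"
proof (rule ccontr)
 assume "~ f x <= 0"
 define K where "K = {z : W. f z >= f x}"
 have "closed K"
  unfolding closed_sequential_limits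
 proof (intro allI impI, elim conjE)
  fix u l assume u: "ALL n. u n : K" "u \<longlonglongrightarrow> l"
  have "l : closure W" using u unfolding K_def closure_sequential by blast
  have "l : W"
  proof (rule ccontr)
   assume "l ~: W"
   then have fr: "l : frontier W" using `l : closure W` W by (simp add: frontier_def interior_open)
   have "\<forall>\<^sub>F z in at l within W. f z < f x" using bd[OF fr, of "f x"] `~ f x <= 0` by simp
   moreover have "filterlim u (at l within W) sequentially"
    unfolding filterlim_at using u `l ~: W` by (auto simp: K_def intro!: always_eventually)
   ultimately have "\<forall>\<^sub>F n in sequentially. f (u n) < f x" by (auto simp: filterlim_iff)
   then obtain n where "f (u n) < f x" using eventually_happens by fastforce
   moreover have "f (u n) >= f x" using u(1) unfolding K_def by blast
   ultimately show False by simp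
  qed
  have "(%n. f (u n)) \<longlonglongrightarrow> f l"
   using continuous_on_tendsto_compose[OF assms(2) u(2) `l : W`] u(1) by (auto simp: K_def)
  then have "f l >= f x" using u(1) by (intro LIMSEQ_le_const) (auto simp: K_def)
  then show "l : K" using `l : W` by (simp add: K_def)
 qed
 moreover have "bounded K" using assms(1) unfolding K_def by (rule bounded_subset) auto
 ultimately have "compact K" by (simp add: compact_eq_bounded_closed)
 moreover have "K ~= {}" using x by (auto simp: K_def)
 moreover have "continuous_on K f" using assms(2) by (rule continuous_on_subset) (auto simp: K_def)
 ultimately obtain y where y: "y : K" "ALL z:K. f z <= f y" using continuous_attains_sup by blast
 then obtain z where "z : W" "f z > f y" using nomax[of y] `~ f x <= 0` by (force simp: K_def)
 then show False using y by (force simp: K_def)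
qed

lemma frontier_limsup_continuous:
 fixes f :: "'a::euclidean_space => real"
 assumes "continuous_on (closure W) f" "!!x. x : frontier W ==> f x <= 0" "xi : frontier W" "0 < e"
 shows "\<forall>\<^sub>F x in at xi within W. f x < e"
proof -
 have "xi : closure W" using assms(3) by (simp add: frontier_def)
 then have "(f \<longlongrightarrow> f xi) (at xi within closure W)" using assms(1) by (simp add: continuous_on_def)
 then have "(f \<longlongrightarrow> f xi) (at xi within W)" by (rule tendsto_within_subset) (rule closure_subset)
 then show ?thesis using order_tendstoD(2) assms by fastforce
qed

text \<open>The sign of \<open>l\<close> is asked for only where \<open>f > 0\<close>. This fits the
  singular equation: where a subsolution exceeds \<open>U\<close>, or \<open>U\<close> exceeds a
  supersolution, monotonicity of the negative power decides the sign.\<close>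

lemma max_principle_strict:
 assumes "bounded W" "open W" "has_lap W f D l"
  and "!!xi e. xi : frontier W ==> 0 < e ==> \<forall>\<^sub>F x in at xi within W. f x < e"
  and l: "!!x. x : W ==> f x > 0 ==> l x > 0"
  and "x : W"
 shows "f x <= 0"
 by (rule no_interior_max_imp_nonpos[OF assms(1) has_lap_continuous[OF assms(3)] assms(4) assms(2) _ assms(6)])
  (use has_lap_max[OF assms(3,2)] l in "force simp: not_less[symmetric]")+

text \<open>The test functions in the viscosity notion are uniformly strictly superharmonic, so that no
 continuity of their Laplacians is needed.\<close>

definition subh :: "'a::euclidean_space set => ('a => real) => bool" where
 "subh W u \<longleftrightarrow> continuous_on W u &
   (ALL V psi D l c. open V --> V <= W --> has_lap V psi D l --> c > 0 --> (ALL z:V. l z <= - c) -->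
    (ALL x:V. EX z:V. u z - psi z > u x - psi x))"

lemma subh_continuous: "subh W u ==> continuous_on W u"
 by (simp add: subh_def)

lemma subh_subset: "subh W u ==> V <= W ==> subh V u"
 unfolding subh_def by (meson continuous_on_subset order_trans)

lemma subhD:
 assumes "subh W u" "open V" "V <= W" "has_lap V psi D l" "c > 0" "!!z. z : V ==> l z <= - c" "x : V"
 shows "EX z:V. u z - psi z > u x - psi x"
 using assms unfolding subh_def by blast

lemma subh_has_lap:
 assumes "has_lap W u D l" "!!x. x : W ==> l x >= 0"
 shows "subh W u"
 unfolding subh_def
proof (intro conjI allI impI ballI)
 show "continuous_on W u" using has_lap_continuous assms(1) by blast
 fix V psi E m x and c :: real
 assume *: "open V" "V <= W" "has_lap V psi E m" "c > 0" "ALL z:V. m z <= - c" "x : V"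
 have h: "has_lap V (%x. u x - psi x) (%x. D x - E x) (%x. l x - m x)"
  using has_lap_diff[OF has_lap_subset[OF assms(1) *(2)] *(3)] .
 have "l x - m x > 0" using assms(2)[of x] * by force
 then show "EX z:V. u z - psi z > u x - psi x"
  using has_lap_max[OF h *(1) *(6)] by force
qed

lemma subh_max:
 assumes "subh W u" "subh W v"
 shows "subh W (%x. max (u x) (v x))"
 unfolding subh_def
proof (intro conjI allI impI ballI)
 show "continuous_on W (%x. max (u x) (v x))"
  using assms by (intro continuous_on_max) (auto simp: subh_def)
 fix V psi E m x and c :: real
 assume *: "open V" "V <= W" "has_lap V psi E m" "c > 0" "ALL z:V. m z <= - c" "x : V"
 obtain z1 z2 where "z1 : V" "u z1 - psi z1 > u x - psi x" "z2 : V" "v z2 - psi z2 > v x - psi x"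
  using subhD[OF assms(1) *(1-4)] subhD[OF assms(2) *(1-4)] * by meson
 then show "EX z:V. max (u z) (v z) - psi z > max (u x) (v x) - psi x"
  by (cases "u x >= v x") (fastforce simp: max_def intro: bexI[of _ z1], fastforce simp: max_def intro: bexI[of _ z2])
qed

lemma subh_cmult:
 assumes "subh W u" "a > 0"
 shows "subh W (%x. a * u x)"
 unfolding subh_def
proof (intro conjI allI impI ballI)
 show "continuous_on W (%x. a * u x)"
  using assms by (intro continuous_intros) (auto simp: subh_def)
 fix V psi E m x and c :: real
 assume *: "open V" "V <= W" "has_lap V psi E m" "c > 0" "ALL z:V. m z <= - c" "x : V"
 have "EX z:V. u z - inverse a * psi z > u x - inverse a * psi x"
  by (rule subhD[OF assms(1) *(1,2) has_lap_cmult[OF *(3), of "inverse a"], of "c / a"])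
   (use * assms(2) in "auto simp: field_simps")
 then obtain z where z: "z : V" "a * (u z - inverse a * psi z) > a * (u x - inverse a * psi x)"
  using assms(2) by auto
 have "a * (inverse a * y) = y" for y using assms(2) by simp
 then have "a * u z - psi z > a * u x - psi x" using z(2) by (simp only: right_diff_distrib)
 then show "EX z:V. a * u z - psi z > a * u x - psi x" using z(1) by blast
qed

text \<open>Adding \<open>eps (R\<^sup>2 - |x|\<^sup>2)\<close> makes the comparison function strictly superharmonic.\<close>

lemma subh_comparison:
 fixes u v :: "'a::euclidean_space => real"
 assumes "bounded W" "open W" "subh W u" "has_lap W v D l" "!!x. x : W ==> l x <= 0"
  and bd: "!!xi e. xi : frontier W ==> 0 < e ==> \<forall>\<^sub>F x in at xi within W. u x - v x < e"
  and x: "x : W"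
 shows "u x <= v x"
proof -
 obtain R where R: "R > 0" "!!x. x : W ==> norm x <= R" using assms(1) bounded_pos by metis
 have Rsq: "(norm x)^2 <= R^2" if "x : W" for x using R(2)[OF that] by (simp add: power_mono)
 have main: "u x - v x <= eps * R^2" if eps: "eps > 0" for eps
 proof -
  define g where "g x = v x + (eps * R^2 - eps * (norm (x - 0))^2)" for x
  have g: "has_lap W g (%x. D x + (0 - eps *R (2 *R (x - 0)))) (%x. l x + (0 - eps * (2 * real DIM('a))))"
   unfolding g_def by (intro has_lap_add has_lap_diff has_lap_cmult has_lap_normsq has_lap_const assms(4))
  have "u x - g x <= 0"
  proof (rule no_interior_max_imp_nonpos[where f="%x. u x - g x", OF assms(1) _ _ assms(2) _ x])
   show "continuous_on W (%x. u x - g x)"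
    using has_lap_continuous[OF g] assms(3) by (intro continuous_intros) (auto simp: subh_def)
   show "EX z:W. u z - g z > u x - g x" if "x : W" for x
    by (rule subhD[OF assms(3,2) order_refl g, of "eps * (2 * real DIM('a))"])
     (use eps that assms(5) in auto)
   fix xi and e :: real assume "xi : frontier W" "0 < e"
   from bd[OF this] have "\<forall>\<^sub>F x in at xi within W. u x - v x < e" .
   moreover have "\<forall>\<^sub>F x in at xi within W. x : W" by (simp add: eventually_at_filter)
   ultimately show "\<forall>\<^sub>F x in at xi within W. u x - g x < e"
   proof eventually_elim
    case (elim x)
    then have "eps * (norm x)^2 <= eps * R^2" using Rsq[of x] eps by (intro mult_left_mono) auto
    then show ?case using elim by (simp add: g_def)
   qed
  qed
  moreover have "g x <= v x + eps * R^2" using eps by (simp add: g_def)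
  ultimately show ?thesis by simp
 qed
 have "u x - v x <= 0 + e" if "e > 0" for e
  using main[of "e / R^2"] R(1) that by simp
 then have "u x - v x <= 0" by (rule field_le_epsilon)
 then show ?thesis by simp
qed

lemma has_lap_comparison:
 fixes u v :: "'a::euclidean_space => real"
 assumes "bounded W" "open W" "has_lap W u D l" "has_lap W v E m" "!!x. x : W ==> m x <= l x"
  and bd: "!!xi e. xi : frontier W ==> 0 < e ==> \<forall>\<^sub>F x in at xi within W. u x - v x < e"
  and x: "x : W"
 shows "u x <= v x"
 using subh_comparison[OF assms(1,2) subh_has_lap[OF has_lap_diff[OF assms(3,4)]] has_lap_const[of W 0], of x]
  assms by simp

lemma has_lap_comparison_closure:
 fixes u v :: "'a::euclidean_space => real"
 assumes "bounded W" "open W" "has_lap W u D l" "has_lap W v E m" "!!x. x : W ==> m x <= l x"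
  and "continuous_on (closure W) u" "continuous_on (closure W) v"
  and "!!x. x : frontier W ==> u x <= v x"
  and x: "x : W"
 shows "u x <= v x"
 by (rule has_lap_comparison[OF assms(1-5) _ x])
  (use frontier_limsup_continuous[of W "%x. u x - v x"] assms in "auto intro!: continuous_intros")

section \<open>Harmonic functions\<close>

definition harmonic_on :: "'a::euclidean_space set => ('a => real) => bool" where
 "harmonic_on W h \<longleftrightarrow> (EX D. has_lap W h D (%x. 0))"

lemma harmonic_on_subset: "harmonic_on W h ==> V <= W ==> harmonic_on V h"
 unfolding harmonic_on_def using has_lap_subset by blast

lemma harmonic_on_continuous: "harmonic_on W h ==> continuous_on W h"
 unfolding harmonic_on_def using has_lap_continuous by blast

lemma harmonic_on_diff: "harmonic_on W h ==> harmonic_on W k ==> harmonic_on W (%x. h x - k x)"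
 unfolding harmonic_on_def using has_lap_diff by fastforce

lemma harmonic_on_add: "harmonic_on W h ==> harmonic_on W k ==> harmonic_on W (%x. h x + k x)"
 unfolding harmonic_on_def using has_lap_add by fastforce

lemma harmonic_on_cmult: "harmonic_on W h ==> harmonic_on W (%x. c * h x)"
 unfolding harmonic_on_def using has_lap_cmult[of W h _ "%x. 0" c] by fastforce

lemma harmonic_on_sum:
 assumes "finite I" "!!i. i : I ==> harmonic_on W (f i)"
 shows "harmonic_on W (%x. SUM i:I. f i x)"
 using assms
proof (induction I rule: finite_induct)
 case empty
 show ?case using has_lap_const[of W 0] by (auto simp: harmonic_on_def)
qed (simp add: harmonic_on_add)

lemma harmonic_on_cong:
 assumes "harmonic_on W h" "open W" "!!x. x : W ==> h x = k x"
 shows "harmonic_on W k"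
 using assms has_lap_cong[of W h] unfolding harmonic_on_def by metis

lemma harmonic_on_scale:
 assumes "harmonic_on W h"
 shows "harmonic_on {x. s *R x : W} (%x. h (s *R x))"
 using assms has_lap_scale[of W h _ "%x. 0" s] unfolding harmonic_on_def by fastforce

lemma harmonic_imp_subh: "harmonic_on W h ==> subh W h"
 unfolding harmonic_on_def using subh_has_lap by fastforce

text \<open>Local gradient fields have to be glued. Since the gradient at a point is unique, the
  definite description \<open>D\<close> agrees with every local choice.\<close>

lemma harmonic_on_UN:
 assumes "!!x. x : W ==> EX V. open V & x : V & harmonic_on V h"
 shows "harmonic_on W h"
proof -
 define D where "D = (%x. THE d. (h has_derivative (%k. d \<bullet> k)) (at x))"
 have "has_lap W h D (%x. 0)" unfolding has_lap_def
 proof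
  fix x assume "x : W"
  then obtain V E where V: "open V" "x : V" "has_lap V h E (%x. 0)"
   using assms unfolding harmonic_on_def by blast
  have "D y = E y" if "y : V" for y
   unfolding D_def
  proof (rule the_equality)
   show 1: "(h has_derivative (%k. E y \<bullet> k)) (at y)" using V that by (simp add: has_lap_def)
   fix d assume "(h has_derivative (%k. d \<bullet> k)) (at y)"
   then have "d \<bullet> k = E y \<bullet> k" for k using has_derivative_unique[OF 1] by metis
   then show "d = E y" by (metis vector_eq_rdot)
  qed
  then have "has_lap V h D (%x. 0)" using has_lap_cong[OF V(3,1)] by metis
  then show "(h has_derivative (%h. D x \<bullet> h)) (at x) & (EX A. (D has_derivative A) (at x) & (SUM b:Basis. A b \<bullet> b) = 0)"
   using V(2) by (simp add: has_lap_def)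
 qed
 then show ?thesis by (auto simp: harmonic_on_def)
qed

text \<open>If \<open>norm d > C\<close>, then moving from \<open>p\<close> in the direction of
  \<open>d\<close> increases \<open>h\<close> faster than \<open>C\<close> times the length of the
  step.\<close>

lemma lipschitz_grad_bound:
 fixes h :: "'a::euclidean_space => real"
 assumes "(h has_derivative (%k. d \<bullet> k)) (at p)" "R > 0"
  "!!x. x : ball p R ==> \<bar>h x - h p\<bar> <= C * norm (x - p)"
 shows "norm d <= C"
proof (rule ccontr)
 assume "~ norm d <= C"
 moreover have "C >= 0"
 proof -
  obtain b :: 'a where "b : Basis" using nonempty_Basis by blast
  then have "0 <= C * norm (p + (R/2) *R b - p)"
   using assms(2) by (intro order_trans[OF abs_ge_zero assms(3)]) (simp add: dist_norm)
  then show ?thesis using `b : Basis` assms(2) by (auto simp: zero_le_mult_iff)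
 qed
 ultimately have nd: "norm d > C" "norm d > 0" by linarith+
 define u where "u = d /\<^sub>R norm d"
 have u: "norm u = 1" "d \<bullet> u = norm d" using nd by (auto simp: u_def power2_norm_eq_inner[symmetric] power2_eq_square)
 have 2: "((%s. p + s *R u) has_derivative (%h. h *R u)) (at 0)"
  by (auto intro!: derivative_eq_intros)
 have "((%s. h (p + s *R u)) has_derivative (%k. d \<bullet> (k *R u))) (at 0)"
  using has_derivative_compose[OF 2, of h "%h. d \<bullet> h"] assms(1) by simp
 then have "((%s. h (p + s *R u) - C * s) has_real_derivative norm d - C) (at 0)"
  using u by (auto intro!: derivative_eq_intros simp: has_field_derivative_def fun_eq_iff algebra_simps)
 from DERIV_pos_inc_right[OF this] nd obtain e where
  e: "e > 0" "!!s. 0 < s ==> s < e ==> h (p + 0 *R u) - C * 0 < h (p + (0 + s) *R u) - C * (0 + s)" by auto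
 define s where "s = min e R / 2"
 have s: "0 < s" "s < e" "s < R" using e assms(2) by (auto simp: s_def)
 have "\<bar>h (p + s *R u) - h p\<bar> <= C * norm (p + s *R u - p)"
  using s u by (intro assms(3)) (simp add: dist_norm)
 then show False using e(2)[OF s(1,2)] u s by simp
qed

section \<open>The Dirichlet problem on balls\<close>

inductive pol :: "('a::euclidean_space => real) => bool" where
 pol_const: "pol (%x. c)"
| pol_lin: "pol p ==> pol (%x. (a \<bullet> x) * p x)"
| pol_add: "pol p ==> pol q ==> pol (%x. p x + q x)"

text \<open>The grading by degree carries Euler's identity, and with it an explicit Laplacian of
  \<open>(norm x)^2 * q x\<close>.\<close>

inductive hpol :: "nat => ('a::euclidean_space => real) => bool" where
 hpol_const: "hpol 0 (%x. c)"
| hpol_lin: "hpol k p ==> hpol (Suc k) (%x. (a \<bullet> x) * p x)"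
| hpol_add: "hpol k p ==> hpol k q ==> hpol k (%x. p x + q x)"

lemma hpol_imp_pol: "hpol k p ==> pol p"
 by (induction rule: hpol.induct) (auto intro: pol.intros)

lemma pol_mult: "pol p ==> pol q ==> pol (%x. p x * q x)"
proof (induction rule: pol.induct)
 case (pol_const c)
 from `pol q` show ?case
 proof (induction rule: pol.induct)
  case (pol_const d) then show ?case by (rule pol.pol_const)
 next
  case (pol_lin p a) then show ?case using pol.pol_lin[OF pol_lin.IH, of a] by (simp add: mult.left_commute)
 next
  case (pol_add p q) then show ?case using pol.pol_add[OF pol_add.IH] by (simp add: distrib_left)
 qed
next
 case (pol_lin p a) then show ?case using pol.pol_lin[of "%x. p x * q x" a] by (simp add: mult.assoc)
next
 case (pol_add p p')
 then show ?case using pol.pol_add[of "%x. p x * q x" "%x. p' x * q x"] by (simp add: distrib_right)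
qed

lemma pol_inner: "pol (%x. a \<bullet> x)"
 using pol_lin[OF pol_const[of 1], of a] by simp

lemma pol_sum: "finite I ==> (!!i. i : I ==> pol (f i)) ==> pol (%x. SUM i:I. f i x)"
 by (induction I rule: finite_induct) (auto intro: pol.intros)

lemma pol_diff: "pol p ==> pol q ==> pol (%x. p x - q x)"
 using pol_add[OF _ pol_mult[OF pol_const[of "-1"]], of p q] by simp

lemma pol_normsq: "pol (%x. (norm x)^2)"
proof -
 have "pol (%x::'a. SUM b:Basis. (b \<bullet> x) * (b \<bullet> x))"
  by (intro pol_sum pol_mult pol_inner finite_Basis)
 moreover have "(SUM b:Basis. (b \<bullet> x) * (b \<bullet> x)) = (norm x)^2" for x :: 'a
  unfolding power2_norm_eq_inner by (subst euclidean_inner[of x x]) (simp add: inner_commute)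
 ultimately show ?thesis by simp
qed

lemma pol_affine:
 assumes "pol p" shows "pol (%x. p (s *R (x - c)))"
 using assms
proof (induction rule: pol.induct)
 case (pol_lin p a)
 have "pol (%x. ((s *R a) \<bullet> x + (- s * (a \<bullet> c))) * p (s *R (x - c)))"
  by (intro pol_mult pol_add pol_inner pol_const pol_lin.IH)
 then show ?case by (simp add: inner_diff_right algebra_simps)
qed (auto intro: pol.intros)

text \<open>Connects \<open>pol\<close> with the polynomials of the Stone-Weierstrass
  theorem.\<close>

lemma real_polynomial_function_imp_pol: "real_polynomial_function f ==> pol f"
proof (induction rule: real_polynomial_function.induct)
 case (linear f)
 have "f x = (SUM b:Basis. f b *R b) \<bullet> x" for x
 proof -
  have l: "linear f" using linear bounded_linear.linear by blast
  have "f x = f (SUM b:Basis. (x \<bullet> b) *R b)" by (simp add: euclidean_representation)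
  also have "... = (SUM b:Basis. (x \<bullet> b) * f b)" by (simp add: linear_sum[OF l] linear_scale[OF l])
  finally show ?thesis by (simp add: inner_sum_left inner_commute[of x] mult.commute)
 qed
 then have "f = (%x. (SUM b:Basis. f b *R b) \<bullet> x)" by blast
 then show ?case using pol_inner by metis
qed (auto intro: pol.intros pol_mult)

lemma partial_eqI: "(f has_derivative f') (at x) ==> partial b f x = f' b"
 unfolding partial_def using frechet_derivative_at by metis

lemma differentiable_partial: "f differentiable (at x) ==> (f has_derivative (%b. partial b f x)) (at x)"
 unfolding partial_def using frechet_derivative_works by (metis (no_types, lifting) ext)

lemma partial_const: "partial b (%x. c) x = 0"
 by (rule partial_eqI) auto

lemma partial_add:
 assumes "f differentiable (at x)" "g differentiable (at x)"
 shows "partial b (%x. f x + g x) x = partial b f x + partial b g x"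
 using partial_eqI[OF has_derivative_add[OF assms[THEN differentiable_partial]]] .

lemma partial_cmult:
 fixes c :: real
 assumes "f differentiable (at x)"
 shows "partial b (%x. c * f x) x = c * partial b f x"
 using partial_eqI[OF has_derivative_mult_right[OF differentiable_partial[OF assms]]] .

lemma partial_lin:
 assumes "f differentiable (at x)"
 shows "partial b (%x. (a \<bullet> x) * f x) x = (a \<bullet> b) * f x + (a \<bullet> x) * partial b f x"
proof -
 have "((%x. a \<bullet> x) has_derivative (%h. a \<bullet> h)) (at x)" by (auto intro!: derivative_eq_intros)
 from partial_eqI[OF has_derivative_mult[OF this differentiable_partial[OF assms]]]
 show ?thesis by simp
qed

lemma partial_sum:
 assumes "finite I" "!!i. i : I ==> f i differentiable (at x)"
 shows "partial b (%x. SUM i:I. f i x) x = (SUM i:I. partial b (f i) x)"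
 using partial_eqI[OF has_derivative_sum[OF assms(2)[THEN differentiable_partial]], of I] by simp

lemma pol_differentiable: "pol p ==> p differentiable (at x)"
 by (induction rule: pol.induct) auto

lemma pol_partial: "pol p ==> pol (partial b p)"
proof (induction rule: pol.induct)
 case (pol_const c)
 have "partial b (%x. c) = (%x. 0)" by (simp add: partial_const fun_eq_iff)
 then show ?case using pol.pol_const by metis
next
 case (pol_lin p a)
 have "partial b (%x. (a \<bullet> x) * p x) = (%x. (a \<bullet> b) * p x + (a \<bullet> x) * partial b p x)"
  by (simp add: partial_lin pol_differentiable pol_lin.hyps fun_eq_iff)
 then show ?case using pol_lin by (simp add: pol_add pol_mult pol_const pol.pol_lin)
next
 case (pol_add p q)
 have "partial b (%x. p x + q x) = (%x. partial b p x + partial b q x)"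
  by (simp add: partial_add pol_differentiable pol_add.hyps fun_eq_iff)
 then show ?case using pol_add by (simp add: pol.pol_add)
qed

lemma pol_partial_commute: "pol p ==> partial b (partial c p) x = partial c (partial b p) x"
proof (induction arbitrary: x rule: pol.induct)
 case (pol_const k)
 have "partial b (%x. k) = (%x. 0)" for b :: 'a by (simp add: partial_const fun_eq_iff)
 then show ?case by (simp add: partial_const)
next
 case (pol_lin p a)
 have 1: "partial b (%x. (a \<bullet> x) * p x) = (%x. (a \<bullet> b) * p x + (a \<bullet> x) * partial b p x)" for b
  by (simp add: partial_lin pol_differentiable pol_lin.hyps fun_eq_iff)
 have d: "p differentiable (at x)" "partial b p differentiable (at x)" for b x
  using pol_lin.hyps by (auto intro: pol_differentiable pol_partial)
 have "partial b (partial c (%x. (a \<bullet> x) * p x)) x =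
  (a \<bullet> c) * partial b p x + ((a \<bullet> b) * partial c p x + (a \<bullet> x) * partial b (partial c p) x)" for b c
  unfolding 1 by (subst partial_add) (auto simp: partial_cmult partial_lin d)
 then show ?case using pol_lin.IH by simp
next
 case (pol_add p q)
 have 1: "partial b (%x. p x + q x) = (%x. partial b p x + partial b q x)" for b
  by (simp add: partial_add pol_differentiable pol_add.hyps fun_eq_iff)
 have d: "partial b p differentiable (at x)" "partial b q differentiable (at x)" for b x
  using pol_add.hyps by (auto intro: pol_differentiable pol_partial)
 show ?case unfolding 1 by (simp add: partial_add d pol_add.IH)
qed

lemma pol_Ck: "pol p ==> Ck_on k p W"
 by (induction k arbitrary: p)
  (auto intro: pol_differentiable pol_partial continuous_at_imp_continuous_on differentiable_imp_continuous_within)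

lemma pol_has_lap: "pol p ==> has_lap W p (%x. SUM b:Basis. partial b p x *R b) (laplacian p)"
 using Ck_on_2_has_lap(1) pol_Ck by blast

lemma pol_laplacian_partial:
 assumes "pol p"
 shows "laplacian (partial c p) x = partial c (laplacian p) x"
proof -
 have d: "q differentiable (at x)" if "pol q" for q x using that pol_differentiable by blast
 have "partial b (partial b (partial c p)) x = partial c (partial b (partial b p)) x" for b
 proof -
  have "partial b (partial c p) = partial c (partial b p)" using pol_partial_commute[OF assms] by blast
  then show ?thesis using pol_partial_commute[OF pol_partial[OF assms]] by simp
 qed
 then show ?thesis
  unfolding laplacian_def[abs_def] by (simp add: partial_sum d pol_partial assms)
qed

lemma harmonic_pol_partial:
 assumes "pol p" "harmonic_on UNIV p"
 shows "harmonic_on UNIV (partial b p)"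
proof -
 have z: "laplacian p = (%x. 0)"
  using assms(2) has_lap_laplacian[OF _ open_UNIV UNIV_I] unfolding harmonic_on_def by blast
 have "laplacian (partial b p) = (%x. 0)"
  by (simp add: fun_eq_iff pol_laplacian_partial[OF assms(1)] z partial_const)
 then show ?thesis using pol_has_lap[OF pol_partial[OF assms(1)], of UNIV b] unfolding harmonic_on_def by metis
qed

lemma hpol_zero: "hpol k (%x. 0)"
proof (induction k)
 case (Suc k)
 show ?case using hpol_lin[OF Suc, of 0] by simp
qed (rule hpol_const)

lemma hpol_cmult: "hpol k p ==> hpol k (%x. c * p x)"
proof (induction rule: hpol.induct)
 case (hpol_lin k p a) then show ?case using hpol.hpol_lin[OF hpol_lin.IH, of a] by (simp add: mult.left_commute)
next
 case (hpol_add k p q) then show ?case using hpol.hpol_add[OF hpol_add.IH] by (simp add: distrib_left)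
qed (rule hpol_const)

lemma hpol_sum: "finite I ==> (!!i. i : I ==> hpol k (f i)) ==> hpol k (%x. SUM i:I. f i x)"
 by (induction I rule: finite_induct) (auto intro: hpol_zero hpol_add)

lemma hpol_normsq_mult:
 assumes "hpol k q" shows "hpol (k + 2) (%x. (norm x)^2 * q x)"
proof -
 have "hpol (k + 2) (%x::'a. SUM b:Basis. (b \<bullet> x) * ((b \<bullet> x) * q x))"
  using hpol_lin[OF hpol_lin[OF assms]] by (intro hpol_sum) auto
 moreover have "(SUM b:Basis. (b \<bullet> x) * ((b \<bullet> x) * q x)) = (norm x)^2 * q x" for x :: 'a
  unfolding power2_norm_eq_inner by (subst euclidean_inner[of x x])
   (simp add: inner_commute[of x] sum_distrib_right mult.assoc)
 ultimately show ?thesis by simp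
qed

text \<open>Truncated subtraction leaves degree 0 at 0, where homogeneity of the derivative says
  nothing about its vanishing; the first conjunct records it.\<close>

lemma hpol_partial: "hpol k p ==> (k = 0 --> (ALL x. partial b p x = 0)) & hpol (k - 1) (partial b p)"
proof (induction rule: hpol.induct)
 case (hpol_const c)
 have "partial b (%x. c) = (%x. 0)" by (simp add: partial_const fun_eq_iff)
 then show ?case using hpol_zero[of 0] by simp
next
 case (hpol_lin k p a)
 have 1: "partial b (%x. (a \<bullet> x) * p x) = (%x. (a \<bullet> b) * p x + (a \<bullet> x) * partial b p x)"
  by (simp add: partial_lin pol_differentiable hpol_imp_pol[OF hpol_lin.hyps] fun_eq_iff)
 show ?case
 proof (cases k)
  case 0
  then show ?thesis using hpol_lin by (simp add: 1 hpol_cmult)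
 next
  case (Suc j)
  then have "hpol k (%x. (a \<bullet> x) * partial b p x)" using hpol_lin.IH hpol.hpol_lin[of j "partial b p" a] by simp
  then show ?thesis using hpol_lin.hyps by (simp add: 1 hpol_cmult hpol_add)
 qed
next
 case (hpol_add k p q)
 have "partial b (%x. p x + q x) = (%x. partial b p x + partial b q x)"
  using hpol_add.hyps[THEN hpol_imp_pol] by (simp add: partial_add pol_differentiable fun_eq_iff)
 then show ?case using hpol_add by (simp add: hpol.hpol_add)
qed

lemma hpol_euler: "hpol k p ==> (SUM b:Basis. (b \<bullet> x) * partial b p x) = real k * p x"
proof (induction rule: hpol.induct)
 case (hpol_const c)
 then show ?case by (simp add: partial_const)
next
 case (hpol_lin k p a)
 have "(SUM b:Basis. (b \<bullet> x) * ((a \<bullet> b) * p x + (a \<bullet> x) * partial b p x))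
  = (SUM b:Basis. (a \<bullet> b) * (x \<bullet> b)) * p x + (a \<bullet> x) * (SUM b:Basis. (b \<bullet> x) * partial b p x)"
  by (simp add: sum_distrib_left sum_distrib_right sum.distrib inner_commute[of x] algebra_simps)
 also have "... = real (Suc k) * ((a \<bullet> x) * p x)"
  by (simp add: hpol_lin.IH euclidean_inner[symmetric] algebra_simps)
 finally show ?case
  by (simp add: partial_lin pol_differentiable hpol_imp_pol[OF hpol_lin.hyps])
next
 case (hpol_add k p q)
 then show ?case
  by (simp add: partial_add pol_differentiable hpol_imp_pol sum.distrib algebra_simps)
qed

lemma hpol_laplacian: "hpol k p ==> hpol (k - 2) (laplacian p) & (k < 2 --> (ALL x. laplacian p x = 0))"
proof
 assume p: "hpol k p"
 have "hpol (k - 1 - 1) (%x. SUM b:Basis. partial b (partial b p) x)"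
  by (rule hpol_sum[OF finite_Basis hpol_partial[OF hpol_partial[OF p, THEN conjunct2], THEN conjunct2]])
 then show "hpol (k - 2) (laplacian p)" unfolding laplacian_def[abs_def] by (simp add: numeral_2_eq_2)
 show "k < 2 --> (ALL x. laplacian p x = 0)"
 proof (intro impI allI)
  fix x :: 'a assume "k < 2"
  then have "hpol 0 (partial b p)" for b using hpol_partial[OF p, of b] by (cases k) auto
  then show "laplacian p x = 0" unfolding laplacian_def using hpol_partial by (intro sum.neutral) blast
 qed
qed

text \<open>In the product rule the cross term is four times the radial derivative of
  \<open>q\<close>, which Euler's identity turns into \<open>4 * k * q\<close>; the rest is
  \<open>2 * DIM('a) * q\<close> and the Laplacian of \<open>q\<close>.\<close>

lemma laplacian_normsq_mult:
 fixes q :: "'a::euclidean_space => real"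
 assumes "hpol k q"
 shows "laplacian (%x. (norm x)^2 * q x) x
  = (norm x)^2 * laplacian q x + (2 * real DIM('a) + 4 * real k) * q x"
proof -
 have n: "has_lap UNIV (%x::'a. (norm x)^2) (%x. 2 *R (x - 0)) (%x. 2 * real DIM('a))"
  using has_lap_normsq[of UNIV "0::'a"] by simp
 have "laplacian (%x. (norm x)^2 * q x) x = (norm x)^2 * laplacian q x + q x * (2 * real DIM('a))
   + 2 * (2 *R (x - 0) \<bullet> (SUM b:Basis. partial b q x *R b))"
  by (rule has_lap_laplacian[OF has_lap_mult[OF n pol_has_lap[OF hpol_imp_pol[OF assms]]]]) auto
 also have "2 *R (x - 0) \<bullet> (SUM b:Basis. partial b q x *R b) = 2 * (SUM b:Basis. (b \<bullet> x) * partial b q x)"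
  by (simp add: inner_sum_right inner_commute[of x] sum_distrib_left mult_ac)
 finally show ?thesis by (simp add: hpol_euler[OF assms] algebra_simps)
qed

text \<open>With \<open>q = \<alpha> f + |x|\<^sup>2 g\<close> the equation for \<open>q\<close> in degree \<open>k\<close> reduces to one of the same shape for
 \<open>g\<close> in degree \<open>k - 2\<close>, with a larger \<open>c\<close>.\<close>

lemma hpol_solve:
 fixes f :: "'a::euclidean_space => real"
 shows "hpol k f ==> c >= 0 ==> EX q. hpol k q & (ALL x. laplacian (%x. (norm x)^2 * q x) x + c * q x = f x)"
proof (induction k arbitrary: f c rule: less_induct)
 case (less k)
 \<comment> \<open>The total coefficient of \<open>q\<close> in the equation, by
   \<open>laplacian_normsq_mult\<close>. It becomes the constant \<open>c\<close> of the equation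
   for \<open>g\<close> two degrees lower.\<close>
 define e where "e = 2 * real DIM('a) + 4 * real k + c"
 have e: "e > 0" using DIM_positive[where 'a='a] less.prems by (simp add: e_def add_pos_nonneg)
 show ?case
 proof (cases "k < 2")
  case True
  have h: "hpol k (%x. (1/e) * f x)" using less.prems by (intro hpol_cmult)
  have "laplacian (%x. (norm x)^2 * ((1/e) * f x)) x + c * ((1/e) * f x) = f x" for x
   unfolding laplacian_normsq_mult[OF h] using hpol_laplacian[OF h] True e
   by (simp add: e_def[symmetric] field_simps) (simp add: e_def algebra_simps)
  then show ?thesis using h by blast
 next
  case False
  then have k: "k - 2 < k" "k - 2 + 2 = k" by auto
  have "hpol (k - 2) (%x. (- (1/e)) * laplacian f x)"
   using hpol_laplacian[OF less.prems(1)] by (intro hpol_cmult) auto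
  from less.IH[OF k(1) this, of e] e obtain g where
   g: "hpol (k - 2) g" "!!x. laplacian (%x. (norm x)^2 * g x) x + e * g x = - (1/e) * laplacian f x" by auto
  define G where "G x = (norm x)^2 * g x" for x
  have G: "hpol k G" using hpol_normsq_mult[OF g(1)] k(2) unfolding G_def[abs_def] by simp
  define q where "q x = (1/e) * f x + G x" for x
  have q: "hpol k q" unfolding q_def[abs_def] by (intro hpol_add hpol_cmult less.prems G)
  have lq: "laplacian q x = (1/e) * laplacian f x + laplacian G x" for x
  proof -
   have "has_lap UNIV q (%x. (1/e) *R (SUM b:Basis. partial b f x *R b) + (SUM b:Basis. partial b G x *R b))
    (%x. (1/e) * laplacian f x + laplacian G x)"
    unfolding q_def[abs_def]
    by (intro has_lap_add has_lap_cmult pol_has_lap hpol_imp_pol[OF G] hpol_imp_pol[OF less.prems(1)])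
   then show ?thesis by (rule has_lap_laplacian) auto
  qed
  have "laplacian (%x. (norm x)^2 * q x) x + c * q x = f x" for x
  proof -
   have "laplacian (%x. (norm x)^2 * q x) x + c * q x = (norm x)^2 * laplacian q x + e * q x"
    unfolding laplacian_normsq_mult[OF q] by (simp add: e_def algebra_simps)
   also have "... = (norm x)^2 * ((1/e) * laplacian f x + (laplacian G x + e * g x)) + f x"
    using e by (simp add: lq q_def G_def algebra_simps)
   also have "... = f x" using g(2)[of x] unfolding G_def[abs_def] by simp
   finally show ?thesis .
  qed
  then show ?thesis using q by blast
 qed
qed

text \<open>If \<open>q\<close> of degree \<open>k - 2\<close> satisfies that
  \<open>(norm x)^2 * q x\<close> has the Laplacian of \<open>p\<close>, then
  \<open>p - (norm x)^2 * q\<close> is harmonic. On the unit sphere \<open>p\<close> is this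
  function plus \<open>q\<close>, and induction applies to \<open>q\<close>.\<close>

lemma hpol_harmonic_on_sphere:
 "hpol k p ==> EX h. pol h & harmonic_on UNIV h & (ALL x:sphere 0 1. h x = p x)"
proof (induction k arbitrary: p rule: less_induct)
 case (less k)
 show ?case
 proof (cases "k < 2")
  case True
  then have "laplacian p = (%x. 0)" using hpol_laplacian[OF less.prems] by auto
  then have "harmonic_on UNIV p" using pol_has_lap[OF hpol_imp_pol[OF less.prems], of UNIV] by (auto simp: harmonic_on_def)
  then show ?thesis using hpol_imp_pol[OF less.prems] by blast
 next
  case False
  obtain q where q: "hpol (k - 2) q" "!!x. laplacian (%x. (norm x)^2 * q x) x = laplacian p x"
   using hpol_solve[of "k - 2" "laplacian p" 0] hpol_laplacian[OF less.prems] by auto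
  obtain h where h: "pol h" "harmonic_on UNIV h" "ALL x:sphere 0 1. h x = q x"
   using less.IH[OF _ q(1)] False by auto
  have pp: "pol p" "pol (%x. (norm x)^2 * q x)" using less.prems q hpol_imp_pol pol_normsq pol_mult by blast+
  have "has_lap UNIV (%x. p x - (norm x)^2 * q x)
    (%x. (SUM b:Basis. partial b p x *R b) - (SUM b:Basis. partial b (%x. (norm x)^2 * q x) x *R b))
    (%x. laplacian p x - laplacian (%x. (norm x)^2 * q x) x)"
   by (intro has_lap_diff pol_has_lap pp)
  then have "harmonic_on UNIV (%x. p x - (norm x)^2 * q x)" by (auto simp: harmonic_on_def q(2))
  then have "harmonic_on UNIV (%x. (p x - (norm x)^2 * q x) + h x)" using h(2) harmonic_on_add by blast
  moreover have "pol (%x. (p x - (norm x)^2 * q x) + h x)" using pp h(1) pol_diff pol_add by blast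
  moreover have "ALL x:sphere 0 1. (p x - (norm x)^2 * q x) + h x = p x" using h(3) by simp
  ultimately show ?thesis by blast
 qed
qed

text \<open>The induction over \<open>pol\<close> carries an arbitrary homogeneous factor
  \<open>q\<close> that absorbs each linear form. This takes the place of splitting a polynomial
  into homogeneous parts.\<close>

lemma pol_harmonic_on_sphere:
 assumes "pol p"
 shows "EX h. pol h & harmonic_on UNIV h & (ALL x:sphere 0 1. h x = p x)"
proof -
 have "EX h. pol h & harmonic_on UNIV h & (ALL x:sphere 0 1. h x = q x * p x)" if "hpol j q" for j q
  using assms that
 proof (induction arbitrary: j q rule: pol.induct)
  case (pol_const c)
  show ?case using hpol_harmonic_on_sphere[OF hpol_cmult[OF pol_const, of c]] by (simp add: mult.commute)
 next
  case (pol_lin p a)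
  show ?case using pol_lin.IH[OF hpol_lin[OF pol_lin.prems, of a]] by (simp add: mult.commute mult.left_commute)
 next
  case (pol_add p p')
  obtain h h' where "pol h" "harmonic_on UNIV h" "ALL x:sphere 0 1. h x = q x * p x"
   "pol h'" "harmonic_on UNIV h'" "ALL x:sphere 0 1. h' x = q x * p' x"
   using pol_add.IH[OF pol_add.prems] by blast
  then show ?case by (intro exI[of _ "%x. h x + h' x"]) (auto simp: pol.pol_add harmonic_on_add distrib_left)
 qed
 from this[OF hpol_const[of 1]] show ?thesis by simp
qed

text \<open>Bernstein's method: with \<open>g\<close> a directional derivative of \<open>h\<close> and \<open>e = R\<^sup>2 - |z - p|\<^sup>2\<close>, the function
 \<open>e\<^sup>2 g\<^sup>2 + A h\<^sup>2\<close> is subharmonic.\<close>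

lemma harmonic_pol_grad_bound:
 fixes h :: "'a::euclidean_space => real"
 assumes h: "pol h" "harmonic_on UNIV h" and R: "R > 0" "!!z. z : cball p R ==> \<bar>h z\<bar> <= M"
  and d: "(h has_derivative (%k. d \<bullet> k)) (at p)"
 shows "norm d <= 4 * real DIM('a) * M / R"
proof -
 define n where "n = real DIM('a)"
 have n: "n >= 1" using DIM_positive[where 'a='a] by (simp add: n_def)
 have M0: "M >= 0" using R(2)[of p] R(1) by force
 \<comment> \<open>The unit vector along the gradient, or 0 if \<open>d = 0\<close>; in both cases
   the derivative of \<open>h\<close> in direction \<open>u\<close> at \<open>p\<close> is
   \<open>norm d\<close>.\<close>
 define u where "u = sgn d"
 have nu: "norm u <= 1" by (simp add: u_def norm_sgn)
 define Dh where "Dh x = (SUM b:Basis. partial b h x *R b)" for x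
 have Dh: "has_lap UNIV h Dh (%x. 0)"
 proof -
  have "laplacian h = (%x. 0)" using h(2) has_lap_laplacian[OF _ open_UNIV UNIV_I] unfolding harmonic_on_def by blast
  then show ?thesis using pol_has_lap[OF h(1), of UNIV] unfolding Dh_def[abs_def] by simp
 qed
 define g where "g x = (SUM b:Basis. (b \<bullet> u) * partial b h x)" for x
 have gD: "g x = Dh x \<bullet> u" for x by (simp add: g_def Dh_def inner_sum_left mult.commute)
 have "harmonic_on UNIV g"
  unfolding g_def[abs_def] by (intro harmonic_on_sum harmonic_on_cmult harmonic_pol_partial h) simp
 then obtain Dg where Dg: "has_lap UNIV g Dg (%x. 0)" unfolding harmonic_on_def by blast
 \<comment> \<open>Chosen so that \<open>2 * A\<close> dominates
   \<open>24 * R^2 + 4 * n * R^2\<close>, the coefficient of \<open>(g z)^2\<close> left over once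
   the cross term is absorbed.\<close>
 define A where "A = (2 * n + 12) * R^2"
 define e where "e z = R^2 - (norm (z - p))^2" for z
 define w where "w z = (e z * e z) * (g z * g z) + A * (h z * h z)" for z
 have le: "has_lap (ball p R) e (%z. 0 - 2 *R (z - p)) (%z. 0 - 2 * n)"
  unfolding e_def n_def by (intro has_lap_diff has_lap_const has_lap_normsq)
 note s = subset_UNIV[of "ball p R"]
 note lw = has_lap_add[OF has_lap_mult[OF has_lap_mult[OF le le] has_lap_mult[OF has_lap_subset[OF Dg s] has_lap_subset[OF Dg s]]]
  has_lap_cmult[OF has_lap_mult[OF has_lap_subset[OF Dh s] has_lap_subset[OF Dh s]], of A], folded w_def]
 have c: "continuous_on S h" "continuous_on S g" for S
  using has_lap_continuous[OF Dh] has_lap_continuous[OF Dg] by (auto intro: continuous_on_subset)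
 have "w p <= A * M^2"
 proof (rule has_lap_comparison_closure[OF bounded_ball open_ball lw has_lap_const])
  show "continuous_on (closure (ball p R)) w" unfolding w_def e_def by (intro continuous_intros c)
  show "p : ball p R" using R(1) by simp
  show "w z <= A * M^2" if "z : frontier (ball p R)" for z
  proof -
   have z: "e z = 0" "z : cball p R" using that R(1) by (auto simp: e_def dist_norm norm_minus_commute)
   have "h z * h z <= M^2" using power_mono[OF R(2)[OF z(2)], of 2] by (simp add: power2_eq_square)
   then show ?thesis using n by (simp add: w_def z A_def mult_left_mono)
  qed
  fix z assume "z : ball p R"
  then have z: "(norm (z - p))^2 <= R^2" by (intro power_mono) (auto simp: dist_norm norm_minus_commute)
  define X where "X = Dg z \<bullet> (z - p)"
  define y where "y = z - p"
  \<comment> \<open>Completing a square: the cross term of the gradients of \<open>e^2\<close> and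
    \<open>g^2\<close> is absorbed by the good term
    \<open>2 * (e z)^2 * norm (Dg z)^2\<close>.\<close>
  have "0 <= (norm (e z *R Dg z - (4 * g z) *R y))^2" by simp
  also have "... = (e z)^2 * (Dg z \<bullet> Dg z) - 8 * e z * g z * X + 16 * (g z)^2 * (norm (z - p))^2"
   unfolding power2_norm_eq_inner X_def y_def[symmetric]
   by (simp add: inner_diff_left inner_diff_right inner_commute[of y "Dg z"] power2_eq_square algebra_simps)
  finally have 1: "16 * e z * g z * X <= 2 * ((e z)^2 * (Dg z \<bullet> Dg z)) + 32 * (g z)^2 * (norm (z - p))^2" by simp
  have "(g z)^2 <= (norm (Dh z))^2"
  proof -
   have "\<bar>g z\<bar> <= norm (Dh z) * norm u" unfolding gD by (rule Cauchy_Schwarz_ineq2)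
   also have "... <= norm (Dh z)" using nu by (simp add: mult_left_le)
   finally show ?thesis using power_mono[of "\<bar>g z\<bar>" "norm (Dh z)" 2] by simp
  qed
  then have "2 * A * (g z)^2 <= 2 * A * (Dh z \<bullet> Dh z)" using n by (intro mult_left_mono) (auto simp: A_def power2_norm_eq_inner)
  moreover have "(24 * (norm (z - p))^2 + 4 * n * e z) * (g z)^2 <= (2 * A) * (g z)^2"
  proof (rule mult_right_mono)
   have "4 * n * e z <= 4 * n * R^2" using n by (intro mult_left_mono) (auto simp: e_def)
   then show "24 * (norm (z - p))^2 + 4 * n * e z <= 2 * A" using z by (simp add: A_def algebra_simps)
  qed simp
  ultimately show "0 <= (e z * e z * (g z * 0 + g z * 0 + 2 * (Dg z \<bullet> Dg z))
   + g z * g z * (e z * (0 - 2 * n) + e z * (0 - 2 * n) + 2 * ((0 - 2 *R (z - p)) \<bullet> (0 - 2 *R (z - p))))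
   + 2 * ((e z *R (0 - 2 *R (z - p)) + e z *R (0 - 2 *R (z - p))) \<bullet> (g z *R Dg z + g z *R Dg z)))
   + A * (h z * 0 + h z * 0 + 2 * (Dh z \<bullet> Dh z))"
   using 1 unfolding X_def power2_norm_eq_inner y_def[symmetric]
   by (simp add: inner_commute[of y "Dg z"] power2_eq_square algebra_simps)
 qed (rule continuous_on_const)
 then have "R ^ 4 * (g p)^2 <= A * M^2"
 proof -
  have "0 <= A * (h p * h p)" using n by (simp add: A_def)
  then show ?thesis using `w p <= A * M^2` by (simp add: w_def e_def power2_eq_square power4_eq_xxxx mult.assoc)
 qed
 also have "... <= (16 * n^2) * R^2 * M^2"
 proof -
  have "n * 1 <= n * n" using n by (intro mult_left_mono) auto
  then have "2 * n + 12 <= 16 * n^2" using n unfolding power2_eq_square by linarith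
  then show ?thesis unfolding A_def by (intro mult_right_mono) auto
 qed
 finally have "R^2 * (R * g p)^2 <= R^2 * (4 * n * M)^2"
 proof -
  have "R ^ 4 * (g p)^2 = R^2 * (R * g p)^2" by algebra
  moreover have "(16 * n^2) * R^2 * M^2 = R^2 * (4 * n * M)^2" by algebra
  ultimately show "R ^ 4 * (g p)^2 <= (16 * n^2) * R^2 * M^2 ==> R^2 * (R * g p)^2 <= R^2 * (4 * n * M)^2" by simp
 qed
 then have "(R * g p)^2 <= (4 * n * M)^2" using R(1) by simp
 then have "R * g p <= 4 * n * M" by (rule power2_le_imp_le) (use n M0 in simp)
 moreover have "g p = norm d"
 proof -
  have "(h has_derivative (%k. Dh p \<bullet> k)) (at p)" using Dh by (simp add: has_lap_def)
  from has_derivative_unique[OF this d] have "Dh p \<bullet> u = d \<bullet> u" by (rule fun_cong)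
  moreover have "d \<bullet> u = norm d"
   by (cases "d = 0") (simp_all add: u_def sgn_div_norm dot_square_norm power2_eq_square)
  ultimately show ?thesis by (simp add: gD)
 qed
 ultimately show ?thesis using R(1) by (simp add: pos_le_divide_eq n_def mult.commute)
qed

section \<open>Regularity: locally uniform limits of harmonic polynomials\<close>

definition harmlim :: "'a::euclidean_space set => ('a => real) => bool" where
 "harmlim W h \<longleftrightarrow> (ALL x:W. EX r>0. cball x r <= W & (EX P. (ALL k. pol (P k) & harmonic_on UNIV (P k)) &
   uniform_limit (cball x r) P h sequentially))"

text \<open>The interior gradient bound, applied to \<open>P m - P k\<close> on balls of radius
  \<open>R - r\<close>, makes the gradients uniformly Cauchy. Derivatives of harmonic polynomials
  are again harmonic polynomials, so the step can be iterated to any order.\<close>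

lemma uniform_limit_harmonic_pol_derivative:
 fixes h :: "'a::euclidean_space => real"
 assumes r: "0 < r" "r < R" and P: "!!k. pol (P k) & harmonic_on UNIV (P k)"
  and lim: "uniform_limit (cball p R) P h sequentially"
 shows "EX D'. (ALL x:ball p r. (h has_derivative (%k. D' x \<bullet> k)) (at x)) &
   (ALL b:Basis. uniform_limit (ball p r) (%k. partial b (P k)) (%x. D' x \<bullet> b) sequentially)"
proof -
 define D where "D k x = (SUM b:Basis. partial b (P k) x *R b)" for k x
 define de where "de = R - r"
 have d0: "de > 0" using r by (simp add: de_def)
 define n where "n = real DIM('a)"
 have n: "n > 0" using DIM_positive by (simp add: n_def)
 have der: "((P k) has_derivative (%h. D k x \<bullet> h)) (at x)" for k x
  using pol_has_lap[of "P k" UNIV] P by (auto simp: has_lap_def D_def)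
 have ball_sub: "cball x de <= cball p R" if "x : ball p r" for x
 proof
  fix z assume "z : cball x de"
  then show "z : cball p R" using that dist_triangle[of p z x] by (simp add: de_def)
 qed
 have cau: "uniformly_Cauchy_on (cball p R) P"
  using lim by (meson uniformly_convergent_Cauchy uniformly_convergent_on_def)
 have "uniformly_Cauchy_on (ball p r) D"
 proof (rule uniformly_Cauchy_onI)
  fix e :: real assume e: "e > 0"
  define e' where "e' = e * de / (8 * n)"
  have e': "e' > 0" using e d0 n by (simp add: e'_def)
  obtain N where N: "!!x m k. x : cball p R ==> m >= N ==> k >= N ==> dist (P m x) (P k x) < e'"
   using cau e' unfolding uniformly_Cauchy_on_def by meson
  have "dist (D m x) (D k x) < e" if x: "x : ball p r" and mk: "m >= N" "k >= N" for x m k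
  proof -
   have pd: "pol (%x. P m x - P k x)" "harmonic_on UNIV (%x. P m x - P k x)"
    using P pol_diff harmonic_on_diff by blast+
   have dd: "((%x. P m x - P k x) has_derivative (%h. (D m x - D k x) \<bullet> h)) (at x)"
    using has_derivative_diff[OF der der] by (simp add: inner_diff_left)
   have "norm (D m x - D k x) <= 4 * real DIM('a) * e' / de"
    by (rule harmonic_pol_grad_bound[OF pd d0 _ dd])
     (use N ball_sub[OF x] mk in "auto simp: dist_real_def subset_iff less_imp_le")
   also have "... < e" using e d0 n by (simp add: e'_def n_def[symmetric])
   finally show ?thesis by (simp add: dist_norm)
  qed
  then show "EX M. ALL x:ball p r. ALL m>=M. ALL k>=M. dist (D m x) (D k x) < e" by blast
 qed
 then obtain D' where D': "uniform_limit (ball p r) D D' sequentially"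
  by (metis Cauchy_uniformly_convergent uniformly_convergent_on_def)
 have conv: "(%k. P k x) \<longlonglongrightarrow> h x" if "x : ball p r" for x
  using tendsto_uniform_limitI[OF lim, of x] that r by auto
 have "EX g. ALL x:ball p r. (%k. P k x) \<longlonglongrightarrow> g x & (g has_derivative (%h. D' x \<bullet> h)) (at x within ball p r)"
 proof (rule has_derivative_sequence[where f'="%k x h. D k x \<bullet> h"])
  show "p : ball p r" "(%k. P k p) \<longlonglongrightarrow> h p" using conv[of p] r by auto
  show "convex (ball p r)" by simp
  show "((P k) has_derivative (%h. D k x \<bullet> h)) (at x within ball p r)" for k x
   using der has_derivative_at_withinI by blast
  fix e :: real assume "e > 0"
  then have "\<forall>\<^sub>F k in sequentially. ALL x:ball p r. dist (D k x) (D' x) < e"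
   using D' by (simp add: uniform_limit_iff)
  then show "\<forall>\<^sub>F k in sequentially. ALL x:ball p r. ALL h. norm (D k x \<bullet> h - D' x \<bullet> h) <= e * norm h"
  proof eventually_elim
   case (elim k)
   show ?case
   proof (intro ballI allI)
    fix x h assume "x : ball p r"
    have "norm (D k x \<bullet> h - D' x \<bullet> h) <= norm (D k x - D' x) * norm h"
     unfolding inner_diff_left[symmetric] real_norm_def by (rule Cauchy_Schwarz_ineq2)
    also have "... <= e * norm h" using elim `x : ball p r`
     by (intro mult_right_mono) (auto simp: dist_norm less_imp_le)
    finally show "norm (D k x \<bullet> h - D' x \<bullet> h) <= e * norm h" .
   qed
  qed
 qed
 then obtain g where g: "!!x. x : ball p r ==> (%k. P k x) \<longlonglongrightarrow> g x"
  "!!x. x : ball p r ==> (g has_derivative (%h. D' x \<bullet> h)) (at x within ball p r)" by blast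
 have gh: "g x = h x" if "x : ball p r" for x using g(1) conv that LIMSEQ_unique by blast
 have "(h has_derivative (%k. D' x \<bullet> k)) (at x)" if x: "x : ball p r" for x
 proof -
  have "(g has_derivative (%h. D' x \<bullet> h)) (at x)" using g(2)[OF x] at_within_open[OF x] by simp
  then show ?thesis by (rule has_derivative_transform_within_open[OF _ open_ball x]) (simp add: gh)
 qed
 moreover have "uniform_limit (ball p r) (%k. partial b (P k)) (%x. D' x \<bullet> b) sequentially" if b: "b : Basis" for b
 proof -
  have "uniform_limit (ball p r) (%k x. D k x \<bullet> b) (%x. D' x \<bullet> b) sequentially"
   using bounded_linear.uniform_limit[OF bounded_linear_inner_left D'] .
  moreover have "D k x \<bullet> b = partial b (P k) x" for k x
   using b by (simp add: D_def inner_sum_left inner_Basis if_distrib cong: if_cong)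
  ultimately show ?thesis by simp
 qed
 ultimately show ?thesis by blast
qed

lemma harmlim_partial_limit:
 assumes "harmlim W h" "x : W"
 obtains r P where "r > 0" "cball x r <= W" "ALL k. pol (P k) & harmonic_on UNIV (P k)" "h differentiable (at x)"
  "!!b. b : Basis ==> uniform_limit (cball x r) (%k. partial b (P k)) (partial b h) sequentially"
proof -
 obtain R P where R: "R > 0" "cball x R <= W" and P: "ALL k. pol (P k) & harmonic_on UNIV (P k)"
  "uniform_limit (cball x R) P h sequentially" using assms unfolding harmlim_def by blast
 have h: "0 < R/2" "R/2 < R" using R by auto
 from uniform_limit_harmonic_pol_derivative[OF h _ P(2)] P(1)
 obtain D' where D': "!!y. y : ball x (R/2) ==> (h has_derivative (%k. D' y \<bullet> k)) (at y)"
  "!!b. b : Basis ==> uniform_limit (ball x (R/2)) (%k. partial b (P k)) (%x. D' x \<bullet> b) sequentially" by blast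
 have s: "cball x (R/4) <= ball x (R/2)" using R by auto
 show ?thesis
 proof (rule that[of "R/4" P])
  show "h differentiable (at x)" using D'(1)[of x] R(1) unfolding differentiable_def by auto
  fix b :: 'a assume b: "b : Basis"
  have "partial b h y = D' y \<bullet> b" if "y : cball x (R/4)" for y using partial_eqI[OF D'(1)] s that by blast
  then show "uniform_limit (cball x (R/4)) (%k. partial b (P k)) (partial b h) sequentially"
   using uniform_limit_on_subset[OF D'(2)[OF b] s] by (subst uniform_limit_cong') auto
 qed (use R P in auto)
qed

lemma harmlim_partial:
 assumes "harmlim W h" "b : Basis"
 shows "harmlim W (partial b h)"
 unfolding harmlim_def
proof
 fix x assume "x : W"
 then obtain r P where "r > 0" "cball x r <= W" "ALL k. pol (P k) & harmonic_on UNIV (P k)"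
  "uniform_limit (cball x r) (%k. partial b (P k)) (partial b h) sequentially"
  using harmlim_partial_limit[OF assms(1)] assms(2) by metis
 then show "EX r>0. cball x r <= W & (EX P. (ALL k. pol (P k) & harmonic_on UNIV (P k)) &
   uniform_limit (cball x r) P (partial b h) sequentially)"
  by (intro exI[of _ r] conjI exI[of _ "%k. partial b (P k)"]) (auto intro: pol_partial harmonic_pol_partial)
qed

lemma harmlim_Ck: "harmlim W h ==> Ck_on k h W"
proof (induction k arbitrary: h)
 case 0
 have "h differentiable (at x)" if "x : W" for x using harmlim_partial_limit[OF 0 that] by blast
 then show ?case by (auto intro!: continuous_at_imp_continuous_on differentiable_imp_continuous_within)
next
 case (Suc k)
 have "h differentiable (at x)" if "x : W" for x using harmlim_partial_limit[OF Suc.prems that] by blast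
 then show ?case using Suc.IH harmlim_partial[OF Suc.prems] by simp
qed

lemma harmlim_imp_harmonic:
 assumes "harmlim W h" "open W"
 shows "harmonic_on W h"
proof -
 have "laplacian h x = 0" if x: "x : W" for x
 proof -
  obtain e P where e: "e > 0" and P: "ALL k. pol (P k) & harmonic_on UNIV (P k)"
   "!!b. b : Basis ==> uniform_limit (cball x e) (%k. partial b (P k)) (partial b h) sequentially"
   using harmlim_partial_limit[OF assms(1) x] by metis
  have "(%k. partial b (partial b (P k)) x) \<longlonglongrightarrow> partial b (partial b h) x" if b: "b : Basis" for b
  proof -
   have "!!k. pol (partial b (P k)) & harmonic_on UNIV (partial b (P k))"
    using P(1) pol_partial harmonic_pol_partial by blast
   from uniform_limit_harmonic_pol_derivative[of "e/2" e, OF _ _ this P(2)[OF b]] e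
   obtain D' where D': "ALL y:ball x (e/2). (partial b h has_derivative (%k. D' y \<bullet> k)) (at y)"
    "uniform_limit (ball x (e/2)) (%k. partial b (partial b (P k))) (%x. D' x \<bullet> b) sequentially"
    using b by auto
   have "partial b (partial b h) x = D' x \<bullet> b" using partial_eqI D'(1) e by (metis centre_in_ball half_gt_zero)
   then show ?thesis using tendsto_uniform_limitI[OF D'(2), of x] e by simp
  qed
  then have "(%k. laplacian (P k) x) \<longlonglongrightarrow> laplacian h x"
   unfolding laplacian_def by (intro tendsto_sum)
  moreover have "laplacian (P k) x = 0" for k
   using P(1) has_lap_laplacian[OF _ open_UNIV UNIV_I] unfolding harmonic_on_def by blast
  ultimately show ?thesis by (simp add: LIMSEQ_const_iff)
 qed
 then have "has_lap W h (%x. SUM b:Basis. partial b h x *R b) (%x. 0)"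
  using has_lap_cong[OF Ck_on_2_has_lap(1)[OF harmlim_Ck[OF assms(1)]] assms(2)] by simp
 then show ?thesis by (auto simp: harmonic_on_def)
qed

lemma harmonic_le_on_ball:
 assumes "r > 0" "harmonic_on (ball p r) u" "harmonic_on (ball p r) v" "continuous_on (cball p r) u"
  "continuous_on (cball p r) v" "!!x. x : sphere p r ==> u x <= v x + c" "x : cball p r"
 shows "u x <= v x + c"
proof (cases "x : ball p r")
 case True
 obtain D E where D: "has_lap (ball p r) u D (%x. 0)" "has_lap (ball p r) v E (%x. 0)"
  using assms by (auto simp: harmonic_on_def)
 show ?thesis
  by (rule has_lap_comparison_closure[OF _ _ D(1) has_lap_add[OF D(2) has_lap_const[of _ c]]])
   (use assms True in "auto intro!: continuous_intros")
next
 case False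
 then have "x : sphere p r" using assms by auto
 then show ?thesis using assms(6) by blast
qed

text \<open>Stone-Weierstrass approximates the data by polynomials, each of which is replaced by a
  harmonic polynomial with the same values on the sphere. By the maximum principle, uniform
  closeness on the sphere gives a uniform Cauchy sequence on the closed ball.\<close>

lemma ball_dirichlet_pol:
 fixes f :: "'a::euclidean_space => real"
 assumes "r > 0" "continuous_on (sphere p r) f"
 obtains q P where "continuous_on (cball p r) q" "!!x. x : sphere p r ==> q x = f x"
  "harmonic_on (ball p r) q" "!!k. pol (P k) & harmonic_on UNIV (P k)" "uniform_limit (cball p r) P q sequentially"
proof -
 have "EX P. pol P & harmonic_on UNIV P & (ALL x:sphere p r. \<bar>P x - f x\<bar> < inverse (Suc k))" for k
 proof -
  have "continuous_on (sphere 0 1) (%x. f (p + r *R x))"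
   by (rule continuous_on_compose2[OF assms(2)]) (use assms(1) in "auto intro!: continuous_intros simp: dist_norm")
  then obtain g where g: "real_polynomial_function g"
   "!!x. x : sphere 0 1 ==> \<bar>f (p + r *R x) - g x\<bar> < inverse (Suc k)"
   using Stone_Weierstrass_real_polynomial_function[OF compact_sphere] inverse_positive_iff_positive
   by (metis of_nat_0_less_iff zero_less_Suc)
  obtain h where h: "pol h" "harmonic_on UNIV h" "ALL x:sphere 0 1. h x = g x"
   using pol_harmonic_on_sphere real_polynomial_function_imp_pol g(1) by blast
  define P where "P x = h (inverse r *R (x - p))" for x
  have "pol P" unfolding P_def[abs_def] by (rule pol_affine[OF h(1)])
  moreover have "harmonic_on UNIV P"
  proof -
   obtain D where D: "has_lap UNIV h D (%x. 0)" using h(2) by (auto simp: harmonic_on_def)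
   have "has_lap UNIV (%x. h (inverse r *R (x - p))) (%x. inverse r *R D (inverse r *R (x - p))) (%x. 0)"
    using has_lap_affine[OF D, of "inverse r" p] by simp
   then show ?thesis unfolding P_def[abs_def] harmonic_on_def by blast
  qed
  moreover have "\<bar>P x - f x\<bar> < inverse (Suc k)" if "x : sphere p r" for x
  proof -
   define y where "y = inverse r *R (x - p)"
   have y: "y : sphere 0 1" using that assms(1) by (auto simp: y_def dist_norm norm_minus_commute)
   have xy: "x = p + r *R y" using assms(1) by (simp add: y_def)
   have "P x = g y" using h(3) y by (simp add: P_def y_def)
   then show ?thesis using g(2)[OF y] xy by (simp add: abs_minus_commute)
  qed
  ultimately show ?thesis by blast
 qed
 then obtain P where P: "!!k. pol (P k)" "!!k. harmonic_on UNIV (P k)"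
  "!!k x. x : sphere p r ==> \<bar>P k x - f x\<bar> < inverse (Suc k)" by metis
 have Pc: "continuous_on A (P k)" for k A
  using harmonic_on_continuous[OF P(2)] continuous_on_subset by blast
 have Ph: "harmonic_on A (P k)" for k A using harmonic_on_subset[OF P(2)] by blast
 have "uniformly_Cauchy_on (cball p r) P"
 proof (rule uniformly_Cauchy_onI)
  fix e :: real assume "e > 0"
  then obtain N where N: "inverse (real (Suc N)) < e / 4"
   using reals_Archimedean[of "e/4"] by auto
  have "P m x <= P k x + e/2" if "x : cball p r" "m >= N" "k >= N" for x m k
  proof (rule harmonic_le_on_ball[OF assms(1) Ph Ph Pc Pc _ that(1)])
   fix z assume z: "z : sphere p r"
   have "inverse (real (Suc m)) <= inverse (real (Suc N))" "inverse (real (Suc k)) <= inverse (real (Suc N))"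
    using that by (auto intro!: le_imp_inverse_le)
   then show "P m z <= P k z + e/2" using P(3)[OF z, of m] P(3)[OF z, of k] N by linarith
  qed
  then have "dist (P m x) (P k x) < e" if "x : cball p r" "m >= N" "k >= N" for x m k
   using that `e > 0` by (auto simp: dist_real_def abs_less_iff) (smt (verit) field_sum_of_halves)+
  then show "EX M. ALL x:cball p r. ALL m>=M. ALL k>=M. dist (P m x) (P k x) < e" by blast
 qed
 then obtain q where q: "uniform_limit (cball p r) P q sequentially"
  by (metis Cauchy_uniformly_convergent uniformly_convergent_on_def)
 show ?thesis
 proof (rule that)
  show "continuous_on (cball p r) q"
   by (rule uniform_limit_theorem[OF _ q]) (auto intro!: always_eventually Pc)
  show "q x = f x" if "x : sphere p r" for x
  proof (rule LIMSEQ_unique)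
   show "(%k. P k x) \<longlonglongrightarrow> q x" using tendsto_uniform_limitI[OF q, of x] that by auto
   have "(%k. P k x - f x) \<longlonglongrightarrow> 0"
    by (rule Lim_null_comparison[OF _ LIMSEQ_inverse_real_of_nat])
     (use P(3)[OF that] in "auto intro!: always_eventually less_imp_le")
   then show "(%k. P k x) \<longlonglongrightarrow> f x" by (simp add: LIM_zero_iff)
  qed
  have "harmlim (ball p r) q"
   unfolding harmlim_def
  proof
   fix x assume "x : ball p r"
   then obtain e where e: "e > 0" "cball x e <= ball p r" using open_contains_cball open_ball by blast
   then have "uniform_limit (cball x e) P q sequentially" using uniform_limit_on_subset[OF q] ball_subset_cball by blast
   then show "EX e>0. cball x e <= ball p r & (EX P. (ALL k. pol (P k) & harmonic_on UNIV (P k)) &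
    uniform_limit (cball x e) P q sequentially)" using e P(1,2) by blast
  qed
  then show "harmonic_on (ball p r) q" by (intro harmlim_imp_harmonic) auto
 qed (use P q in auto)
qed

lemma ball_dirichlet:
 assumes "r > 0" "continuous_on (sphere p r) f"
 obtains q where "continuous_on (cball p r) q" "!!x. x : sphere p r ==> q x = f x" "harmonic_on (ball p r) q"
 using ball_dirichlet_pol[OF assms] by metis

text \<open>On the closed ball \<open>h\<close> is the solution of the Dirichlet problem with its
  own boundary values, hence the polynomial limit constructed for them.\<close>

lemma harmonic_pol_limit:
 assumes "harmonic_on W h" "cball p r <= W" "r > 0"
 obtains P where "!!k. pol (P k) & harmonic_on UNIV (P k)" "uniform_limit (cball p r) P h sequentially"
proof -
 have hc: "continuous_on (cball p r) h" using harmonic_on_continuous[OF assms(1)] assms(2) continuous_on_subset by blast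
 then have "continuous_on (sphere p r) h" by (rule continuous_on_subset) auto
 from ball_dirichlet_pol[OF assms(3) this] obtain q P where q: "continuous_on (cball p r) q"
  "!!x. x : sphere p r ==> q x = h x" "harmonic_on (ball p r) q"
  and P: "!!k. pol (P k) & harmonic_on UNIV (P k)" "uniform_limit (cball p r) P q sequentially" by metis
 have hb: "harmonic_on (ball p r) h" using assms(2) by (intro harmonic_on_subset[OF assms(1)]) auto
 have "q x = h x" if "x : cball p r" for x
  using harmonic_le_on_ball[OF assms(3) q(3) hb q(1) hc, of 0 x] harmonic_le_on_ball[OF assms(3) hb q(3) hc q(1), of 0 x]
   q(2) that by force
 then have "uniform_limit (cball p r) P h sequentially"
  by (intro uniform_limit_cong'[THEN iffD1, OF _ _ P(2)]) auto
 then show ?thesis using that P(1) by blast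
qed

lemma harmonic_imp_harmlim:
 assumes "harmonic_on W h" "open W"
 shows "harmlim W h"
 unfolding harmlim_def
proof
 fix x assume "x : W"
 then obtain e where e: "e > 0" "cball x e <= W" using assms(2) open_contains_cball by blast
 then show "EX e>0. cball x e <= W & (EX P. (ALL k. pol (P k) & harmonic_on UNIV (P k)) &
   uniform_limit (cball x e) P h sequentially)" using harmonic_pol_limit[OF assms(1) e(2,1)] by metis
qed

text \<open>The bound \<open>M\<close> is known on the open ball only. The approximating polynomials
  are therefore controlled on the concentric ball of radius \<open>3 * R/4\<close> by
  \<open>M + e\<close>; balls of radius \<open>R/2\<close> about points of
  \<open>ball p (R/4)\<close> stay inside it, and finally \<open>e\<close> tends to 0.\<close>

lemma harmonic_lipschitz:
 fixes h :: "'a::euclidean_space => real"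
 assumes "R > 0" "harmonic_on (ball p R) h" and M: "!!z. z : ball p R ==> \<bar>h z\<bar> <= M"
  and x: "x : ball p (R/4)" and y: "y : ball p (R/4)"
 shows "\<bar>h x - h y\<bar> <= 8 * real DIM('a) * M / R * norm (x - y)"
proof -
 define n where "n = real DIM('a)"
 have "cball p (3 * R/4) <= ball p R" "3 * R/4 > 0" using assms(1) by auto
 from harmonic_pol_limit[OF assms(2) this] obtain P where
  P: "!!k. pol (P k) & harmonic_on UNIV (P k)" "uniform_limit (cball p (3 * R/4)) P h sequentially" by metis
 have main: "\<bar>h x - h y\<bar> <= 8 * n * M / R * norm (x - y) + e * (8 * n / R * norm (x - y))" if e: "e > 0" for e
 proof -
  have ev: "\<forall>\<^sub>F k in sequentially. \<bar>P k x - P k y\<bar> <= 8 * n * (M + e) / R * norm (x - y)"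
  proof -
   have "\<forall>\<^sub>F k in sequentially. ALL z:cball p (3 * R/4). dist (P k z) (h z) < e"
    using P(2) e unfolding uniform_limit_iff by blast
   then show ?thesis
   proof eventually_elim
    case (elim k)
    have Pk: "\<bar>P k z\<bar> <= M + e" if "z : cball p (3 * R/4)" for z
     using elim that M[of z] assms(1) by (force simp: dist_real_def)
    define D where "D x = (SUM b:Basis. partial b (P k) x *R b)" for x
    have der: "(P k has_derivative (%h. D x \<bullet> h)) (at x)" for x
     using pol_has_lap[of "P k" UNIV] P(1) by (auto simp: has_lap_def D_def)
    have "norm (P k x - P k y) <= 8 * n * (M + e) / R * norm (x - y)"
    proof (rule differentiable_bound[OF convex_ball _ _ x y])
     fix z assume z: "z : ball p (R/4)"
     show "(P k has_derivative (%h. D z \<bullet> h)) (at z within ball p (R/4))" by (rule has_derivative_at_withinI[OF der])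
     have "cball z (R/2) <= cball p (3 * R/4)"
     proof
      fix w assume "w : cball z (R/2)"
      then show "w : cball p (3 * R/4)" using z dist_triangle[of p w z] by simp
     qed
     then have "norm (D z) <= 4 * real DIM('a) * (M + e) / (R/2)"
      using P(1) Pk assms(1) by (intro harmonic_pol_grad_bound[OF _ _ _ _ der]) auto
     then have D: "norm (D z) <= 8 * n * (M + e) / R" by (simp add: n_def)
     show "onorm (%h. D z \<bullet> h) <= 8 * n * (M + e) / R"
     proof (rule onorm_le)
      show "norm (D z \<bullet> h) <= 8 * n * (M + e) / R * norm h" for h
       using Cauchy_Schwarz_ineq2[of "D z" h] mult_right_mono[OF D, of "norm h"] by simp
     qed
    qed
    then show ?case by simp
   qed
  qed
  have c: "(%k. P k z) \<longlonglongrightarrow> h z" if "z : ball p (R/4)" for z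
  proof (rule tendsto_uniform_limitI[OF P(2)])
   have "dist p z < R/4" using that by simp
   then show "z : cball p (3 * R/4)" using assms(1) by simp
  qed
  have "\<bar>h x - h y\<bar> <= 8 * n * (M + e) / R * norm (x - y)"
   by (rule tendsto_upperbound[OF _ ev]) (use c[OF x] c[OF y] in "auto intro!: tendsto_intros")
  then show ?thesis by (simp add: algebra_simps add_divide_distrib)
 qed
 have "\<bar>h x - h y\<bar> <= 8 * n * M / R * norm (x - y)"
 proof (cases "x = y")
  case False
  define c where "c = 8 * n / R * norm (x - y)"
  have "c > 0" using False assms(1) DIM_positive[where 'a='a] by (simp add: c_def n_def)
  show ?thesis
  proof (rule field_le_epsilon)
   show "\<bar>h x - h y\<bar> <= 8 * n * M / R * norm (x - y) + e" if "0 < e" for e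
    using main[of "e / c"] that `c > 0` by (simp only: c_def[symmetric]) simp
  qed
 qed simp
 then show ?thesis by (simp add: n_def)
qed

lemma harmonic_grad_bound:
 fixes h :: "'a::euclidean_space => real"
 assumes "harmonic_on (ball p R) h" "R > 0" "!!z. z : ball p R ==> \<bar>h z\<bar> <= M"
  "(h has_derivative (%k. d \<bullet> k)) (at p)"
 shows "norm d <= 8 * real DIM('a) * M / R"
 by (rule lipschitz_grad_bound[OF assms(4), of "R/4"])
  (use assms harmonic_lipschitz[OF assms(2,1,3), of _ p] in auto)

lemma harmonic_Ck: "harmonic_on W h ==> open W ==> Ck_on k h W"
 using harmlim_Ck harmonic_imp_harmlim by blast

lemma harmonic_partial: "harmonic_on W h ==> open W ==> b : Basis ==> harmonic_on W (partial b h)"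
 using harmlim_imp_harmonic[OF harmlim_partial[OF harmonic_imp_harmlim]] .

text \<open>The limit is compared with the harmonic function having its values on the sphere; both
  are within \<open>e/2\<close> of the same \<open>f k\<close>.\<close>

lemma uniform_limit_harmonic:
 fixes h :: "'a::euclidean_space => real"
 assumes "r > 0" "!!k. harmonic_on (ball p r) (f k)" "!!k. continuous_on (cball p r) (f k)"
  "uniform_limit (cball p r) f h sequentially"
 shows "harmonic_on (ball p r) h"
proof -
 have hc: "continuous_on (cball p r) h"
  by (rule uniform_limit_theorem[OF _ assms(4)]) (auto intro!: always_eventually assms)
 then have "continuous_on (sphere p r) h" by (rule continuous_on_subset) auto
 from ball_dirichlet[OF assms(1) this] obtain q where q: "continuous_on (cball p r) q"
  "!!x. x : sphere p r ==> q x = h x" "harmonic_on (ball p r) q" by blast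
 have "h x = q x" if x: "x : cball p r" for x
 proof -
  have "\<bar>h x - q x\<bar> <= 0 + e" if e: "e > 0" for e
  proof -
   have "e/2 > 0" using e by simp
   then have "\<forall>\<^sub>F k in sequentially. ALL x:cball p r. dist (f k x) (h x) < e/2"
    using assms(4) unfolding uniform_limit_iff by blast
   then obtain k where k: "ALL x:cball p r. dist (f k x) (h x) < e/2" using eventually_happens by fastforce
   have ks: "\<bar>f k z - q z\<bar> < e/2" if "z : sphere p r" for z
    using k that q(2)[OF that] by (auto simp: dist_real_def)
   have "f k x <= q x + e/2"
    by (rule harmonic_le_on_ball[OF assms(1,2) q(3) assms(3) q(1) _ x]) (smt (verit) ks field_sum_of_halves)
   moreover have "q x <= f k x + e/2"
    by (rule harmonic_le_on_ball[OF assms(1) q(3) assms(2) q(1) assms(3) _ x]) (smt (verit) ks field_sum_of_halves)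
   moreover have "\<bar>f k x - h x\<bar> < e/2" using k x by (auto simp: dist_real_def)
   ultimately show ?thesis by linarith
  qed
  then have "\<bar>h x - q x\<bar> <= 0" by (rule field_le_epsilon)
  then show ?thesis by simp
 qed
 then show ?thesis using harmonic_on_cong[OF q(3) open_ball] by auto
qed

section \<open>Barriers, the strong maximum principle and harmonic majorants\<close>

text \<open>Linear lower bound for \<open>s powr (-N)\<close> at the end point \<open>R\<close>. It
  reduces to \<open>N = 1\<close>, where it says that \<open>(2 * R - s) * s <= R^2\<close>. It
  turns the annular barrier into a multiple of the distance to the outer sphere.\<close>

lemma powr_convex_ineq:
 fixes s R N :: real
 assumes "0 < s" "s <= R" "N >= 1"
 shows "s powr (-N) - R powr (-N) >= R powr (-N) * ((R - s) / R)"
proof -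
 have R: "R > 0" using assms by simp
 have 1: "(s / R) powr (-1) <= (s / R) powr (-N)"
  using assms R by (intro powr_mono') auto
 have 2: "R / s >= 1 + (R - s) / R"
 proof -
  have "(1 + (R - s) / R) * s <= R"
  proof -
   have "R * R - (2 * R - s) * s = (R - s)^2" by (simp add: power2_eq_square algebra_simps)
   then have "(2 * R - s) * s <= R * R" by (smt (verit) zero_le_power2)
   then show ?thesis using R by (simp add: field_simps)
  qed
  then show ?thesis using assms by (simp add: pos_le_divide_eq)
 qed
 have 3: "(s / R) powr (-1) = R / s" using assms R by (simp add: powr_minus)
 have "s powr (-N) = R powr (-N) * (s / R) powr (-N)"
  using assms R by (simp add: powr_mult[symmetric])
 also have "... >= R powr (-N) * (1 + (R - s) / R)"
  using 1 2 3 by (intro mult_left_mono) auto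
 finally show ?thesis by (simp add: algebra_simps)
qed

text \<open>Quantitative Hopf lemma. In the annulus the comparison function is a multiple of
  \<open>norm (x - p) powr (-N) - R2 powr (-N)\<close> with \<open>N\<close> the dimension: it is
  subharmonic, at most \<open>m\<close> on the inner sphere and zero on the outer one.\<close>

lemma superharmonic_annulus_lower:
 fixes Q :: "'a::euclidean_space => real"
 assumes R: "0 < R1" "R1 <= R2" and Q: "has_lap (ball p R2) Q D l" "!!x. x : ball p R2 ==> l x <= 0"
  and pos: "!!x. x : ball p R2 ==> Q x >= 0"
  and m: "m >= 0" "!!x. x : cball p R1 ==> x : ball p R2 ==> Q x >= m" and x: "x : ball p R2"
 shows "Q x >= (R1 / R2) powr DIM('a) * m * ((R2 - dist p x) / R2)"
proof -
 define N where "N = real DIM('a)"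
 have N: "N >= 1" using DIM_positive[where 'a='a] by (simp add: N_def)
 have R2: "R2 > 0" using R by simp
 define c where "c = (R1 / R2) powr N"
 have c: "0 < c" "c <= 1" using R N by (auto simp: c_def powr_le1)
 show ?thesis
 proof (cases "x : cball p R1")
  case True
  have "(R2 - dist p x) / R2 <= 1" "(R2 - dist p x) / R2 >= 0" using R2 x by (auto simp: field_simps)
  then have "c * m * ((R2 - dist p x) / R2) <= 1 * m * 1" using c m by (intro mult_mono) auto
  then show ?thesis using m(2)[OF True x] by (simp add: c_def N_def)
 next
  case False
  define W where "W = ball p R2 - cball p R1"
  have W: "open W" "bounded W" "p ~: W" using R by (auto simp: W_def intro: bounded_subset[OF bounded_ball[of p R2]])
  define k where "k = m * R1 powr N"
  have k: "k >= 0" using m by (simp add: k_def)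
  define b where "b z = k * norm (z - p) powr (-N) - k * R2 powr (-N)" for z
  have lb: "has_lap W b (%z. k *R ((-N * norm (z - p) powr (-N - 2)) *R (z - p)) - 0)
    (%z. k * (-N * (-N + real DIM('a) - 2) * norm (z - p) powr (-N - 2)) - 0)"
   unfolding b_def by (intro has_lap_diff has_lap_cmult has_lap_const has_lap_norm_powr W)
  have lQ: "has_lap W Q D l" using has_lap_subset[OF Q(1)] by (simp add: W_def)
  have xW: "x : W" using x False by (simp add: W_def)
  have "b x <= Q x"
  proof (rule has_lap_comparison[OF W(2,1) lb lQ _ _ xW])
   fix z assume "z : W"
   then have "l z <= 0" using Q(2) by (simp add: W_def)
   moreover have "k * (-N * (-N + real DIM('a) - 2) * norm (z - p) powr (-N - 2)) >= 0"
    using k N by (simp add: N_def)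
   ultimately show "l z <= k * (-N * (-N + real DIM('a) - 2) * norm (z - p) powr (-N - 2)) - 0" by simp
  next
   fix xi e assume xi: "xi : frontier W" and e: "(0::real) < e"
   have "xi : closure W" "xi ~: W" using xi W(1) by (auto simp: frontier_def interior_open)
   moreover have "closure W <= {z. R1 <= dist p z & dist p z <= R2}"
   proof (rule closure_minimal)
    have "{z. R1 <= dist p z & dist p z <= R2} = cball p R2 - ball p R1" by auto
    then show "closed {z. R1 <= dist p z & dist p z <= R2}" by (metis closed_cball closed_Diff open_ball)
   qed (auto simp: W_def)
   ultimately have xi': "dist p xi = R1 | dist p xi = R2" "R1 <= dist p xi" "dist p xi <= R2" by (auto simp: W_def)
   have xip: "xi ~= p" using xi' R by auto
   have bl: "(b \<longlongrightarrow> b xi) (at xi within W)" unfolding b_def by (intro tendsto_intros) (use xip in auto)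
   have WW: "\<forall>\<^sub>F z in at xi within W. z : W" by (simp add: eventually_at_filter)
   show "\<forall>\<^sub>F z in at xi within W. b z - Q z < e"
   proof (cases "dist p xi = R2")
    case True
    then have "b xi = 0" by (simp add: b_def dist_norm norm_minus_commute)
    then have "\<forall>\<^sub>F z in at xi within W. b z < e" using order_tendstoD(2)[OF bl] e by simp
    with WW show ?thesis by eventually_elim (use pos in "force simp: W_def")
   next
    case False
    then have d1: "dist p xi = R1" "R1 < R2" using xi' by auto
    then have "xi : ball p R2" "xi : cball p R1" by auto
    then have q: "Q xi >= m" using m by blast
    have "(Q \<longlongrightarrow> Q xi) (at xi within ball p R2)"
     using has_lap_continuous[OF Q(1)] `xi : ball p R2` by (simp add: continuous_on_def)
    then have "(Q \<longlongrightarrow> Q xi) (at xi within W)" by (rule tendsto_within_subset) (auto simp: W_def)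
    then have t: "((%z. b z - Q z) \<longlongrightarrow> b xi - Q xi) (at xi within W)" using bl by (intro tendsto_diff)
    have "R1 powr N * R1 powr (-N) = 1" using R by (simp add: powr_add[symmetric])
    then have "b xi = m - k * R2 powr (-N)" using d1 by (simp add: b_def k_def dist_norm norm_minus_commute)
    then have "b xi <= m" using k by simp
    then show ?thesis using order_tendstoD(2)[OF t] q e by simp
   qed
  qed
  moreover have "b x >= c * m * ((R2 - dist p x) / R2)"
  proof -
   have dx: "0 < dist p x" "dist p x <= R2" using False x R by auto
   have "b x = k * (dist p x powr (-N) - R2 powr (-N))"
    by (simp add: b_def dist_norm norm_minus_commute algebra_simps)
   also have "... >= k * (R2 powr (-N) * ((R2 - dist p x) / R2))"
    using powr_convex_ineq[OF dx N] k by (intro mult_left_mono) auto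
   also have "k * (R2 powr (-N) * ((R2 - dist p x) / R2)) = c * m * ((R2 - dist p x) / R2)"
    using R by (simp add: k_def c_def powr_divide powr_minus field_simps)
   finally show ?thesis .
  qed
  ultimately show ?thesis by (simp add: c_def N_def)
 qed
qed

text \<open>The set where \<open>Q > 0\<close> is relatively closed: a limit point \<open>x0\<close>
  lies well inside a ball about some nearby \<open>p\<close> with \<open>Q p > 0\<close>, and the
  Hopf bound in that ball gives \<open>Q x0 > 0\<close>.\<close>

lemma superharmonic_strong_positivity:
 fixes Q :: "'a::euclidean_space => real"
 assumes W: "open W" "connected W" and Q: "has_lap W Q D l" "!!x. x : W ==> l x <= 0"
  "!!x. x : W ==> Q x >= 0" and x1: "x1 : W" "Q x1 > 0" and x: "x : W"
 shows "Q x > 0"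
proof -
 define A where "A = {z : W. Q z > 0}"
 have Qc: "continuous_on W Q" using has_lap_continuous Q(1) by blast
 have oA: "open A"
 proof -
  have "A = W Int Q -` {0<..}" by (auto simp: A_def)
  then show ?thesis using continuous_openin_preimage_gen[OF Qc open_greaterThan, of 0] W(1)
   by (simp add: openin_open_eq)
 qed
 have "closedin (top_of_set W) A"
  unfolding closedin_limpt
 proof (intro conjI allI impI)
  show "A <= W" by (auto simp: A_def)
  fix x0 assume a: "x0 islimpt A & x0 : W"
  then obtain r where r: "r > 0" "ball x0 r <= W" using W(1) openE by blast
  obtain p where p: "p : A" "dist p x0 < r/4" using a r islimpt_approachable[of x0 A] by (metis zero_less_divide_iff zero_less_numeral)
  have bp: "ball p (r/2) <= W"
  proof
   fix z assume "z : ball p (r/2)"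
   then have "dist x0 z < r" using dist_triangle[of x0 z p] p(2) r(1) by (simp add: dist_commute)
   then show "z : W" using r(2) by auto
  qed
  have "p : W" "Q p > 0" using p by (auto simp: A_def)
  obtain e where e: "e > 0" "!!z. z : W ==> dist z p < e ==> dist (Q z) (Q p) < Q p / 2"
   using Qc `p : W` `Q p > 0` unfolding continuous_on_iff by (meson half_gt_zero)
  define R1 where "R1 = min (e/2) (r/4)"
  have R1: "0 < R1" "R1 <= r/2" "R1 < e" using e(1) r(1) by (auto simp: R1_def)
  have "Q x0 >= (R1 / (r/2)) powr DIM('a) * (Q p / 2) * ((r/2 - dist p x0) / (r/2))"
  proof (rule superharmonic_annulus_lower[OF R1(1,2) has_lap_subset[OF Q(1) bp]])
   show "x0 : ball p (r/2)" using p(2) r(1) by simp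
   fix z assume "z : cball p R1" "z : ball p (r/2)"
   then have "dist (Q z) (Q p) < Q p / 2" using e(2)[of z] bp R1 by (auto simp: dist_commute)
   then show "Q p / 2 <= Q z" unfolding dist_real_def by linarith
  qed (use bp Q `Q p > 0` in auto)
  moreover have "(R1 / (r/2)) powr DIM('a) * (Q p / 2) * ((r/2 - dist p x0) / (r/2)) > 0"
   using R1 r(1) p(2) `Q p > 0` by (intro mult_pos_pos) auto
  ultimately show "x0 : A" using a by (simp add: A_def)
 qed
 moreover have "openin (top_of_set W) A" using oA W(1) by (auto simp: openin_open_eq A_def)
 ultimately have "A = {} | A = W" using W(2) unfolding connected_clopen by blast
 then show ?thesis using x1 x by (auto simp: A_def)
qed

text \<open>The superharmonic barrier is \<open>2 * M * (1 - (R / dist c x) powr N)\<close>. It is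
  nonnegative outside the exterior ball, and at least \<open>M\<close> at distance
  \<open>2 * R\<close> because \<open>(1/2) powr N <= 1/2\<close>. Near the ball it grows at most
  linearly.\<close>

lemma exterior_ball_barrier:
 fixes u :: "'a::euclidean_space => real"
 assumes R: "R > 0" and ext: "ball c R Int W = {}" and W: "open W"
  and u: "subh (W Int ball c (2 * R)) u" and M: "M >= 0" "!!x. x : W ==> x : ball c (2 * R) ==> u x <= M"
  and bd: "!!xi e. xi : frontier W ==> xi : ball c (2 * R) ==> 0 < e ==> \<forall>\<^sub>F x in at xi within W. u x < e"
  and x: "x : W" "x : ball c (2 * R)"
 shows "u x <= 2 * real DIM('a) * M * ((dist c x - R) / R)"
proof -
 define N where "N = real DIM('a)"
 have N: "N >= 1" using DIM_positive[where 'a='a] by (simp add: N_def)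
 define V where "V = W Int ball c (2 * R)"
 have V: "open V" "bounded V" using W by (auto simp: V_def intro: bounded_subset[OF bounded_ball[of c "2 * R"]])
 have outside: "dist c z >= R" if "z : closure V" for z
 proof -
  have "closure V <= - ball c R" using ext by (intro closure_minimal) (auto simp: V_def)
  then show ?thesis using that by auto
 qed
 have cV: "c ~: V" using outside[of c] R closure_subset[of V] by auto
 define b where "b z = 2 * M - (2 * M * R powr N) * norm (z - c) powr (-N)" for z
 have lb: "has_lap V b (%z. 0 - (2 * M * R powr N) *R ((-N * norm (z - c) powr (-N - 2)) *R (z - c)))
    (%z. 0 - (2 * M * R powr N) * (-N * (-N + real DIM('a) - 2) * norm (z - c) powr (-N - 2)))"
  unfolding b_def by (intro has_lap_diff has_lap_cmult has_lap_const has_lap_norm_powr cV)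
 have bform: "b z = 2 * M * (1 - (R / dist c z) powr N)" if "dist c z >= R" for z
 proof -
  have "R powr N * norm (z - c) powr (-N) = (R / dist c z) powr N"
   using that R by (simp add: powr_minus powr_divide dist_norm norm_minus_commute) (simp add: divide_inverse)
  then show ?thesis by (simp add: b_def algebra_simps)
 qed
 have bnn: "b z >= 0" if "dist c z >= R" for z
 proof -
  have "(R / dist c z) powr N <= 1" using that R N by (intro powr_le1) (auto simp: divide_le_eq_1)
  then show ?thesis unfolding bform[OF that] using M by simp
 qed
 have "u x <= b x"
 proof (rule subh_comparison[OF V(2,1) u[folded V_def] lb])
  show "x : V" using x by (simp add: V_def)
  show "0 - (2 * M * R powr N) * (-N * (-N + real DIM('a) - 2) * norm (z - c) powr (-N - 2)) <= 0" for z
   using M N by (simp add: N_def)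
  fix xi e assume xi: "xi : frontier V" and e: "(0::real) < e"
  have cl: "xi : closure V" "xi ~: V" using xi V(1) by (auto simp: frontier_def interior_open)
  have "closure V <= cball c (2 * R)" by (intro closure_minimal) (auto simp: V_def)
  then have d: "dist c xi >= R" "dist c xi <= 2 * R" using cl outside by auto
  then have "xi ~= c" using R by auto
  have bl: "(b \<longlongrightarrow> b xi) (at xi within V)" unfolding b_def by (intro tendsto_intros) (use `xi ~= c` in auto)
  have VV: "\<forall>\<^sub>F z in at xi within V. z : V" by (simp add: eventually_at_filter)
  show "\<forall>\<^sub>F z in at xi within V. u z - b z < e"
  proof (cases "dist c xi = 2 * R")
   case True
   have "(1/2::real) powr N <= (1/2) powr 1" using N by (intro powr_mono') auto
   then have "M * 1 <= 2 * M * (1 - (1/2) powr N)"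
    using M mult_left_mono[of "1/2" "1 - (1/2::real) powr N" "2*M"] by simp
   then have "b xi >= M" using True bform[OF d(1)] R by simp
   then have "\<forall>\<^sub>F z in at xi within V. b z > M - e" using order_tendstoD(1)[OF bl, of "M - e"] e by simp
   with VV show ?thesis by eventually_elim (use M in "force simp: V_def")
  next
   case False
   then have xb: "xi : ball c (2 * R)" using d by simp
   have "xi : closure W" using cl(1) closure_mono[of V W] by (auto simp: V_def)
   moreover have "xi ~: W" using cl(2) xb by (simp add: V_def)
   ultimately have "xi : frontier W" using W by (simp add: frontier_def interior_open)
   from bd[OF this xb e] have "\<forall>\<^sub>F z in at xi within V. u z < e"
    by (rule filter_leD[OF at_le, rotated]) (auto simp: V_def)
   with VV show ?thesis
   proof eventually_elim
    case (elim z)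
    then have "b z >= 0" using bnn outside closure_subset by blast
    then show ?case using elim by simp
   qed
  qed
 qed
 also have "b x <= 2 * M * (N * ((dist c x - R) / R))"
 proof -
  have dx: "dist c x >= R" using outside x closure_subset[of V] by (auto simp: V_def)
  define y where "y = R / dist c x"
  have "dist c x > 0" using dx R by linarith
  then have y: "0 < y" "y <= 1" using dx R by (auto simp: y_def divide_le_eq_1 simp del: zero_less_dist_iff)
  have "1 - y powr N <= N * (1 / y - 1)"
  proof -
   have ln: "ln y >= 1 - 1/y" using ln_le_minus_one[of "1/y"] y by (simp add: ln_div)
   have "y powr N = exp (N * ln y)" using y by (simp add: powr_def)
   also have "... >= 1 + N * ln y" using exp_ge_add_one_self by blast
   also have "1 + N * ln y >= 1 + N * (1 - 1/y)" using ln N by simp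
   finally show ?thesis by (simp add: algebra_simps)
  qed
  also have "1 / y - 1 = (dist c x - R) / R" using R dx by (simp add: y_def field_simps)
  finally show ?thesis unfolding bform[OF dx] y_def[symmetric] using M by (intro mult_left_mono) auto
 qed
 finally show ?thesis by (simp add: N_def algebra_simps)
qed

section \<open>Perron's method: the least harmonic majorant of \<open>u\<close> below a
  superharmonic \<open>U\<close>\<close>

context
 fixes W :: "'a::euclidean_space set" and u U :: "'a => real" and D l
 assumes W: "open W" and u: "subh W u" and U: "has_lap W U D l" "!!x. x : W ==> l x <= 0"
  and uU: "!!x. x : W ==> 0 <= u x" "!!x. x : W ==> u x <= U x"
begin

definition majorants :: "('a => real) set" where
 "majorants = {w. subh W (%x. - w x) & (ALL x:W. u x <= w x & w x <= U x)}"

lemma U_majorant: "U : majorants"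
 using subh_has_lap[OF has_lap_minus[OF U(1)]] U(2) uU by (auto simp: majorants_def)

lemma majorant_continuous: "w : majorants ==> continuous_on W w"
 using continuous_on_minus[of W "%x. - w x"] by (auto simp: majorants_def subh_def)

text \<open>Harmonic replacement in a ball lowers \<open>w\<close>. The result is still a majorant:
  inside the ball it is harmonic, and at a point outside it agrees with \<open>w\<close> while being
  at most \<open>w\<close> elsewhere, so the test points for \<open>w\<close> serve again.\<close>

lemma majorant_lift:
 assumes w: "w : majorants" and b: "cball p r <= W" "r > 0"
 obtains q where "harmonic_on (ball p r) q" "(%x. if x : ball p r then q x else w x) : majorants"
  "!!x. x : ball p r ==> q x <= w x" "!!x. x : ball p r ==> u x <= q x"
proof -
 have wc: "continuous_on W w" using majorant_continuous[OF w] .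
 have wcc: "continuous_on (cball p r) w" using wc b(1) continuous_on_subset by blast
 have "continuous_on (sphere p r) w" using wcc by (rule continuous_on_subset) auto
 from ball_dirichlet[OF b(2) this] obtain q where q: "continuous_on (cball p r) q"
  "!!x. x : sphere p r ==> q x = w x" "harmonic_on (ball p r) q" by metis
 obtain E where E: "has_lap (ball p r) q E (%x. 0)" using q(3) by (auto simp: harmonic_on_def)
 have bW: "ball p r <= W" using b(1) by auto
 have sw: "subh W (%x. - w x)" using w by (simp add: majorants_def)
 have uc: "continuous_on (cball p r) u" using subh_continuous[OF u] b(1) continuous_on_subset by blast
 have qw: "q x <= w x" if "x : ball p r" for x
 proof -
  have "- w x <= - q x"
   by (rule subh_comparison[OF _ _ subh_subset[OF sw bW] has_lap_minus[OF E]])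
    (use that b(2) q wcc frontier_limsup_continuous[of "ball p r" "%x. - w x - - q x"]
     in "auto intro!: continuous_intros")
  then show ?thesis by simp
 qed
 have uq: "u x <= q x" if "x : ball p r" for x
 proof (rule subh_comparison[OF _ _ subh_subset[OF u bW] E])
  fix xi and e :: real assume *: "xi : frontier (ball p r)" "0 < e"
  show "\<forall>\<^sub>F x in at xi within ball p r. u x - q x < e"
  proof (rule frontier_limsup_continuous[OF _ _ *])
   show "continuous_on (closure (ball p r)) (%x. u x - q x)" using b(2) uc q(1) by (auto intro!: continuous_intros)
   fix x assume "x : frontier (ball p r)"
   then have "x : sphere p r" "x : W" using b by auto
   then show "u x - q x <= 0" using q(2) w by (auto simp: majorants_def)
  qed
 qed (use that in auto)
 define v where "v = (%x. if x : ball p r then q x else w x)"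
 have vw: "v x <= w x" if "x : W" for x using qw by (simp add: v_def)
 have vc: "continuous_on W v"
 proof -
  have "continuous_on (cball p r Un (W - ball p r)) (%x. if x : cball p r then q x else w x)"
  proof (rule continuous_on_cases_local)
   have eq: "cball p r Un (W - ball p r) = W" using b(1) ball_subset_cball[of p r] by blast
   show "closedin (top_of_set (cball p r Un (W - ball p r))) (cball p r)"
    unfolding eq using b(1) closedin_closed_Int[of "cball p r" W] by (simp add: inf.absorb2)
   show "closedin (top_of_set (cball p r Un (W - ball p r))) (W - ball p r)"
    unfolding eq using closedin_closed_Int[of "- ball p r" W] open_ball by (simp add: Diff_eq closed_Compl)
   show "continuous_on (cball p r) q" "continuous_on (W - ball p r) w"
    using q(1) wc continuous_on_subset by blast+
   show "!!x. x : cball p r & x ~: cball p r | x : W - ball p r & x : cball p r ==> q x = w x"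
    using q(2) by auto
  qed
  moreover have "cball p r Un (W - ball p r) = W" using b(1) ball_subset_cball[of p r] by blast
  moreover have "(if x : cball p r then q x else w x) = v x" for x
   using q(2)[of x] by (auto simp: v_def)
  ultimately show ?thesis by simp
 qed
 have "subh W (%x. - v x)"
  unfolding subh_def
 proof (intro conjI allI impI ballI)
  show "continuous_on W (%x. - v x)" using vc by (intro continuous_intros)
  fix V psi F m x and c :: real
  assume *: "open V" "V <= W" "has_lap V psi F m" "c > 0" "ALL z:V. m z <= - c" "x : V"
  show "EX z:V. - v z - psi z > - v x - psi x"
  proof (cases "x : ball p r")
   case True
   have "subh (ball p r) (%x. - q x)" using subh_has_lap[OF has_lap_minus[OF E]] by simp
   then have "EX z:V Int ball p r. - q z - psi z > - q x - psi x"
    by (rule subhD[OF _ _ _ has_lap_subset[OF *(3)], of _ _ "V Int ball p r" c x]) (use * True in auto)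
   then obtain z where "z : V Int ball p r" "- q z - psi z > - q x - psi x" by blast
   then show ?thesis using True by (auto simp: v_def)
  next
   case False
   obtain z where z: "z : V" "- w z - psi z > - w x - psi x" using subhD[OF sw *(1-4)] * by blast
   then have "- v z - psi z > - v x - psi x" using vw[of z] False *(2) by (auto simp: v_def)
   then show ?thesis using z(1) by blast
  qed
 qed
 moreover have "u x <= v x & v x <= U x" if "x : W" for x
  using uq qw w that by (auto simp: v_def majorants_def intro: order_trans)
 ultimately have "v : majorants" by (simp add: majorants_def)
 then show ?thesis using that[OF q(3)] qw uq by (simp add: v_def)
qed

definition least_majorant :: "'a => real" where
 "least_majorant x = (INF w\<in>majorants. w x)"

lemma least_majorant_le: "w : majorants ==> x : W ==> least_majorant x <= w x"
 unfolding least_majorant_def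
 by (rule cINF_lower) (auto intro!: bdd_belowI[of _ "u x"] simp: majorants_def)

lemma least_majorant_ge: "(!!w. w : majorants ==> a <= w x) ==> a <= least_majorant x"
 unfolding least_majorant_def using U_majorant by (intro cINF_greatest) auto

lemma least_majorant_bounds: "x : W ==> u x <= least_majorant x" "x : W ==> least_majorant x <= U x"
 using least_majorant_le[OF U_majorant] by (auto intro!: least_majorant_ge simp: majorants_def)

text \<open>After a harmonic replacement in \<open>ball p r\<close>, every competitor is harmonic
  there with values between 0 and the maximum of \<open>U\<close>, hence Lipschitz on
  \<open>ball p (r/4)\<close> with a common constant. The infimum inherits the constant.\<close>

lemma least_majorant_continuous: "continuous_on W least_majorant"
proof (rule continuous_at_imp_continuous_on, rule ballI)
 fix p assume "p : W"
 then obtain r where r: "r > 0" "cball p r <= W" using W open_contains_cball by blast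
 have "compact (U ` cball p r)"
  using has_lap_continuous[OF U(1)] r(2) by (intro compact_continuous_image) (auto intro: continuous_on_subset)
 then obtain M where M: "!!x. x : cball p r ==> norm (U x) <= M" using compact_imp_bounded bounded_iff by (metis imageI)
 define L where "L = 8 * real DIM('a) * M / r"
 have L: "least_majorant x <= least_majorant y + L * norm (x - y)" if xy: "x : ball p (r/4)" "y : ball p (r/4)" for x y
 proof -
  have inb: "x : ball p r" "y : ball p r" "x : W" "y : W" using xy r by auto
  have "least_majorant x - L * norm (x - y) <= w y" if w: "w : majorants" for w
  proof -
   obtain q where q: "harmonic_on (ball p r) q" "(%x. if x : ball p r then q x else w x) : majorants"
    "!!x. x : ball p r ==> q x <= w x" "!!x. x : ball p r ==> u x <= q x"
    using majorant_lift[OF w r(2,1)] by blast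
   have "\<bar>q z\<bar> <= M" if "z : ball p r" for z
   proof -
    have zW: "z : W" using that r by auto
    have "0 <= q z" "q z <= U z" using uU(1)[OF zW] q(4)[OF that] q(3)[OF that] w zW by (auto simp: majorants_def)
    then show ?thesis using M[of z] that by auto
   qed
   then have "q x - q y <= L * norm (x - y)"
    unfolding L_def using harmonic_lipschitz[OF r(1) q(1) _ xy, of M] by fastforce
   moreover have "least_majorant x <= q x" using least_majorant_le[OF q(2) inb(3)] inb by simp
   ultimately show ?thesis using q(3)[OF inb(2)] by linarith
  qed
  then have "least_majorant x - L * norm (x - y) <= least_majorant y" by (rule least_majorant_ge)
  then show ?thesis by simp
 qed
 have "L-lipschitz_on (ball p (r/4)) least_majorant"
 proof (rule lipschitz_onI)
  fix x y assume "x : ball p (r/4)" "y : ball p (r/4)"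
  from L[OF this] L[OF this(2,1)] show "dist (least_majorant x) (least_majorant y) <= L * dist x y"
   by (simp add: dist_norm abs_le_iff norm_minus_commute)
  next
  have "M >= 0" using M[of p] r by (metis centre_in_cball less_imp_le norm_ge_zero order_trans)
  then show "0 <= L" using r by (simp add: L_def)
 qed
 then have "continuous_on (ball p (r/4)) least_majorant" by (rule lipschitz_on_continuous_on)
 then show "isCont least_majorant p" using r(1) by (simp add: continuous_on_eq_continuous_at)
qed

text \<open>If a test function defeats the infimum at \<open>x\<close>, adding a small multiple of
  the squared distance to \<open>x\<close> makes the contact strict. A majorant almost equal to the
  infimum at \<open>x\<close> then touches the perturbed test function at an interior point of the
  ball, which is impossible for that majorant.\<close>

lemma least_majorant_in: "least_majorant : majorants"
proof -
 have "subh W (%x. - least_majorant x)"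
  unfolding subh_def
 proof (intro conjI allI impI ballI)
  show "continuous_on W (%x. - least_majorant x)" using least_majorant_continuous by (intro continuous_intros)
  fix V psi F m x and c :: real
  assume *: "open V" "V <= W" "has_lap V psi F m" "c > 0" "ALL z:V. m z <= - c" "x : V"
  show "EX z:V. - least_majorant z - psi z > - least_majorant x - psi x"
  proof (rule ccontr)
   assume "~ ?thesis"
   then have mx: "least_majorant z + psi z >= least_majorant x + psi x" if "z : V" for z using that by force
   obtain r where r: "r > 0" "cball x r <= V" using *(1,6) open_contains_cball by blast
   \<comment> \<open>The perturbation adds \<open>de * (2 * DIM('a)) = c/2\<close> to the Laplacian,
     so half of the strict superharmonicity survives.\<close>
   define de where "de = c / (4 * real DIM('a))"
   have de: "de > 0" using *(4) by (simp add: de_def)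
   define psi' where "psi' z = psi z + de * (norm (z - x))^2" for z
   have l': "has_lap V psi' (%z. F z + de *R (2 *R (z - x))) (%z. m z + de * (2 * real DIM('a)))"
    unfolding psi'_def by (intro has_lap_add has_lap_cmult has_lap_normsq *(3))
   have lneg: "m z + de * (2 * real DIM('a)) <= - (c/2)" if "z : V" for z
    using *(5) that by (force simp: de_def)
   have xW: "x : W" using * by blast
   have "EX w:majorants. w x < least_majorant x + de * r^2 / 2"
   proof (rule ccontr)
    assume "~ ?thesis"
    then have "least_majorant x + de * r^2 / 2 <= least_majorant x" by (intro least_majorant_ge) force
    moreover have "de * r^2 > 0" using de r(1) by simp
    ultimately show False by simp
   qed
   then obtain w where w: "w : majorants" "w x < least_majorant x + de * r^2 / 2" by blast
   have "continuous_on (cball x r) (%z. w z + psi' z)"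
    using majorant_continuous[OF w(1)] has_lap_continuous[OF l'] r(2) *(2)
    by (intro continuous_on_add) (auto intro: continuous_on_subset)
   then obtain y where y: "y : cball x r" "ALL z:cball x r. w y + psi' y <= w z + psi' z"
    using continuous_attains_inf[OF compact_cball, of x r "%z. w z + psi' z"] r(1) by (auto simp: less_imp_le)
   have yb: "y : ball x r"
   proof (rule ccontr)
    assume "y ~: ball x r"
    then have "norm (y - x) = r" using y(1) by (simp add: dist_norm norm_minus_commute)
    moreover have "y : V" "y : W" using y(1) r(2) *(2) by blast+
    moreover have "w y >= least_majorant y" using least_majorant_le[OF w(1)] `y : W` by blast
    moreover have "w y + psi' y <= w x + psi' x" using y(2) r(1) by simp
    moreover have "de * r^2 > 0" using de r(1) by simp
    ultimately show False using mx[of y] w(2) by (simp add: psi'_def)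
   qed
   have sub: "ball x r <= V" "ball x r <= W" using r(2) *(2) ball_subset_cball by blast+
   have "subh W (%z. - w z)" using w(1) by (simp add: majorants_def)
   have "EX z:ball x r. - w z - psi' z > - w y - psi' y"
    by (rule subhD[OF `subh W (%z. - w z)` open_ball sub(2) has_lap_subset[OF l' sub(1)], of "c/2" y])
     (use *(4) lneg sub yb in auto)
   then obtain z where "z : ball x r" "- w z - psi' z > - w y - psi' y" by blast
   moreover have "w y + psi' y <= w z + psi' z" using y(2) calculation(1) ball_subset_cball by blast
   ultimately show False by simp
  qed
 qed
 then show ?thesis using least_majorant_bounds by (simp add: majorants_def)
qed

text \<open>The harmonic replacement of the least majorant is a majorant lying below it, hence equal
  to it.\<close>

lemma least_majorant_harmonic: "harmonic_on W least_majorant"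
proof (rule harmonic_on_UN)
 fix p assume "p : W"
 then obtain r where r: "r > 0" "cball p r <= W" using W open_contains_cball by blast
 obtain q where q: "harmonic_on (ball p r) q"
  "(%x. if x : ball p r then q x else least_majorant x) : majorants"
  "!!x. x : ball p r ==> q x <= least_majorant x"
  using majorant_lift[OF least_majorant_in r(2,1)] by metis
 have "q x = least_majorant x" if "x : ball p r" for x
 proof -
  have "x : W" using that r(2) by auto
  from least_majorant_le[OF q(2) this] q(3)[OF that] that show ?thesis by simp
 qed
 then have "harmonic_on (ball p r) least_majorant" using harmonic_on_cong[OF q(1)] by auto
 then show "EX V. open V & p : V & harmonic_on V least_majorant" using r(1) by (intro exI[of _ "ball p r"]) auto
qed

text \<open>The competitor \<open>w\<close> need not stay below \<open>U\<close>; its minimum with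
  \<open>U\<close> is a majorant.\<close>

lemma least_majorant_minimal:
 assumes "harmonic_on W w" "!!x. x : W ==> u x <= w x" "x : W"
 shows "least_majorant x <= w x"
proof -
 obtain E where E: "has_lap W w E (%x. 0)" using assms(1) by (auto simp: harmonic_on_def)
 have "subh W (%x. max (- w x) (- U x))"
  using subh_max[OF subh_has_lap[OF has_lap_minus[OF E]] subh_has_lap[OF has_lap_minus[OF U(1)]]] U(2) by simp
 moreover have "max (- w x) (- U x) = - min (w x) (U x)" for x by simp
 ultimately have "(%x. min (w x) (U x)) : majorants" using assms(2) uU by (simp add: majorants_def)
 from least_majorant_le[OF this assms(3)] show ?thesis by simp
qed

end

lemma exists_least_harmonic_majorant:
 fixes W :: "'a::euclidean_space set"
 assumes "open W" "subh W u" "has_lap W U D l" "!!x. x : W ==> l x <= 0"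
  "!!x. x : W ==> 0 <= u x" "!!x. x : W ==> u x <= U x"
 obtains h where "harmonic_on W h" "!!x. x : W ==> u x <= h x" "!!x. x : W ==> h x <= U x"
  "!!w x. harmonic_on W w ==> (!!x. x : W ==> u x <= w x) ==> x : W ==> h x <= w x"
 using least_majorant_harmonic[OF assms] least_majorant_bounds[OF assms] least_majorant_minimal[OF assms]
 by (rule that)

section \<open>Cones with interior and exterior balls\<close>

text \<open>The last condition provides Harnack chains going upwards: the cone is the epigraph of a Lipschitz function.\<close>

definition good_cone :: "real => 'a::euclidean_space set => bool" where
 "good_cone rho D \<longleftrightarrow> 0 < rho & rho <= 1/4 & open D & D ~= {} & 0 ~: D &
   (ALL x:D. ALL s>0. s *R x : D) &
   (ALL y:frontier D. y ~= 0 --> (EX c. dist y c = rho * norm y & ball c (rho * norm y) Int D = {})) &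
   (ALL x:D. EX c. ball c (rho * norm x) <= D & dist x c + rho * infdist x (- D) <= rho * norm x) &
   (EX e. norm e = 1 & (ALL x:D. ALL s>=0. ball (x + s *R e) (rho * s) <= D))"

lemma good_coneD:
 assumes "good_cone rho D"
 shows "0 < rho" "rho <= 1/4" "open D" "D ~= {}" "0 ~: D" "!!x s. x : D ==> s > 0 ==> s *R x : D"
 using assms unfolding good_cone_def by auto

lemma ball_infdist_subset:
 assumes "0 ~: (D::'a::euclidean_space set)"
 shows "ball x (infdist x (- D)) <= D"
proof
 fix z assume z: "z : ball x (infdist x (- D))"
 show "z : D"
 proof (rule ccontr)
  assume "z ~: D"
  then have "infdist x (- D) <= dist x z" by (intro infdist_le) simp
  then show False using z by simp
 qed
qed

lemma infdist_ge_ball: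
 assumes "ball x r <= D" "- D ~= {}"
 shows "infdist x (- D) >= r"
proof -
 have "r <= dist x a" if "a : - D" for a using assms(1) that by force
 then show ?thesis unfolding infdist_notempty[OF assms(2)] using assms(2) by (intro cINF_greatest)
qed

lemma infdist_scale:
 assumes "good_cone rho D" "s > 0"
 shows "infdist (s *R x) (- D) = s * infdist x (- D)"
proof -
 have z: "0 : - D" using good_coneD(5)[OF assms(1)] by simp
 have mem: "s *R a : - D" if "a : - D" "s > 0" for a s
 proof
  assume "s *R a : D"
  then have "inverse s *R (s *R a) : D" using good_coneD(6)[OF assms(1)] that(2) by (meson positive_imp_inverse_positive)
  then show False using that by simp
 qed
 have le: "infdist (s *R x) (- D) <= s * infdist x (- D)" if "s > 0" for s x
 proof -
  have "infdist (s *R x) (- D) / s <= infdist x (- D)"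
  proof -
   have "infdist (s *R x) (- D) / s <= dist x a" if a: "a : - D" for a
   proof -
    have "infdist (s *R x) (- D) <= dist (s *R x) (s *R a)" by (rule infdist_le[OF mem[OF a `s > 0`]])
    moreover have "dist (s *R x) (s *R a) = s * dist x a"
     using `s > 0` by (simp add: dist_norm scaleR_diff_right[symmetric])
    ultimately show ?thesis using `s > 0` by (simp add: field_simps)
   qed
   then show ?thesis using z by (subst (2) infdist_notempty) (auto intro!: cINF_greatest)
  qed
  then show ?thesis using that by (simp add: field_simps)
 qed
 have "infdist x (- D) <= inverse s * infdist (s *R x) (- D)"
  using le[of "inverse s" "s *R x"] assms(2) by simp
 then show ?thesis using le[OF assms(2), of x] assms(2) by (simp add: field_simps)
qed

lemma infdist_cone_bounds:
 assumes "good_cone rho D" "x : D"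
 shows "0 < infdist x (- D)" "infdist x (- D) <= norm x" "norm x > 0"
proof -
 have z: "0 : - D" using good_coneD(5)[OF assms(1)] by simp
 have "closed (- D)" using good_coneD(3)[OF assms(1)] by (simp add: closed_Compl)
 then have "infdist x (- D) ~= 0" using in_closed_iff_infdist_zero[of "- D" x] z assms(2) by auto
 then show "0 < infdist x (- D)" using infdist_nonneg[of x "- D"] by linarith
 show "infdist x (- D) <= norm x" using infdist_le[OF z, of x] by simp
 show "norm x > 0" using assms good_coneD(5) by force
qed

lemma cone_nearest:
 assumes "good_cone rho D" "x : D"
 obtains y where "y : frontier D" "dist x y = infdist x (- D)"
proof -
 have z: "0 : - D" using good_coneD(5)[OF assms(1)] by simp
 have "closed (- D)" using good_coneD(3)[OF assms(1)] by (simp add: closed_Compl)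
 then obtain y where y: "y : - D" "infdist x (- D) = dist x y" using infdist_attains_inf z by blast
 have "ball x (dist x y) <= D" using ball_infdist_subset[OF good_coneD(5)[OF assms(1)], of x] y by simp
 then have "closure (ball x (dist x y)) <= closure D" by (rule closure_mono)
 moreover have "dist x y > 0" using infdist_cone_bounds(1)[OF assms] y by simp
 ultimately have "y : closure D" by auto
 then have "y : frontier D" using y good_coneD(3)[OF assms(1)] by (simp add: frontier_def interior_open)
 then show ?thesis using that y by simp
qed

lemma zero_in_frontier_cone:
 assumes "good_cone rho D" shows "0 : frontier D"
proof -
 obtain x where x: "x : D" using good_coneD(4)[OF assms] by blast
 have "(%n. inverse (real (Suc n)) *R x) \<longlonglongrightarrow> 0 *R x"
  by (intro tendsto_scaleR tendsto_const LIMSEQ_inverse_real_of_nat)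
 moreover have "inverse (real (Suc n)) *R x : D" for n using good_coneD(6)[OF assms x] by simp
 ultimately have "0 : closure D" unfolding closure_sequential
  by (intro exI[of _ "%n. inverse (real (Suc n)) *R x"]) simp
 then show ?thesis using good_coneD(3,5)[OF assms] by (simp add: frontier_def interior_open)
qed

text \<open>Two points are joined by going up along \<open>e\<close> to a height proportional to
  their distance and then straight across; at that height the vertical ball condition contains the
  segment.\<close>

lemma good_cone_connected:
 assumes "good_cone rho D" shows "connected D"
proof -
 obtain e where e: "!!x s. x : D ==> s >= 0 ==> ball (x + s *R e) (rho * s) <= D"
  using assms unfolding good_cone_def by blast
 have rho: "rho > 0" "rho <= 1/4" using good_coneD[OF assms] by auto
 have up: "connected_component D x (x + s *R e)" if x: "x : D" and s: "s >= 0" for x s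
 proof -
  have "closed_segment x (x + s *R e) <= D"
  proof
   fix z assume "z : closed_segment x (x + s *R e)"
   then obtain u where u: "0 <= u" "u <= 1" "z = (1 - u) *R x + u *R (x + s *R e)" unfolding in_segment by blast
   have z: "z = x + (u * s) *R e" unfolding u(3) by (simp add: algebra_simps)
   show "z : D"
   proof (cases "u * s = 0")
    case True then show ?thesis using z x by auto
   next
    case False
    then have "z : ball (x + (u * s) *R e) (rho * (u * s))" using z rho u s by (simp add: zero_less_mult_iff)
    then show ?thesis using e[OF x, of "u * s"] u s by auto
   qed
  qed
  then show ?thesis by (intro connected_componentI[of "closed_segment x (x + s *R e)"]) auto
 qed
 have "connected_component D x y" if xy: "x : D" "y : D" for x y
 proof -
  define s where "s = (dist x y + 1) / rho"
  have s: "s >= 0" "rho * s = dist x y + 1" using rho by (auto simp: s_def)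
  have "closed_segment (x + s *R e) (y + s *R e) <= ball (x + s *R e) (rho * s)"
   unfolding s by (intro closed_segment_subset) (auto simp: dist_norm norm_minus_commute add_nonneg_pos)
  then have "closed_segment (x + s *R e) (y + s *R e) <= D" using e[OF xy(1) s(1)] by blast
  then have "connected_component D (x + s *R e) (y + s *R e)"
   by (intro connected_componentI[of "closed_segment (x + s *R e) (y + s *R e)"]) auto
  then show ?thesis using up[OF xy(1) s(1)] up[OF xy(2) s(1)]
   by (meson connected_component_sym connected_component_trans)
 qed
 then show ?thesis by (simp add: connected_iff_connected_component)
qed

text \<open>The cone is mapped onto its truncation by a radial change of scale.\<close>

lemma good_cone_connected_ball:
 assumes "good_cone rho D" "R > 0" shows "connected (D Int ball 0 R)"
proof -
 define f where "f x = (R / (1 + norm x)) *R x" for x :: 'a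
 have p: "1 + norm x > 0" for x :: 'a by (simp add: add_pos_nonneg)
 have "connected (f ` D)"
  by (rule connected_continuous_image[OF _ good_cone_connected[OF assms(1)]])
   (use p in "auto simp: f_def less_imp_neq[symmetric] intro!: continuous_intros")
 moreover have "f ` D = D Int ball 0 R"
 proof (intro equalityI subsetI)
  fix z assume "z : f ` D"
  then obtain x where x: "x : D" "z = f x" by blast
  have "norm (f x) = R * (norm x / (1 + norm x))" using assms(2) p[of x] by (simp add: f_def)
  also have "... < R * 1" using p[of x] assms(2) by (intro mult_strict_left_mono) (auto simp: field_simps)
  finally show "z : D Int ball 0 R"
   using x good_coneD(6)[OF assms(1)] assms(2) p[of x] by (simp add: f_def)
 next
  fix z assume z: "z : D Int ball 0 R"
  define x where "x = (1 / (R - norm z)) *R z"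
  have rz: "R - norm z > 0" using z by simp
  have "x : D" using good_coneD(6)[OF assms(1), of z] z rz by (simp add: x_def)
  moreover have "f x = z"
  proof -
   have "norm x = norm z / (R - norm z)" using rz by (simp add: x_def)
   then have "1 + norm x = R / (R - norm z)" using rz by (simp add: field_simps)
   then show ?thesis using rz assms(2) by (simp add: f_def x_def)
  qed
  ultimately show "z : f ` D" by force
 qed
 ultimately show ?thesis by simp
qed

text \<open>If the distance \<open>d\<close> to the complement is comparable to
  \<open>norm x\<close>, the bound \<open>M\<close> suffices. Otherwise the exterior ball of radius
  \<open>rho * norm y\<close> at a nearest boundary point \<open>y\<close> gives the linear barrier;
  its double misses the vertex, where the boundary values are not controlled.\<close>

lemma cone_boundary_upper:
 fixes D :: "'a::euclidean_space set"
 assumes D: "good_cone rho D" and u: "subh (D Int ball 0 R) u"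
  and M: "M >= 0" "!!z. z : D ==> norm z < R ==> u z <= M"
  and bd: "!!xi e. xi : frontier D ==> xi ~= 0 ==> norm xi < R ==> 0 < e ==> \<forall>\<^sub>F z in at xi within D. u z < e"
  and x: "x : D" "norm x <= R / 2"
 shows "u x <= (4 * real DIM('a) / rho) * M * (infdist x (- D) / norm x)"
proof -
 define n where "n = real DIM('a)"
 have n: "n >= 1" using DIM_positive[where 'a='a] by (simp add: n_def)
 have rho: "rho > 0" "rho <= 1/4" using good_coneD[OF D] by auto
 define d where "d = infdist x (- D)"
 have d: "0 < d" "d <= norm x" "norm x > 0" using infdist_cone_bounds[OF D x(1)] by (auto simp: d_def)
 show ?thesis
 proof (cases "d >= rho * norm x / 4")
  case True
  have "1 <= (4 * n / rho) * (d / norm x)"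
  proof -
   have "1 = (4 / rho) * ((rho * norm x / 4) / norm x)" using rho d by simp
   also have "... <= (4 * n / rho) * (d / norm x)"
    using True rho n d by (intro mult_mono divide_right_mono) auto
   finally show ?thesis .
  qed
  then have "M * 1 <= M * ((4 * n / rho) * (d / norm x))" using M(1) by (rule mult_left_mono)
  then show ?thesis using M(2)[of x] x d by (simp add: d_def n_def mult_ac)
 next
  case False
  obtain y where y: "y : frontier D" "dist x y = d" using cone_nearest[OF D x(1)] d_def by metis
  have rhox: "rho * norm x <= norm x / 4" using rho d mult_right_mono[of rho "1/4" "norm x"] by simp
  have ny: "norm y >= 15/16 * norm x" "norm y <= 17/16 * norm x"
   using y(2) False rhox norm_triangle_ineq2[of x y] norm_triangle_ineq2[of y x]
   by (auto simp: dist_norm norm_minus_commute)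
  then have y0: "y ~= 0" using d by auto
  obtain c where c: "dist y c = rho * norm y" "ball c (rho * norm y) Int D = {}"
   using D y(1) y0 unfolding good_cone_def by blast
  define r where "r = rho * norm y"
  have r: "r > 0" "r <= norm y / 4" "r >= rho * (15/16 * norm x)"
   using rho ny y0 mult_right_mono[of rho "1/4" "norm y"] by (auto simp: r_def)
  have big: "norm z < R" if "z : ball c (2*r)" for z
  proof -
   have "norm z <= norm y + dist y c + dist c z"
    using norm_triangle_ineq[of "y" "z - y"] dist_triangle[of y z c] by (simp add: dist_norm norm_minus_commute)
   then show ?thesis using that c(1) r ny x d by (simp add: r_def[symmetric])
  qed
  have c0: "0 ~: ball c (2*r)"
   using norm_triangle_ineq2[of y c] c(1) r y0 by (auto simp: dist_norm norm_minus_commute r_def[symmetric])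
  define W where "W = D Int ball 0 R"
  have W: "open W" using good_coneD[OF D] by (simp add: W_def open_Int)
  have dxc: "dist c x <= d + r" using dist_triangle[of c x y] y(2) c(1) by (simp add: dist_commute r_def)
  have xb: "x : ball c (2*r)"
  proof -
   have "rho * norm x / 4 < rho * (15/16 * norm x)" using rho d by simp
   then have "d < r" using False r(3) by linarith
   then show ?thesis using dxc by simp
  qed
  have "u x <= 2 * real DIM('a) * M * ((dist c x - r) / r)"
  proof (rule exterior_ball_barrier[OF r(1) _ W])
   show "ball c r Int W = {}" using c(2) by (auto simp: r_def W_def)
   show "subh (W Int ball c (2*r)) u" by (rule subh_subset[OF u]) (auto simp: W_def)
   show "u z <= M" if "z : W" "z : ball c (2*r)" for z using M(2) that by (simp add: W_def)
   show "x : W" using x d by (simp add: W_def)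
   fix xi e assume xi: "xi : frontier W" "xi : ball c (2*r)" and e: "(0::real) < e"
   have "xi : closure D" using xi(1) closure_mono[of W D] by (auto simp: frontier_def W_def)
   moreover have "xi ~: W" using xi(1) W by (simp add: frontier_def interior_open)
   then have "xi ~: D" using big[OF xi(2)] by (simp add: W_def)
   ultimately have "xi : frontier D" using good_coneD(3)[OF D] by (simp add: frontier_def interior_open)
   moreover have "xi ~= 0" using c0 xi(2) by auto
   ultimately have "\<forall>\<^sub>F z in at xi within D. u z < e" using bd big xi e by blast
   then show "\<forall>\<^sub>F z in at xi within W. u z < e"
    by (rule filter_leD[OF at_le, rotated]) (auto simp: W_def)
  qed (use M xb in auto)
  also have "... <= 2 * n * M * (d / r)"
   unfolding n_def[symmetric] using dxc r n M by (intro mult_left_mono divide_right_mono) auto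
  also have "... <= 2 * n * M * (d / (rho * (15/16 * norm x)))"
   using r n M d rho by (intro mult_left_mono divide_left_mono) auto
  also have "... = (32/15) * (n / rho) * M * (d / norm x)" using d rho by (simp add: field_simps)
  also have "... <= 4 * (n / rho) * M * (d / norm x)"
   using n rho M d by (intro mult_right_mono) auto
  finally show ?thesis by (simp add: n_def d_def)
 qed
qed

text \<open>Hopf's bound in the ball of radius \<open>rho * norm x\<close> provided by the cone.
  Points of the concentric half ball have depth at least half that radius, where \<open>m\<close> is
  available, and the inequality tying the centre to \<open>infdist x (- D)\<close> bounds the
  distance to the sphere from below.\<close>

lemma cone_boundary_lower:
 fixes D :: "'a::euclidean_space set"
 assumes D: "good_cone rho D" and Q: "has_lap (D Int ball 0 R) Q E l" "!!z. z : D Int ball 0 R ==> l z <= 0"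
  "!!z. z : D Int ball 0 R ==> Q z >= 0"
  and x: "x : D" "2 * norm x <= R"
  and m: "m >= 0" "!!z. z : D ==> norm x / 2 <= norm z ==> norm z <= 3/2 * norm x ==>
   infdist z (- D) >= rho * norm x / 2 ==> Q z >= m"
 shows "Q x >= (1/2) powr DIM('a) * m * (infdist x (- D) / norm x)"
proof -
 define n where "n = real DIM('a)"
 have rho: "rho > 0" "rho <= 1/4" using good_coneD[OF D] by auto
 have nx: "norm x > 0" using infdist_cone_bounds[OF D x(1)] by auto
 define r where "r = rho * norm x"
 have r: "r > 0" "r <= norm x / 4" using rho nx mult_right_mono[of rho "1/4" "norm x"] by (auto simp: r_def)
 obtain c where c: "ball c r <= D" "dist x c + rho * infdist x (- D) <= r"
  using D x(1) unfolding good_cone_def r_def by blast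
 have "rho * infdist x (- D) > 0" using infdist_cone_bounds(1)[OF D x(1)] rho by simp
 then have xc: "dist x c < r" using c(2) by linarith
 have nz: "norm z <= norm x + dist x c + dist c z" "norm x <= norm z + dist x c + dist c z" for z
  using norm_triangle_ineq[of x "z - x"] norm_triangle_ineq[of z "x - z"] dist_triangle[of x z c]
  by (auto simp: dist_norm norm_minus_commute)
 have sub: "ball c r <= D Int ball 0 R"
 proof
  fix z assume z: "z : ball c r"
  then have "norm z < R" using nz(1)[of z] xc r x nx by simp
  then show "z : D Int ball 0 R" using z c by auto
 qed
 have "Q x >= ((r/2) / r) powr DIM('a) * m * ((r - dist c x) / r)"
 proof (rule superharmonic_annulus_lower[OF _ _ has_lap_subset[OF Q(1) sub]])
  show "l z <= 0" "0 <= Q z" if "z : ball c r" for z using Q sub that by blast+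
  show "x : ball c r" using xc by (simp add: dist_commute)
  fix z assume z: "z : cball c (r/2)" "z : ball c r"
  show "m <= Q z"
  proof (rule m(2))
   show "z : D" using z c by blast
   show "norm x / 2 <= norm z" "norm z <= 3/2 * norm x" using nz[of z] z(1) xc r by auto
   have "ball z (r/2) <= ball c r"
   proof
    fix y assume "y : ball z (r/2)"
    then show "y : ball c r" using z(1) dist_triangle[of c y z] by auto
   qed
   then have "ball z (r/2) <= D" using c by blast
   then have "r/2 <= infdist z (- D)" using good_coneD(5)[OF D] by (intro infdist_ge_ball) auto
   then show "rho * norm x / 2 <= infdist z (- D)" by (simp add: r_def)
  qed
 qed (use r m in auto)
 moreover have "(r - dist c x) / r >= infdist x (- D) / norm x"
 proof -
  have "infdist x (- D) / norm x = rho * infdist x (- D) / r" using rho by (simp add: r_def)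
  also have "... <= (r - dist c x) / r" using c(2) r by (intro divide_right_mono) (auto simp: dist_commute)
  finally show ?thesis .
 qed
 then have "(1/2) powr DIM('a) * m * (infdist x (- D) / norm x) <= (1/2) powr DIM('a) * m * ((r - dist c x) / r)"
  using m(1) by (intro mult_left_mono) auto
 moreover have "(r/2) / r = 1/2" using r by simp
 ultimately show ?thesis by (simp only:)
qed

lemma homogeneous_grad:
 assumes "(f has_derivative (%h. d \<bullet> h)) (at x)" "eps > 0"
  "!!s. \<bar>s - 1\<bar> < eps ==> s > 0 ==> f (s *R x) = s powr a * f x"
 shows "d \<bullet> x = a * f x"
proof -
 have 2: "((%s. s *R x) has_derivative (%h. h *R x)) (at (1::real))"
  by (auto intro!: derivative_eq_intros)
 have "((%s. f (s *R x)) has_derivative (%k. d \<bullet> (k *R x))) (at 1)"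
  using has_derivative_compose[OF 2, of f "%h. d \<bullet> h"] assms(1) by simp
 then have "((%s. f (s *R x)) has_real_derivative d \<bullet> x) (at 1)"
  by (simp add: has_field_derivative_def mult_commute_abs)
 then have "((%s. s powr a * f x) has_real_derivative d \<bullet> x) (at 1)"
  by (rule has_field_derivative_transform_within_open[where S="ball 1 (min eps 1)"])
   (use assms(2,3) in "auto simp: dist_real_def")
 moreover have "((%s. s powr a * f x) has_real_derivative (a * 1 powr (a - 1)) * f x) (at 1)"
  by (intro DERIV_cmult_right has_real_derivative_powr) simp
 ultimately show ?thesis using DERIV_unique by fastforce
qed

section \<open>Lower and upper bounds away from the vertex\<close>

lemma powr_neg_strict_antimono: "0 < a ==> a < b ==> (g::real) > 0 ==> b powr (-g) < a powr (-g)"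
 by (simp add: powr_less_mono2_neg)

text \<open>A paraboloid with maximum \<open>c * R powr phi\<close> is a subsolution: where it
  exceeds \<open>U\<close>, also \<open>U\<close> is below this maximum, and \<open>c\<close> is
  defined by \<open>2 * n * c = c powr (-ga)\<close>. The powers of \<open>R\<close> match because
  \<open>phi - 2 = - ga * phi\<close>.\<close>

lemma solution_lower_ball:
 fixes U :: "'a::euclidean_space => real"
 assumes ga: "ga > 1" and U: "has_lap W U E l" "!!z. z : W ==> l z = - (U z powr (-ga))"
  "!!z. z : W ==> U z > 0" and b: "ball x R <= W" "R > 0"
 shows "U x >= (1 / (2 * DIM('a))) powr (1 / (1 + ga)) * R powr (2 / (1 + ga))"
proof -
 define n where "n = real DIM('a)"
 have n: "n >= 1" using DIM_positive[where 'a='a] by (simp add: n_def)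
 define c where "c = (1 / (2 * n)) powr (1 / (1 + ga))"
 define phi where "phi = 2 / (1 + ga)"
 have c: "c > 0" using n by (simp add: c_def)
 have ceq: "2 * n * c = c powr (-ga)"
 proof -
  have "c powr (1 + ga) = 1 / (2 * n)" using n ga by (simp add: c_def powr_powr)
  then have "c * c powr ga = 1 / (2 * n)" using c by (simp add: powr_add)
  then show ?thesis using n c by (simp add: powr_minus field_simps)
 qed
 define k where "k = c * R powr (phi - 2)"
 have k: "k > 0" using c b by (simp add: k_def)
 define v where "v z = k * R^2 - k * (norm (z - x))^2" for z
 have lv: "has_lap (ball x R) v (%z. 0 - k *R (2 *R (z - x))) (%z. 0 - k * (2 * real DIM('a)))"
  unfolding v_def by (intro has_lap_diff has_lap_cmult has_lap_normsq has_lap_const)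
 have vx: "v x = c * R powr phi" using b by (simp add: v_def k_def powr_diff powr_numeral)
 have vle: "v z <= c * R powr phi" for z
  using vx k by (simp add: v_def)
 have "v x - U x <= 0"
 proof (rule max_principle_strict[OF bounded_ball open_ball has_lap_diff[OF lv has_lap_subset[OF U(1) b(1)]]])
  show "x : ball x R" using b by simp
  fix z assume z: "z : ball x R" "0 < v z - U z"
  have zW: "z : W" using z b by blast
  have "U z < c * R powr phi" using z(2) vle[of z] by simp
  then have "(c * R powr phi) powr (-ga) < U z powr (-ga)" using U(3)[OF zW] ga by (intro powr_neg_strict_antimono) auto
  moreover have "(c * R powr phi) powr (-ga) = k * (2 * n)"
  proof -
   have "(c * R powr phi) powr (-ga) = c powr (-ga) * R powr (- ga * phi)"
    using c by (simp add: powr_mult powr_powr mult.commute)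
   also have "- ga * phi = phi - 2" using ga by (simp add: phi_def field_simps)
   finally show ?thesis by (simp add: ceq[symmetric] k_def)
  qed
  ultimately show "0 < 0 - k * (2 * real DIM('a)) - l z" using U(2)[OF zW] by (simp add: n_def)
 next
  fix xi and e :: real assume xi: "xi : frontier (ball x R)" "0 < e"
  have "continuous_on UNIV v" unfolding v_def by (intro continuous_intros)
  then have "(v \<longlongrightarrow> v xi) (at xi within ball x R)" by (meson UNIV_I continuous_on_def subset_UNIV tendsto_within_subset)
  moreover have "v xi = 0" using xi(1) b by (simp add: v_def dist_norm norm_minus_commute)
  ultimately have "\<forall>\<^sub>F z in at xi within ball x R. v z < e" using order_tendstoD(2) xi(2) by fastforce
  moreover have "\<forall>\<^sub>F z in at xi within ball x R. z : ball x R" by (simp add: eventually_at_filter)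
  ultimately show "\<forall>\<^sub>F z in at xi within ball x R. v z - U z < e"
   by eventually_elim (use U(3) b in force)
 qed
 then show ?thesis using vx by (simp add: c_def n_def phi_def)
qed

section \<open>Existence of a positive homogeneous harmonic function\<close>

text \<open>The radial derivative, the dot product of \<open>x\<close> with the gradient. It turns
  statements on decay along rays into linear ones, to which the maximum principle applies.\<close>

definition euler :: "('a::euclidean_space => real) => 'a => real" where
 "euler h x = (SUM b:Basis. (b \<bullet> x) * partial b h x)"

text \<open>The Laplacian of the radial derivative is the radial derivative of the Laplacian plus
  twice the Laplacian.\<close>

lemma harmonic_euler:
 assumes "open W" "harmonic_on W h"
 shows "harmonic_on W (euler h)"
proof -
 let ?G = "%b x. SUM c:Basis. partial c (partial b h) x *R c"
 let ?l = "%x. SUM b:Basis. (b \<bullet> x) * laplacian (partial b h) x + partial b h x * 0 + 2 * (b \<bullet> ?G b x)"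
 have 1: "has_lap W (euler h) (%x. SUM b:Basis. (b \<bullet> x) *R ?G b x + partial b h x *R b) ?l"
  unfolding euler_def[abs_def]
  by (intro has_lap_sum finite_Basis has_lap_mult has_lap_inner Ck_on_2_has_lap harmonic_Ck harmonic_partial assms)
 have lap0: "laplacian k x = 0" if "harmonic_on W k" "x : W" for k x
  using that has_lap_laplacian[OF _ assms(1)] unfolding harmonic_on_def by blast
 have "?l x = 0" if x: "x : W" for x
 proof -
  have "?l x = (SUM b:Basis. 2 * partial b (partial b h) x)"
  proof (rule sum.cong[OF refl], goal_cases)
   case (1 b)
   have "laplacian (partial b h) x = 0" using lap0[OF harmonic_partial[OF assms(2,1) 1] x] .
   moreover have "b \<bullet> ?G b x = partial b (partial b h) x"
    using 1 by (simp add: inner_sum_right inner_Basis if_distrib cong: if_cong)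
   ultimately show ?case by simp
  qed
  also have "... = 2 * laplacian h x" by (simp add: laplacian_def sum_distrib_left)
  finally show ?thesis using lap0[OF assms(2) x] by simp
 qed
 with has_lap_cong[OF 1 assms(1) refl refl, of "%x. 0"] show ?thesis unfolding harmonic_on_def by blast
qed

lemma euler_ray_deriv:
 assumes "open W" "harmonic_on W h" "s *R x : W" "s > 0"
 shows "((%s. h (s *R x)) has_real_derivative euler h (s *R x) / s) (at s)"
proof -
 have "has_lap W h (%x. SUM b:Basis. partial b h x *R b) (laplacian h)"
  using Ck_on_2_has_lap(1) harmonic_Ck assms by blast
 then have 1: "(h has_derivative (%k. (SUM b:Basis. partial b h (s *R x) *R b) \<bullet> k)) (at (s *R x))"
  using assms(3) by (simp add: has_lap_def)
 have 2: "((%s. s *R x) has_derivative (%h. h *R x)) (at s)" by (auto intro!: derivative_eq_intros)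
 have "((%s. h (s *R x)) has_derivative (%k. (SUM b:Basis. partial b h (s *R x) *R b) \<bullet> (k *R x))) (at s)"
  using has_derivative_compose[OF 2, of h "%k. (SUM b:Basis. partial b h (s *R x) *R b) \<bullet> k"] 1 by simp
 moreover have "(SUM b:Basis. partial b h (s *R x) *R b) \<bullet> x = euler h (s *R x) / s"
  using assms(4) by (simp add: euler_def inner_sum_left sum_divide_distrib mult.commute)
 then have "(%k. (SUM b:Basis. partial b h (s *R x) *R b) \<bullet> (k *R x)) = (*) (euler h (s *R x) / s)"
  by (simp add: fun_eq_iff)
 ultimately show ?thesis by (simp only: has_field_derivative_def)
qed

text \<open>The Euler inequality says that \<open>t powr (-a) * h (t *R x)\<close> does not increase
  with \<open>t\<close>.\<close>

lemma euler_le_imp_scaling: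
 assumes "open W" "harmonic_on W h" "!!t. 0 < t ==> t <= 1 ==> t *R x : W"
  "!!t. 0 < t ==> t <= 1 ==> euler h (t *R x) <= a * h (t *R x)" "0 < s" "s <= 1"
 shows "s powr a * h x <= h (s *R x)"
proof -
 define f where "f t = t powr (-a) * h (t *R x)" for t
 have "f 1 <= f s"
 proof (rule DERIV_nonpos_imp_nonincreasing[OF assms(6)])
  fix t assume t: "s <= t" "t <= 1"
  then have t0: "0 < t" using assms(5) by simp
  have "(f has_real_derivative (- a * t powr (- a - 1)) * h (t *R x) + euler h (t *R x) / t * t powr (-a)) (at t)"
   unfolding f_def
   by (rule DERIV_mult[OF has_real_derivative_powr[OF t0] euler_ray_deriv[OF assms(1,2) assms(3)[OF t0 t(2)] t0]])
  moreover have "t powr (- a - 1) = t powr (-a) / t" using t0 by (simp add: powr_diff)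
  then have "(- a * t powr (- a - 1)) * h (t *R x) + euler h (t *R x) / t * t powr (-a)
   = t powr (-a) / t * (euler h (t *R x) - a * h (t *R x))" by (simp add: algebra_simps)
  moreover have "... <= 0" using assms(4)[OF t0 t(2)] t0 by (intro mult_nonneg_nonpos) auto
  ultimately show "EX y. (f has_real_derivative y) (at t) & y <= 0" by auto
 qed
 then have "s powr a * h x <= s powr a * (s powr (-a) * h (s *R x))" by (intro mult_left_mono) (auto simp: f_def)
 also have "... = h (s *R x)" using assms(5) by (simp add: mult.assoc[symmetric] powr_add[symmetric])
 finally show ?thesis .
qed

lemma scaling_imp_euler_le:
 assumes "open W" "harmonic_on W h" "x : W" "!!s. 0 < s ==> s <= 1 ==> s powr a * h x <= h (s *R x)"
 shows "euler h x <= a * h x"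
proof (rule ccontr)
 assume n: "~ euler h x <= a * h x"
 have "((%s. h (s *R x)) has_real_derivative euler h x) (at 1)"
  using euler_ray_deriv[OF assms(1,2), of 1 x] assms(3) by simp
 moreover have "((%s. s powr a * h x) has_real_derivative (a * 1 powr (a - 1)) * h x) (at 1)"
  by (intro DERIV_cmult_right has_real_derivative_powr) simp
 ultimately have "((%s. h (s *R x) - s powr a * h x) has_real_derivative euler h x - (a * 1 powr (a - 1)) * h x) (at 1)"
  by (rule DERIV_diff)
 from DERIV_pos_inc_left[OF this] n obtain d where
  d: "d > 0" "!!k. 0 < k ==> k < d ==> h ((1 - k) *R x) - (1 - k) powr a * h x < h (1 *R x) - 1 powr a * h x"
  by auto
 define k where "k = min d 1 / 2"
 have "0 < k" "k < d" "k < 1" using d(1) by (auto simp: k_def)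
 then show False using d(2)[of k] assms(4)[of "1 - k"] by simp
qed

lemma euler_eq_imp_homogeneous:
 assumes "open W" "harmonic_on W h" "!!t. 0 < t ==> t <= 1 ==> t *R x : W"
  "!!t. 0 < t ==> t <= 1 ==> euler h (t *R x) = a * h (t *R x)" "0 < s" "s <= 1"
 shows "h (s *R x) = s powr a * h x"
proof -
 have 1: "s powr a * h x <= h (s *R x)"
  by (rule euler_le_imp_scaling[OF assms(1-3) _ assms(5,6)]) (use assms(4) in auto)
 have hm: "harmonic_on W (%x. - 1 * h x)" using harmonic_on_cmult assms(2) by blast
 have eu: "euler (%x. - 1 * h x) y = - euler h y" if "y : W" for y
 proof -
  have "h differentiable (at y)"
   using assms(2) that unfolding harmonic_on_def has_lap_def differentiable_def by blast
  from partial_cmult[OF this, of _ "-1"] show ?thesis by (simp add: euler_def sum_negf)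
 qed
 have "s powr a * (- 1 * h x) <= - 1 * h (s *R x)"
  by (rule euler_le_imp_scaling[OF assms(1) hm assms(3) _ assms(5,6)]) (use assms(3,4) eu in auto)
 then show ?thesis using 1 by simp
qed

lemma eventually_at_ball:
 assumes "norm xi < r"
 shows "\<forall>\<^sub>F x in at xi within D. x : D Int ball 0 r"
proof -
 have "norm x < r" if "dist x xi < r - norm xi" for x
  using that norm_triangle_ineq2[of x xi] by (simp add: dist_norm)
 then show ?thesis unfolding eventually_at using assms by (intro exI[of _ "r - norm xi"]) auto
qed

lemma eventually_at_cone_scale:
 assumes "good_cone rho D" "s > 0" "\<forall>\<^sub>F x in at (s *R xi) within D. P x"
 shows "\<forall>\<^sub>F x in at xi within D. P (s *R x)"
proof -
 obtain d where d: "d > 0" "!!x. x : D ==> x ~= s *R xi ==> dist x (s *R xi) < d ==> P x"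
  using assms(3) unfolding eventually_at by blast
 have "P (s *R x)" if x: "x : D" "x ~= xi" "dist x xi < d / s" for x
 proof (rule d(2))
  show "s *R x : D" using good_coneD(6)[OF assms(1) x(1) assms(2)] .
  show "s *R x ~= s *R xi" using x(2) assms(2) by simp
  have "dist (s *R x) (s *R xi) = s * dist x xi"
   using assms(2) by (simp add: dist_norm scaleR_diff_right[symmetric])
  then show "dist (s *R x) (s *R xi) < d" using x(3) assms(2) by (simp add: field_simps)
 qed
 then show ?thesis unfolding eventually_at using d(1) assms(2)
  by (intro exI[of _ "d / s"]) (auto simp: dist_commute)
qed

lemma frontier_cone_scale:
 assumes "good_cone rho D" "s > 0" "xi : frontier D"
 shows "s *R xi : frontier D"
proof -
 have cl: "xi : closure D" "xi ~: D" using assms(3) good_coneD(3)[OF assms(1)] by (auto simp: frontier_def interior_open)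
 obtain u where u: "!!n. u n : D" "u \<longlonglongrightarrow> xi" using cl(1) unfolding closure_sequential by blast
 have "(%n. s *R u n) \<longlonglongrightarrow> s *R xi" using u(2) by (intro tendsto_intros)
 moreover have "s *R u n : D" for n using u(1) good_coneD(6)[OF assms(1)] assms(2) by blast
 ultimately have "s *R xi : closure D" unfolding closure_sequential by (intro exI[of _ "%n. s *R u n"]) simp
 moreover have "s *R xi ~: D"
 proof
  assume "s *R xi : D"
  then have "inverse s *R (s *R xi) : D" using good_coneD(6)[OF assms(1)] assms(2) by (meson positive_imp_inverse_positive)
  then show False using cl(2) assms(2) by simp
 qed
 ultimately show ?thesis using good_coneD(3)[OF assms(1)] by (simp add: frontier_def interior_open)
qed

text \<open>Splits the boundary condition on a truncated cone into two: values on the cap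
  \<open>norm x = r\<close> inside the cone, and an upper limit at the frontier of the cone, vertex
  included.\<close>

lemma cone_ball_limsup:
 fixes f :: "'a::euclidean_space => real"
 assumes D: "good_cone rho D" and r: "0 < r" "r < R" and f: "continuous_on (D Int ball 0 R) f"
  "!!x. x : D ==> norm x = r ==> f x <= 0"
  and lat: "!!xi e. xi : frontier D ==> norm xi <= r ==> 0 < e ==> \<forall>\<^sub>F x in at xi within D. x : ball 0 r --> f x < e"
  and xi: "xi : frontier (D Int ball 0 r)" and e: "0 < e"
 shows "\<forall>\<^sub>F x in at xi within (D Int ball 0 r). f x < e"
proof -
 have op: "open (D Int ball 0 r)" using good_coneD(3)[OF D] by (simp add: open_Int)
 have cl: "xi : closure (D Int ball 0 r)" "xi ~: D Int ball 0 r"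
  using xi unfolding frontier_def interior_open[OF op] by blast+
 have "closure (D Int ball 0 r) <= cball 0 r" by (intro closure_minimal) auto
 then have nr: "norm xi <= r" using cl by auto
 have "xi : closure D" using cl(1) closure_mono[of "D Int ball 0 r" D] by auto
 show ?thesis
 proof (cases "xi : D")
  case True
  then have "norm xi = r" using cl(2) nr by simp
  then have "f xi <= 0" using f(2) True by blast
  moreover have "(f \<longlongrightarrow> f xi) (at xi within (D Int ball 0 R))"
   using f(1) True nr r by (simp add: continuous_on_def)
  then have "(f \<longlongrightarrow> f xi) (at xi within (D Int ball 0 r))"
   by (rule tendsto_within_subset) (use r in auto)
  ultimately show ?thesis using order_tendstoD(2) e by fastforce
 next
  case False
  then have "xi : frontier D" using `xi : closure D` good_coneD(3)[OF D] by (simp add: frontier_def interior_open)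
  from lat[OF this nr e] have "\<forall>\<^sub>F x in at xi within (D Int ball 0 r). x : ball 0 r --> f x < e"
   by (rule filter_leD[OF at_le, rotated]) auto
  moreover have "\<forall>\<^sub>F x in at xi within (D Int ball 0 r). x : D Int ball 0 r" by (simp add: eventually_at_filter)
  ultimately show ?thesis by eventually_elim auto
 qed
qed

text \<open>What the Perron argument uses of the solution: a bounded nonnegative superharmonic
  function, vanishing on the lateral boundary, above a multiple of the distance to the power
  \<open>phi\<close>. The singular equation acts only through this lower bound.\<close>

locale cone_solution =
 fixes D :: "'a::euclidean_space set" and U :: "'a => real" and DU lU and rho phi c0 Mu :: real
 assumes D: "good_cone rho D"
  and Ulap: "has_lap (D Int ball 0 1) U DU lU" "!!x. x : D Int ball 0 1 ==> lU x <= 0"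
  and Ubd: "!!x. x : D Int ball 0 1 ==> 0 <= U x" "!!x. x : D Int ball 0 1 ==> U x <= Mu"
  and U0: "!!xi e. xi : frontier D ==> norm xi < 1 ==> 0 < e ==> \<forall>\<^sub>F x in at xi within D. U x < e"
  and Ulow: "!!x. x : D ==> norm x <= 1/2 ==> U x >= c0 * infdist x (- D) powr phi" "c0 > 0"
  and phi: "0 < phi" "phi <= 1"
begin

lemma oD: "open D" "open (D Int ball 0 r)"
 using good_coneD(3)[OF D] by (auto simp: open_Int)

lemma Uc: "continuous_on (D Int ball 0 1) U"
 using has_lap_continuous Ulap by blast

lemma rho: "0 < rho" "rho <= 1/4"
 using good_coneD[OF D] by auto

text \<open>The scaling inequality says that \<open>h\<close> decays towards the vertex at most with
  the power \<open>psi\<close>. A homogeneous function is the extremal case; it will be found at the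
  smallest possible \<open>psi\<close>.\<close>

definition adm :: "real => ('a => real) => bool" where
 "adm psi h \<longleftrightarrow> harmonic_on (D Int ball 0 (1/2)) h & (ALL x:D Int ball 0 (1/2). 0 <= h x & h x <= U x) &
   (ALL x:D Int ball 0 (1/2). ALL s. 0 < s & s <= 1 --> s powr psi * h x <= h (s *R x)) &
   (EX x:D Int ball 0 (1/2). h x > 0)"

lemma scaleD: "x : D ==> 0 < s ==> s *R x : D"
 using good_coneD(6)[OF D] by blast

text \<open>On \<open>norm y = 1/2\<close> a harmonic function bounded by \<open>m\<close> is at
  most \<open>8 * n / rho * m\<close> times the distance; \<open>c0\<close> converts this into a
  bound by \<open>U\<close>.\<close>

definition C1 :: real where "C1 = 8 * real DIM('a) / (rho * c0)"

lemma C1_pos: "C1 > 0"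
 using rho Ulow(2) DIM_positive[where 'a='a] by (simp add: C1_def)

text \<open>On the cap the linear upper bound for \<open>k\<close> meets
  \<open>U >= c0 * d powr phi >= c0 * d\<close>, as \<open>d <= 1/2\<close> and
  \<open>phi <= 1\<close>. Hence any harmonic function with zero lateral values, once normalised by
  its supremum, fits below \<open>U\<close>.\<close>

lemma harmonic_le_U:
 assumes k: "harmonic_on (D Int ball 0 1) k" "!!x. x : D Int ball 0 1 ==> 0 <= k x" "!!x. x : D Int ball 0 1 ==> k x <= m" "m > 0"
  and k0: "!!xi e. xi : frontier D ==> norm xi < 1 ==> 0 < e ==> \<forall>\<^sub>F x in at xi within D. k x < e"
  and x: "x : D Int ball 0 (1/2)"
 shows "k x <= C1 * m * U x"
proof -
 obtain E where E: "has_lap (D Int ball 0 1) k E (%x. 0)" using k(1) by (auto simp: harmonic_on_def)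
 have sub: "D Int ball 0 (1/2) <= D Int ball 0 1" by auto
 have C: "C1 * m >= 0" using C1_pos k(4) by simp
 show ?thesis
 proof (rule has_lap_comparison[OF _ oD(2) has_lap_subset[OF E sub] has_lap_subset[OF has_lap_cmult[OF Ulap(1)] sub] _ _ x])
  show "bounded (D Int ball 0 (1/2))" by (rule bounded_subset[OF bounded_ball[of 0 "1/2"]]) auto
  show "C1 * m * lU y <= 0" if "y : D Int ball 0 (1/2)" for y
   using Ulap(2)[of y] sub that C by (auto intro: mult_nonneg_nonpos)
  fix xi and e :: real assume xi: "xi : frontier (D Int ball 0 (1/2))" "0 < e"
  show "\<forall>\<^sub>F x in at xi within D Int ball 0 (1/2). k x - C1 * m * U x < e"
  proof (rule cone_ball_limsup[OF D _ _ _ _ _ xi])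
   show "continuous_on (D Int ball 0 1) (%x. k x - C1 * m * U x)"
    using Uc harmonic_on_continuous[OF k(1)] by (intro continuous_intros)
   fix y assume y: "y : D" "norm y = 1/2"
   define d where "d = infdist y (- D)"
   have d: "0 < d" "d <= 1/2" using infdist_cone_bounds[OF D y(1)] y(2) by (auto simp: d_def)
   have "k y <= 4 * real DIM('a) / rho * m * (infdist y (- D) / norm y)"
    by (rule cone_boundary_upper[OF D harmonic_imp_subh[OF k(1)]]) (use k y k0 in auto)
   also have "... = C1 * m * (c0 * d)" unfolding y(2) using Ulow(2) rho by (simp add: C1_def d_def)
   also have "... <= C1 * m * (c0 * d powr phi)"
   proof -
    have "d powr 1 <= d powr phi" using d phi by (intro powr_mono') auto
    then show ?thesis using C Ulow(2) d by (intro mult_left_mono) auto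
   qed
   also have "... <= C1 * m * U y" using Ulow(1)[OF y(1)] y(2) C by (intro mult_left_mono) (auto simp: d_def)
   finally show "k y - C1 * m * U y <= 0" by simp
  next
   fix xi and e :: real assume "xi : frontier D" "norm xi <= 1/2" "0 < e"
   then have "\<forall>\<^sub>F x in at xi within D. k x < e" using k0 by auto
   moreover have "\<forall>\<^sub>F x in at xi within D. x : D" by (simp add: eventually_at_filter)
   ultimately show "\<forall>\<^sub>F x in at xi within D. x : ball 0 (1/2) --> k x - C1 * m * U x < e"
   proof eventually_elim
    case (elim x)
    then have "x : ball 0 (1/2) ==> C1 * m * U x >= 0" using Ubd(1)[of x] by (intro mult_nonneg_nonneg[OF C]) auto
    then show ?case using elim by auto
   qed
  qed auto
 qed
qed

text \<open>Zooming in by \<open>th\<close> and dividing by the supremum \<open>m\<close> restores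
  admissibility by \<open>harmonic_le_U\<close>. Some point has a value above \<open>m/2\<close>,
  and the scaling inequality carries it to a quarter of its norm. The resulting lower bound, uniform
  in \<open>psi\<close>, keeps later limits from vanishing.\<close>

lemma adm_dilate:
 assumes "0 < th" "th <= 1/2" "psi <= phi"
  and h: "harmonic_on (D Int ball 0 th) h" "!!x. x : D Int ball 0 th ==> 0 <= h x" "!!x. x : D Int ball 0 th ==> h x <= U x"
   "!!x s. x : D Int ball 0 th ==> 0 < s ==> s <= 1 ==> s powr psi * h x <= h (s *R x)"
   "x1 : D Int ball 0 th" "h x1 > 0"
 shows "EX h'. adm psi h' & (EX x:D Int ball 0 (1/4). h' x >= 4 powr (-phi) / (2 * C1))"
proof -
 define k where "k x = h (th *R x)" for x
 have inth: "th *R x : D Int ball 0 th" if "x : D Int ball 0 1" for x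
  using that scaleD assms(1) by auto
 have kh: "harmonic_on (D Int ball 0 1) k"
  unfolding k_def[abs_def] by (rule harmonic_on_subset[OF harmonic_on_scale[OF h(1), of th]]) (use inth in blast)
 have k0: "0 <= k x" "k x <= U (th *R x)" "k x <= Mu" if "x : D Int ball 0 1" for x
 proof -
  have i: "th *R x : D Int ball 0 th" by (rule inth[OF that])
  then have "th *R x : D Int ball 0 1" using assms(2) by auto
  then have "U (th *R x) <= Mu" by (rule Ubd(2))
  then show "0 <= k x" "k x <= U (th *R x)" "k x <= Mu" using h(2)[OF i] h(3)[OF i] by (auto simp: k_def)
 qed
 have ks: "s powr psi * k x <= k (s *R x)" if "x : D Int ball 0 1" "0 < s" "s <= 1" for x s
  using h(4)[OF inth[OF that(1)] that(2,3)] by (simp add: k_def mult.commute)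
 define x2 where "x2 = (1 / th) *R x1"
 have x2: "x2 : D Int ball 0 1" "k x2 > 0" using h(5,6) assms(1) scaleD by (auto simp: x2_def k_def)
 define m where "m = (SUP x\<in>D Int ball 0 1. k x)"
 have bdd: "bdd_above (k ` (D Int ball 0 1))" using k0(3) by (intro bdd_aboveI[of _ Mu]) auto
 have km: "k x <= m" if "x : D Int ball 0 1" for x unfolding m_def using that bdd by (intro cSUP_upper) auto
 have m: "m > 0" using km[OF x2(1)] x2(2) by simp
 define h' where "h' x = (1 / (C1 * m)) * k x" for x
 have Cm: "C1 * m > 0" using C1_pos m by simp
 have hU: "k x <= C1 * m * U x" if "x : D Int ball 0 (1/2)" for x
 proof (rule harmonic_le_U[OF kh k0(1) km m _ that])
  fix xi and e :: real assume xi: "xi : frontier D" "norm xi < 1" "0 < e"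
  have "th *R xi : frontier D" using frontier_cone_scale[OF D assms(1) xi(1)] .
  moreover have "norm (th *R xi) < 1" using xi(2) assms(1,2) mult_strict_mono'[of th 1 "norm xi" 1] by simp
  ultimately have "\<forall>\<^sub>F x in at (th *R xi) within D. U x < e" using U0 xi(3) by blast
  then have 1: "\<forall>\<^sub>F x in at xi within D. U (th *R x) < e" by (rule eventually_at_cone_scale[OF D assms(1)])
  have 2: "\<forall>\<^sub>F x in at xi within D. x : D Int ball 0 1" by (rule eventually_at_ball[OF xi(2)])
  from 1 2 show "\<forall>\<^sub>F x in at xi within D. k x < e"
   by eventually_elim (use k0(2) in force)
 qed
 obtain x where x: "x : D Int ball 0 1" "k x > m / 2"
 proof -
  have "m / 2 < (SUP x\<in>D Int ball 0 1. k x)" using m by (simp add: m_def[symmetric])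
  moreover have "D Int ball 0 1 ~= {}" using x2(1) by blast
  ultimately show ?thesis using less_cSUP_iff[OF _ bdd] that by blast
 qed
 define y where "y = (1/4) *R x"
 have y: "y : D Int ball 0 (1/4)" using x(1) scaleD by (simp add: y_def)
 have "4 powr (-phi) * (m/2) <= (1/4) powr psi * k x"
 proof (rule mult_mono)
  have "(4::real) powr (-phi) = (1/4) powr phi" by (simp add: powr_minus_divide powr_divide)
  also have "... <= (1/4) powr psi" using assms(3) by (intro powr_mono') auto
  finally show "(4::real) powr (-phi) <= (1/4) powr psi" .
 qed (use x m in auto)
 also have "... <= k y" using ks[OF x(1), of "1/4"] by (simp add: y_def)
 finally have ky: "k y >= 4 powr (-phi) * (m/2)" .
 have "h' y >= 4 powr (-phi) / (2 * C1)"
 proof -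
  have "4 powr (-phi) / (2 * C1) = (1 / (C1 * m)) * (4 powr (-phi) * (m/2))" using m C1_pos by simp
  also have "... <= h' y" unfolding h'_def using ky Cm by (intro mult_left_mono) auto
  finally show ?thesis .
 qed
 moreover have "adm psi h'"
  unfolding adm_def
 proof (intro conjI ballI allI impI)
  have sub: "D Int ball 0 (1/2) <= D Int ball 0 1" by auto
  show "harmonic_on (D Int ball 0 (1/2)) h'" unfolding h'_def by (intro harmonic_on_cmult harmonic_on_subset[OF kh sub])
  fix x assume x: "x : D Int ball 0 (1/2)"
  then have x': "x : D Int ball 0 1" by auto
  show "0 <= h' x" using k0(1)[OF x'] Cm by (simp add: h'_def)
  show "h' x <= U x" using hU[OF x] Cm by (simp add: h'_def field_simps)
  fix s :: real assume s: "0 < s & s <= 1"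
  have "(1 / (C1 * m)) * (s powr psi * k x) <= (1 / (C1 * m)) * k (s *R x)"
   using ks[OF x'] s Cm by (intro mult_left_mono) auto
  then show "s powr psi * h' x <= h' (s *R x)" by (simp add: h'_def mult.left_commute)
 next
  have "4 powr (-phi) * (m/2) > 0" using m by simp
  then have "h' y > 0" using ky Cm unfolding h'_def by (intro mult_pos_pos) auto
  then show "EX x:D Int ball 0 (1/2). 0 < h' x" using y by (intro bexI[of _ y]) auto
 qed
 ultimately show ?thesis using y by blast
qed

text \<open>\<open>w\<close> may change sign; the multiple \<open>u\<close> of its positive part is
  subharmonic, homogeneous and below \<open>U\<close>. The least harmonic majorant \<open>h\<close>
  of \<open>u\<close> inherits the scaling inequality from minimality, as
  \<open>s powr (- phi) * h (s *R x)\<close> also majorises \<open>u\<close>.\<close>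

lemma adm_exists:
 assumes w: "harmonic_on D w" "!!x s. x : D ==> s > 0 ==> w (s *R x) = s powr phi * w x"
  and w0: "!!xi e. xi : frontier D ==> xi ~= 0 ==> 0 < e ==> \<forall>\<^sub>F x in at xi within D. w x < e"
  and wM: "!!x. x : D ==> w x <= Mw * norm x powr phi" "Mw > 0" and x1: "x1 : D" "w x1 > 0"
 shows "EX h. adm phi h"
proof -
 define n where "n = real DIM('a)"
 have n: "n >= 1" using DIM_positive[where 'a='a] by (simp add: n_def)
 define W where "W = D Int ball 0 (1/2)"
 define c where "c = c0 * rho / (8 * n * Mw)"
 have c: "c > 0" using Ulow(2) rho n wM(2) by (simp add: c_def)
 define v where "v x = max (w x) 0" for x
 have v: "subh D v" unfolding v_def[abs_def]
  by (intro subh_max harmonic_imp_subh w(1)) (use has_lap_const[of D 0] in "auto simp: harmonic_on_def")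
 define u where "u x = c * v x" for x
 have usub: "subh W u" unfolding u_def[abs_def]
  by (intro subh_cmult c subh_subset[OF v]) (auto simp: W_def)
 have u_pos: "0 <= u x" for x using c by (simp add: u_def v_def)
 have us: "u (s *R x) = s powr phi * u x" if "x : D" "s > 0" for x s
  using w(2)[OF that] by (simp add: u_def v_def max_def mult_le_0_iff not_le mult_pos_pos zero_less_mult_iff)
 have uU: "u x <= U x" if x: "x : W" for x
 proof -
  have xD: "x : D" "norm x < 1/2" using x by (auto simp: W_def)
  define d where "d = infdist x (- D)"
  have d: "0 < d" "d <= norm x" "norm x > 0" using infdist_cone_bounds[OF D xD(1)] by (auto simp: d_def)
  have "v x <= (4 * real DIM('a) / rho) * (Mw * (2 * norm x) powr phi) * (infdist x (- D) / norm x)"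
  proof (rule cone_boundary_upper[OF D])
   show "subh (D Int ball 0 (2 * norm x)) v" by (rule subh_subset[OF v]) auto
   show "0 <= Mw * (2 * norm x) powr phi" using wM by simp
   fix z assume z: "z : D" "norm z < 2 * norm x"
   have "w z <= Mw * norm z powr phi" using wM(1)[OF z(1)] .
   also have "... <= Mw * (2 * norm x) powr phi" using z(2) wM(2) phi by (intro mult_left_mono powr_mono2) auto
   finally show "v z <= Mw * (2 * norm x) powr phi" using wM(2) by (simp add: v_def)
  next
   fix xi and e :: real assume "xi : frontier D" "xi ~= 0" "0 < e"
   from w0[OF this] show "\<forall>\<^sub>F z in at xi within D. v z < e"
    by eventually_elim (use `0 < e` in "simp add: v_def")
  qed (use xD in auto)
  also have "... <= (4 * n / rho) * (Mw * (2 * norm x powr phi)) * (d / norm x) powr phi"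
  proof (intro mult_mono)
   have "(2::real) powr phi <= 2 powr 1" using phi by (intro powr_mono) auto
   then show "(2 * norm x) powr phi <= 2 * norm x powr phi" by (simp add: powr_mult mult_right_mono)
   have "(d / norm x) powr 1 <= (d / norm x) powr phi" using d phi by (intro powr_mono') auto
   then show "infdist x (- D) / norm x <= (d / norm x) powr phi" using d by (simp add: d_def)
  qed (use n rho wM d in "auto simp: n_def d_def infdist_nonneg")
  also have "... = (8 * n * Mw / rho) * d powr phi" using d by (simp add: powr_divide)
  finally have "u x <= c * ((8 * n * Mw / rho) * d powr phi)" unfolding u_def using c by (intro mult_left_mono) auto
  also have "... = c0 * d powr phi" using n rho wM by (simp add: c_def)
  also have "... <= U x" using Ulow(1)[OF xD(1)] xD(2) by (simp add: d_def)
  finally show ?thesis .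
 qed
 have sub: "W <= D Int ball 0 1" by (auto simp: W_def)
 have oW: "open W" using oD by (simp add: W_def)
 have lU: "lU x <= 0" if "x : W" for x using Ulap(2) sub that by blast
 obtain h where h: "harmonic_on W h" "!!x. x : W ==> u x <= h x" "!!x. x : W ==> h x <= U x"
  "!!w x. harmonic_on W w ==> (!!x. x : W ==> u x <= w x) ==> x : W ==> h x <= w x"
  using exists_least_harmonic_majorant[OF oW usub has_lap_subset[OF Ulap(1) sub] lU u_pos uU] by metis
 have "adm phi h"
  unfolding adm_def W_def[symmetric]
 proof (intro conjI ballI allI impI h(1))
  fix x assume x: "x : W"
  show "0 <= h x" using h(2)[OF x] u_pos[of x] by simp
  show "h x <= U x" using h(3)[OF x] .
  fix s :: real assume s: "0 < s & s <= 1"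
  have sW: "s *R z : W" if "z : W" for z
  proof -
   have "s * norm z <= 1 * norm z" using s by (intro mult_right_mono) auto
   then show ?thesis using that s scaleD by (auto simp: W_def)
  qed
  have "h x <= (1 / s powr phi) * h (s *R x)"
  proof (rule h(4)[OF _ _ x])
   show "harmonic_on W (%x. (1 / s powr phi) * h (s *R x))"
    by (intro harmonic_on_cmult harmonic_on_subset[OF harmonic_on_scale[OF h(1), of s]]) (use sW in blast)
   fix z assume z: "z : W"
   have "s powr phi * u z <= h (s *R z)" using us[of z s] h(2)[OF sW[OF z]] z s by (auto simp: W_def)
   then show "u z <= (1 / s powr phi) * h (s *R z)" using s by (simp add: field_simps)
  qed
  then show "s powr phi * h x <= h (s *R x)" using s by (simp add: field_simps)
 next
  have x10: "norm x1 > 0" using infdist_cone_bounds[OF D x1(1)] by simp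
  define z where "z = (1 / (4 * norm x1)) *R x1"
  have z: "z : W" using scaleD[OF x1(1)] x10 by (simp add: W_def z_def)
  have "u z > 0" using us[OF x1(1), of "1 / (4 * norm x1)"] x10 x1(2) c unfolding z_def by (simp add: u_def v_def)
  then show "EX x:W. 0 < h x" using h(2)[OF z] z by (intro bexI[of _ z]) auto
 qed
 then show ?thesis by blast
qed

text \<open>Arzela-Ascoli on the closure of the smaller truncated cone. Interior equicontinuity is
  the harmonic Lipschitz bound; at boundary points, the vertex included, it follows from
  \<open>h <= U\<close> and the vanishing of \<open>U\<close>.\<close>

lemma adm_limit:
 assumes a: "!!k::nat. adm (psi k) (h k)" "psi \<longlonglongrightarrow> psi'"
  and c: "c > 0" "!!k. EX x:D Int ball 0 (1/4). h k x >= c"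
 obtains g where "harmonic_on (D Int ball 0 (1/4)) g" "!!x. x : D Int ball 0 (1/4) ==> 0 <= g x"
  "!!x. x : D Int ball 0 (1/4) ==> g x <= U x"
  "!!x s. x : D Int ball 0 (1/4) ==> 0 < s ==> s <= 1 ==> s powr psi' * g x <= g (s *R x)"
  "EX x:D Int ball 0 (1/4). g x > 0"
proof -
 define W where "W = D Int ball 0 (1/4)"
 define K where "K = closure W"
 \<comment> \<open>Extension by 0 makes the family meaningful on the compact closure, with the right
   boundary values.\<close>
 define F where "F k x = (if x : D Int ball 0 (1/2) then h k x else 0)" for k x
 have hb: "0 <= h k x" "h k x <= U x" "h k x <= Mu" if "x : D Int ball 0 (1/2)" for k x
  using a(1)[of k] that Ubd(2)[of x] by (auto simp: adm_def intro: order_trans)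
 have KC: "K <= cball 0 (1/4)" unfolding K_def W_def by (intro closure_minimal) auto
 have "bounded W" unfolding W_def by (rule bounded_subset[OF bounded_ball[of 0 "1/4"]]) auto
 then have cK: "compact K" by (simp add: K_def)
 have Mu: "Mu >= 0"
 proof -
  obtain x where "x : D Int ball 0 (1/2)" using a(1)[of 0] by (auto simp: adm_def)
  then show ?thesis using hb[of x 0] by simp
 qed
 have equi: "EX d>0. ALL k y. y : K & norm (x - y) < d --> norm (F k x - F k y) < e" if x: "x : K" and e: "0 < e" for x e
 proof (cases "x : D")
  case True
  then have "x : D Int ball 0 (1/2)" using x KC by auto
  then obtain r where r: "r > 0" "ball x r <= D Int ball 0 (1/2)" using oD openE by blast
  define L where "L = 8 * real DIM('a) * Mu / r"
  have L: "L >= 0" using Mu r by (simp add: L_def)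
  define d where "d = min (r/4) (e / (L + 1))"
  have d: "d > 0" using r e L by (simp add: d_def)
  have "norm (F k x - F k y) < e" if y: "norm (x - y) < d" for k y
  proof -
   have xy: "x : ball x (r/4)" "y : ball x (r/4)" using r y by (auto simp: d_def dist_norm)
   have "harmonic_on (D Int ball 0 (1/2)) (h k)" using a(1)[of k] by (simp add: adm_def)
   then have "harmonic_on (ball x r) (h k)" by (rule harmonic_on_subset[OF _ r(2)])
   moreover have "\<bar>h k z\<bar> <= Mu" if "z : ball x r" for z using hb[of z k] r(2) that by force
   ultimately have "\<bar>h k x - h k y\<bar> <= L * norm (x - y)"
    unfolding L_def using harmonic_lipschitz[OF r(1) _ _ xy] by blast
   also have "... <= L * (e / (L + 1))" using y L by (intro mult_left_mono) (auto simp: d_def)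
   also have "... < e" using L e by (simp add: field_simps)
   finally show ?thesis using xy r by (auto simp: F_def subset_eq)
  qed
  then show ?thesis using d by blast
 next
  case False
  have "x : closure D" using x closure_mono[of W D] by (auto simp: K_def W_def)
  then have "x : frontier D" using False oD(1) by (simp add: frontier_def interior_open)
  moreover have "norm x < 1" using x KC by auto
  ultimately have "\<forall>\<^sub>F z in at x within D. U z < e" using U0 e by blast
  then obtain d where d: "d > 0" "!!z. z : D ==> z ~= x ==> dist z x < d ==> U z < e"
   unfolding eventually_at by blast
  have "norm (F k x - F k y) < e" if y: "norm (x - y) < d" for k y
  proof (cases "y : D Int ball 0 (1/2)")
   case True
   then have "U y < e" using d(2)[of y] False y by (auto simp: dist_norm norm_minus_commute)
   then show ?thesis using hb[OF True, of k] False True by (simp add: F_def)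
  next
   case F2: False
   then have "F k y = 0" "F k x = 0" using False by (auto simp: F_def)
   then show ?thesis using e by simp
  qed
  then show ?thesis using d by blast
 qed
 have Fb: "norm (F k x) <= Mu" if "x : K" for k x using hb[of x k] Mu by (auto simp: F_def)
 obtain g kap where g: "continuous_on K g" "strict_mono (kap :: nat => nat)"
  "!!e. 0 < e ==> EX N. ALL n x. n >= N & x : K --> norm (F (kap n) x - g x) < e"
  using Arzela_Ascoli[OF cK Fb equi] by metis
 have WK: "W <= K" unfolding K_def by (rule closure_subset)
 have FW: "F k x = h k x" if "x : W" for k x using that by (auto simp: F_def W_def)
 have ul: "uniform_limit W (%n. h (kap n)) g sequentially"
  unfolding uniform_limit_iff
 proof (intro allI impI)
  fix e :: real assume "0 < e"
  then obtain N where "ALL n x. n >= N & x : K --> norm (F (kap n) x - g x) < e" using g(3) by blast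
  then show "\<forall>\<^sub>F n in sequentially. ALL x:W. dist (h (kap n) x) (g x) < e"
   unfolding eventually_sequentially dist_norm using WK FW by (intro exI[of _ N]) (metis subsetD)
 qed
 have conv: "(%n. h (kap n) x) \<longlonglongrightarrow> g x" if "x : W" for x
  using tendsto_uniform_limitI[OF ul that] .
 have W2: "x : D Int ball 0 (1/2)" if "x : W" for x using that by (auto simp: W_def)
 show ?thesis
 proof (rule that[of g], fold W_def)
  show "harmonic_on W g"
  proof (rule harmonic_on_UN)
   fix p assume "p : W"
   then obtain r where r: "r > 0" "cball p r <= W" using oD(2) open_contains_cball unfolding W_def by blast
   have hW: "harmonic_on W (h k)" for k
   proof (rule harmonic_on_subset)
    show "harmonic_on (D Int ball 0 (1/2)) (h k)" using a(1)[of k] by (simp add: adm_def)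
    show "W <= D Int ball 0 (1/2)" using W2 by blast
   qed
   have "harmonic_on (ball p r) g"
   proof (rule uniform_limit_harmonic[OF r(1)])
    show "harmonic_on (ball p r) (h (kap k))" for k by (rule harmonic_on_subset[OF hW]) (use r in auto)
    show "continuous_on (cball p r) (h (kap k))" for k
     using harmonic_on_continuous[OF hW] r(2) continuous_on_subset by blast
    show "uniform_limit (cball p r) (%k. h (kap k)) g sequentially" by (rule uniform_limit_on_subset[OF ul r(2)])
   qed
   then show "EX V. open V & p : V & harmonic_on V g" using r(1) by (intro exI[of _ "ball p r"]) auto
  qed
  show "0 <= g x" if "x : W" for x
   using conv[OF that] hb(1)[OF W2[OF that]] by (intro LIMSEQ_le_const) auto
  show "g x <= U x" if "x : W" for x
   using conv[OF that] hb(2)[OF W2[OF that]] by (intro LIMSEQ_le_const2) auto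
  fix x and s :: real assume x: "x : W" and s: "0 < s" "s <= 1"
  have "s * norm x <= 1 * norm x" using s by (intro mult_right_mono) auto
  then have sx: "s *R x : W" using x s scaleD by (auto simp: W_def)
  have "(%n. psi (kap n)) \<longlonglongrightarrow> psi'" using LIMSEQ_subseq_LIMSEQ[OF a(2) g(2)] by (simp add: o_def)
  then have "(%n. s powr psi (kap n) * h (kap n) x) \<longlonglongrightarrow> s powr psi' * g x"
   using s conv[OF x] by (intro tendsto_intros) auto
  moreover have "s powr psi k * h k x <= h k (s *R x)" for k using a(1)[of k] W2[OF x] s by (auto simp: adm_def)
  ultimately show "s powr psi' * g x <= g (s *R x)"
   using conv[OF sx] by (intro LIMSEQ_le) auto
 next
  have "c / 2 > 0" using c by simp
  then obtain N where N: "ALL n x. n >= N & x : K --> norm (F (kap n) x - g x) < c/2" using g(3) by blast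
  obtain x where x: "x : W" "h (kap N) x >= c" using c(2)[of "kap N"] by (auto simp: W_def)
  then have "norm (h (kap N) x - g x) < c/2" using N WK FW[OF x(1)] by force
  then have "g x > 0" using x(2) c(1) unfolding real_norm_def by linarith
  then show "EX x:W. 0 < g x" using x(1) by blast
 qed
qed

text \<open>The defect \<open>q\<close> in the Euler inequality is harmonic and nonnegative, hence
  positive once it is positive somewhere. On \<open>norm y = 1/8\<close>, \<open>h\<close> is at
  most and \<open>q\<close> at least a multiple of the distance, so \<open>eps * h <= q\<close>
  there and, by comparison, further in: the exponent can be lowered by \<open>eps\<close>.\<close>

lemma euler_gap:
 assumes psi: "psi > 0" and h: "harmonic_on (D Int ball 0 (1/4)) h" "!!x. x : D Int ball 0 (1/4) ==> 0 <= h x"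
  "!!x. x : D Int ball 0 (1/4) ==> h x <= U x"
  and Q: "!!x. x : D Int ball 0 (1/4) ==> euler h x <= psi * h x"
  and x1: "x1 : D Int ball 0 (1/4)" "euler h x1 < psi * h x1"
 shows "EX eps>0. eps < psi & (ALL x:D Int ball 0 (1/8). euler h x <= (psi - eps) * h x)"
proof -
 define W where "W = D Int ball 0 (1/4)"
 have oW: "open W" using oD by (simp add: W_def)
 define q where "q x = psi * h x - euler h x" for x
 have qh: "harmonic_on W q"
  unfolding q_def by (intro harmonic_on_diff harmonic_on_cmult harmonic_euler oW) (use h in "auto simp: W_def")
 then obtain E where E: "has_lap W q E (%x. 0)" by (auto simp: harmonic_on_def)
 have q0: "q x >= 0" if "x : W" for x using Q that by (simp add: q_def W_def)
 have "connected W" unfolding W_def by (rule good_cone_connected_ball[OF D]) simp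
 have qpos: "q x > 0" if "x : W" for x
  by (rule superharmonic_strong_positivity[OF oW `connected W` E _ q0 _ _ that, of x1])
   (use x1 in "auto simp: q_def W_def")
 \<comment> \<open>The points that \<open>cone_boundary_lower\<close> asks about when
   \<open>norm y = 1/8\<close>: norms from 1/16 to 3/16 and depth at least
   \<open>rho / 16\<close>.\<close>
 define Kc where "Kc = {z. 1/16 <= norm z & norm z <= 3/16 & rho / 16 <= infdist z (- D)}"
 have KW: "Kc <= W"
 proof
  fix z assume z: "z : Kc"
  have "z : D"
  proof (rule ccontr)
   assume "z ~: D"
   then have "infdist z (- D) = 0" by (intro infdist_zero) simp
   then show False using z rho by (simp add: Kc_def)
  qed
  then show "z : W" using z by (auto simp: Kc_def W_def)
 qed
 have "closed Kc"
 proof -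
  have "Kc = {z. 1/16 <= norm z} Int {z. norm z <= 3/16} Int {z. rho / 16 <= infdist z (- D)}" by (auto simp: Kc_def)
  then show ?thesis by (auto intro!: closed_Int closed_Collect_le continuous_intros)
 qed
 moreover have "bounded Kc" by (rule bounded_subset[OF bounded_cball[of 0 "3/16"]]) (auto simp: Kc_def)
 ultimately have "compact Kc" by (simp add: compact_eq_bounded_closed)
 have "EX m>0. ALL z:Kc. q z >= m"
 proof (cases "Kc = {}")
  case True then show ?thesis by (intro exI[of _ 1]) auto
 next
  case False
  obtain z where "z : Kc" "ALL y:Kc. q z <= q y"
   using continuous_attains_inf[OF `compact Kc` False] continuous_on_subset[OF harmonic_on_continuous[OF qh] KW] by blast
  then show ?thesis using qpos KW by (intro exI[of _ "q z"]) auto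
 qed
 then obtain m where m: "m > 0" "!!z. z : Kc ==> q z >= m" by blast
 define n where "n = real DIM('a)"
 have n: "n >= 1" using DIM_positive[where 'a='a] by (simp add: n_def)
 have Mu: "Mu >= 0" using h(2,3)[OF x1(1)] Ubd(2)[of x1] x1(1) by auto
 define b where "b = (1/2) powr n * m"
 have b: "b > 0" using m by (simp add: b_def)
 define eps where "eps = min (psi/2) (b / (4 * n / rho * (Mu + 1)))"
 have eps: "eps > 0" "eps < psi" using psi b n rho Mu by (auto simp: eps_def)
 have epsb: "eps * (4 * n / rho * Mu) <= b"
 proof -
  have "eps * (4 * n / rho * Mu) <= eps * (4 * n / rho * (Mu + 1))" using eps(1) n rho by (intro mult_left_mono) auto
  also have "... <= (b / (4 * n / rho * (Mu + 1))) * (4 * n / rho * (Mu + 1))"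
   using n rho Mu by (intro mult_right_mono) (auto simp: eps_def)
  also have "... = b"
  proof -
   have "4 * n / rho * (Mu + 1) ~= 0" using n rho Mu by simp
   then show ?thesis by simp
  qed
  finally show ?thesis .
 qed
 have sub: "D Int ball 0 (1/8) <= W" by (auto simp: W_def)
 obtain F where F: "has_lap W h F (%x. 0)" using h(1) by (auto simp: harmonic_on_def W_def)
 have main: "eps * h x <= q x" if x: "x : D Int ball 0 (1/8)" for x
 proof (rule has_lap_comparison[OF _ oD(2) has_lap_subset[OF has_lap_cmult[OF F] sub] has_lap_subset[OF E sub] _ _ x])
  show "bounded (D Int ball 0 (1/8))" by (rule bounded_subset[OF bounded_ball[of 0 "1/8"]]) auto
  fix xi and e :: real assume xi: "xi : frontier (D Int ball 0 (1/8))" "0 < e"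
  show "\<forall>\<^sub>F x in at xi within D Int ball 0 (1/8). eps * h x - q x < e"
  proof (rule cone_ball_limsup[OF D _ _ _ _ _ xi, where R="1/4"])
   show "continuous_on (D Int ball 0 (1/4)) (%x. eps * h x - q x)"
    using harmonic_on_continuous[OF qh] harmonic_on_continuous[OF h(1)] unfolding W_def by (intro continuous_intros)
   fix y assume y: "y : D" "norm y = 1/8"
   define d where "d = infdist y (- D) / norm y"
   have d: "d >= 0" using y by (simp add: d_def infdist_nonneg)
   have hM: "h z <= Mu" if "z : D" "norm z < 1/4" for z using h(3)[of z] Ubd(2)[of z] that by auto
   have "h y <= (4 * real DIM('a) / rho) * Mu * (infdist y (- D) / norm y)"
   proof (rule cone_boundary_upper[OF D harmonic_imp_subh[OF h(1)]])
    show "0 <= Mu" by (rule Mu)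
    fix xi and e :: real assume xi: "xi : frontier D" "norm xi < 1/4" "0 < e"
    then have 1: "\<forall>\<^sub>F x in at xi within D. U x < e" using U0 by auto
    have 2: "\<forall>\<^sub>F x in at xi within D. x : D Int ball 0 (1/4)" by (rule eventually_at_ball[OF xi(2)])
    from 1 2 show "\<forall>\<^sub>F x in at xi within D. h x < e" by eventually_elim (use h(3) in force)
   qed (use hM y in auto)
   then have hy: "h y <= 4 * n / rho * Mu * d" by (simp add: n_def d_def)
   have "q y >= (1/2) powr DIM('a) * m * (infdist y (- D) / norm y)"
   proof (rule cone_boundary_lower[OF D, where R="1/4"])
    show "has_lap (D Int ball 0 (1/4)) q E (%x. 0)" using E by (simp add: W_def)
    show "0 <= q z" if "z : D Int ball 0 (1/4)" for z using q0 that by (simp add: W_def)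
    fix z assume "z : D" "norm y / 2 <= norm z" "norm z <= 3/2 * norm y" "rho * norm y / 2 <= infdist z (- D)"
    then show "m <= q z" using y(2) by (intro m(2)) (simp add: Kc_def)
   qed (use m y in auto)
   then have qy: "q y >= b * d" by (simp add: b_def n_def d_def)
   have "eps * h y <= eps * (4 * n / rho * Mu * d)" using hy eps(1) by (intro mult_left_mono) auto
   also have "... = (eps * (4 * n / rho * Mu)) * d" by simp
   also have "... <= b * d" using epsb d by (intro mult_right_mono) auto
   finally show "eps * h y - q y <= 0" using qy by simp
  next
   fix xi and e :: real assume xi: "xi : frontier D" "norm xi <= 1/8" "0 < e"
   then have "\<forall>\<^sub>F x in at xi within D. U x < e / eps" using U0[of xi "e/eps"] eps(1) by auto
   moreover have "\<forall>\<^sub>F x in at xi within D. x : D" by (simp add: eventually_at_filter)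
   ultimately show "\<forall>\<^sub>F x in at xi within D. x : ball 0 (1/8) --> eps * h x - q x < e"
   proof eventually_elim
    case (elim x)
    show ?case
    proof
     assume "x : ball 0 (1/8)"
     then have xW: "x : W" using elim by (auto simp: W_def)
     then have "h x < e / eps" using h(3)[of x] elim by (auto simp: W_def)
     then have "eps * h x < e" using eps(1) by (simp add: field_simps)
     then show "eps * h x - q x < e" using q0[OF xW] by simp
    qed
   qed
  qed auto
 qed auto
 have "ALL x:D Int ball 0 (1/8). euler h x <= (psi - eps) * h x"
 proof
  fix x assume "x : D Int ball 0 (1/8)"
  from main[OF this] show "euler h x <= (psi - eps) * h x" by (simp add: q_def algebra_simps)
 qed
 then show ?thesis using eps by blast
qed

text \<open>The infimum \<open>psi\<close> of admissible exponents is attained by compactness. If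
  the Euler inequality for the limit \<open>g\<close> were strict anywhere, \<open>euler_gap\<close>
  would give an admissible exponent below the infimum; equality everywhere means
  homogeneity.\<close>

theorem exists_homogeneous_harmonic:
 assumes "EX h. adm phi h"
 obtains psi H where "0 < psi" "psi <= phi" "harmonic_on D H" "!!x. x : D ==> H x > 0"
  "!!x s. x : D ==> s > 0 ==> H (s *R x) = s powr psi * H x"
  "!!xi e. xi : frontier D ==> xi ~= 0 ==> 0 < e ==> \<forall>\<^sub>F x in at xi within D. H x < e"
proof -
 define A where "A = {psi. 0 < psi & psi <= phi & (EX h. adm psi h)}"
 have A: "phi : A" "bdd_below A" using assms phi by (auto simp: A_def intro!: bdd_belowI[of _ 0])
 define psi where "psi = Inf A"
 have psi0: "psi >= 0" unfolding psi_def using A by (intro cInf_greatest) (auto simp: A_def)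
 have psiphi: "psi <= phi" unfolding psi_def using A by (intro cInf_lower)
 define c where "c = 4 powr (-phi) / (2 * C1)"
 have c: "c > 0" using C1_pos by (simp add: c_def)
 have "EX psi' h. psi' < psi + inverse (Suc k) & psi' : A & adm psi' h & (EX x:D Int ball 0 (1/4). h x >= c)" for k
 proof -
  have "Inf A < psi + inverse (Suc k)" by (simp add: psi_def)
  then obtain psi' where psi': "psi' : A" "psi' < psi + inverse (Suc k)" using cInf_lessD[of A] A by auto
  then obtain h0 where h0: "adm psi' h0" by (auto simp: A_def)
  then obtain x1 where x1: "x1 : D Int ball 0 (1/2)" "h0 x1 > 0" by (auto simp: adm_def)
  have "EX h'. adm psi' h' & (EX x:D Int ball 0 (1/4). h' x >= 4 powr (-phi) / (2 * C1))"
   by (rule adm_dilate[of "1/2" psi' h0 x1]) (use h0 x1 psi'(1) in "auto simp: adm_def A_def")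
  then show ?thesis using psi' unfolding c_def by blast
 qed
 then obtain psis hs where s: "!!k. psis k < psi + inverse (Suc k)" "!!k. psis k : A" "!!k. adm (psis k) (hs k)"
  "!!k. EX x:D Int ball 0 (1/4). hs k x >= c" by metis
 have lim: "psis \<longlonglongrightarrow> psi"
 proof (rule tendsto_sandwich)
  show "\<forall>\<^sub>F k in sequentially. psi <= psis k" unfolding psi_def using s(2) A by (auto intro!: always_eventually cInf_lower)
  show "\<forall>\<^sub>F k in sequentially. psis k <= psi + inverse (Suc k)" using s(1) by (auto intro!: always_eventually less_imp_le)
  show "(%k. psi + inverse (Suc k)) \<longlonglongrightarrow> psi" using tendsto_add[OF tendsto_const LIMSEQ_inverse_real_of_nat] by simp
 qed simp
 obtain g where g: "harmonic_on (D Int ball 0 (1/4)) g" "!!x. x : D Int ball 0 (1/4) ==> 0 <= g x"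
  "!!x. x : D Int ball 0 (1/4) ==> g x <= U x"
  "!!x s. x : D Int ball 0 (1/4) ==> 0 < s ==> s <= 1 ==> s powr psi * g x <= g (s *R x)"
  "EX x:D Int ball 0 (1/4). g x > 0"
  by (rule adm_limit[OF s(3) lim c s(4)]) (rule that)
 define W where "W = D Int ball 0 (1/4)"
 have oW: "open W" using oD by (simp add: W_def)
 have sW: "s *R x : D Int ball 0 r" if "x : D Int ball 0 r" "0 < s" "s <= 1" for x s r
 proof -
  have "s * norm x <= 1 * norm x" using that by (intro mult_right_mono) auto
  then show ?thesis using that scaleD by auto
 qed
 obtain x0 where x0: "x0 : W" "g x0 > 0" using g(5) by (auto simp: W_def)
 \<comment> \<open>With \<open>psi = 0\<close> the function \<open>g\<close> would not decrease
   towards the vertex along a ray, while \<open>g <= U\<close> tends to 0 there.\<close>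
 have psipos: "psi > 0"
 proof (rule ccontr)
  assume "~ psi > 0"
  then have z: "psi = 0" using psi0 by simp
  have "\<forall>\<^sub>F x in at 0 within D. U x < g x0" using U0[OF zero_in_frontier_cone[OF D] _ x0(2)] by simp
  then obtain d where d: "d > 0" "!!x. x : D ==> x ~= 0 ==> dist x 0 < d ==> U x < g x0"
   unfolding eventually_at by blast
  have nx: "norm x0 > 0" using infdist_cone_bounds[OF D] x0(1) by (auto simp: W_def)
  define s where "s = min 1 (d / (2 * norm x0))"
  have s: "0 < s" "s <= 1" using d nx by (auto simp: s_def)
  have "s * norm x0 <= d / (2 * norm x0) * norm x0" using nx by (intro mult_right_mono) (auto simp: s_def)
  then have sd: "s * norm x0 < d" using nx d by simp
  have sx: "s *R x0 : W" using sW[of x0 "1/4" s] x0 s by (simp add: W_def)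
  have "g x0 <= g (s *R x0)" using g(4)[of x0 s] x0 s z by (simp add: W_def)
  also have "... <= U (s *R x0)" using g(3) sx by (simp add: W_def)
  also have "... < g x0" using d(2)[of "s *R x0"] sx sd s nx by (auto simp: W_def)
  finally show False by simp
 qed
 have eule: "euler g x <= psi * g x" if "x : W" for x
  by (rule scaling_imp_euler_le[OF oW]) (use g that in "auto simp: W_def")
 have eueq: "euler g x = psi * g x" if x: "x : W" for x
 proof (rule ccontr)
  assume "euler g x ~= psi * g x"
  then have lt: "euler g x < psi * g x" using eule[OF x] by simp
  obtain eps where eps: "eps > 0" "eps < psi" "!!x. x : D Int ball 0 (1/8) ==> euler g x <= (psi - eps) * g x"
   using euler_gap[OF psipos g(1-3) _ _ lt] eule x unfolding W_def by blast
  have hg: "harmonic_on (D Int ball 0 (1/8)) g" by (rule harmonic_on_subset[OF g(1)]) auto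
  have "(1/2) powr psi * g x0 > 0" using x0 by simp
  moreover have "(1/2) powr psi * g x0 <= g ((1/2) *R x0)" using g(4)[of x0 "1/2"] x0 by (simp add: W_def)
  ultimately have x08: "g ((1/2) *R x0) > 0" by linarith
  have x08': "(1/2) *R x0 : D Int ball 0 (1/8)" using x0 scaleD[of x0 "1/2"] by (auto simp: W_def)
  have "EX h'. adm (psi - eps) h' & (EX x:D Int ball 0 (1/4). h' x >= 4 powr (-phi) / (2 * C1))"
  proof (rule adm_dilate[of "1/8" "psi - eps" g, OF _ _ _ hg _ _ _ x08' x08])
   show "psi - eps <= phi" using psiphi eps by simp
   fix x assume x: "x : D Int ball 0 (1/8)"
   then have xW: "x : D Int ball 0 (1/4)" by auto
   show "0 <= g x" "g x <= U x" using g(2,3)[OF xW] .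
   fix s :: real assume s: "0 < s" "s <= 1"
   show "s powr (psi - eps) * g x <= g (s *R x)"
    by (rule euler_le_imp_scaling[OF oD(2) hg _ _ s]) (use sW[OF x] eps(3) in auto)
  qed auto
  then have "psi - eps : A" using eps psiphi by (auto simp: A_def)
  then have "psi <= psi - eps" unfolding psi_def using A(2) by (intro cInf_lower)
  then show False using eps by simp
 qed
 have hom: "g (s *R x) = s powr psi * g x" if "x : W" "0 < s" "s <= 1" for x s
  by (rule euler_eq_imp_homogeneous[OF oW _ _ _ that(2,3)])
   (use g(1) eueq sW[of x "1/4"] that in "auto simp: W_def")
 have "connected W" unfolding W_def by (rule good_cone_connected_ball[OF D]) simp
 obtain E where E: "has_lap W g E (%x. 0)" using g(1) by (auto simp: harmonic_on_def W_def)
 have gpos: "g x > 0" if "x : W" for x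
  by (rule superharmonic_strong_positivity[OF oW `connected W` E _ _ x0 that]) (use g(2) in "auto simp: W_def")
 \<comment> \<open>\<open>H\<close> continues \<open>g\<close> by homogeneity to the whole cone,
   evaluating it at the point of norm 1/8 on the same ray; \<open>Heq\<close> shows that any other
   admissible scale gives the same value.\<close>
 define sig where "sig x = 1 / (8 * norm x)" for x :: 'a
 define H where "H x = (sig x) powr (-psi) * g (sig x *R x)" for x
 have nx: "norm x > 0" if "x : D" for x using infdist_cone_bounds[OF D that] by simp
 have sig: "sig x > 0" "sig x *R x : W" if "x : D" for x
  using nx[OF that] scaleD[OF that, of "sig x"] by (auto simp: sig_def W_def)
 have Heq: "H x = s powr (-psi) * g (s *R x)" if x: "x : D" and s: "s > 0" "s *R x : W" for x s
 proof -
  have key: "s powr (-psi) * g (s *R x) = t powr (-psi) * g (t *R x)"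
   if "0 < s" "s <= t" "t *R x : W" for s t
  proof -
   have "g ((s / t) *R (t *R x)) = (s / t) powr psi * g (t *R x)" using that by (intro hom) auto
   then have "g (s *R x) = (s / t) powr psi * g (t *R x)" using that by simp
   moreover have "s powr (-psi) * (s / t) powr psi = t powr (-psi)"
    using that by (simp add: powr_divide powr_minus_divide)
   ultimately show ?thesis by (simp add: mult.assoc[symmetric])
  qed
  show ?thesis
  proof (cases "s <= sig x")
   case True
   then show ?thesis using key[of s "sig x"] sig[OF x] s by (simp add: H_def)
  next
   case False
   then show ?thesis using key[of "sig x" s] sig[OF x] s by (simp add: H_def)
  qed
 qed
 show ?thesis
 proof (rule that[OF psipos psiphi])
  show "H x > 0" if "x : D" for x using gpos[OF sig(2)[OF that]] sig(1)[OF that] by (simp add: H_def)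
  show "H (s *R x) = s powr psi * H x" if x: "x : D" and s: "s > 0" for x s
  proof -
   have "H (s *R x) = (sig x / s) powr (-psi) * g ((sig x / s) *R (s *R x))"
    using sig[OF x] s by (intro Heq scaleD x) auto
   also have "(sig x / s) *R (s *R x) = sig x *R x" using s by simp
   also have "(sig x / s) powr (-psi) = s powr psi * sig x powr (-psi)"
    using sig[OF x] s by (simp add: powr_divide powr_minus_divide)
   finally have "H (s *R x) = s powr psi * sig x powr (-psi) * g (sig x *R x)" .
   then have "H (s *R x) = s powr psi * H x" by (simp add: H_def)
   then show ?thesis .
  qed
  show "harmonic_on D H"
  proof (rule harmonic_on_UN)
   fix p assume p: "p : D"
   define V where "V = {x. sig p *R x : W}"
   have "continuous_on UNIV (%x::'a. sig p *R x)" by (intro continuous_intros)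
   then have "open V" unfolding V_def using open_vimage[OF oW, of "%x. sig p *R x"] by (simp add: vimage_def)
   moreover have "p : V" using sig[OF p] by (simp add: V_def)
   moreover have "harmonic_on V H"
   proof (rule harmonic_on_cong[OF _ `open V`])
    show "harmonic_on V (%x. sig p powr (-psi) * g (sig p *R x))"
     unfolding V_def by (intro harmonic_on_cmult harmonic_on_scale) (use g(1) in "simp add: W_def")
    fix x assume x: "x : V"
    have "inverse (sig p) *R (sig p *R x) : D" using scaleD[of "sig p *R x" "inverse (sig p)"] x sig(1)[OF p] by (simp add: V_def W_def)
    then have "x : D" using sig(1)[OF p] by simp
    then show "sig p powr (-psi) * g (sig p *R x) = H x" using Heq[of x "sig p"] x sig(1)[OF p] by (simp add: V_def)
   qed
   ultimately show "EX V. open V & p : V & harmonic_on V H" by blast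
  qed
  fix xi and e :: real assume xi: "xi : frontier D" "xi ~= 0" and e: "0 < e"
  have s: "sig xi > 0" "norm (sig xi *R xi) = 1/8" using xi(2) by (auto simp: sig_def)
  define e' where "e' = e / sig xi powr (-psi)"
  have e': "e' > 0" using e s by (simp add: e'_def)
  have "\<forall>\<^sub>F x in at (sig xi *R xi) within D. U x < e'"
   using U0[OF frontier_cone_scale[OF D s(1) xi(1)] _ e'] s(2) by simp
  moreover have "\<forall>\<^sub>F x in at (sig xi *R xi) within D. x : W"
   unfolding W_def by (rule eventually_at_ball) (use s(2) in simp)
  ultimately have "\<forall>\<^sub>F x in at (sig xi *R xi) within D. U x < e' & x : W" by (rule eventually_conj)
  then have "\<forall>\<^sub>F x in at xi within D. U (sig xi *R x) < e' & sig xi *R x : W"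
   by (rule eventually_at_cone_scale[OF D s(1)])
  moreover have "\<forall>\<^sub>F x in at xi within D. x : D" by (simp add: eventually_at_filter)
  ultimately show "\<forall>\<^sub>F x in at xi within D. H x < e"
  proof eventually_elim
   case (elim x)
   then have "H x = sig xi powr (-psi) * g (sig xi *R x)" using Heq s(1) by blast
   also have "... < sig xi powr (-psi) * e'"
    using g(3)[of "sig xi *R x"] elim s(1) by (intro mult_strict_left_mono) (auto simp: W_def)
   also have "... = e" using s(1) by (simp add: e'_def)
   finally show ?case .
  qed
 qed
qed

end

section \<open>Uniform bounds for homogeneous harmonic functions\<close>

text \<open>Harnack chain for superharmonic functions, lower bounds only. One step of length at most
  \<open>r\<close> uses the Hopf bound in a ball of radius \<open>4 * r\<close>, on points within
  \<open>2 * r\<close> of its centre, and costs the factor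
  \<open>(1/4) powr DIM('a) / 2\<close>.\<close>

lemma harnack_chain:
 fixes H :: "'a::euclidean_space => real"
 assumes H: "has_lap D H E l" "!!x. x : D ==> l x <= 0" "!!x. x : D ==> H x >= 0" and r: "r > 0"
 shows "[|dist p q <= real N * r; !!z. z : closed_segment p q ==> ball z (4 * r) <= D; m >= 0;
  !!x. x : cball p r ==> H x >= m; x : cball q r|] ==> H x >= ((1/4) powr DIM('a) / 2) ^ N * m"
proof (induction N arbitrary: p m)
 case 0
 then show ?case by simp
next
 case (Suc N)
 \<comment> \<open>One of \<open>Suc N\<close> equal steps from \<open>p\<close> to
   \<open>q\<close>.\<close>
 define p' where "p' = p + (1 / real (Suc N)) *R (q - p)"
 have seg: "p' : closed_segment p q" unfolding in_segment p'_def
  by (intro exI[of _ "1 / real (Suc N)"]) (simp add: algebra_simps)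
 have d1: "dist p p' <= r"
 proof -
  have "dist p p' = dist p q / real (Suc N)" by (simp add: p'_def dist_norm norm_minus_commute)
  also have "... <= (real (Suc N) * r) / real (Suc N)" by (intro divide_right_mono Suc.prems(1)) simp
  finally show ?thesis by simp
 qed
 have d2: "dist p' q <= real N * r"
 proof -
  have "q - p' = (real N / real (Suc N)) *R (q - p)"
  proof -
   have "real N / real (Suc N) = 1 - 1 / real (Suc N)" by (simp add: field_simps)
   then have "(real N / real (Suc N)) *R (q - p) = (q - p) - (1 / real (Suc N)) *R (q - p)"
    by (simp add: scaleR_left_diff_distrib)
   then show ?thesis by (simp add: p'_def)
  qed
  then have "norm (q - p') = (real N / real (Suc N)) * norm (q - p)" by simp
  then have "dist p' q = (real N / real (Suc N)) * dist p q" by (simp add: dist_norm norm_minus_commute)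
  also have "... <= (real N / real (Suc N)) * (real (Suc N) * r)" by (intro mult_left_mono Suc.prems(1)) simp
  finally show ?thesis by simp
 qed
 have bp: "ball p (4 * r) <= D" using Suc.prems(2)[of p] by simp
 show ?case
 proof -
  have "((1/4) powr DIM('a) / 2) ^ N * ((1/4) powr DIM('a) / 2 * m) <= H x"
  proof (rule Suc.IH[OF d2 _ _ _ Suc.prems(5)])
   show "ball z (4 * r) <= D" if "z : closed_segment p' q" for z
    using Suc.prems(2) that seg by (meson ends_in_segment(2) subset_closed_segment subset_iff)
   show "0 <= (1/4) powr DIM('a) / 2 * m" using Suc.prems(3) by simp
   fix z assume z: "z : cball p' r"
   have dz: "dist p z <= 2 * r" using z d1 dist_triangle[of p z p'] by simp
   have "H z >= (r / (4 * r)) powr DIM('a) * m * ((4 * r - dist p z) / (4 * r))"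
   proof (rule superharmonic_annulus_lower[OF r _ has_lap_subset[OF H(1) bp]])
    show "l x <= 0" "0 <= H x" if "x : ball p (4 * r)" for x using H(2,3) bp that by blast+
   qed (use Suc.prems r dz in auto)
   moreover have "(r / (4 * r)) powr DIM('a) * m * ((4 * r - dist p z) / (4 * r)) >= (1/4) powr DIM('a) * m * (1/2)"
    using r dz Suc.prems(3) by (intro mult_mono) (auto simp: field_simps)
   ultimately have "(1/4) powr DIM('a) * m * (1/2) <= H z" by linarith
   then show "(1/4) powr DIM('a) / 2 * m <= H z" by simp
  qed
  then show ?thesis by (simp add: mult_ac)
 qed
qed

definition cone_harmonic :: "'a::euclidean_space set => real => ('a => real) => bool" where
 "cone_harmonic D phi H \<longleftrightarrow> harmonic_on D H & (ALL x:D. H x > 0) & (ALL x:D. ALL s>0. H (s *R x) = s powr phi * H x) &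
  (ALL xi:frontier D. xi ~= 0 --> (ALL e>0. \<forall>\<^sub>F x in at xi within D. H x < e))"

lemma cone_harmonic_cmult:
 assumes "cone_harmonic D phi H" "c > 0" shows "cone_harmonic D phi (%x. c * H x)"
 unfolding cone_harmonic_def
proof (intro conjI ballI allI impI)
 show "harmonic_on D (%x. c * H x)" using assms harmonic_on_cmult by (auto simp: cone_harmonic_def)
 fix xi and e :: real assume "xi : frontier D" "xi ~= 0" "e > 0"
 then have "\<forall>\<^sub>F x in at xi within D. H x < e / c" using assms by (auto simp: cone_harmonic_def)
 then show "\<forall>\<^sub>F x in at xi within D. c * H x < e" by eventually_elim (use assms(2) in "simp add: field_simps")
qed (use assms in "auto simp: cone_harmonic_def")

text \<open>Extended by 0, \<open>H\<close> is continuous on the compact set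
  \<open>closure D Int sphere 0 1\<close> and attains its maximum there; the maximum is positive,
  hence attained inside \<open>D\<close>.\<close>

lemma cone_harmonic_normalise:
 assumes D: "good_cone rho D" and H: "cone_harmonic D phi H"
 obtains c th where "c > 0" "th : D" "norm th = 1" "c * H th = 1" "!!x. x : D ==> c * H x <= norm x powr phi"
proof -
 have oD: "open D" using good_coneD(3)[OF D] .
 define F where "F x = (if x : D then H x else 0)" for x
 define K where "K = closure D Int sphere 0 1"
 have cK: "compact K" unfolding K_def by (simp add: closed_Int_compact)
 have Hc: "continuous_on D H" using H harmonic_on_continuous by (auto simp: cone_harmonic_def)
 have Hp: "H x > 0" if "x : D" for x using H that by (simp add: cone_harmonic_def)
 have "continuous_on K F"
  unfolding continuous_on_iff
 proof (intro ballI allI impI)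
  fix x and e :: real assume x: "x : K" and e: "0 < e"
  show "EX d>0. ALL x':K. dist x' x < d --> dist (F x') (F x) < e"
  proof (cases "x : D")
   case True
   then obtain d1 where d1: "d1 > 0" "!!x'. x' : D ==> dist x' x < d1 ==> dist (H x') (H x) < e"
    using Hc e unfolding continuous_on_iff by blast
   obtain d2 where d2: "d2 > 0" "ball x d2 <= D" using True oD openE by blast
   have "dist (F x') (F x) < e" if "dist x' x < min d1 d2" for x'
   proof -
    have "x' : D" using d2(2) that by (auto simp: dist_commute)
    then show ?thesis using d1(2)[of x'] that True by (simp add: F_def)
   qed
   then show ?thesis using d1(1) d2(1) by (intro exI[of _ "min d1 d2"]) auto
  next
   case False
   then have "x : frontier D" "x ~= 0" using x oD by (auto simp: K_def frontier_def interior_open)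
   then have "\<forall>\<^sub>F z in at x within D. H z < e" using H e by (auto simp: cone_harmonic_def)
   then obtain d where d: "d > 0" "!!z. z : D ==> z ~= x ==> dist z x < d ==> H z < e"
    unfolding eventually_at by blast
   have "dist (F x') (F x) < e" if "dist x' x < d" for x'
   proof (cases "x' : D")
    case True
    then have "H x' < e" "H x' > 0" using d(2)[of x'] that False Hp by auto
    then show ?thesis using True False by (simp add: F_def)
   qed (use False e in "simp add: F_def")
   then show ?thesis using d(1) by blast
  qed
 qed
 moreover obtain x0 where "x0 : D" using good_coneD(4)[OF D] by blast
 define x1 where "x1 = (1 / norm x0) *R x0"
 have n0: "norm x0 > 0" using infdist_cone_bounds[OF D `x0 : D`] by simp
 have x1: "x1 : D" "norm x1 = 1" using good_coneD(6)[OF D `x0 : D`] n0 by (auto simp: x1_def)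
 then have x1K: "x1 : K" using closure_subset by (auto simp: K_def)
 ultimately obtain th where th: "th : K" "!!y. y : K ==> F y <= F th"
  using continuous_attains_sup[OF cK] by blast
 have "F th > 0" using th(2)[OF x1K] Hp[OF x1(1)] x1 by (simp add: F_def)
 then have thD: "th : D" "norm th = 1" using th(1) by (auto simp: F_def K_def split: if_splits)
 define c where "c = 1 / H th"
 have c: "c > 0" "c * H th = 1" using Hp[OF thD(1)] by (auto simp: c_def)
 have "c * H x <= norm x powr phi" if x: "x : D" for x
 proof -
  have nx: "norm x > 0" using infdist_cone_bounds[OF D x] by simp
  define y where "y = (1 / norm x) *R x"
  have y: "y : D" "norm y = 1" using good_coneD(6)[OF D x] nx by (auto simp: y_def)
  then have "y : K" using closure_subset by (auto simp: K_def)
  then have "H y <= H th" using th(2)[of y] y thD by (simp add: F_def)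
  moreover have "H x = norm x powr phi * H y"
  proof -
   have "x = norm x *R y" using nx by (simp add: y_def)
   then show ?thesis using H y nx unfolding cone_harmonic_def by metis
  qed
  moreover have "norm x powr phi * (c * H y) <= norm x powr phi * (c * H th)"
   using c calculation(1) by (intro mult_left_mono) auto
  ultimately have "c * H x <= norm x powr phi * (c * H th)" by (simp add: mult.left_commute)
  then show ?thesis using c by simp
 qed
 then show ?thesis using that c thD by blast
qed

text \<open>\<open>c\<close> and \<open>C\<close> stand outside the quantifier over
  \<open>H\<close>. A function of this kind may be multiplied by any positive constant, so the
  bounds are stated for a normalised \<open>H'\<close>.\<close>

definition cone_bounds :: "real => real => real => 'a::euclidean_space set => bool" where
 "cone_bounds phi c C D \<longleftrightarrow> (ALL H. cone_harmonic D phi H --> (EX H' E. cone_harmonic D phi H' & has_lap D H' E (%x. 0) &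
   (ALL x:D. c * infdist x (- D) * norm x powr (phi - 1) <= H' x & H' x <= C * infdist x (- D) * norm x powr (phi - 1) &
     H' x <= norm x powr phi & norm (E x) <= C * norm x powr (phi - 1))))"

text \<open>The linear upper bound forces the point \<open>th\<close> where the normalised function
  equals 1 to have depth at least \<open>1 / C\<close>. From there a Harnack chain in three legs, up
  along \<open>e\<close>, across and down, reaches every deep point, and Hopf's bound continues to
  the boundary. The gradient bound is the interior estimate at the scale of the distance.\<close>

lemma cone_harmonic_bounds:
 assumes rho: "0 < rho" "rho <= 1/4" and phi: "0 < phi" "phi < 1"
 obtains c C where "c > 0" "C > 0"
  "!!D::'a::euclidean_space set. good_cone rho D ==> cone_bounds phi c C D"
proof -
 define n where "n = real DIM('a)"
 have n: "n >= 1" using DIM_positive[where 'a='a] by (simp add: n_def)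
 define C where "C = 8 * n / rho"
 have C: "C >= 8" "C > 0"
 proof -
  have "8 * 1 / 1 <= 8 * n / rho" using rho n by (intro frac_le) auto
  then show "C >= 8" by (simp add: C_def)
  then show "C > 0" by simp
 qed
 define de0 where "de0 = 1 / C"
 have de0: "de0 > 0" "de0 <= 1" using C by (auto simp: de0_def)
 \<comment> \<open>On \<open>ball th de0\<close> the function is at most 2, so its Lipschitz
   constant nearby is \<open>16 * n / de0\<close>; within \<open>de1\<close> it drops by at most
   1/2.\<close>
 define de1 where "de1 = de0 / (32 * n)"
 have de1: "de1 > 0" "de1 <= de0 / 8"
 proof -
  show "de1 > 0" using de0 n by (simp add: de1_def)
  show "de1 <= de0 / 8" unfolding de1_def using de0 n by (intro divide_left_mono) auto
 qed
 define r where "r = min de1 (rho / 8)"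
 have r: "r > 0" "r <= de1" "4 * r <= de0" "4 * r <= rho / 2" "4 * r <= 1" using de1 rho de0 by (auto simp: r_def)
 \<comment> \<open>Enough steps of length \<open>r\<close> for a vertical leg of length
   \<open>4 / rho\<close> and for the horizontal one, of length at most 5/2.\<close>
 define N where "N = nat \<lceil>(4 / rho + 3) / r\<rceil>"
 have N: "4 / rho + 3 <= real N * r"
 proof -
  have "(4 / rho + 3) / r <= real N" unfolding N_def by linarith
  then show ?thesis using r(1) by (simp add: field_simps)
 qed
 define tau where "tau = (1/4) powr n / 2"
 have tau: "tau > 0" by (simp add: tau_def)
 define m0 where "m0 = tau ^ N * (tau ^ N * (tau ^ N * (1/2)))"
 have m0: "m0 > 0" using tau by (simp add: m0_def)
 define c where "c = (1/2) powr n * m0"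
 have c: "c > 0" using m0 by (simp add: c_def)
 define C' where "C' = 48 * n * C"
 have C': "C' >= C" "C' > 0" using C n mult_mono[of 1 "12 * n" C C] by (auto simp: C'_def)
 have main: "cone_bounds phi c C' D" if D: "good_cone rho D" for D :: "'a set"
  unfolding cone_bounds_def
 proof (intro allI impI, goal_cases)
  case (1 H0)
  note H0 = this
  obtain a th where a: "a > 0" "th : D" "norm th = 1" "a * H0 th = 1" "!!x. x : D ==> a * H0 x <= norm x powr phi"
   using cone_harmonic_normalise[OF D H0] by metis
  define H where "H x = a * H0 x" for x
  have H: "cone_harmonic D phi H" unfolding H_def[abs_def] by (rule cone_harmonic_cmult[OF H0 a(1)])
  have Hh: "harmonic_on D H" and Hpos: "!!x. x : D ==> H x > 0"
   and Hs: "!!x s. x : D ==> s > 0 ==> H (s *R x) = s powr phi * H x"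
   and Hbd: "!!xi e. xi : frontier D ==> xi ~= 0 ==> e > 0 ==> \<forall>\<^sub>F x in at xi within D. H x < e"
   using H by (auto simp: cone_harmonic_def)
  obtain E where E: "has_lap D H E (%x. 0)" using Hh by (auto simp: harmonic_on_def)
  have Hle: "H x <= norm x powr phi" if "x : D" for x using a(5)[OF that] by (simp add: H_def)
  have nx: "norm x > 0" if "x : D" for x using infdist_cone_bounds[OF D that] by simp
  have up: "H x <= C * infdist x (- D) * norm x powr (phi - 1)" if x: "x : D" for x
  proof -
   have "H x <= (4 * real DIM('a) / rho) * (2 * norm x powr phi) * (infdist x (- D) / norm x)"
   proof (rule cone_boundary_upper[OF D])
    show "subh (D Int ball 0 (2 * norm x)) H" by (rule harmonic_imp_subh[OF harmonic_on_subset[OF Hh]]) auto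
    fix z assume z: "z : D" "norm z < 2 * norm x"
    have "(2::real) powr phi <= 2 powr 1" using phi by (intro powr_mono) auto
    then have "(2 * norm x) powr phi <= 2 * norm x powr phi" by (simp add: powr_mult mult_right_mono)
    moreover have "norm z powr phi <= (2 * norm x) powr phi" using z phi by (intro powr_mono2) auto
    ultimately show "H z <= 2 * norm x powr phi" using Hle[OF z(1)] by simp
   qed (use Hbd x in auto)
   also have "... = C * infdist x (- D) * norm x powr (phi - 1)"
    using nx[OF x] by (simp add: C_def n_def powr_diff)
   finally show ?thesis .
  qed
  have dth: "infdist th (- D) >= de0"
   using up[OF a(2)] a(3,4) C by (simp add: H_def de0_def field_simps)
  have bth: "ball th de0 <= D" using ball_infdist_subset[OF good_coneD(5)[OF D], of th] dth by auto
  have Hth: "H x >= 1/2" if x: "x : cball th r" for x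
  proof -
   have "dist th x <= de1" using x r by simp
   have xin: "x : ball th (de0/4)" using x r de1 de0 by simp
   have "\<bar>H th - H x\<bar> <= 8 * real DIM('a) * 2 / de0 * norm (th - x)"
   proof (rule harmonic_lipschitz[OF de0(1) harmonic_on_subset[OF Hh bth] _ _ xin])
    fix z assume z: "z : ball th de0"
    then have zD: "z : D" using bth by blast
    have "norm z <= 2" using z de0(2) a(3) norm_triangle_ineq2[of z th] by (simp add: dist_norm norm_minus_commute)
    then have "norm z powr phi <= 2 powr phi" using phi by (intro powr_mono2) auto
    also have "(2::real) powr phi <= 2 powr 1" using phi by (intro powr_mono) auto
    finally show "\<bar>H z\<bar> <= 2" using Hle[OF zD] Hpos[OF zD] by simp
   qed (use de0 in simp)
   also have "... <= 8 * real DIM('a) * 2 / de0 * de1"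
    using `dist th x <= de1` de0 by (intro mult_left_mono) (auto simp: dist_norm)
   also have "... = 1/2" using de0 n by (simp add: de1_def n_def)
   finally show ?thesis using a(4) abs_ge_self[of "H th - H x"] by (simp add: H_def)
  qed
  obtain e where e: "norm e = 1" "!!x s. x : D ==> s >= 0 ==> ball (x + s *R e) (rho * s) <= D"
   using D unfolding good_cone_def by blast
  \<comment> \<open>The vertical ball condition makes \<open>D\<close> invariant under upward
    translation, so a ball contained in \<open>D\<close> stays there when moved along
    \<open>e\<close>.\<close>
  have shift: "ball (x + s *R e) d <= D" if "ball x d <= D" "s >= 0" for x s d
  proof
   fix z assume z: "z : ball (x + s *R e) d"
   moreover have "x - (z - s *R e) = (x + s *R e) - z" by simp
   ultimately have "z - s *R e : ball x d" by (simp only: mem_ball dist_norm)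
   then have zD: "z - s *R e : D" using that by blast
   show "z : D"
   proof (cases "s = 0")
    case True then show ?thesis using zD by simp
   next
    case False
    then have "z : ball (z - s *R e + s *R e) (rho * s)" using rho that(2) by simp
    then show ?thesis using e(2)[OF zD that(2)] by blast
   qed
  qed
  \<comment> \<open>With \<open>rho * L = 4\<close> the ball about the lifted \<open>th\<close>
    contains the horizontal leg together with the chain balls, which need radius
    \<open>5/2 + 1\<close>.\<close>
  define L where "L = 4 / rho"
  have L: "L > 0" "rho * L = 4" using rho by (auto simp: L_def)
  have segup: "EX s>=0. z = x + s *R e" if zz: "z : closed_segment x (x + L *R e)" for z x
  proof -
   obtain u where u: "0 <= u" "z = (1 - u) *R x + u *R (x + L *R e)" using zz unfolding in_segment by blast
   have "z = x + u *R (L *R e)" unfolding u(2) scaleR_left_diff_distrib scaleR_add_right by simp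
   then have "z = x + (u * L) *R e" by simp
   moreover have "u * L >= 0" using L(1) u(1) by simp
   ultimately show ?thesis by blast
  qed
  have LN: "L <= real N * r" using N by (simp add: L_def)
  have Hnn: "H x >= 0" if "x : D" for x using Hpos[OF that] by simp
  note chain = harnack_chain[OF E order_refl Hnn r(1), folded n_def, folded tau_def]
  have deep: "H z >= m0" if z: "z : D" "norm z <= 3/2" "infdist z (- D) >= rho / 2" for z
  proof -
   have bz: "ball z (4 * r) <= D" using ball_infdist_subset[OF good_coneD(5)[OF D], of z] z(3) r(4) by auto
   have 1: "tau ^ N * (1/2) <= H x" if "x : cball (th + L *R e) r" for x
   proof (rule chain[of th "th + L *R e", OF _ _ _ _ _ that])
    show "dist th (th + L *R e) <= real N * r" using LN L e(1) by (simp add: dist_norm)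
    show "ball y (4 * r) <= D" if "y : closed_segment th (th + L *R e)" for y
    proof -
     obtain s where "s >= 0" "y = th + s *R e" using segup[OF `y : _`] by blast
     then have "ball y de0 <= D" using shift[OF bth] by blast
     then show ?thesis using r(3) by auto
    qed
   qed (use Hth in auto)
   have 2: "tau ^ N * (tau ^ N * (1/2)) <= H x" if "x : cball (z + L *R e) r" for x
   proof (rule chain[of "th + L *R e" "z + L *R e", OF _ _ _ _ _ that])
    have d: "dist th z <= 5/2" using norm_triangle_ineq4[of th z] a(3) z(2) by (simp add: dist_norm)
    moreover have "4 / rho > 0" using rho by simp
    ultimately have "dist th z <= real N * r" using N by linarith
    then show "dist (th + L *R e) (z + L *R e) <= real N * r" by simp
    show "ball y (4 * r) <= D" if y: "y : closed_segment (th + L *R e) (z + L *R e)" for y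
    proof -
     have "dist (th + L *R e) y <= dist (th + L *R e) (z + L *R e)"
      using y by (metis dist_commute dist_in_closed_segment(1))
     then have "dist (th + L *R e) y <= 5/2" using d by simp
     then have "ball y (4 * r) <= ball (th + L *R e) (rho * L)"
      unfolding L using r(5) by (intro subset_trans[OF _ subset_ball[of "5/2 + 1" 4]])
       (auto simp: ball_subset_ball_iff dist_commute)
     then show ?thesis using e(2)[OF a(2), of L] L by auto
    qed
    show "0 <= tau ^ N * (1/2)" using tau by simp
   qed (use 1 in auto)
   have "tau ^ N * (tau ^ N * (tau ^ N * (1/2))) <= H z"
   proof (rule chain[of "z + L *R e" z])
    show "dist (z + L *R e) z <= real N * r" using LN L e(1) by (simp add: dist_norm)
    show "ball y (4 * r) <= D" if yy: "y : closed_segment (z + L *R e) z" for y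
    proof -
     obtain s where "s >= 0" "y = z + s *R e" using segup[of y z] yy by (auto simp: closed_segment_commute)
     then show ?thesis using shift[OF bz] by blast
    qed
    show "0 <= tau ^ N * (tau ^ N * (1/2))" using tau by simp
   qed (use 2 r in auto)
   then show ?thesis by (simp add: m0_def)
  qed
  have low: "c * infdist x (- D) * norm x powr (phi - 1) <= H x" if x: "x : D" for x
  proof -
   define y where "y = (1 / norm x) *R x"
   have y: "y : D" "norm y = 1" using good_coneD(6)[OF D x] nx[OF x] by (auto simp: y_def)
   have xy: "x = norm x *R y" using nx[OF x] by (simp add: y_def)
   have "H y >= (1/2) powr DIM('a) * m0 * (infdist y (- D) / norm y)"
   proof (rule cone_boundary_lower[OF D, where R=2 and E=E and l="%x. 0"])
    show "has_lap (D Int ball 0 2) H E (%x. 0)" by (rule has_lap_subset[OF E]) auto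
   qed (use Hnn y m0 deep in auto)
   then have Hy: "c * infdist y (- D) <= H y" using y by (simp add: c_def n_def)
   have "infdist x (- D) = norm x * infdist y (- D)" using infdist_scale[OF D nx[OF x], of y] xy by simp
   then have "c * infdist x (- D) * norm x powr (phi - 1) = norm x powr phi * (c * infdist y (- D))"
    using nx[OF x] by (simp add: powr_diff)
   also have "... <= norm x powr phi * H y" using Hy by (intro mult_left_mono) auto
   also have "... = H x" using Hs[OF y(1) nx[OF x]] xy by simp
   finally show ?thesis .
  qed
  have gr: "norm (E x) <= C' * norm x powr (phi - 1)" if x: "x : D" for x
  proof -
   define d where "d = infdist x (- D)"
   have d: "0 < d" "d <= norm x" using infdist_cone_bounds[OF D x] by (auto simp: d_def)
   have b: "ball x d <= D" unfolding d_def by (rule ball_infdist_subset[OF good_coneD(5)[OF D]])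
   have "norm (E x) <= 8 * real DIM('a) * (3 * C * d * norm x powr (phi - 1)) / (d/2)"
   proof (rule harmonic_grad_bound)
    show "harmonic_on (ball x (d/2)) H" by (rule harmonic_on_subset[OF Hh]) (use b d in auto)
    show "(H has_derivative (\<bullet>) (E x)) (at x)" using E x by (simp add: has_lap_def)
    fix z assume z: "z : ball x (d/2)"
    have zD: "z : D" using z b d by auto
    have nz: "norm z >= norm x / 2" using z d norm_triangle_ineq2[of x z] by (simp add: dist_norm)
    have dz: "infdist z (- D) <= 3/2 * d"
     using infdist_triangle[of z "- D" x] z by (simp add: d_def dist_commute)
    have "norm z powr (phi - 1) <= (norm x / 2) powr (phi - 1)" using nz nx[OF x] phi by (intro powr_mono2') auto
    also have "... = 2 powr (1 - phi) * norm x powr (phi - 1)"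
    proof -
     have "(2::real) powr (phi - 1) = 1 / 2 powr (1 - phi)" using powr_minus_divide[of 2 "1 - phi"] by simp
     then show ?thesis by (simp add: powr_divide)
    qed
    also have "... <= 2 * norm x powr (phi - 1)"
     using phi powr_mono[of "1 - phi" 1 "2::real"] by (intro mult_right_mono) auto
    finally have pz: "norm z powr (phi - 1) <= 2 * norm x powr (phi - 1)" .
    have "H z <= C * infdist z (- D) * norm z powr (phi - 1)" by (rule up[OF zD])
    also have "... <= C * (3/2 * d) * (2 * norm x powr (phi - 1))"
     using C dz pz d by (intro mult_mono) (auto simp: infdist_nonneg)
    finally show "\<bar>H z\<bar> <= 3 * C * d * norm x powr (phi - 1)" using Hpos[OF zD] by simp
   qed (use d in auto)
   also have "... = C' * norm x powr (phi - 1)" using d by (simp add: C'_def n_def)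
   finally show ?thesis .
  qed
  have up': "H x <= C' * infdist x (- D) * norm x powr (phi - 1)" if x: "x : D" for x
   using up[OF x] C' by (intro order_trans[OF _ mult_right_mono[OF mult_right_mono[OF C'(1)]]]) (auto simp: infdist_nonneg)
  show ?case using H E Hle low gr up' by blast
 qed
 show ?thesis by (rule that[OF c C'(2) main])
qed

section \<open>Uniform bounds for the solution away from the vertex\<close>

text \<open>The comparison function is at least 1 on the unit ball with Laplacian exactly -1; where
  \<open>U\<close> exceeds it, \<open>U powr (-ga) < 1\<close>.\<close>

lemma solution_le_2:
 fixes U :: "'a::euclidean_space => real"
 assumes ga: "ga > 1" and W: "open W" "W <= ball 0 1" and U: "has_lap W U E l" "!!z. z : W ==> l z = - (U z powr (-ga))"
  and bd: "!!xi e. xi : frontier W ==> 0 < e ==> \<forall>\<^sub>F x in at xi within W. U x < e" and x: "x : W"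
 shows "U x <= 2"
proof -
 define n where "n = real DIM('a)"
 have n: "n >= 1" using DIM_positive[where 'a='a] by (simp add: n_def)
 define k where "k = 1 / (2 * n)"
 have k: "k > 0" "k <= 1" using n by (auto simp: k_def)
 define v where "v z = (1 + k) - k * (norm (z - 0))^2" for z :: 'a
 have lv: "has_lap W v (%z. 0 - k *R (2 *R (z - 0))) (%z. 0 - k * (2 * real DIM('a)))"
  unfolding v_def by (intro has_lap_diff has_lap_cmult has_lap_normsq has_lap_const)
 have v1: "v z >= 1" if "z : W" for z
 proof -
  have "norm z < 1" using W that by auto
  then have "(norm z)^2 <= 1" by (simp add: power_le_one)
  then have "k * (norm z)^2 <= k * 1" using k by (intro mult_left_mono) auto
  then show ?thesis by (simp add: v_def)
 qed
 have "U x - v x <= 0"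
 proof (rule max_principle_strict[OF _ W(1) has_lap_diff[OF U(1) lv] _ _ x])
  show "bounded W" using W(2) bounded_ball bounded_subset by blast
  fix z assume z: "z : W" "0 < U z - v z"
  then have "U z > 1" using v1[OF z(1)] by simp
  then have "U z powr (-ga) < 1 powr (-ga)" using ga by (intro powr_neg_strict_antimono) auto
  then show "0 < l z - (0 - k * (2 * real DIM('a)))" using U(2)[OF z(1)] n by (simp add: k_def n_def)
 next
  fix xi and e :: real assume *: "xi : frontier W" "0 < e"
  have "\<forall>\<^sub>F x in at xi within W. x : W" by (simp add: eventually_at_filter)
  with bd[OF *] show "\<forall>\<^sub>F x in at xi within W. U x - v x < e" by eventually_elim (use v1 in force)
 qed
 moreover have "v x <= 2" using k by (simp add: v_def) (smt (verit) mult_nonneg_nonneg zero_le_power2)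
 ultimately show ?thesis by simp
qed

text \<open>The barrier is the one-dimensional profile \<open>A * y powr phi\<close> of the distance
  \<open>y\<close> to the exterior ball. In a shell of relative width \<open>de\<close> the
  curvature term takes at most half of the concavity \<open>1 - phi\<close>, and the condition on
  \<open>A powr (1 + ga)\<close> says that the other half dominates the singular term.\<close>

lemma solution_exterior_barrier:
 fixes U :: "'a::euclidean_space => real"
 assumes ga: "ga > 1" and phi: "phi = 2 / (1 + ga)" and de: "de = (1 - phi) / (2 * DIM('a))"
  and W: "open W" and U: "has_lap W U E l" "!!z. z : W ==> l z = - (U z powr (-ga))"
  and bd: "!!xi e. xi : frontier W ==> 0 < e ==> \<forall>\<^sub>F x in at xi within W. U x < e"
  and ext: "ball c R Int W = {}" "R > 0" and M: "!!z. z : W ==> U z <= M"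
  and A: "A > 0" "A powr (1 + ga) >= 2 / (phi * (1 - phi))" "A * (de * R) powr phi >= M"
  and x: "x : W" "dist c x < (1 + de) * R"
 shows "U x <= A * (dist c x - R) powr phi"
proof -
 define n where "n = real DIM('a)"
 have n: "n >= 1" using DIM_positive[where 'a='a] by (simp add: n_def)
 have phi01: "0 < phi" "phi < 1" using ga by (auto simp: phi)
 have de0: "de > 0" using phi01 n by (simp add: de)
 define V where "V = W Int ball c ((1 + de) * R)"
 have V: "open V" "bounded V" using W by (auto simp: V_def intro: bounded_subset[OF bounded_ball[of c "(1 + de) * R"]])
 have clV: "dist c z >= R" if "z : closure V" for z
 proof -
  have "closure V <= - ball c R" using ext by (intro closure_minimal) (auto simp: V_def)
  then show ?thesis using that by auto
 qed
 \<comment> \<open>An open set disjoint from a ball cannot contain a point of its sphere; hence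
   \<open>y\<close> is positive in \<open>V\<close> and its powers are differentiable.\<close>
 have strict: "dist c z > R" if z: "z : V" for z
 proof (rule ccontr)
  assume "~ dist c z > R"
  moreover have "dist c z >= R" using clV z closure_subset by blast
  ultimately have eq: "z : sphere c R" by simp
  have "z : closure (ball c R)" using eq ext(2) by auto
  then have "ball c R Int V ~= {}" using V(1) z open_Int_closure_eq_empty[of V "ball c R"] by blast
  then show False using ext(1) by (auto simp: V_def)
 qed
 have cV: "c ~: V" using strict[of c] ext(2) by auto
 define y where "y z = norm (z - c) - R" for z
 define w where "w z = A * y z powr phi" for z
 have ly: "has_lap V y (%z. (z - c) /\<^sub>R norm (z - c) - 0) (%z. (real DIM('a) - 1) / norm (z - c) - 0)"
  unfolding y_def by (intro has_lap_diff has_lap_norm has_lap_const cV)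
 have ypos: "y z > 0" if "z : V" for z using strict[OF that] by (simp add: y_def dist_norm norm_minus_commute)
 have lw: "has_lap V w (%z. (A * (phi * y z powr (phi - 1))) *R ((z - c) /\<^sub>R norm (z - c) - 0))
   (%z. (A * (phi * ((phi - 1) * y z powr (phi - 1 - 1)))) * (norm ((z - c) /\<^sub>R norm (z - c) - 0))^2
    + (A * (phi * y z powr (phi - 1))) * ((real DIM('a) - 1) / norm (z - c) - 0))"
  unfolding w_def
  by (rule has_lap_comp[where p="%y. A * y powr phi" and p'="%y. A * (phi * y powr (phi - 1))"
     and p''="%y. A * (phi * ((phi - 1) * y powr (phi - 1 - 1)))", OF ly])
   (rule DERIV_cmult, rule has_real_derivative_powr, rule ypos, assumption,
    rule DERIV_cmult, rule DERIV_cmult, rule has_real_derivative_powr, rule ypos, assumption)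
 have "U x - w x <= 0"
 proof (rule max_principle_strict[OF V(2,1) has_lap_diff[OF has_lap_subset[OF U(1)] lw]])
  show "V <= W" by (auto simp: V_def)
  show "x : V" using x by (simp add: V_def)
  fix z assume z: "z : V" "0 < U z - w z"
  have zW: "z : W" using z by (simp add: V_def)
  have yp: "y z > 0" by (rule ypos[OF z(1)])
  have nz: "norm (z - c) > 0" using z(1) cV by auto
  have unit: "norm ((z - c) /\<^sub>R norm (z - c) - 0) = 1" using nz by simp
  have yle: "y z <= de * norm (z - c)"
  proof -
   have "y z <= de * R" using z(1) by (simp add: y_def V_def dist_norm norm_minus_commute algebra_simps)
   also have "... <= de * norm (z - c)" using strict[OF z(1)] de0 by (simp add: dist_norm norm_minus_commute)
   finally show ?thesis .
  qed
  have p1: "y z powr (phi - 1) = y z * y z powr (phi - 2)" using yp by (simp add: powr_diff powr_numeral power2_eq_square)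
  have p2: "y z powr (phi - 1 - 1) = y z powr (phi - 2)" by (simp add: algebra_simps)
  define Y where "Y = y z powr (phi - 2)"
  have Y: "Y > 0" using yp by (simp add: Y_def)
  have q: "y z * ((n - 1) / norm (z - c)) <= (1 - phi) / 2"
  proof -
   have "y z * ((n - 1) / norm (z - c)) <= (de * norm (z - c)) * ((n - 1) / norm (z - c))"
    using yle n nz by (intro mult_right_mono) auto
   also have "... = de * (n - 1)" using nz by simp
   also have "... <= de * n" using de0 by simp
   also have "... = (1 - phi) / 2" using n by (simp add: de n_def)
   finally show ?thesis .
  qed
  have "A * (phi * ((phi - 1) * Y)) + (A * (phi * (y z * Y))) * ((n - 1) / norm (z - c))
   = A * phi * Y * (y z * ((n - 1) / norm (z - c)) - (1 - phi))" by (simp add: algebra_simps)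
  also have "... <= A * phi * Y * ((1 - phi) / 2 - (1 - phi))" using A phi01 Y q by (intro mult_left_mono) auto
  also have "... = - (A * (phi * (1 - phi) / 2) * Y)" by (simp add: field_simps)
  also have "... <= - (A powr (-ga) * Y)"
  proof -
   have "A * A powr ga * (phi * (1 - phi) / 2) >= 1" using A phi01 by (simp add: powr_add field_simps)
   then have "A powr (-ga) <= A * (phi * (1 - phi) / 2)" using A(1) by (simp add: powr_minus field_simps)
   then show ?thesis using Y by (simp add: mult_right_mono)
  qed
  finally have lwz: "A * (phi * ((phi - 1) * Y)) + (A * (phi * (y z * Y))) * ((n - 1) / norm (z - c)) <= - (A powr (-ga) * Y)" .
  have "U z powr (-ga) < w z powr (-ga)"
   using z(2) A(1) yp ga by (intro powr_neg_strict_antimono) (auto simp: w_def)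
  also have "w z powr (-ga) = A powr (-ga) * Y"
  proof -
   have "phi * - ga = phi - 2" using ga by (simp add: phi field_simps)
   then show ?thesis using A(1) yp by (simp add: w_def Y_def powr_mult powr_powr)
  qed
  finally show "0 < l z - (A * (phi * ((phi - 1) * y z powr (phi - 1 - 1))) * (norm ((z - c) /\<^sub>R norm (z - c) - 0))^2
    + (A * (phi * y z powr (phi - 1))) * ((real DIM('a) - 1) / norm (z - c) - 0))"
   using lwz U(2)[OF zW] unfolding unit p1 p2 by (simp add: Y_def n_def)
 next
  fix xi and e :: real assume xi: "xi : frontier V" and e: "0 < e"
  have cl: "xi : closure V" "xi ~: V" using xi unfolding frontier_def interior_open[OF V(1)] by blast+
  have "closure V <= cball c ((1 + de) * R)" by (intro closure_minimal) (auto simp: V_def)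
  then have d: "R <= dist c xi" "dist c xi <= (1 + de) * R" using clV[OF cl(1)] cl by auto
  have VV: "\<forall>\<^sub>F z in at xi within V. z : V" by (simp add: eventually_at_filter)
  show "\<forall>\<^sub>F z in at xi within V. U z - w z < e"
  proof (cases "dist c xi = (1 + de) * R")
   case True
   then have yxi: "y xi = de * R" by (simp add: y_def dist_norm norm_minus_commute algebra_simps)
   have "(w \<longlongrightarrow> w xi) (at xi within V)"
    unfolding w_def y_def using yxi de0 ext(2) by (intro tendsto_intros) (auto simp: y_def)
   moreover have "w xi >= M" using A(3) by (simp add: w_def yxi)
   ultimately have "\<forall>\<^sub>F z in at xi within V. w z > M - e" using order_tendstoD(1)[of w "w xi" _ "M - e"] e by simp
   with VV show ?thesis by eventually_elim (use M in "force simp: V_def")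
  next
   case False
   then have xb: "xi : ball c ((1 + de) * R)" using d by simp
   have "xi : closure W" using cl(1) closure_mono[of V W] by (auto simp: V_def)
   moreover have "xi ~: W" using cl(2) xb by (simp add: V_def)
   ultimately have "xi : frontier W" using W by (simp add: frontier_def interior_open)
   from bd[OF this e] have "\<forall>\<^sub>F z in at xi within V. U z < e"
    by (rule filter_leD[OF at_le, rotated]) (auto simp: V_def)
   with VV show ?thesis
   proof eventually_elim
    case (elim z)
    have "w z >= 0" using A(1) by (simp add: w_def)
    then show ?case using elim by simp
   qed
  qed
 qed
 then show ?thesis by (simp add: w_def y_def dist_norm norm_minus_commute)
qed

definition upper_away :: "real => real => 'a::euclidean_space set => bool" where
 "upper_away ga C W \<longleftrightarrow> (ALL U E l x. has_lap W U E l --> (ALL z:W. l z = - (U z powr (-ga))) -->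
   (ALL xi:frontier W. ALL e>0. \<forall>\<^sub>F x in at xi within W. U x < e) --> x : W --> norm x >= 1/16 -->
   U x <= C * infdist x (- W) powr (2 / (1 + ga)))"

text \<open>Near a boundary point \<open>y\<close> at a distance from the vertex there is an
  exterior ball of one fixed radius \<open>R\<close>: at a point of \<open>D\<close> outside the
  unit ball it lies further out on the same ray, and on the lateral boundary the ball of radius
  \<open>rho * norm y\<close> is shrunk towards \<open>y\<close>. Where the distance is at least
  \<open>de * R\<close>, the bound \<open>U <= 2\<close> is enough.\<close>

lemma solution_upper_away:
 assumes ga: "ga > 1" and rho: "0 < rho" "rho <= 1/4"
 obtains C where "C > 0"
  "!!D::'a::euclidean_space set. good_cone rho D ==> upper_away ga C (D Int ball 0 1)"
proof -
 define n where "n = real DIM('a)"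
 have n: "n >= 1" using DIM_positive[where 'a='a] by (simp add: n_def)
 define phi where "phi = 2 / (1 + ga)"
 have phi01: "0 < phi" "phi < 1" using ga by (auto simp: phi_def)
 define de where "de = (1 - phi) / (2 * DIM('a))"
 have de: "de > 0" "de <= 1"
 proof -
  show "de > 0" using phi01 n by (simp add: de_def)
  have "de <= 1 / 1" unfolding de_def using phi01 n by (intro frac_le) (auto simp: n_def[symmetric])
  then show "de <= 1" by simp
 qed
 \<comment> \<open>If \<open>norm x >= 1/16\<close> and the distance is below \<open>R\<close>, the
   nearest point has norm at least 1/32, so \<open>R\<close> is at most
   \<open>rho * norm y\<close>.\<close>
 define R where "R = rho / 64"
 have R: "R > 0" "R <= 1/256" using rho by (auto simp: R_def)
 define A where "A = max ((2 / (phi * (1 - phi))) powr (1 / (1 + ga))) (2 / (de * R) powr phi)"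
 have A: "A > 0" "A powr (1 + ga) >= 2 / (phi * (1 - phi))" "A * (de * R) powr phi >= 2"
 proof -
  have p: "(de * R) powr phi > 0" using de R by simp
  show A0: "A > 0" using p unfolding A_def by (simp add: less_max_iff_disj)
  have "2 / (phi * (1 - phi)) = ((2 / (phi * (1 - phi))) powr (1 / (1 + ga))) powr (1 + ga)"
   using phi01 ga by (simp add: powr_powr)
  also have "... <= A powr (1 + ga)" using ga by (intro powr_mono2) (auto simp: A_def)
  finally show "A powr (1 + ga) >= 2 / (phi * (1 - phi))" .
  have "2 = 2 / (de * R) powr phi * (de * R) powr phi" using p by simp
  also have "... <= A * (de * R) powr phi" by (intro mult_right_mono) (auto simp: A_def)
  finally show "A * (de * R) powr phi >= 2" .
 qed
 show ?thesis
 proof (rule that[OF A(1)], unfold upper_away_def, intro allI impI, goal_cases)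
  case (1 D U E l x)
  define W where "W = D Int ball 0 1"
  note D = 1(1) and U = 1(2) 1(3)[rule_format] and bd = 1(4)[rule_format] and x = 1(5,6)
  note U = U[folded W_def] and bd = bd[folded W_def]
  have oW: "open W" using good_coneD(3)[OF D] by (simp add: W_def open_Int)
  have zW: "0 : - W" using good_coneD(5)[OF D] by (simp add: W_def)
  have U2: "U z <= 2" if "z : W" for z
   by (rule solution_le_2[OF ga oW _ U bd that]) (auto simp: W_def)
  define d where "d = infdist x (- W)"
  show ?case
  proof (cases "d >= de * R")
   case True
   have "A * (de * R) powr phi <= A * d powr phi" using A(1) True de R phi01 by (intro mult_left_mono powr_mono2) auto
   then show ?thesis using A(3) U2[of x] x by (simp add: d_def W_def phi_def)
  next
   case False
   have "closed (- W)" using oW by (simp add: closed_Compl)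
   then obtain y where y: "y : - W" "d = dist x y" using infdist_attains_inf zW unfolding d_def by blast
   have "de * R <= 1 * R" using de R by (intro mult_right_mono) auto
   then have dR: "d < R" using False by simp
   have ny: "norm y >= 1/32" using norm_triangle_ineq2[of x y] x(2) y(2) dR R by (simp add: dist_norm)
   have yx: "dist y x = d" using y(2) by (simp add: dist_commute)
   have d0: "d > 0"
   proof -
    have "x : W" using x by (simp add: W_def)
    then have "x ~= y" using y(1) by auto
    then show ?thesis using y(2) by simp
   qed
   have "EX c. dist y c = R & ball c R Int W = {}"
   proof (cases "y : D")
    case True
    then have ny1: "norm y >= 1" using y(1) by (auto simp: W_def)
    define c where "c = (1 + R / norm y) *R y"
    have "c - y = (R / norm y) *R y" by (simp add: c_def algebra_simps)
    moreover have "y ~= 0" using ny1 by auto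
    ultimately have dc: "dist y c = R" using R by (simp add: dist_norm norm_minus_commute)
    have nc: "norm c = norm y + R"
    proof -
     have "norm c = (1 + R / norm y) * norm y" using R ny1 by (simp add: c_def)
     also have "... = norm y + R" using ny1 by (simp add: algebra_simps) (use ny1 in auto)
     finally show ?thesis .
    qed
    have "norm z >= 1" if "z : ball c R" for z
     using that nc ny1 norm_triangle_ineq2[of c z] by (simp add: dist_norm)
    then have "ball c R Int W = {}" by (force simp: W_def)
    then show ?thesis using dc by blast
   next
    case F2: False
    have "ball x d <= W" unfolding d_def by (rule ball_infdist_subset) (use zW in simp)
    then have "closure (ball x d) <= closure D" by (intro closure_mono) (auto simp: W_def)
    then have "y : closure D" using d0 y(2) by auto
    then have "y : frontier D" using F2 good_coneD(3)[OF D] by (simp add: frontier_def interior_open)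
    moreover have y0: "y ~= 0" using ny by auto
    ultimately obtain c where c: "dist y c = rho * norm y" "ball c (rho * norm y) Int D = {}"
     using D unfolding good_cone_def by blast
    define a where "a = R / (rho * norm y)"
    have ay: "rho * norm y > 0" "R <= rho * norm y" using rho y0 ny by (auto simp: R_def)
    have a: "0 < a" "a <= 1" "a * (rho * norm y) = R" using ay R by (auto simp: a_def divide_le_eq_1)
    define c' where "c' = y + a *R (c - y)"
    have dc: "dist y c' = R" using a c(1) by (simp add: c'_def dist_norm norm_minus_commute)
    have "dist c c' = (1 - a) * (rho * norm y)"
    proof -
     have "c - c' = (1 - a) *R (c - y)" by (simp add: c'_def algebra_simps)
     then show ?thesis using a c(1) by (simp add: dist_norm norm_minus_commute)
    qed
    then have cc: "dist c c' = rho * norm y - R" using a(3) by (simp add: algebra_simps)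
    have "ball c' R <= ball c (rho * norm y)"
    proof
     fix z assume "z : ball c' R"
     then show "z : ball c (rho * norm y)" using cc dist_triangle[of c z c'] by simp
    qed
    then have "ball c' R Int W = {}" using c(2) by (auto simp: W_def)
    then show ?thesis using dc by blast
   qed
   then obtain c where c: "dist y c = R" "ball c R Int W = {}" by blast
   have cx: "dist c x <= d + R" using dist_triangle[of c x y] c(1) yx by (simp add: dist_commute)
   have "U x <= A * (dist c x - R) powr phi"
    by (rule solution_exterior_barrier[OF ga phi_def de_def oW U bd c(2) R(1) U2 A])
     (use x cx False in "auto simp: W_def algebra_simps")
   also have "... <= A * d powr phi"
   proof -
    have "dist c x >= R" using c(2) x by (force simp: W_def)
    then show ?thesis using A(1) cx phi01 by (intro mult_left_mono powr_mono2) auto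
   qed
   finally show ?thesis by (simp add: d_def W_def phi_def)
  qed
 qed
qed

section \<open>The radial and angular profiles\<close>

text \<open>A primitive of \<open>(1 + y) powr (q - 1)\<close>.\<close>

definition Lam :: "real => real => real" where
 "Lam q y = (if q = 0 then ln (1 + y) else ((1 + y) powr q - 1) / q)"

lemma powr_shift_deriv:
 assumes "y > (-1::real)"
 shows "((%y. (1 + y) powr r) has_real_derivative r * (1 + y) powr (r - 1)) (at y)"
proof -
 have "((%w. w powr r) has_real_derivative r * (1 + y) powr (r - 1)) (at (1 + y))"
  using assms by (intro has_real_derivative_powr) simp
 moreover have "((%y. 1 + y) has_real_derivative 1) (at y)" by (auto intro!: derivative_eq_intros)
 ultimately have "((%y. (1 + y) powr r) has_real_derivative (r * (1 + y) powr (r - 1)) * 1) (at y)"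
  by (rule DERIV_chain2)
 then show ?thesis by simp
qed

lemma Lam_deriv: "y > -1 ==> (Lam q has_real_derivative (1 + y) powr (q - 1)) (at y)"
proof (cases "q = 0")
 case True
 assume y: "y > -1"
 have "Lam q = (%y. ln (1 + y))" using True by (simp add: Lam_def fun_eq_iff)
 moreover have "((%y. ln (1 + y)) has_real_derivative 1 / (1 + y)) (at y)"
  using y by (auto intro!: derivative_eq_intros)
 moreover have "(1 + y) powr (q - 1) = 1 / (1 + y)" using True y powr_minus_divide[of "1 + y" 1] by simp
 ultimately show ?thesis by simp
next
 case False
 assume y: "y > -1"
 have "Lam q = (%y. ((1 + y) powr q - 1) / q)" using False by (simp add: Lam_def fun_eq_iff)
 moreover have "((%y. ((1 + y) powr q - 1) / q) has_real_derivative (q * (1 + y) powr (q - 1) - 0) / q) (at y)"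
  by (intro DERIV_cdivide DERIV_diff DERIV_const powr_shift_deriv y)
 ultimately show ?thesis using False by simp
qed

lemma Lam_0: "Lam q 0 = 0"
 by (simp add: Lam_def)

lemma Lam_mono: "0 <= a ==> a <= b ==> Lam q a <= Lam q b"
proof (rule DERIV_nonneg_imp_nondecreasing[of a b])
 fix x assume "0 <= a" "a <= x"
 then show "EX d. (Lam q has_real_derivative d) (at x) & 0 <= d"
  using Lam_deriv[of x q] by (intro exI[of _ "(1 + x) powr (q - 1)"]) simp
qed

lemma Lam_nonneg: "0 <= y ==> Lam q y >= 0"
 using Lam_mono[of 0 y q] by (simp add: Lam_0)

lemma Lam_le: assumes "q <= 1" "0 <= y" shows "Lam q y <= y"
proof -
 have "Lam q y - y <= Lam q 0 - 0"
 proof (rule DERIV_nonpos_imp_nonincreasing[OF assms(2), where f="%y. Lam q y - y"])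
  fix z :: real assume z: "0 <= z" "z <= y"
  have "((%y. Lam q y - y) has_real_derivative (1 + z) powr (q - 1) - 1) (at z)"
   by (intro DERIV_diff Lam_deriv DERIV_ident) (use z in simp)
  moreover have "(1 + z) powr (q - 1) <= (1 + z) powr 0" using z assms(1) by (intro powr_mono) auto
  ultimately show "EX d. ((%y. Lam q y - y) has_real_derivative d) (at z) & d <= 0" using z by (intro exI[of _ "(1 + z) powr (q - 1) - 1"]) auto
 qed
 then show ?thesis by (simp add: Lam_0)
qed

lemma Lam_concave: assumes "q <= 1" "0 <= y" shows "y * (1 + y) powr (q - 1) <= Lam q y"
proof -
 have "Lam q 0 - 0 * (1 + 0) powr (q - 1) <= Lam q y - y * (1 + y) powr (q - 1)"
 proof (rule DERIV_nonneg_imp_nondecreasing[OF assms(2), where f="%y. Lam q y - y * (1 + y) powr (q - 1)"])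
  fix z :: real assume z: "0 <= z" "z <= y"
  have p: "((%y. (1 + y) powr (q - 1)) has_real_derivative (q - 1) * (1 + z) powr (q - 1 - 1)) (at z)"
   by (rule powr_shift_deriv) (use z in simp)
  have "((%y. Lam q y - y * (1 + y) powr (q - 1)) has_real_derivative
    (1 + z) powr (q - 1) - (1 * (1 + z) powr (q - 1) + (q - 1) * (1 + z) powr (q - 1 - 1) * z)) (at z)"
   by (intro DERIV_diff Lam_deriv DERIV_mult DERIV_ident p) (use z in simp)
  moreover have "(1 + z) powr (q - 1) - (1 * (1 + z) powr (q - 1) + (q - 1) * (1 + z) powr (q - 1 - 1) * z) >= 0"
   using z assms(1) by (simp add: mult_nonpos_nonneg)
  ultimately show "EX d. ((%y. Lam q y - y * (1 + y) powr (q - 1)) has_real_derivative d) (at z) & d >= 0" by blast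
 qed
 then show ?thesis by (simp add: Lam_0)
qed

text \<open>The ratio of \<open>Lam q y\<close> to \<open>y\<close> does not increase; its
  derivative has the sign given by \<open>Lam_concave\<close>.\<close>

lemma Lam_scale: assumes "q <= 1" "0 < a" "a <= 1" "0 < y" shows "a * Lam q y <= Lam q (a * y)"
proof -
 have ay: "a * y <= y" "0 < a * y" using assms by auto
 have "Lam q y / y <= Lam q (a * y) / (a * y)"
 proof (rule DERIV_nonpos_imp_nonincreasing[OF ay(1), where f="%y. Lam q y / y"])
  fix z :: real assume z: "a * y <= z" "z <= y"
  then have z0: "z > 0" using ay by simp
  have "((%y. Lam q y / y) has_real_derivative ((1 + z) powr (q - 1) * z - Lam q z * 1) / (z * z)) (at z)"
   by (intro DERIV_divide Lam_deriv DERIV_ident) (use z0 in auto)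
  moreover have "((1 + z) powr (q - 1) * z - Lam q z * 1) / (z * z) <= 0"
   using Lam_concave[OF assms(1), of z] z0 by (intro divide_nonpos_pos) (auto simp: mult.commute)
  ultimately show "EX d. ((%y. Lam q y / y) has_real_derivative d) (at z) & d <= 0" by blast
 qed
 then show ?thesis using assms by (simp add: field_simps)
qed

text \<open>\<open>q\<close> is chosen so that \<open>phi * q = 2 - ga\<close>. Then
  \<open>z powr (phi - 2) * (1 + z powr phi) powr (q - 1)\<close> behaves like
  \<open>z powr (phi - 2) = z powr (- phi * ga)\<close> for small \<open>z\<close> and like
  \<open>z powr (- ga)\<close> for large \<open>z\<close>, which are the two regimes of the singular
  term. The sign of \<open>q\<close> separates the three cases of the theorem.\<close>

locale exponents =
 fixes ga phi q :: real
 assumes ga: "ga > 1" and phi_def: "phi = 2 / (1 + ga)" and q_def: "q = (2 - ga) / phi"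
begin

lemma phi: "0 < phi" "phi < 1"
 using ga by (auto simp: phi_def)

lemma phiga: "phi * ga = 2 - phi" "phi * (1 + ga) = 2"
 using ga by (auto simp: phi_def field_simps)

lemma q_eq: "phi * (q - 1) = - ga * (1 - phi)" "phi * q = 2 - ga"
proof -
 show 2: "phi * q = 2 - ga" using phi by (simp add: q_def)
 have "phi * (q - 1) = 2 - ga - phi" using 2 by (simp add: right_diff_distrib)
 also have "... = - ga * (1 - phi)" using phiga(1) by (simp add: algebra_simps)
 finally show "phi * (q - 1) = - ga * (1 - phi)" .
qed

lemma q1: "q < 1"
proof -
 have "phi * (q - 1) < 0" unfolding q_eq using ga phi by (simp add: mult_neg_pos)
 then show ?thesis using phi by (simp add: mult_less_0_iff)
qed

definition G :: "real => real" where "G z = Lam q (z powr phi)"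
definition G1 :: "real => real" where "G1 z = phi * z powr (phi - 1) * (1 + z powr phi) powr (q - 1)"
definition G2 :: "real => real" where
 "G2 z = phi * z powr (phi - 2) * (1 + z powr phi) powr (q - 2) * ((phi - 1) * (1 + z powr phi) + (q - 1) * phi * z powr phi)"

text \<open>The size of \<open>- G2\<close>; it is comparable to \<open>(z + z powr phi) powr (- ga)\<close>.\<close>

definition P :: "real => real" where "P z = z powr (phi - 2) * (1 + z powr phi) powr (q - 1)"

lemma G_deriv: assumes "z > 0" shows "(G has_real_derivative G1 z) (at z)"
proof -
 have "((%z. Lam q (z powr phi)) has_real_derivative (1 + z powr phi) powr (q - 1) * (phi * z powr (phi - 1))) (at z)"
  by (rule DERIV_chain2[OF Lam_deriv has_real_derivative_powr[OF assms]]) (use powr_ge_zero[of z phi] in linarith)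
 then show ?thesis unfolding G_def[abs_def] G1_def by (simp add: mult_ac)
qed

lemma G1_deriv: assumes z: "z > 0" shows "(G1 has_real_derivative G2 z) (at z)"
proof -
 define y where "y = z powr phi"
 have y: "y > 0" using z by (simp add: y_def)
 have p: "((%z. (1 + z powr phi) powr (q - 1)) has_real_derivative ((q - 1) * (1 + y) powr (q - 1 - 1)) * (phi * z powr (phi - 1))) (at z)"
 proof (rule DERIV_chain2[of "%w. w powr (q - 1)" _ "%z. 1 + z powr phi"])
  show "((%w. w powr (q - 1)) has_real_derivative (q - 1) * (1 + y) powr (q - 1 - 1)) (at (1 + z powr phi))"
  proof -
   have "1 + y > 0" using y by simp
   from has_real_derivative_powr[OF this, of "q - 1"] show ?thesis by (simp only: y_def)
  qed
  show "((%z. 1 + z powr phi) has_real_derivative phi * z powr (phi - 1)) (at z)"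
   using DERIV_add[OF DERIV_const has_real_derivative_powr[OF z]] by simp
 qed
 have d: "(G1 has_real_derivative (phi * ((phi - 1) * z powr (phi - 1 - 1))) * (1 + y) powr (q - 1)
   + ((q - 1) * (1 + y) powr (q - 1 - 1)) * (phi * z powr (phi - 1)) * (phi * z powr (phi - 1))) (at z)"
  unfolding G1_def[abs_def] y_def[symmetric]
  using DERIV_mult[OF DERIV_cmult[OF has_real_derivative_powr[OF z]] p, of phi "phi - 1"] by (simp add: y_def)
 have e1: "(1 + y) powr (q - 1) = (1 + y) * (1 + y) powr (q - 2)" using y by (simp add: powr_diff powr_numeral power2_eq_square)
 have e2: "(1 + y) powr (q - 1 - 1) = (1 + y) powr (q - 2)" "z powr (phi - 1 - 1) = z powr (phi - 2)"
  by (simp_all add: algebra_simps)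
 have e3: "z powr (phi - 1) * z powr (phi - 1) = z powr (phi - 2) * y"
  unfolding y_def powr_add[symmetric] by (simp add: algebra_simps)
 have "(phi * ((phi - 1) * z powr (phi - 1 - 1))) * (1 + y) powr (q - 1)
   + ((q - 1) * (1 + y) powr (q - 1 - 1)) * (phi * z powr (phi - 1)) * (phi * z powr (phi - 1))
  = phi * (phi - 1) * z powr (phi - 2) * ((1 + y) * (1 + y) powr (q - 2))
   + (q - 1) * (1 + y) powr (q - 2) * phi * phi * (z powr (phi - 1) * z powr (phi - 1))"
  unfolding e2 e1 by simp
 also have "... = G2 z" unfolding e3 G2_def y_def[symmetric] by (simp add: algebra_simps)
 finally show ?thesis using d by simp
qed

lemma P_pos: "z > 0 ==> P z > 0"
 unfolding P_def using powr_ge_zero[of z phi] by (intro mult_pos_pos) (auto simp: add_nonneg_eq_0_iff)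

lemma G1_P: assumes "z > 0" shows "G1 z = phi * (z * P z)"
 using assms by (simp add: G1_def P_def powr_diff powr_numeral power2_eq_square)

text \<open>The two terms of \<open>G2\<close> are both negative because \<open>phi < 1\<close> and
  \<open>q < 1\<close>. The first alone gives the lower bound for \<open>- G2\<close>; the second is
  bounded using \<open>y <= 1 + y\<close>.\<close>

lemma G2_P:
 assumes z: "z > 0"
 shows "- G2 z >= phi * (1 - phi) * P z" "- G2 z <= (phi * (1 - phi) + phi * phi * (1 - q)) * P z"
proof -
 define y where "y = z powr phi"
 have y: "y > 0" using z by (simp add: y_def)
 define X where "X = z powr (phi - 2) * (1 + y) powr (q - 2)"
 have X: "X > 0" using z y by (simp add: X_def)
 have e1: "(1 + y) powr (q - 1) = (1 + y) * (1 + y) powr (q - 2)" using y by (simp add: powr_diff powr_numeral power2_eq_square)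
 have PX: "P z = X * (1 + y)" by (simp add: P_def X_def y_def[symmetric] e1)
 have GX: "- G2 z = phi * (1 - phi) * (X * (1 + y)) + phi * phi * (1 - q) * (X * y)"
  by (simp add: G2_def X_def y_def[symmetric] algebra_simps)
 have c: "phi * phi * (1 - q) >= 0" using phi q1 by simp
 have b: "phi * phi * (1 - q) * (X * y) >= 0" "phi * phi * (1 - q) * (X * y) <= phi * phi * (1 - q) * (X * (1 + y))"
  using X y by (auto intro!: mult_nonneg_nonneg[OF c] mult_left_mono[OF _ c])
 show "- G2 z >= phi * (1 - phi) * P z" unfolding GX PX using b(1) by simp
 show "- G2 z <= (phi * (1 - phi) + phi * phi * (1 - q)) * P z" unfolding GX PX using b(2) by (simp add: algebra_simps)
qed

text \<open>Once the common factor \<open>z powr (phi - 2)\<close> is removed,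
  \<open>(1 + z powr phi) powr (q - 1)\<close> is compared with
  \<open>(1 + z powr (1 - phi)) powr (- ga)\<close>. For \<open>z <= 1\<close> both lie in a fixed
  range below 1; for \<open>z > 1\<close> both are comparable to
  \<open>z powr (- ga * (1 - phi))\<close>, as
  \<open>phi * (q - 1) = - ga * (1 - phi)\<close>.\<close>

lemma P_bounds:
 assumes z: "z > 0"
 shows "P z <= 2 powr ga * (z + z powr phi) powr (- ga)" "P z >= 2 powr (q - 1) * (z + z powr phi) powr (- ga)"
proof -
 define a where "a = (1 + z powr phi) powr (q - 1)"
 define b where "b = (1 + z powr (1 - phi)) powr (- ga)"
 have zb: "(z + z powr phi) powr (- ga) = z powr (phi - 2) * b"
 proof -
  have "z + z powr phi = z powr phi * (1 + z powr (1 - phi))"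
   using z by (simp add: distrib_left powr_add[symmetric])
  then have "(z + z powr phi) powr (- ga) = (z powr phi) powr (- ga) * b"
   by (simp add: powr_mult b_def add_nonneg_nonneg)
  also have "(z powr phi) powr (- ga) = z powr (phi - 2)" using phiga(1) by (simp add: powr_powr)
  finally show ?thesis .
 qed
 have Pa: "P z = z powr (phi - 2) * a" by (simp add: P_def a_def)
 have ab: "a <= 2 powr ga * b & 2 powr (q - 1) * b <= a"
 proof (cases "z <= 1")
  case True
  have y1: "z powr phi <= 1" "z powr (1 - phi) <= 1" using True z phi by (auto intro!: powr_le1)
  have a1: "a <= 1" "a >= 2 powr (q - 1)"
  proof -
   have "a <= 1 powr (q - 1)" unfolding a_def using q1 z by (intro powr_mono2') auto
   then show "a <= 1" by simp
   show "a >= 2 powr (q - 1)" unfolding a_def using q1 z y1 by (intro powr_mono2') (auto intro: add_pos_nonneg)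
  qed
  have b1: "b <= 1" "b >= 2 powr (- ga)"
  proof -
   have "b <= 1 powr (- ga)" unfolding b_def using ga z by (intro powr_mono2') auto
   then show "b <= 1" by simp
   show "b >= 2 powr (- ga)" unfolding b_def using ga z y1 by (intro powr_mono2') (auto intro: add_pos_nonneg)
  qed
  have "2 powr ga * b >= 2 powr ga * 2 powr (- ga)" using b1 by (intro mult_left_mono) auto
  then have "2 powr ga * b >= 1" by (simp add: powr_add[symmetric])
  moreover have "2 powr (q - 1) * b <= 2 powr (q - 1) * 1" using b1 by (intro mult_left_mono) auto
  ultimately show ?thesis using a1 by linarith
 next
  case False
  define k where "k = z powr (- ga * (1 - phi))"
  have y1: "z powr phi >= 1" "z powr (1 - phi) >= 1" using False phi by (auto intro!: ge_one_powr_ge_zero)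
  have ka: "(z powr phi) powr (q - 1) = k" "(z powr (1 - phi)) powr (- ga) = k"
  proof -
   show "(z powr phi) powr (q - 1) = k" unfolding powr_powr k_def q_eq(1) ..
   have "(1 - phi) * - ga = - ga * (1 - phi)" by (rule mult.commute)
   then show "(z powr (1 - phi)) powr (- ga) = k" unfolding powr_powr k_def by (simp only:)
  qed
  have "a <= (z powr phi) powr (q - 1)" unfolding a_def using q1 z by (intro powr_mono2') auto
  then have a1: "a <= k" using ka by simp
  have "(2 * z powr phi) powr (q - 1) <= a" unfolding a_def using q1 z y1 by (intro powr_mono2') (auto intro: add_pos_nonneg)
  then have a2: "2 powr (q - 1) * k <= a" using ka by (simp add: powr_mult)
  have "b <= (z powr (1 - phi)) powr (- ga)" unfolding b_def using ga z by (intro powr_mono2') auto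
  then have b1: "b <= k" using ka by simp
  have "(2 * z powr (1 - phi)) powr (- ga) <= b" unfolding b_def using ga z y1 by (intro powr_mono2') (auto intro: add_pos_nonneg)
  then have "2 powr (- ga) * k <= b" using ka by (simp add: powr_mult)
  then have "2 powr ga * (2 powr (- ga) * k) <= 2 powr ga * b" by (intro mult_left_mono) auto
  then have b2: "k <= 2 powr ga * b" by (simp add: mult.assoc[symmetric] powr_add[symmetric])
  have "2 powr (q - 1) * b <= 2 powr (q - 1) * k" using b1 by (intro mult_left_mono) auto
  then show ?thesis using a1 a2 b2 by linarith
 qed
 have z0: "z powr (phi - 2) >= 0" by simp
 show "P z <= 2 powr ga * (z + z powr phi) powr (- ga)"
  using mult_left_mono[OF conjunct1[OF ab] z0] unfolding Pa zb by (simp add: mult.left_commute)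
 show "P z >= 2 powr (q - 1) * (z + z powr phi) powr (- ga)"
  using mult_left_mono[OF conjunct2[OF ab] z0] unfolding Pa zb by (simp add: mult.left_commute)
qed

lemma G_nonneg: "G z >= 0"
 unfolding G_def by (rule Lam_nonneg) simp

lemma G_mono: "0 <= a ==> a <= b ==> G a <= G b"
 unfolding G_def using phi by (intro Lam_mono powr_mono2) auto

lemma G_le: "G z <= z powr phi"
 unfolding G_def using q1 by (intro Lam_le) auto

text \<open>Concavity of \<open>Lam q\<close>. It gives
  \<open>G z - z * G1 z >= (1 - phi) * G z\<close>, the surplus that feeds the growth of the
  coefficient of \<open>H\<close> in the subsolution.\<close>

lemma G1_le: assumes "z > 0" shows "z * G1 z <= phi * G z"
proof -
 have "z * z powr (phi - 1) = z powr phi" using assms by (simp add: powr_diff)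
 then have "z * G1 z = phi * (z powr phi * (1 + z powr phi) powr (q - 1))"
  by (simp add: G1_def mult_ac)
 also have "... <= phi * G z" unfolding G_def using phi q1 by (intro mult_left_mono Lam_concave) auto
 finally show ?thesis .
qed

text \<open>The growth term of the subsolution is linear in the angular variable, of size
  \<open>e * Lam q (T powr phi)\<close>; this bounds it by the surplus, which is of size
  \<open>G (T * e)\<close>.\<close>

lemma G_scale: assumes "0 < e" "e <= 1" "0 < T" shows "e * Lam q (T powr phi) <= G (T * e)"
proof -
 have ep: "0 < e powr phi" "e powr phi <= 1" using assms phi by (auto intro!: powr_le1)
 have "e powr 1 <= e powr phi" using assms phi by (intro powr_mono') auto
 then have "e * Lam q (T powr phi) <= e powr phi * Lam q (T powr phi)"
  using assms by (intro mult_right_mono Lam_nonneg) auto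
 also have "... <= Lam q (e powr phi * T powr phi)" using q1 ep assms by (intro Lam_scale) auto
 also have "... = G (T * e)" using assms by (simp add: G_def powr_mult mult.commute)
 finally show ?thesis .
qed

definition cG :: real where "cG = min (1/2) (2 powr (q - 1))"

lemma cG_pos: "cG > 0" "cG <= 1/2"
 by (auto simp: cG_def)

lemma G_lower: assumes "z > 0" shows "G z + z >= cG * (z + z powr phi)"
proof (cases "z <= 1")
 case True
 have y: "z powr phi <= 1" using True assms phi by (auto intro!: powr_le1)
 have "2 powr (q - 1) * z powr phi <= (1 + z powr phi) powr (q - 1) * z powr phi"
  using q1 y by (intro mult_right_mono powr_mono2') (auto intro: add_pos_nonneg)
 also have "... <= G z" unfolding G_def using q1 Lam_concave[of q "z powr phi"] by (simp add: mult.commute)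
 finally have "cG * z powr phi <= G z" using mult_right_mono[of cG "2 powr (q - 1)" "z powr phi"] by (simp add: cG_def)
 moreover have "cG * z <= z" using cG_pos assms by simp
 ultimately show ?thesis by (simp add: distrib_left)
next
 case False
 have "z powr phi <= z powr 1" using False phi by (intro powr_mono) auto
 then have "cG * (z + z powr phi) <= (1/2) * (z + z)" using cG_pos assms by (intro mult_mono) auto
 then show ?thesis using G_nonneg[of z] by simp
qed

lemma LamT_le: assumes "T > 0" shows "T powr (-phi) * Lam q (T powr phi) <= 1"
proof -
 have "T powr (-phi) * Lam q (T powr phi) <= T powr (-phi) * T powr phi" using q1 by (intro mult_left_mono Lam_le) auto
 then show ?thesis using assms by (simp add: powr_add[symmetric])
qed

text \<open>The right-hand side is a multiple of \<open>(T powr (1 - phi)) powr (- ga)\<close>, the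
  singular term of the profile far from the boundary; the left-hand side is the size of the growth
  term there.\<close>

lemma LamT_ge: assumes "T >= 1" shows "T powr (-phi) * Lam q (T powr phi) >= 2 powr (q - 1) * T powr (- ga * (1 - phi))"
proof -
 have T: "T powr phi >= 1" using assms phi by (intro ge_one_powr_ge_zero) auto
 have "2 powr (q - 1) * T powr (- ga * (1 - phi)) = (2 * T powr phi) powr (q - 1)"
  by (simp add: powr_mult powr_powr q_eq(1))
 also have "... <= (1 + T powr phi) powr (q - 1)" using q1 T by (intro powr_mono2') (auto intro: add_pos_nonneg)
 also have "... = T powr (-phi) * (T powr phi * (1 + T powr phi) powr (q - 1))"
  using assms by (simp add: mult.assoc[symmetric] powr_add[symmetric])
 also have "... <= T powr (-phi) * Lam q (T powr phi)" using q1 by (intro mult_left_mono Lam_concave) auto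
 finally show ?thesis .
qed

text \<open>The scaling identity behind the amplitude \<open>T powr (- phi)\<close>: the singular
  term of the rescaled profile and its second derivative, which brings the factor
  \<open>T^2\<close>, have the same weight.\<close>

lemma kappa_power: assumes "T > 0" shows "(T powr (-phi)) powr (-ga) = T powr (-phi) * T^2"
 unfolding powr_powr using assms phiga(1) by (simp add: powr_diff powr_minus powr_numeral divide_inverse)

end

section \<open>Sub- and supersolutions near the vertex\<close>

lemma has_lap_norm_powr0:
 fixes V :: "'a::euclidean_space set"
 assumes "0 ~: V"
 shows "has_lap V (%x. norm x powr a) (%x. (a * norm x powr (a - 2)) *R x)
  (%x. a * (a + real DIM('a) - 2) * norm x powr (a - 2))"
 using has_lap_norm_powr[OF assms, of a] by simp

lemma has_lap_powr_mult_comp: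
 fixes V :: "'a::euclidean_space set"
 assumes V: "0 ~: V" "open V" and e: "has_lap V e De le"
  and g: "!!x. x : V ==> (g has_real_derivative g' (e x)) (at (e x))"
   "!!x. x : V ==> (g' has_real_derivative g'' (e x)) (at (e x))"
 shows "EX DD. has_lap V (%x. norm x powr a * g (e x)) DD
  (%x. norm x powr (a - 2) * (a * (a + real DIM('a) - 2) * g (e x) + 2 * a * g' (e x) * (x \<bullet> De x)
    + (norm x)^2 * (g'' (e x) * (norm (De x))^2 + g' (e x) * le x)))"
proof -
 have h: "has_lap V (%x. norm x powr a * g (e x))
  (%x. norm x powr a *R (g' (e x) *R De x) + g (e x) *R ((a * norm x powr (a - 2)) *R x))
  (%x. norm x powr a * (g'' (e x) * (norm (De x))^2 + g' (e x) * le x)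
   + g (e x) * (a * (a + real DIM('a) - 2) * norm x powr (a - 2))
   + 2 * (((a * norm x powr (a - 2)) *R x) \<bullet> (g' (e x) *R De x)))"
  by (intro has_lap_mult has_lap_norm_powr0 has_lap_comp V e g)
 have p: "norm x powr a = norm x powr (a - 2) * (norm x)^2" if "x : V" for x using that V(1) by (auto simp: powr_diff powr_numeral)
 show ?thesis
  by (rule exI, rule has_lap_cong[OF h V(2) refl refl]) (simp only: p, simp add: algebra_simps)
qed

lemma exterior_ball_infdist:
 fixes D :: "'a::euclidean_space set"
 assumes D: "open D" and R: "R > 0" and c: "ball c R Int D = {}" and x: "x : D"
 shows "infdist x (- D) <= norm (x - c) - R"
proof -
 have xc: "norm (x - c) >= R" using c x by (force simp: dist_norm norm_minus_commute)
 have nxc: "x ~= c" using xc R by auto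
 define w where "w = c + (R / norm (x - c)) *R (x - c)"
 have "dist c w = R" using nxc R by (simp add: w_def dist_norm)
 then have "w : closure (ball c R)" using R by simp
 moreover have "closure (ball c R) <= - D"
  using c D by (intro closure_minimal) (auto simp: closed_Compl)
 ultimately have "infdist x (- D) <= dist x w" by (intro infdist_le) blast
 also have "dist x w = norm (x - c) - R"
 proof -
  have "x - w = (1 - R / norm (x - c)) *R (x - c)" by (simp add: w_def algebra_simps)
  then have "dist x w = \<bar>1 - R / norm (x - c)\<bar> * norm (x - c)" by (simp add: dist_norm)
  also have "... = norm (x - c) - R" using xc R nxc by (auto simp: abs_if field_simps)
  finally show ?thesis .
 qed
 finally show ?thesis .
qed

text \<open>The function \<open>norm (x - c) - R\<close> lies above the distance to the complement
  and equals it at \<open>x0\<close>, so it can replace that distance at a touching point. If the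
  nearest boundary point is the vertex, the ball degenerates to radius 0 about the vertex.\<close>

lemma touching_exterior_ball:
 assumes D: "good_cone rho D" and x0: "x0 : D"
 obtains c R where "norm (x0 - c) - R = infdist x0 (- D)" "!!x. x : D ==> norm (x - c) - R >= infdist x (- D)"
  "norm (x0 - c) >= rho * norm x0" "c ~: D"
proof -
 have rho: "0 < rho" "rho <= 1/4" using good_coneD[OF D] by auto
 obtain y where y: "y : frontier D" "dist x0 y = infdist x0 (- D)" using cone_nearest[OF D x0] .
 show ?thesis
 proof (cases "y = 0")
  case True
  show ?thesis
  proof (rule that[of 0 0])
   show "norm (x0 - 0) >= rho * norm x0" using rho by (simp add: mult_left_le_one_le)
   show "norm (x - 0) - 0 >= infdist x (- D)" if "x : D" for x using infdist_cone_bounds(2)[OF D that] by simp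
  qed (use True y good_coneD(5)[OF D] in auto)
 next
  case False
  then obtain c where c: "dist y c = rho * norm y" "ball c (rho * norm y) Int D = {}"
   using D y(1) unfolding good_cone_def by blast
  define R where "R = rho * norm y"
  have R: "R > 0" using rho False by (simp add: R_def)
  have ge: "norm (x - c) - R >= infdist x (- D)" if x: "x : D" for x
   using exterior_ball_infdist[OF good_coneD(3)[OF D] R _ x] c(2) by (simp add: R_def)
  have le: "norm (x0 - c) - R <= infdist x0 (- D)"
   using dist_triangle[of x0 c y] y(2) c(1) by (simp add: dist_norm R_def)
  show ?thesis
  proof (rule that[of c R])
   show "norm (x0 - c) - R = infdist x0 (- D)" using le ge[OF x0] by simp
   then have "norm (x0 - c) = dist x0 y + rho * norm y" using y(2) by (simp add: R_def)
   also have "... >= rho * dist x0 y + rho * norm y" using rho by (simp add: mult_left_le_one_le)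
   also have "rho * dist x0 y + rho * norm y = rho * (dist x0 y + norm y)" by (simp add: distrib_left)
   also have "... >= rho * norm x0"
    using rho norm_triangle_ineq[of "x0 - y" y] by (intro mult_left_mono) (auto simp: dist_norm)
   finally show "norm (x0 - c) >= rho * norm x0" .
   show "c ~: D" using c(2) R by (auto simp: R_def disjoint_iff)
  qed (use ge in auto)
 qed
qed

lemma eventually_infdist_less:
 assumes "good_cone rho D" "xi : frontier D" "e > 0"
 shows "\<forall>\<^sub>F x in at xi within D. infdist x (- D) < e"
proof -
 have "xi : - D" using assms(2) good_coneD(3)[OF assms(1)] by (simp add: frontier_def interior_open)
 then have "infdist x (- D) < e" if "dist x xi < e" for x using infdist_le[of xi "- D" x] that by simp
 then show ?thesis unfolding eventually_at using assms(3) by blast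
qed

locale cone_profile = exponents +
 fixes D :: "'a::euclidean_space set" and H :: "'a => real" and EH U EU lU and rho c C cU CU :: real
 assumes dim: "DIM('a) >= 2" and D: "good_cone rho D"
  and H: "cone_harmonic D phi H" "has_lap D H EH (%x. 0)"
  and Hb: "c > 0" "C > 0" "!!x. x : D ==> c * infdist x (- D) * norm x powr (phi - 1) <= H x"
   "!!x. x : D ==> H x <= C * infdist x (- D) * norm x powr (phi - 1)"
   "!!x. x : D ==> H x <= norm x powr phi" "!!x. x : D ==> norm (EH x) <= C * norm x powr (phi - 1)"
  and U: "has_lap (D Int ball 0 1) U EU lU" "!!x. x : D Int ball 0 1 ==> lU x = - (U x powr (- ga))"
   "!!x. x : D Int ball 0 1 ==> U x > 0"
  and U0: "!!xi e. xi : frontier D ==> norm xi < 1 ==> 0 < e ==> \<forall>\<^sub>F x in at xi within D. U x < e"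
  and Ulow: "cU > 0" "!!x. x : D ==> norm x <= 1/2 ==> U x >= cU * infdist x (- D) powr phi"
  and Uup: "CU > 0" "!!x. x : D ==> norm x = 1/16 ==> U x <= CU * infdist x (- D) powr phi"
begin

definition n :: real where "n = real DIM('a)"
definition lam :: real where "lam = phi * (phi + n - 2)"
text \<open>The derivative of \<open>phi * (phi + n - 2)\<close> with respect to \<open>phi\<close>:
  the coefficient of \<open>H x / (norm x)^2\<close> in the Laplacian of
  \<open>ln (norm x) * H x\<close>.\<close>

definition N :: real where "N = n - 2 + 2 * phi"

lemma n: "n >= 2" using dim by (simp add: n_def)
lemma lam: "lam > 0" using n phi by (simp add: lam_def)
lemma N: "N > 0" using n phi by (simp add: N_def)

lemma oD: "open D" "0 ~: D" using good_coneD[OF D] by auto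
lemma rho: "0 < rho" "rho <= 1/4" using good_coneD[OF D] by auto

lemma nx: "x : D ==> norm x > 0" using infdist_cone_bounds[OF D] by simp

lemma Hpos: "x : D ==> H x > 0" using H(1) by (simp add: cone_harmonic_def)

lemma EH_radial: "x : D ==> EH x \<bullet> x = phi * H x"
 by (rule homogeneous_grad[of _ _ _ 1]) (use H in "auto simp: has_lap_def cone_harmonic_def")

definition e :: "'a => real" where "e x = norm x powr (-phi) * H x"

lemma H_e: "x : D ==> H x = norm x powr phi * e x"
 using nx[of x] by (simp add: e_def mult.assoc[symmetric] powr_add[symmetric])

lemma e_bounds:
 assumes x: "x : D"
 shows "0 < e x" "e x <= 1" "c * (infdist x (- D) / norm x) <= e x" "e x <= C * (infdist x (- D) / norm x)"
proof -
 have p: "norm x powr (-phi) > 0" using nx[OF x] by simp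
 show "0 < e x" using p Hpos[OF x] by (simp add: e_def)
 have q: "norm x powr (-phi) * (k * infdist x (- D) * norm x powr (phi - 1)) = k * (infdist x (- D) / norm x)" for k using nx[OF x] by (simp add: powr_diff powr_minus)
 show "c * (infdist x (- D) / norm x) <= e x" unfolding e_def q[symmetric] using Hb(3)[OF x] by (intro mult_left_mono) auto
 show "e x <= C * (infdist x (- D) / norm x)" unfolding e_def q[symmetric] using Hb(4)[OF x] by (intro mult_left_mono) auto
 have "e x <= norm x powr (-phi) * norm x powr phi" unfolding e_def using Hb(5)[OF x] by (intro mult_left_mono) auto
 then show "e x <= 1" using nx[OF x] by (simp add: powr_add[symmetric])
qed

lemma e_powr_le: assumes x: "x : D" shows "norm x powr phi * e x powr phi <= C powr phi * infdist x (- D) powr phi"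
proof -
 have "norm x * e x <= C * infdist x (- D)" using e_bounds(4)[OF x] nx[OF x] by (simp add: field_simps)
 then have "(norm x * e x) powr phi <= (C * infdist x (- D)) powr phi" using phi e_bounds[OF x] by (intro powr_mono2) auto
 then show ?thesis using Hb e_bounds[OF x] by (simp add: powr_mult infdist_nonneg)
qed

text \<open>Degree 0 makes the gradient of \<open>e\<close> orthogonal to \<open>x\<close>, and
  harmonicity of \<open>H\<close> becomes the eigenvalue equation of the angular part.\<close>

lemma e_has_lap:
 obtains De where "has_lap D e De (%x. - lam * e x / (norm x)^2)" "!!x. x : D ==> x \<bullet> De x = 0"
  "!!x. x : D ==> norm x * norm (De x) <= C + 1"
proof -
 define De where "De x = norm x powr (-phi) *R EH x + H x *R ((-phi * norm x powr (-phi - 2)) *R x)" for x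
 have p: "norm x powr (-phi - 2) * (norm x)^2 = norm x powr (-phi)" if "x : D" for x
  using nx[OF that] by (simp add: powr_diff powr_numeral)
 have h: "has_lap D (%x. norm x powr (-phi) * H x) De
  (%x. norm x powr (-phi) * 0 + H x * (-phi * (-phi + real DIM('a) - 2) * norm x powr (-phi - 2))
   + 2 * (((-phi * norm x powr (-phi - 2)) *R x) \<bullet> EH x))"
  unfolding De_def by (intro has_lap_mult has_lap_norm_powr0 oD H)
 show ?thesis
 proof (rule that[of De])
  show "has_lap D e De (%x. - lam * e x / (norm x)^2)"
  proof (rule has_lap_cong[OF h oD(1)])
   fix x assume x: "x : D"
   have "x \<bullet> EH x = phi * H x" using EH_radial[OF x] by (simp add: inner_commute)
   then have "norm x powr (-phi) * 0 + H x * (-phi * (-phi + real DIM('a) - 2) * norm x powr (-phi - 2))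
    + 2 * (((-phi * norm x powr (-phi - 2)) *R x) \<bullet> EH x) = - lam * (norm x powr (-phi - 2) * H x)"
    by (simp add: lam_def n_def algebra_simps)
   also have "norm x powr (-phi - 2) * H x = e x / (norm x)^2"
    using p[OF x] nx[OF x] by (simp add: e_def field_simps)
   finally show "norm x powr (-phi) * 0 + H x * (-phi * (-phi + real DIM('a) - 2) * norm x powr (-phi - 2))
    + 2 * (((-phi * norm x powr (-phi - 2)) *R x) \<bullet> EH x) = - lam * e x / (norm x)^2" by simp
  qed (auto simp: e_def)
  fix x assume x: "x : D"
  have "De x \<bullet> x = norm x powr (-phi) * (phi * H x) - phi * H x * (norm x powr (-phi - 2) * (norm x)^2)"
   using EH_radial[OF x] by (simp add: De_def inner_diff_left power2_norm_eq_inner)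
  then show "x \<bullet> De x = 0" unfolding p[OF x] by (simp add: inner_commute)
  have "norm (De x) <= norm x powr (-phi) * norm (EH x) + H x * (phi * norm x powr (-phi - 2) * norm x)"
   unfolding De_def using phi Hpos[OF x]
   by (intro order_trans[OF norm_triangle_ineq]) (simp add: abs_mult)
  then have "norm x * norm (De x) <= norm x * (norm x powr (-phi) * norm (EH x) + H x * (phi * norm x powr (-phi - 2) * norm x))"
   by (intro mult_left_mono) auto
  also have "... = norm x * norm x powr (-phi) * norm (EH x) + phi * (H x * (norm x powr (-phi - 2) * (norm x)^2))"
   by (simp add: algebra_simps power2_eq_square)
  also have "... = norm x * norm x powr (-phi) * norm (EH x) + phi * e x" unfolding p[OF x] by (simp add: e_def)
  also have "... <= norm x * norm x powr (-phi) * (C * norm x powr (phi - 1)) + 1 * 1"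
   using Hb(6)[OF x] phi e_bounds[OF x] by (intro add_mono mult_mono mult_left_mono) auto
  also have "norm x * norm x powr (-phi) * (C * norm x powr (phi - 1)) = C"
   using nx[OF x] by (simp add: powr_diff powr_minus)
  finally show "norm x * norm (De x) <= C + 1" by simp
 qed
qed

lemma G_T_deriv: assumes "T > 0" "y > 0"
 shows "((%y. G (T * y)) has_real_derivative T * G1 (T * y)) (at y)"
  "((%y. T * G1 (T * y)) has_real_derivative T^2 * G2 (T * y)) (at y)"
proof -
 have l: "((%y. T * y) has_real_derivative T) (at y)" by (auto intro!: derivative_eq_intros)
 have "((%y. G (T * y)) has_real_derivative G1 (T * y) * T) (at y)"
  by (rule DERIV_chain2[OF G_deriv l]) (use assms in simp)
 then show "((%y. G (T * y)) has_real_derivative T * G1 (T * y)) (at y)" by (simp add: mult.commute)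
 have "((%y. G1 (T * y)) has_real_derivative G2 (T * y) * T) (at y)"
  by (rule DERIV_chain2[OF G1_deriv l]) (use assms in simp)
 from DERIV_cmult[OF this, of T] show "((%y. T * G1 (T * y)) has_real_derivative T^2 * G2 (T * y)) (at y)"
  by (simp add: power2_eq_square mult_ac)
qed

lemma Uc: "continuous_on (D Int ball 0 1) U"
 using has_lap_continuous U(1) by blast

text \<open>In the window \<open>tau \<le> t \<le> 2 tau\<close>, \<open>t = ln (1 / |x|)\<close>, the scale \<open>T\<close> is frozen. The coefficient of \<open>H\<close> starts from
 zero at \<open>t = tau\<close>, where only the lower bound by the distance is known, and is bounded, so that the
 comparison can be made down to the vertex.\<close>

lemma subsolution_bound:
 assumes tau: "tau >= 1" and T: "T > 0" "k > 0" "T / tau <= k * Lam q (T powr phi)"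
  and be: "be > 0" "be <= 1" "be * k * (1 + N) <= lam * (1 - phi)"
  and b: "b > 0" "b powr (1 + ga) * ((C + 1)^2 * (phi * (1 - phi) + phi * phi * (1 - q)) * 2 powr ga) <= 1" "b * C powr phi <= cU"
  and x: "x : D" "norm x = exp (- 2 * tau)"
 shows "U x >= b * (be / 2) * T powr (1 - phi) * H x"
proof -
 define r0 where "r0 = exp (- tau)"
 have r0: "0 < r0" "r0 <= 1/2"
 proof -
  show "0 < r0" by (simp add: r0_def)
  have "exp 1 <= exp tau" using tau by simp
  moreover have "(2::real) <= exp 1" using exp_ge_add_one_self[of 1] by simp
  ultimately have "2 <= exp tau" by linarith
  then show "r0 <= 1/2" by (simp add: r0_def exp_minus field_simps)
 qed
 \<comment> \<open>The coefficient of \<open>H\<close> will be proportional to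
   \<open>1 - (norm z / r0) powr nu\<close>. With \<open>nu = 1 / tau\<close> it reaches
   \<open>1 - exp (-1) >= 1/2\<close> at \<open>norm z = exp (- 2 * tau)\<close>, and its radial
   derivatives are of order \<open>1 / tau\<close>.\<close>
 define nu where "nu = 1 / tau"
 have nu: "0 < nu" "nu <= 1" using tau by (auto simp: nu_def)
 define kap where "kap = T powr (-phi)"
 have kap: "kap > 0" using T by (simp add: kap_def)
 define K2 where "K2 = phi * (1 - phi) + phi * phi * (1 - q)"
 have K2: "K2 > 0" using phi q1 by (simp add: K2_def add_pos_nonneg)
 define W where "W = D Int ball 0 r0"
 have W: "open W" "W <= D" "W <= D Int ball 0 1" "bounded W"
  using oD r0 by (auto simp: W_def open_Int intro: bounded_subset[OF bounded_ball[of 0 r0]])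
 obtain De where De: "has_lap D e De (%x. - lam * e x / (norm x)^2)" "!!x. x : D ==> x \<bullet> De x = 0"
  "!!x. x : D ==> norm x * norm (De x) <= C + 1" using e_has_lap by blast
 obtain DG where DG: "has_lap D (%x. norm x powr phi * G (T * e x)) DG
  (%x. norm x powr (phi - 2) * (phi * (phi + real DIM('a) - 2) * G (T * e x) + 2 * phi * (T * G1 (T * e x)) * (x \<bullet> De x)
    + (norm x)^2 * ((T^2 * G2 (T * e x)) * (norm (De x))^2 + (T * G1 (T * e x)) * (- lam * e x / (norm x)^2))))"
  using has_lap_powr_mult_comp[OF oD(2,1) De(1), of "%y. G (T * y)" "%y. T * G1 (T * y)" "%y. T^2 * G2 (T * y)" phi]
   G_T_deriv[OF T(1) e_bounds(1)] by blast
 define k1 where "k1 = be * T * r0 powr (-nu)"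
 have k1: "k1 > 0" using be T r0 by (simp add: k1_def)
 define v where "v z = (b * kap) * ((be * T) * H z - k1 * (norm z powr nu * H z) + norm z powr phi * G (T * e z))" for z
 define lv where "lv z = (b * kap) * ((be * T) * 0 - k1 * (norm z powr nu * 0
   + H z * (nu * (nu + real DIM('a) - 2) * norm z powr (nu - 2)) + 2 * (((nu * norm z powr (nu - 2)) *R z) \<bullet> EH z))
  + norm z powr (phi - 2) * (phi * (phi + real DIM('a) - 2) * G (T * e z) + 2 * phi * (T * G1 (T * e z)) * (z \<bullet> De z)
    + (norm z)^2 * ((T^2 * G2 (T * e z)) * (norm (De z))^2 + (T * G1 (T * e z)) * (- lam * e z / (norm z)^2))))" for z
 have "EX Dv. has_lap D v Dv lv"
  unfolding v_def[abs_def] lv_def[abs_def]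
  using has_lap_cmult[OF has_lap_add[OF has_lap_diff[OF has_lap_cmult[OF H(2), of "be * T"]
   has_lap_cmult[OF has_lap_mult[OF has_lap_norm_powr0[OF oD(2), of nu] H(2)], of k1]] DG], of "b * kap"] by blast
 then obtain Dv where lv: "has_lap D v Dv lv" by blast
 have vform: "v z = b * kap * norm z powr phi * (be * (T * e z) * (1 - (norm z / r0) powr nu) + G (T * e z))" if z: "z : D" for z
 proof -
  have "k1 * norm z powr nu = be * T * (norm z / r0) powr nu"
   using r0 nx[OF z] by (simp add: k1_def powr_divide powr_minus_divide)
  then have "v z = (b * kap) * ((be * T) * H z - (be * T * (norm z / r0) powr nu) * H z + norm z powr phi * G (T * e z))"
   unfolding v_def by (simp add: mult.assoc[symmetric])
  then show ?thesis unfolding H_e[OF z] by (simp add: algebra_simps)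
 qed
 have vle: "v z <= b * kap * norm z powr phi * (T * e z + (T * e z) powr phi)" if z: "z : D" for z
 proof -
  have Te: "T * e z > 0" using T e_bounds[OF z] by simp
  have "1 - (norm z / r0) powr nu <= 1" by simp
  then have "be * (T * e z) * (1 - (norm z / r0) powr nu) <= be * (T * e z) * 1"
   using be Te by (intro mult_left_mono) auto
  also have "... <= 1 * (T * e z)" using be Te mult_right_mono[of be 1 "T * e z"] by simp
  finally have "be * (T * e z) * (1 - (norm z / r0) powr nu) + G (T * e z) <= T * e z + (T * e z) powr phi"
   using G_le[of "T * e z"] by simp
  then show ?thesis unfolding vform[OF z] using b kap by (intro mult_left_mono) auto
 qed
 have lvge: "lv z >= - (b * kap * norm z powr (phi - 2) * (T^2 * ((C + 1)^2 * K2 * 2 powr ga) * (T * e z + (T * e z) powr phi) powr (-ga)))"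
  if z: "z : W" for z
 proof -
  have zD: "z : D" and zr: "norm z < r0" using z by (auto simp: W_def)
  define Z where "Z = T * e z"
  have Z: "Z > 0" using T e_bounds[OF zD] by (simp add: Z_def)
  define r where "r = norm z"
  have r: "r > 0" using nx[OF zD] by (simp add: r_def)
  have rr: "r powr (nu - 2) = r powr nu / r^2" "r powr (phi - 2) = r powr phi / r^2"
   using r by (simp_all add: powr_diff powr_numeral)
  have zEH: "z \<bullet> EH z = phi * H z" using EH_radial[OF zD] by (simp add: inner_commute)
  have "H z * (nu * (nu + n - 2) * r powr (nu - 2)) + 2 * ((nu * r powr (nu - 2)) * (z \<bullet> EH z))
    = nu * (nu + N) * (r powr nu / r^2) * H z"
   unfolding rr zEH N_def by (simp add: algebra_simps add_divide_distrib)
  also have "... = nu * (nu + N) * r powr nu * (r powr (phi - 2) * e z)"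
   unfolding rr H_e[OF zD] r_def[symmetric] by simp
  finally have t1: "H z * (nu * (nu + n - 2) * r powr (nu - 2)) + 2 * ((nu * r powr (nu - 2)) * (z \<bullet> EH z))
    = nu * (nu + N) * r powr nu * (r powr (phi - 2) * e z)" .
  have t2: "r^2 * ((T^2 * G2 Z) * (norm (De z))^2 + (T * G1 Z) * (- lam * e z / r^2))
    = T^2 * G2 Z * (r * norm (De z))^2 - lam * (Z * G1 Z)"
   using r by (simp add: Z_def power_mult_distrib algebra_simps)
  have lvz: "lv z = b * kap * r powr (phi - 2) * (- (k1 * r powr nu * nu * (nu + N) * e z)
    + (lam * G Z + T^2 * G2 Z * (r * norm (De z))^2 - lam * (Z * G1 Z)))"
  proof -
   have "lv z = (b * kap) * (- k1 * (H z * (nu * (nu + n - 2) * r powr (nu - 2)) + 2 * ((nu * r powr (nu - 2)) * (z \<bullet> EH z)))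
     + r powr (phi - 2) * (lam * G Z + r^2 * ((T^2 * G2 Z) * (norm (De z))^2 + (T * G1 Z) * (- lam * e z / r^2))))"
    unfolding lv_def De(2)[OF zD] by (simp add: lam_def n_def Z_def r_def)
   also have "... = b * kap * r powr (phi - 2) * (- (k1 * r powr nu * nu * (nu + N) * e z)
    + (lam * G Z + T^2 * G2 Z * (r * norm (De z))^2 - lam * (Z * G1 Z)))"
    unfolding t1 t2 by (simp add: algebra_simps)
   finally show ?thesis .
  qed
  \<comment> \<open>The cost of the growing coefficient. Since \<open>T / tau\<close> is at most
    \<open>k * Lam q (T powr phi)\<close>, the choice of \<open>be\<close> puts it below
    \<open>lam * (1 - phi) * G Z\<close>, which is what \<open>s2\<close> leaves of the
    surplus.\<close>
  have s1: "k1 * r powr nu * nu * (nu + N) * e z <= lam * (1 - phi) * G Z"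
  proof -
   have "k1 * r powr nu = be * T * (r / r0) powr nu"
    using r0 r by (simp add: k1_def powr_divide powr_minus_divide)
   also have "... <= be * T * 1"
    using be T zr r r0 nu by (intro mult_left_mono powr_le1) (auto simp: r_def divide_le_eq_1)
   finally have kr: "k1 * r powr nu <= be * T" by simp
   have "nu * (nu + N) * e z <= nu * (1 + N) * e z"
    using nu N e_bounds[OF zD] by (intro mult_right_mono mult_left_mono) auto
   from mult_mono[OF kr this] have "k1 * r powr nu * (nu * (nu + N) * e z) <= be * T * (nu * (1 + N) * e z)"
    using nu N e_bounds[OF zD] be T by simp
   also have "... = be * (1 + N) * ((T / tau) * e z)" by (simp add: nu_def)
   also have "... <= be * (1 + N) * ((k * Lam q (T powr phi)) * e z)"
    using be N T(3) e_bounds[OF zD] by (intro mult_left_mono mult_right_mono) auto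
   also have "... = (be * k * (1 + N)) * (e z * Lam q (T powr phi))" by (simp add: mult_ac)
   also have "... <= (lam * (1 - phi)) * G Z"
    unfolding Z_def
   proof (rule mult_mono[OF be(3) G_scale[OF e_bounds(1,2)[OF zD] T(1)]])
    show "0 <= lam * (1 - phi)" using lam phi by simp
    show "0 <= e z * Lam q (T powr phi)" using e_bounds(1)[OF zD] Lam_nonneg[of "T powr phi" q] by simp
   qed
   finally show ?thesis by (simp add: mult.assoc)
  qed
  have s2: "lam * (Z * G1 Z) <= lam * (phi * G Z)" using lam G1_le[OF Z] by (intro mult_left_mono) auto
  \<comment> \<open>An upper bound for the angular gradient suffices here: a concave profile makes
    this term negative, and the singular term has to compensate for it.\<close>
  have s3: "- (T^2 * G2 Z * (r * norm (De z))^2) <= T^2 * ((C + 1)^2 * K2 * 2 powr ga) * (Z + Z powr phi) powr (-ga)"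
  proof -
   have g0: "- G2 Z >= 0" using G2_P(1)[OF Z] P_pos[OF Z] phi by (smt (verit) mult_nonneg_nonneg)
   have "- G2 Z <= K2 * P Z" using G2_P(2)[OF Z] by (simp add: K2_def)
   also have "... <= K2 * (2 powr ga * (Z + Z powr phi) powr (-ga))" using K2 P_bounds(1)[OF Z] by (intro mult_left_mono) auto
   finally have g1: "- G2 Z <= K2 * (2 powr ga * (Z + Z powr phi) powr (-ga))" .
   have "(r * norm (De z))^2 <= (C + 1)^2" using De(3)[OF zD] r by (intro power_mono) (auto simp: r_def)
   then have "(r * norm (De z))^2 * (- G2 Z) <= (C + 1)^2 * (K2 * (2 powr ga * (Z + Z powr phi) powr (-ga)))"
    using g0 g1 by (intro mult_mono) auto
   then have "T^2 * ((r * norm (De z))^2 * (- G2 Z)) <= T^2 * ((C + 1)^2 * (K2 * (2 powr ga * (Z + Z powr phi) powr (-ga))))"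
    by (intro mult_left_mono) auto
   then show ?thesis by (simp add: mult_ac)
  qed
  have "- (k1 * r powr nu * nu * (nu + N) * e z) + (lam * G Z + T^2 * G2 Z * (r * norm (De z))^2 - lam * (Z * G1 Z))
   >= - (T^2 * ((C + 1)^2 * K2 * 2 powr ga) * (Z + Z powr phi) powr (-ga))"
   using s1 s2 s3 by (simp add: algebra_simps)
  then have "b * kap * r powr (phi - 2) * (- (T^2 * ((C + 1)^2 * K2 * 2 powr ga) * (Z + Z powr phi) powr (-ga))) <= lv z"
   unfolding lvz using b kap by (intro mult_left_mono) auto
  then show ?thesis by (simp add: Z_def r_def)
 qed
 have main: "v z - U z <= 0" if z: "z : W" for z
 proof (rule max_principle_strict[OF W(4,1) has_lap_diff[OF has_lap_subset[OF lv W(2)] has_lap_subset[OF U(1) W(3)]] _ _ z])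
  fix z assume z: "z : W" "0 < v z - U z"
  then have zD: "z : D" "z : D Int ball 0 1" using W by auto
  define S where "S = T * e z + (T * e z) powr phi"
  have S: "S > 0" using T e_bounds[OF zD(1)] by (auto simp: S_def intro!: add_pos_nonneg)
  have r: "norm z > 0" by (rule nx[OF zD(1)])
  have "U z < b * kap * norm z powr phi * S" using z(2) vle[OF zD(1)] by (simp add: S_def)
  then have "(b * kap * norm z powr phi * S) powr (-ga) < U z powr (-ga)"
   using U(3)[OF zD(2)] ga by (intro powr_neg_strict_antimono) auto
  also have "(b * kap * norm z powr phi * S) powr (-ga) = b powr (-ga) * (kap * T^2) * norm z powr (phi - 2) * S powr (-ga)"
  proof -
   have "phi * - ga = phi - 2" using phiga(1) by simp
   then show ?thesis using b kap r S kappa_power[OF T(1)] by (simp add: powr_mult powr_powr kap_def[symmetric])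
  qed
  finally have 1: "b powr (-ga) * (kap * T^2) * norm z powr (phi - 2) * S powr (-ga) < U z powr (-ga)" .
  have "b * ((C + 1)^2 * K2 * 2 powr ga) <= b powr (-ga)"
  proof -
   have "b * (b powr ga * ((C + 1)^2 * K2 * 2 powr ga)) <= 1" using b(1,2) by (simp add: powr_add K2_def mult.assoc)
   then show ?thesis using b(1) by (simp add: powr_minus field_simps)
  qed
  then have "(b * ((C + 1)^2 * K2 * 2 powr ga)) * ((kap * T^2) * norm z powr (phi - 2) * S powr (-ga))
   <= b powr (-ga) * ((kap * T^2) * norm z powr (phi - 2) * S powr (-ga))"
   using kap by (intro mult_right_mono) auto
  moreover have "- lv z <= (b * ((C + 1)^2 * K2 * 2 powr ga)) * ((kap * T^2) * norm z powr (phi - 2) * S powr (-ga))"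
   using lvge[OF z(1)] by (simp add: S_def mult_ac)
  ultimately show "0 < lv z - lU z" using 1 U(2)[OF zD(2)] by (simp add: mult_ac)
 next
  fix xi and eps :: real assume xi: "xi : frontier W" "0 < eps"
  show "\<forall>\<^sub>F z in at xi within W. v z - U z < eps"
   unfolding W_def
  proof (rule cone_ball_limsup[OF D r0(1) _ _ _ _ xi[unfolded W_def], where R=1])
   show "r0 < 1" using r0 by simp
   show "continuous_on (D Int ball 0 1) (%z. v z - U z)"
    using Uc continuous_on_subset[OF has_lap_continuous[OF lv], of "D Int ball 0 1"] by (intro continuous_on_diff) auto
   fix z assume z: "z : D" "norm z = r0"
   have "v z = b * kap * norm z powr phi * G (T * e z)" unfolding vform[OF z(1)] using z(2) r0 by simp
   also have "... <= b * kap * norm z powr phi * (T * e z) powr phi" using b kap G_le by (intro mult_left_mono) auto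
   also have "... = b * (norm z powr phi * e z powr phi)"
    using T by (simp add: powr_mult kap_def powr_minus)
   also have "... <= b * C powr phi * infdist z (- D) powr phi" using b e_powr_le[OF z(1)] by (simp add: mult.assoc)
   also have "... <= cU * infdist z (- D) powr phi" using b(3) by (intro mult_right_mono) auto
   also have "... <= U z" using Ulow(2)[OF z(1)] z(2) r0 by simp
   finally show "v z - U z <= 0" by simp
  next
   fix xi and eps :: real assume xi: "xi : frontier D" and eps: "0 < eps"
   \<comment> \<open>This constant depends on \<open>T\<close>. It serves only to show that
     \<open>v\<close> vanishes at the boundary, so it does not enter the final bound.\<close>
   define K where "K = b * kap * (T + T powr phi) * C powr phi"
   have K: "K > 0" using b kap T Hb by (simp add: K_def add_pos_nonneg)
   have vd: "v z <= K * infdist z (- D) powr phi" if z: "z : D" for z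
   proof -
    have "e z <= e z powr phi" using powr_mono'[of phi 1 "e z"] e_bounds[OF z] phi by simp
    then have "T * e z + (T * e z) powr phi <= (T + T powr phi) * e z powr phi"
     using T e_bounds[OF z] by (simp add: powr_mult distrib_right)
    then have "b * kap * norm z powr phi * (T * e z + (T * e z) powr phi) <= b * kap * norm z powr phi * ((T + T powr phi) * e z powr phi)"
     using b kap by (intro mult_left_mono) auto
    also have "... = b * kap * (T + T powr phi) * (norm z powr phi * e z powr phi)" by simp
    also have "... <= b * kap * (T + T powr phi) * (C powr phi * infdist z (- D) powr phi)"
     using b kap T e_powr_le[OF z] by (intro mult_left_mono) auto
    finally show ?thesis using vle[OF z] by (simp add: K_def mult.assoc)
   qed
   have "(eps / K) powr (1 / phi) > 0" using eps K by simp
   then have "\<forall>\<^sub>F z in at xi within D. infdist z (- D) < (eps / K) powr (1 / phi)" by (rule eventually_infdist_less[OF D xi])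
   moreover have "\<forall>\<^sub>F z in at xi within D. z : D" by (simp add: eventually_at_filter)
   ultimately show "\<forall>\<^sub>F z in at xi within D. z : ball 0 r0 --> v z - U z < eps"
   proof eventually_elim
    case (elim z)
    have "infdist z (- D) powr phi < ((eps / K) powr (1 / phi)) powr phi"
     using elim phi by (intro powr_less_mono2) (auto simp: infdist_nonneg)
    also have "... = eps / K" using phi eps K by (simp add: powr_powr)
    finally have "K * infdist z (- D) powr phi < eps" using K by (simp add: field_simps)
    then have vz: "v z < eps" using vd elim by fastforce
    show ?case
    proof
     assume "z : ball 0 r0"
     then have "U z > 0" using U(3)[of z] elim r0 by auto
     then show "v z - U z < eps" using vz by simp
    qed
   qed
  qed
 qed
 have xW: "x : W" using x tau by (simp add: W_def r0_def)
 have "v x >= b * (be / 2) * T powr (1 - phi) * H x"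
 proof -
  have "norm x / r0 = exp (- tau)" using x(2) by (simp add: r0_def exp_diff[symmetric])
  then have "(norm x / r0) powr nu = exp (- 1)" using tau by (simp add: powr_def nu_def)
  moreover have "exp (- 1 :: real) <= 1/2" using exp_ge_add_one_self[of 1] by (simp add: exp_minus field_simps)
  ultimately have half: "1 - (norm x / r0) powr nu >= 1/2" by simp
  have Te: "T * e x > 0" using T e_bounds[OF x(1)] by simp
  have "be * (T * e x) * (1/2) <= be * (T * e x) * (1 - (norm x / r0) powr nu)"
   using half be Te by (intro mult_left_mono) auto
  then have "be * (T * e x) * (1/2) <= be * (T * e x) * (1 - (norm x / r0) powr nu) + G (T * e x)"
   using G_nonneg[of "T * e x"] by linarith
  then have "b * kap * norm x powr phi * (be * (T * e x) * (1/2)) <= v x"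
   unfolding vform[OF x(1)] using b kap by (intro mult_left_mono) auto
  moreover have "kap * T = T powr (1 - phi)" using T by (simp add: kap_def powr_diff powr_minus field_simps)
  then have "b * kap * norm x powr phi * (be * (T * e x) * (1/2)) = b * (be / 2) * T powr (1 - phi) * H x"
   unfolding H_e[OF x(1)] by (simp add: mult_ac)
  ultimately show ?thesis by linarith
 qed
 then show ?thesis using main[OF xW] by simp
qed

end

section \<open>Ingredients of the supersolution: the logarithmic factor and the smoothed angular
  distance\<close>

lemma has_lap_ln_norm:
 fixes V :: "'a::euclidean_space set"
 assumes V: "0 ~: V" "open V"
 shows "has_lap V (%x. ln (norm x)) (%x. x /\<^sub>R (norm x)^2) (%x. (real DIM('a) - 2) / (norm x)^2)"
proof -
 have n: "norm x > 0" if "x : V" for x using that V by auto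
 have h: "has_lap V (%x. ln ((norm (x - 0))^2) / 2) (%x. (1 / (2 * (norm (x - 0))^2)) *R (2 *R (x - 0)))
  (%x. (- 1 / (2 * ((norm (x - 0))^2)^2)) * (norm (2 *R (x - 0)))^2 + (1 / (2 * (norm (x - 0))^2)) * (2 * real DIM('a)))"
 proof (rule has_lap_comp[OF has_lap_normsq, where p="%y. ln y / 2" and p'="%y. 1 / (2 * y)" and p''="%y. - 1 / (2 * y^2)"])
  fix x assume x: "x : V"
  then have y: "(norm (x - 0))^2 > 0" using n by auto
  show "((%y. ln y / 2) has_real_derivative 1 / (2 * (norm (x - 0))^2)) (at ((norm (x - 0))^2))"
   using y by (auto intro!: derivative_eq_intros)
  show "((%y. 1 / (2 * y)) has_real_derivative - 1 / (2 * ((norm (x - 0))^2)^2)) (at ((norm (x - 0))^2))"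
   using y by (auto intro!: derivative_eq_intros simp: power2_eq_square)
 qed
 show ?thesis
 proof (rule has_lap_cong[OF h V(2)])
  fix x assume x: "x : V"
  show "ln ((norm (x - 0))^2) / 2 = ln (norm x)" using n[OF x] ln_realpow[of "norm x" 2] by simp
  show "(1 / (2 * (norm (x - 0))^2)) *R (2 *R (x - 0)) = x /\<^sub>R (norm x)^2" by (simp add: inverse_eq_divide)
  show "- 1 / (2 * ((norm (x - 0))^2)^2) * (norm (2 *R (x - 0)))^2 + 1 / (2 * (norm (x - 0))^2) * (2 * real DIM('a))
   = (real DIM('a) - 2) / (norm x)^2"
  proof -
   have a: "- 1 / (2 * y^2) * (4 * y) + 1 / (2 * y) * (2 * m) = (m - 2) / y" if "y > 0" for y m :: real
    using that by (simp add: field_simps power2_eq_square)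
   have "(norm (2 *R (x - 0)))^2 = 4 * (norm (x - 0))^2" by (simp add: power_mult_distrib)
   then show ?thesis using a[of "(norm (x - 0))^2" "real DIM('a)"] n[OF x] by simp
  qed
 qed
qed

text \<open>With \<open>u\<close> the unit vector from \<open>p\<close> to \<open>x\<close>,
  \<open>s\<close> the ratio and \<open>X\<close> the dot product of \<open>x / norm x\<close> with
  \<open>u\<close>, one finds \<open>(norm x)^2 * (norm (DS x))^2 = 1 - 2 * s * X + s^2\<close>. For
  small \<open>s\<close> the gradient is thus nondegenerate, which is not known of \<open>e\<close>.
  The distance from \<open>p\<close> bounds the curvature term of the Laplacian.\<close>

lemma has_lap_dist_ratio:
 fixes V :: "'a::euclidean_space set"
 assumes V: "0 ~: V" "open V" "p ~: V" and rho: "rho > 0"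
 obtains DS lS where "has_lap V (%x. (norm (x - p) - R) / norm x) DS lS"
  "!!x. x : V ==> 0 <= norm (x - p) - R ==> norm (x - p) - R <= norm x ==> norm (x - p) >= rho * norm x ==>
   \<bar>x \<bullet> DS x\<bar> <= 2 & (norm x)^2 * (norm (DS x))^2 >= 1 - 2 * ((norm (x - p) - R) / norm x) &
   \<bar>(norm x)^2 * lS x\<bar> <= real DIM('a) + 5 + real DIM('a) / rho"
proof -
 define n where "n = real DIM('a)"
 have n1: "n >= 1" using DIM_positive[where 'a='a] by (simp add: n_def)
 have nx: "norm x > 0" if "x : V" for x using that V by auto
 have h1: "has_lap V (%x. norm (x - p) - R) (%x. (x - p) /\<^sub>R norm (x - p) - 0) (%x. (real DIM('a) - 1) / norm (x - p) - 0)"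
  by (intro has_lap_diff has_lap_const has_lap_norm V)
 define DS where "DS x = norm x powr (-1) *R ((x - p) /\<^sub>R norm (x - p) - 0) + (norm (x - p) - R) *R ((-1 * norm x powr (-1 - 2)) *R x)" for x
 define lS where "lS x = norm x powr (-1) * ((real DIM('a) - 1) / norm (x - p) - 0)
   + (norm (x - p) - R) * (-1 * (-1 + real DIM('a) - 2) * norm x powr (-1 - 2))
   + 2 * (((-1 * norm x powr (-1 - 2)) *R x) \<bullet> ((x - p) /\<^sub>R norm (x - p) - 0))" for x
 have h2: "has_lap V (%x. norm x powr (-1) * (norm (x - p) - R)) DS lS"
  unfolding DS_def[abs_def] lS_def[abs_def] by (intro has_lap_mult has_lap_norm_powr0 V(1) h1)
 have pw: "norm x powr (-1) = 1 / norm x" "norm x powr (-1 - 2) = 1 / norm x ^ 3" if "x : V" for x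
  using nx[OF that] by (auto simp: powr_minus_divide powr_numeral)
 have h: "has_lap V (%x. (norm (x - p) - R) / norm x) DS lS"
  by (rule has_lap_cong[OF h2 V(2)]) (auto simp: pw)
 show ?thesis
 proof (rule that[OF h])
  fix x assume x: "x : V" and d: "0 <= norm (x - p) - R" "norm (x - p) - R <= norm x" and far: "norm (x - p) >= rho * norm x"
  define r where "r = norm x"
  define u where "u = (x - p) /\<^sub>R norm (x - p)"
  define s where "s = (norm (x - p) - R) / r"
  have r: "r > 0" using nx[OF x] by (simp add: r_def)
  have s: "0 <= s" "s <= 1" using d r by (auto simp: s_def r_def divide_le_eq_1)
  have sr: "norm (x - p) - R = s * r" using r by (simp add: s_def)
  have "x ~= p" using V(3) x by auto
  then have nu: "norm u = 1" by (simp add: u_def)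
  define X where "X = (x \<bullet> u) / r"
  have X: "\<bar>X\<bar> <= 1"
  proof -
   have "\<bar>x \<bullet> u\<bar> <= r" using Cauchy_Schwarz_ineq2[of x u] nu by (simp add: r_def)
   then show ?thesis using r by (simp add: X_def)
  qed
  have xu: "x \<bullet> u = X * r" using r by (simp add: X_def)
  have DSx: "DS x = (1 / r) *R (u - (s / r) *R x)"
   using r unfolding DS_def sr u_def[symmetric] r_def[symmetric] pw[OF x, folded r_def] by (simp add: algebra_simps power3_eq_cube)
  have xx: "x \<bullet> x = r^2" by (simp add: r_def power2_norm_eq_inner)
  have xDS: "x \<bullet> DS x = X - s"
   using r unfolding DSx by (simp add: inner_diff_right xu xx power2_eq_square field_simps)
  have "(norm (u - (s / r) *R x))^2 = u \<bullet> u - 2 * ((s / r) * (x \<bullet> u)) + (s / r) * ((s / r) * (x \<bullet> x))"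
   unfolding power2_norm_eq_inner by (simp add: inner_diff_left inner_diff_right inner_commute[of u x] algebra_simps)
  also have "u \<bullet> u = 1" using nu by (simp add: power2_norm_eq_inner[symmetric])
  finally have nD: "(norm (u - (s / r) *R x))^2 = 1 - 2 * (s * X) + s^2"
   unfolding xu xx using r by (simp add: power2_eq_square)
  have rD: "r^2 * (norm (DS x))^2 = 1 - 2 * (s * X) + s^2"
   unfolding DSx nD[symmetric] using r by (simp add: power_mult_distrib power_divide)
  define m where "m = (n - 1) / norm (x - p)"
  have l: "r^2 * lS x = r * ((n - 1) / norm (x - p)) - (n - 3) * s - 2 * X"
   unfolding lS_def sr u_def[symmetric] r_def[symmetric] n_def[symmetric] m_def[symmetric] pw[OF x, folded r_def] using r
   by (simp add: xu power2_eq_square power3_eq_cube field_simps)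
  have q: "0 <= r * ((n - 1) / norm (x - p))" "r * ((n - 1) / norm (x - p)) <= n / rho"
  proof -
   have pp: "rho * r > 0" "norm (x - p) > 0" using rho r V(3) x by auto
   show "0 <= r * ((n - 1) / norm (x - p))" using r n1 by simp
   have "r * ((n - 1) / norm (x - p)) <= r * (n / (rho * r))"
    using far pp n1 r by (intro mult_left_mono frac_le) (auto simp: r_def)
   also have "... = n / rho" using r rho by simp
   finally show "r * ((n - 1) / norm (x - p)) <= n / rho" .
  qed
  have "\<bar>(n - 3) * s\<bar> <= \<bar>n - 3\<bar> * 1" unfolding abs_mult using s by (intro mult_left_mono) auto
  then have "\<bar>(n - 3) * s\<bar> <= n + 3" using n1 by simp
  then have 3: "\<bar>r^2 * lS x\<bar> <= n + 5 + n / rho" unfolding l using q X by linarith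
  have "s * X <= s * 1" using s X by (intro mult_left_mono) auto
  then have 2: "r^2 * (norm (DS x))^2 >= 1 - 2 * s" unfolding rD by (simp add: add_increasing2)
  have 1: "\<bar>x \<bullet> DS x\<bar> <= 2" unfolding xDS using s X by linarith
  show "\<bar>x \<bullet> DS x\<bar> <= 2 & (norm x)^2 * (norm (DS x))^2 >= 1 - 2 * ((norm (x - p) - R) / norm x) &
   \<bar>(norm x)^2 * lS x\<bar> <= real DIM('a) + 5 + real DIM('a) / rho"
   using 1 2 3 by (simp add: r_def s_def n_def)
 qed
qed

context exponents
begin

text \<open>The added power of \<open>s\<close> has coefficient \<open>Lam q (T powr phi)\<close>,
  the value of \<open>G (T * s)\<close> at \<open>s = 1\<close>. Near the boundary its concavity
  controls the zeroth-order term \<open>lam * gs T s\<close>, which is of the same size.\<close>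

definition gs :: "real => real => real" where "gs T s = G (T * s) + Lam q (T powr phi) * s powr phi"
definition gs1 :: "real => real => real" where "gs1 T s = T * G1 (T * s) + Lam q (T powr phi) * (phi * s powr (phi - 1))"
definition gs2 :: "real => real => real" where
 "gs2 T s = T^2 * G2 (T * s) + Lam q (T powr phi) * (phi * ((phi - 1) * s powr (phi - 2)))"

lemma gs_deriv:
 assumes "T > 0" "s > 0"
 shows "(gs T has_real_derivative gs1 T s) (at s)" "(gs1 T has_real_derivative gs2 T s) (at s)"
proof -
 have l: "((%y. T * y) has_real_derivative T) (at s)" by (auto intro!: derivative_eq_intros)
 have "((%y. G (T * y)) has_real_derivative G1 (T * s) * T) (at s)"
  by (rule DERIV_chain2[OF G_deriv l]) (use assms in simp)
 from DERIV_add[OF this DERIV_cmult[OF has_real_derivative_powr[OF assms(2), of phi], of "Lam q (T powr phi)"]]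
 show "(gs T has_real_derivative gs1 T s) (at s)"
  unfolding gs_def[abs_def] gs1_def by (simp add: mult.commute)
 have "((%y. G1 (T * y)) has_real_derivative G2 (T * s) * T) (at s)"
  by (rule DERIV_chain2[OF G1_deriv l]) (use assms in simp)
 from DERIV_add[OF DERIV_cmult[OF this, of T] DERIV_cmult[OF DERIV_cmult[OF has_real_derivative_powr[OF assms(2), of "phi - 1"], of phi], of "Lam q (T powr phi)"]]
 show "(gs1 T has_real_derivative gs2 T s) (at s)"
  unfolding gs1_def[abs_def] gs2_def by (simp add: power2_eq_square mult_ac)
qed

lemma gs_mono: "T > 0 ==> 0 <= a ==> a <= b ==> gs T a <= gs T b"
 unfolding gs_def using phi by (intro add_mono G_mono mult_left_mono powr_mono2 Lam_nonneg) auto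

lemma gs_ge: "gs T s >= G (T * s)"
 unfolding gs_def using Lam_nonneg[of "T powr phi" q] by simp

text \<open>The angular part of the Laplacian of \<open>|x| powr phi * gs T s\<close>. Where \<open>s\<close> is small the concavity of \<open>gs T\<close> dominates.\<close>

lemma gs_bracket:
 assumes T: "T > 0" and s: "0 < s" "s <= 1" and lam: "lam > 0" and CS: "CS > 0"
  and X: "\<bar>X\<bar> <= 2" and Y: "Y >= 0" "Y >= 1 - 2 * s" and Z: "\<bar>Z\<bar> <= CS"
  and de: "0 < de" "de <= 1/4" "de <= (1 - phi) / (4 * (CS + 4))" "de <= phi * (1 - phi) / (16 * lam)"
 defines "br \<equiv> lam * gs T s + 2 * phi * gs1 T s * X + (gs2 T s * Y + gs1 T s * Z)"
 shows "s <= de ==> br <= - (1/8) * (T^2 * (- G2 (T * s)))"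
  "s > de ==> br <= 2 * (lam + (CS + 4) / de) * Lam q (T powr phi)"
proof -
 define L1 where "L1 = Lam q (T powr phi)"
 have L1: "L1 >= 0" by (simp add: L1_def Lam_nonneg)
 have Ts: "T * s > 0" using T s by simp
 have pw1: "s * s powr (phi - 1) = s powr phi" and pw2: "s * s powr (phi - 2) = s powr (phi - 1)"
  using s by (simp_all add: powr_diff powr_numeral power2_eq_square)
 have sp: "s powr phi <= 1" using s phi by (intro powr_le1) auto
 have gs_le: "gs T s <= 2 * L1"
 proof -
  have "G (T * s) <= G (T * 1)" using T s by (intro G_mono mult_left_mono) auto
  also have "... = L1" by (simp add: G_def L1_def)
  finally have "G (T * s) <= L1" .
  moreover have "L1 * s powr phi <= L1 * 1" using L1 sp by (intro mult_left_mono) auto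
  ultimately show ?thesis by (simp add: gs_def L1_def)
 qed
 have P: "P (T * s) > 0" by (rule P_pos[OF Ts])
 have G1p: "G1 (T * s) = phi * ((T * s) * P (T * s))" by (rule G1_P[OF Ts])
 have G2p: "- G2 (T * s) >= phi * (1 - phi) * P (T * s)" by (rule G2_P(1)[OF Ts])
 have G2n: "- G2 (T * s) >= 0"
  using G2p P phi by (smt (verit) mult_nonneg_nonneg)
 have gs1n: "gs1 T s >= 0" unfolding gs1_def using T s phi P L1 by (simp add: G1p L1_def)
 have sg1: "s * gs1 T s <= phi * gs T s"
 proof -
  have "s * gs1 T s = (T * s) * G1 (T * s) + L1 * (phi * (s * s powr (phi - 1)))"
   by (simp add: gs1_def L1_def algebra_simps)
  also have "... <= phi * G (T * s) + L1 * (phi * s powr phi)"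
   unfolding pw1 using G1_le[OF Ts] by simp
  finally show ?thesis by (simp add: gs_def L1_def algebra_simps)
 qed
 \<comment> \<open>Both summands of \<open>gs T\<close> have second derivative at least
   \<open>(1 - phi) / s\<close> times the first derivative in absolute value; for small
   \<open>s\<close> this absorbs the first-order terms.\<close>
 have g2: "(1 - phi) * gs1 T s <= s * (- gs2 T s)"
 proof -
  have "s * (T^2 * (phi * (1 - phi) * P (T * s))) <= s * (T^2 * (- G2 (T * s)))"
   using s G2p by (intro mult_left_mono) auto
  moreover have "s * (T^2 * (phi * (1 - phi) * P (T * s))) = (1 - phi) * (T * G1 (T * s))"
   by (simp add: G1p power2_eq_square)
  moreover have "s * (L1 * (phi * ((1 - phi) * s powr (phi - 2)))) = (1 - phi) * (L1 * (phi * s powr (phi - 1)))"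
   unfolding pw2[symmetric] by (simp only: mult_ac)
  ultimately show ?thesis by (simp add: gs1_def gs2_def L1_def algebra_simps)
 qed
 have g2n: "- gs2 T s >= T^2 * (- G2 (T * s)) + phi * (1 - phi) * (L1 * s powr (phi - 2))"
  by (simp add: gs2_def L1_def algebra_simps)
 have L1s: "L1 * s powr (phi - 2) >= 0" using L1 by simp
 have g2n0: "- gs2 T s >= T^2 * (- G2 (T * s))" "T^2 * (- G2 (T * s)) >= 0" "- gs2 T s >= phi * (1 - phi) * (L1 * s powr (phi - 2))"
 proof -
  show a: "T^2 * (- G2 (T * s)) >= 0" using G2n by (intro mult_nonneg_nonneg) auto
  have "phi * (1 - phi) * (L1 * s powr (phi - 2)) >= 0" using phi L1 by (intro mult_nonneg_nonneg) auto
  then show "- gs2 T s >= T^2 * (- G2 (T * s))" "- gs2 T s >= phi * (1 - phi) * (L1 * s powr (phi - 2))" using g2n a by linarith+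
 qed
 have lin: "2 * phi * gs1 T s * X + gs1 T s * Z <= (CS + 4) * gs1 T s"
 proof -
  have "2 * phi * gs1 T s * X <= 2 * phi * gs1 T s * 2" using X gs1n phi by (intro mult_left_mono) auto
  also have "... <= 2 * 1 * gs1 T s * 2" using gs1n phi by (intro mult_right_mono mult_left_mono) auto
  finally have "2 * phi * gs1 T s * X <= 4 * gs1 T s" by simp
  moreover have "gs1 T s * Z <= gs1 T s * CS" using Z gs1n by (intro mult_left_mono) auto
  ultimately show ?thesis by (simp add: algebra_simps)
 qed
 have lgs: "lam * gs T s <= lam * (2 * L1)" using lam gs_le by (intro mult_left_mono) auto
 show "br <= - (1/8) * (T^2 * (- G2 (T * s)))" if sd: "s <= de"
 proof -
  define M where "M = - gs2 T s"
  have M: "M >= 0" using g2n0 by (simp add: M_def)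
  have "Y >= 1/2" using Y(2) sd de(2) by linarith
  then have m1: "gs2 T s * Y <= - (1/2) * M" using mult_left_mono[of "1/2" Y M] M by (simp add: M_def)
  have "(1 - phi) * ((CS + 4) * gs1 T s) <= (CS + 4) * (s * M)"
   using mult_left_mono[OF g2, of "CS + 4"] CS by (simp add: M_def mult_ac)
  also have "... <= (CS + 4) * (de * M)" using CS sd M by (intro mult_left_mono mult_right_mono) auto
  also have "... <= (1 - phi) * (M / 4)"
  proof -
   have "(CS + 4) * de <= (1 - phi) / 4" using de(3) CS by (simp add: field_simps)
   from mult_right_mono[OF this M] show ?thesis by (simp add: mult_ac)
  qed
  finally have m2: "(CS + 4) * gs1 T s <= M / 4" using phi by simp
  have m3: "lam * (2 * L1) <= M / 8"
  proof -
   have "de powr (-1) <= s powr (-1)" using s sd by (intro powr_mono2') auto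
   also have "... <= s powr (phi - 2)" using s phi by (intro powr_mono') auto
   finally have "1 / de <= s powr (phi - 2)" using de by (simp add: powr_minus_divide)
   then have "phi * (1 - phi) * (L1 * (1 / de)) <= phi * (1 - phi) * (L1 * s powr (phi - 2))"
    using phi L1 by (intro mult_left_mono) auto
   then have a: "phi * (1 - phi) * (L1 * (1 / de)) <= M" using g2n0 by (simp add: M_def)
   have "16 * lam <= phi * (1 - phi) / de" using de lam by (simp add: field_simps)
   then have "16 * lam * L1 <= phi * (1 - phi) / de * L1" using L1 by (intro mult_right_mono) auto
   then show ?thesis using a by simp
  qed
  \<comment> \<open>The concavity gives \<open>- M / 2\<close> because \<open>Y >= 1/2\<close>;
    first-order terms take \<open>M / 4\<close> and the zeroth-order term
    \<open>M / 8\<close>.\<close>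
  have "br <= M / 8 + M / 4 - (1/2) * M" unfolding br_def using lgs lin m1 m2 m3 by linarith
  also have "... = - (1/8) * M" by simp
  finally show ?thesis using g2n0(1) by (simp add: M_def)
 qed
 show "br <= 2 * (lam + (CS + 4) / de) * Lam q (T powr phi)" if sd: "s > de"
 proof -
  have "gs2 T s * Y <= 0" using g2n0 Y(1) by (intro mult_nonpos_nonneg) auto
  moreover have "gs1 T s <= 2 * L1 / de"
  proof -
   have "de * gs1 T s <= s * gs1 T s" using sd gs1n by (intro mult_right_mono) auto
   also have "... <= phi * gs T s" by (rule sg1)
   also have "... <= 1 * (2 * L1)" using phi gs_le L1 gs_ge[of T s] G_nonneg[of "T * s"] by (intro mult_mono) auto
   finally show ?thesis using de by (simp add: field_simps)
  qed
  then have "(CS + 4) * gs1 T s <= (CS + 4) * (2 * L1 / de)" using CS by (intro mult_left_mono) auto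
  ultimately have "br <= lam * (2 * L1) + (CS + 4) * (2 * L1 / de)" unfolding br_def using lgs lin by linarith
  also have "... = 2 * (lam + (CS + 4) / de) * L1" by (simp add: algebra_simps add_divide_distrib)
  finally show ?thesis by (simp add: L1_def)
 qed
qed

end

context cone_profile
begin

definition CS :: real where "CS = n + 5 + n / rho"

text \<open>The distance \<open>d\<close> to the complement is not differentiable. At a maximum point of \<open>U - Vb\<close> it is replaced by the
 distance to an exterior ball touching at a nearest boundary point.\<close>

lemma supersolution_bound:
 assumes tau: "tau >= 1" and T: "T >= 1" "k > 0" "k * Lam q (T powr phi) <= T / tau"
  and de: "0 < de" "de <= 1/4" "de <= (1 - phi) / (4 * (CS + 4))" "de <= phi * (1 - phi) / (16 * lam)"
  and B: "B > 0" "B * cG >= CU" "(B * cG) powr (-ga) <= B * (phi * (1 - phi) * 2 powr (q - 1)) / 8"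
  and A: "A * c >= B" "A * N * c * de * k >= 4 * B * (lam + (CS + 4) / de)"
   "(A * c * de) powr (-ga) <= A * N * c * de * k / 2 * 2 powr (q - 1)"
  and x: "x : D" "norm x = exp (- tau)" "norm x < 1/16"
 shows "U x <= 2 * A * T powr (1 - phi) * H x + 2 * B * infdist x (- D) powr phi"
proof -
 define kap where "kap = T powr (-phi)"
 have T0: "T > 0" using T by simp
 have kap: "kap > 0" using T0 by (simp add: kap_def)
 have kapT: "T powr (1 - phi) = kap * T" using T0 by (simp add: kap_def powr_diff powr_minus field_simps)
 define L1 where "L1 = Lam q (T powr phi)"
 have L1: "L1 >= 0" by (simp add: L1_def Lam_nonneg)
 have CS: "CS > 0" using n rho by (simp add: CS_def add_pos_nonneg)
 have A0: "A > 0" using A(1) B(1) Hb(1) by (smt (verit) zero_less_mult_pos2)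
 define W where "W = D Int ball 0 (1/16)"
 have W: "open W" "W <= D" "W <= D Int ball 0 1" "bounded W"
  using oD by (auto simp: W_def open_Int intro: bounded_subset[OF bounded_ball[of 0 "1/16::real"]])
 define d where "d z = infdist z (- D)" for z
 have d: "0 < d z" "d z <= norm z" if "z : D" for z using infdist_cone_bounds[OF D that] by (auto simp: d_def)
 \<comment> \<open>The coefficient of \<open>H\<close> is proportional to \<open>1 + t / tau\<close>
   with \<open>t = ln (1 / norm z)\<close>, hence to 2 at \<open>t = tau\<close>. The logarithm
   makes the first term superharmonic with Laplacian of size \<open>N * T / tau\<close>, which pays
   where the angular profile is not concave enough.\<close>
 define V where "V S z = A * (kap * T) * ((1 - (1 / tau) * ln (norm z)) * H z) + B * kap * (norm z powr phi * gs T (S z))" for S z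
 define Vb where "Vb = V (%z. d z / norm z)"
 have ln_neg: "1 - (1 / tau) * ln (norm z) >= 1" if "z : D" "norm z <= 1" for z
  using that nx[of z] tau by (simp add: divide_nonpos_pos)
 have V_ge: "Vb z >= kap * norm z powr phi * (A * (T * e z) + B * G (T * (d z / norm z)))" if z: "z : D" "norm z <= 1" for z
 proof -
  have "1 * H z <= (1 - (1 / tau) * ln (norm z)) * H z" using ln_neg[OF z] Hpos[OF z(1)] by (intro mult_right_mono) auto
  then have "A * (kap * T) * (1 * H z) <= A * (kap * T) * ((1 - (1 / tau) * ln (norm z)) * H z)"
   using A0 kap T0 by (intro mult_left_mono) auto
  moreover have "B * kap * (norm z powr phi * G (T * (d z / norm z))) <= B * kap * (norm z powr phi * gs T (d z / norm z))"
   using B kap by (intro mult_left_mono gs_ge) auto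
  ultimately have "A * (kap * T) * (1 * H z) + B * kap * (norm z powr phi * G (T * (d z / norm z))) <= Vb z"
   by (simp add: Vb_def V_def)
  then show ?thesis unfolding H_e[OF z(1)] by (simp add: algebra_simps)
 qed
 have V_ge1: "Vb z >= kap * norm z powr phi * (B * cG * (T * (d z / norm z) + (T * (d z / norm z)) powr phi))"
  if z: "z : D" "norm z <= 1" for z
 proof -
  define w where "w = T * (d z / norm z)"
  have w: "w > 0" using T0 d[OF z(1)] nx[OF z(1)] by (simp add: w_def)
  have "B * w <= (A * c) * w" using A(1) w by (intro mult_right_mono) auto
  also have "... = A * (T * (c * (d z / norm z)))" by (simp add: w_def)
  also have "... <= A * (T * e z)" using A0 T0 e_bounds(3)[OF z(1)] by (intro mult_left_mono) (auto simp: d_def)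
  finally have "B * w <= A * (T * e z)" .
  moreover have "B * (cG * (w + w powr phi)) <= B * (G w + w)" using B G_lower[OF w] by (intro mult_left_mono) auto
  ultimately have "B * cG * (w + w powr phi) <= A * (T * e z) + B * G w" by (simp add: algebra_simps)
  then have "kap * norm z powr phi * (B * cG * (w + w powr phi)) <= kap * norm z powr phi * (A * (T * e z) + B * G w)"
   using kap by (intro mult_left_mono) auto
  then show ?thesis using V_ge[OF z] by (simp add: w_def)
 qed
 have V_ge2: "Vb z >= kap * T * norm z powr phi * (A * c * (d z / norm z))" if z: "z : D" "norm z <= 1" for z
 proof -
  have "A * (T * (c * (d z / norm z))) <= A * (T * e z)"
   using A0 T0 e_bounds(3)[OF z(1)] by (intro mult_left_mono) (auto simp: d_def)
  moreover have "0 <= B * G (T * (d z / norm z))" using B G_nonneg by simp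
  ultimately have "A * (T * (c * (d z / norm z))) <= A * (T * e z) + B * G (T * (d z / norm z))" by linarith
  then have "kap * norm z powr phi * (A * (T * (c * (d z / norm z)))) <= kap * norm z powr phi * (A * (T * e z) + B * G (T * (d z / norm z)))"
   using kap by (intro mult_left_mono) auto
  then show ?thesis using V_ge[OF z] by (simp add: mult_ac)
 qed
 have V_pos: "Vb z > 0" if z: "z : D" "norm z <= 1" for z
 proof -
  have "kap * T * norm z powr phi * (A * c * (d z / norm z)) > 0"
   using kap T0 A0 Hb(1) d[OF z(1)] nx[OF z(1)] by simp
  then show ?thesis using V_ge2[OF z] by linarith
 qed
 have Vc: "continuous_on (D Int ball 0 1) Vb"
 proof -
  have h: "continuous_on (D Int ball 0 1) H" using has_lap_continuous[OF H(2)] by (rule continuous_on_subset) auto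
  have g: "continuous_on {0<..} (gs T)"
   by (rule continuous_at_imp_continuous_on) (use gs_deriv(1)[OF T0] DERIV_isCont in blast)
  have s: "continuous_on (D Int ball 0 1) (%z. d z / norm z)"
   unfolding d_def using oD by (intro continuous_intros) auto
  have "continuous_on (D Int ball 0 1) (%z. gs T (d z / norm z))"
   by (rule continuous_on_compose2[OF g s]) (use d nx in auto)
  then show ?thesis unfolding Vb_def V_def using oD tau by (intro continuous_intros h) auto
 qed
 have main: "U z - Vb z <= 0" if zW: "z : W" for z
 proof (rule no_interior_max_imp_nonpos[OF W(4) _ _ W(1) _ zW])
  show "continuous_on W (%z. U z - Vb z)"
   using Uc Vc W(3) by (intro continuous_on_diff) (auto intro: continuous_on_subset)
  fix xi and eps :: real assume xi: "xi : frontier W" "0 < eps"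
  show "\<forall>\<^sub>F z in at xi within W. U z - Vb z < eps"
   unfolding W_def
  proof (rule cone_ball_limsup[OF D _ _ _ _ _ xi[unfolded W_def], where R=1])
   show "continuous_on (D Int ball 0 1) (%z. U z - Vb z)" using Uc Vc by (intro continuous_on_diff)
   fix z assume z: "z : D" "norm z = 1/16"
   have "U z <= CU * d z powr phi" using Uup(2)[OF z] by (simp add: d_def)
   also have "... <= B * cG * d z powr phi" using B(2) by (intro mult_right_mono) auto
   also have "... = kap * norm z powr phi * (B * cG * (T * (d z / norm z)) powr phi)"
   proof -
    have "norm z powr phi * (d z / norm z) powr phi = d z powr phi"
     using d[OF z(1)] nx[OF z(1)] by (simp add: powr_divide)
    moreover have "kap * T powr phi = 1" using T0 by (simp add: kap_def powr_add[symmetric])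
    moreover have "kap * norm z powr phi * (B * cG * (T * (d z / norm z)) powr phi)
     = B * cG * ((kap * T powr phi) * (norm z powr phi * (d z / norm z) powr phi))"
     using T0 d[OF z(1)] by (simp add: powr_mult powr_divide)
    ultimately show ?thesis by (metis mult.right_neutral mult_1)
   qed
   also have "... <= kap * norm z powr phi * (B * cG * (T * (d z / norm z) + (T * (d z / norm z)) powr phi))"
    using kap B cG_pos T0 d[OF z(1)] by (intro mult_left_mono) auto
   also have "... <= Vb z" by (rule V_ge1[OF z(1)]) (use z(2) in simp)
   finally show "U z - Vb z <= 0" by simp
  next
   fix xi and eps :: real assume xi: "xi : frontier D" "norm xi <= 1/16" and eps: "0 < eps"
   have "\<forall>\<^sub>F z in at xi within D. U z < eps" using U0[OF xi(1) _ eps] xi(2) by simp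
   moreover have "\<forall>\<^sub>F z in at xi within D. z : D" by (simp add: eventually_at_filter)
   ultimately show "\<forall>\<^sub>F z in at xi within D. z : ball 0 (1/16) --> U z - Vb z < eps"
   proof eventually_elim
    case (elim z)
    then show ?case using V_pos[of z] by auto
   qed
  qed auto
 next
  fix z0 assume z0: "z0 : W" "0 < U z0 - Vb z0"
  then have zD: "z0 : D" "z0 : D Int ball 0 1" "norm z0 <= 1" using W by (auto simp: W_def)
  show "EX z:W. U z0 - Vb z0 < U z - Vb z"
  proof (rule ccontr)
   assume "~ ?thesis"
   then have mx: "U z - Vb z <= U z0 - Vb z0" if "z : W" for z using that by force
   obtain p R where p: "norm (z0 - p) - R = d z0" "!!z. z : D ==> norm (z - p) - R >= d z"
    "norm (z0 - p) >= rho * norm z0" "p ~: D" using touching_exterior_ball[OF D zD(1)] unfolding d_def by blast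
   define S where "S z = (norm (z - p) - R) / norm z" for z
   obtain DS lS where S: "has_lap W S DS lS"
    and Sb: "!!x. x : W ==> 0 <= norm (x - p) - R ==> norm (x - p) - R <= norm x ==> norm (x - p) >= rho * norm x ==>
     \<bar>x \<bullet> DS x\<bar> <= 2 & (norm x)^2 * (norm (DS x))^2 >= 1 - 2 * ((norm (x - p) - R) / norm x) &
     \<bar>(norm x)^2 * lS x\<bar> <= real DIM('a) + 5 + real DIM('a) / rho"
    using has_lap_dist_ratio[of W p rho R] W oD p(4) rho unfolding S_def[abs_def] by blast
   have Spos: "S z > 0" "S z >= d z / norm z" if "z : W" for z
   proof -
    have zD: "z : D" using that W by auto
    show "S z >= d z / norm z" unfolding S_def using p(2)[OF zD] nx[OF zD] by (intro divide_right_mono) auto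
    moreover have "d z / norm z > 0" using d[OF zD] nx[OF zD] by simp
    ultimately show "S z > 0" by linarith
   qed
   have S0: "S z0 = d z0 / norm z0" by (simp add: S_def p(1))
   define s where "s = S z0"
   have s: "0 < s" "s <= 1" using d[OF zD(1)] nx[OF zD(1)] by (auto simp: s_def S0)
   \<comment> \<open>\<open>gs T\<close> is nondecreasing, so replacing the distance by the larger
     smooth function raises \<open>Vb\<close>, without changing it at \<open>z0\<close>. Thus
     \<open>z0\<close> also maximises \<open>U - V S\<close>, where second derivatives
     exist.\<close>
   have max: "U z - V S z <= U z0 - V S z0" if z: "z : W" for z
   proof -
    have zD: "z : D" using z W by auto
    have "gs T (d z / norm z) <= gs T (S z)" using Spos[OF z] d[OF zD] nx[OF zD] T0 by (intro gs_mono) auto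
    then have "Vb z <= V S z" unfolding Vb_def V_def using B kap by (intro add_left_mono mult_left_mono) auto
    moreover have "V S z0 = Vb z0" by (simp add: Vb_def V_def S0)
    ultimately show ?thesis using mx[OF z] by simp
   qed
   obtain DG where DG: "has_lap W (%x. norm x powr phi * gs T (S x)) DG
    (%x. norm x powr (phi - 2) * (phi * (phi + real DIM('a) - 2) * gs T (S x) + 2 * phi * gs1 T (S x) * (x \<bullet> DS x)
     + (norm x)^2 * (gs2 T (S x) * (norm (DS x))^2 + gs1 T (S x) * lS x)))"
    using has_lap_powr_mult_comp[OF _ W(1) S, of "gs T" "gs1 T" "gs2 T" phi] gs_deriv[OF T0 Spos(1)] W oD by blast
   define lV where "lV x = A * (kap * T) * ((1 - (1 / tau) * ln (norm x)) * 0 + H x * (0 - (1 / tau) * ((real DIM('a) - 2) / (norm x)^2))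
     + 2 * ((0 - (1 / tau) *R (x /\<^sub>R (norm x)^2)) \<bullet> EH x))
    + B * kap * (norm x powr (phi - 2) * (phi * (phi + real DIM('a) - 2) * gs T (S x) + 2 * phi * gs1 T (S x) * (x \<bullet> DS x)
     + (norm x)^2 * (gs2 T (S x) * (norm (DS x))^2 + gs1 T (S x) * lS x)))" for x
   have W0: "0 ~: W" using W oD by blast
   have "EX DV. has_lap W (V S) DV lV"
    unfolding lV_def[abs_def] V_def[abs_def]
    using has_lap_add[OF has_lap_cmult[OF has_lap_mult[OF has_lap_diff[OF has_lap_const[of W 1]
     has_lap_cmult[OF has_lap_ln_norm[OF W0 W(1)], of "1 / tau"]] has_lap_subset[OF H(2) W(2)]], of "A * (kap * T)"]
     has_lap_cmult[OF DG, of "B * kap"]] by blast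
   then obtain DV where DV: "has_lap W (V S) DV lV" by blast
   have lU: "lU z0 - lV z0 <= 0"
    by (rule has_lap_max[OF has_lap_diff[OF has_lap_subset[OF U(1) W(3)] DV] W(1) z0(1) max])
   define r where "r = norm z0"
   have r: "r > 0" using nx[OF zD(1)] by (simp add: r_def)
   define br where "br = lam * gs T s + 2 * phi * gs1 T s * (z0 \<bullet> DS z0) + (gs2 T s * (r^2 * (norm (DS z0))^2) + gs1 T s * (r^2 * lS z0))"
   have lV: "- lV z0 = kap * r powr (phi - 2) * (A * (T / tau) * N * e z0 - B * br)"
   proof -
    have zEH: "z0 \<bullet> EH z0 = phi * H z0" using EH_radial[OF zD(1)] by (simp add: inner_commute)
    have pw: "r powr (phi - 2) = r powr phi / r^2" using r by (simp add: powr_diff powr_numeral)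
    have "H z0 * (0 - (1 / tau) * ((n - 2) / r^2)) + 2 * ((0 - (1 / tau) *R (z0 /\<^sub>R r^2)) \<bullet> EH z0)
     = - (N * (H z0 / r^2) / tau)"
     using zEH by (simp add: N_def inverse_eq_divide algebra_simps add_divide_distrib diff_divide_distrib)
    also have "H z0 / r^2 = r powr (phi - 2) * e z0" unfolding H_e[OF zD(1)] pw r_def[symmetric] by simp
    finally have 1: "H z0 * (0 - (1 / tau) * ((n - 2) / r^2)) + 2 * ((0 - (1 / tau) *R (z0 /\<^sub>R r^2)) \<bullet> EH z0)
     = - (N * (r powr (phi - 2) * e z0) / tau)" .
    have 2: "phi * (phi + n - 2) * gs T s + 2 * phi * gs1 T s * (z0 \<bullet> DS z0)
     + r^2 * (gs2 T s * (norm (DS z0))^2 + gs1 T s * lS z0) = br"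
     by (simp add: br_def lam_def algebra_simps)
    have "lV z0 = A * (kap * T) * (H z0 * (0 - (1 / tau) * ((n - 2) / r^2)) + 2 * ((0 - (1 / tau) *R (z0 /\<^sub>R r^2)) \<bullet> EH z0))
     + B * kap * (r powr (phi - 2) * (phi * (phi + n - 2) * gs T s + 2 * phi * gs1 T s * (z0 \<bullet> DS z0)
     + r^2 * (gs2 T s * (norm (DS z0))^2 + gs1 T s * lS z0)))"
     unfolding lV_def n_def r_def s_def by simp
    then show ?thesis unfolding 1 2 by (simp add: algebra_simps)
   qed
   have Zb: "\<bar>z0 \<bullet> DS z0\<bar> <= 2" "r^2 * (norm (DS z0))^2 >= 1 - 2 * s" "\<bar>r^2 * lS z0\<bar> <= CS"
    using Sb[OF z0(1)] p(1,3) d[OF zD(1)] unfolding r_def s_def S_def CS_def n_def by auto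
   have Y0: "r^2 * (norm (DS z0))^2 >= 0" by simp
   have br1: "br <= - (1/8) * (T^2 * (- G2 (T * s)))" if "s <= de"
    unfolding br_def by (rule gs_bracket(1)[OF T0 s lam CS Zb(1) Y0 Zb(2,3) de that])
   have br2: "br <= 2 * (lam + (CS + 4) / de) * L1" if "s > de"
    unfolding br_def L1_def by (rule gs_bracket(2)[OF T0 s lam CS Zb(1) Y0 Zb(2,3) de that])
   have rg: "(r powr phi) powr (-ga) = r powr (phi - 2)" using phiga(1) by (simp add: powr_powr)
   have Upow: "U z0 powr (-ga) < Vb z0 powr (-ga)"
    using z0(2) V_pos[OF zD(1,3)] ga by (intro powr_neg_strict_antimono) auto
   have "Vb z0 powr (-ga) <= - lV z0"
   proof (cases "s <= de")
    case True
    \<comment> \<open>Close to the boundary: the strict concavity of \<open>G (T * s)\<close> alone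
      dominates the singular term of \<open>Vb\<close>, by the choice of \<open>B\<close>.\<close>
    define z where "z = T * s"
    have z: "z > 0" using T0 s by (simp add: z_def)
    define ZZ where "ZZ = z + z powr phi"
    have ZZ: "ZZ > 0" using z by (simp add: ZZ_def add_pos_nonneg)
    have "Vb z0 >= (kap * r powr phi) * ((B * cG) * ZZ)"
     using V_ge1[OF zD(1,3)] by (simp add: z_def ZZ_def s_def S0 r_def)
    moreover have "(kap * r powr phi) * ((B * cG) * ZZ) > 0" using kap r B cG_pos ZZ by simp
    ultimately have "Vb z0 powr (-ga) <= ((kap * r powr phi) * ((B * cG) * ZZ)) powr (-ga)"
     using ga by (intro powr_mono2') auto
    also have "... = (kap * T^2) * r powr (phi - 2) * ((B * cG) powr (-ga) * ZZ powr (-ga))"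
     using kap r B cG_pos ZZ by (simp add: powr_mult rg kappa_power[OF T0, folded kap_def])
    also have "... <= (kap * T^2) * r powr (phi - 2) * ((B * (phi * (1 - phi) * 2 powr (q - 1)) / 8) * ZZ powr (-ga))"
     using kap B(3) by (intro mult_left_mono mult_right_mono) auto
    also have "... = kap * r powr (phi - 2) * (B * ((1/8) * (T^2 * (phi * (1 - phi) * (2 powr (q - 1) * ZZ powr (-ga))))))"
     by (simp add: mult_ac)
    also have "... <= kap * r powr (phi - 2) * (B * ((1/8) * (T^2 * (- G2 z))))"
    proof -
     have "phi * (1 - phi) * (2 powr (q - 1) * ZZ powr (-ga)) <= phi * (1 - phi) * P z"
      using phi P_bounds(2)[OF z] by (intro mult_left_mono) (auto simp: ZZ_def)
     also have "... <= - G2 z" by (rule G2_P(1)[OF z])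
     finally show ?thesis using kap B by (intro mult_left_mono) auto
    qed
    also have "... <= kap * r powr (phi - 2) * (A * (T / tau) * N * e z0 - B * br)"
    proof -
     have "0 <= A * (T / tau) * N * e z0" using A0 T0 tau N e_bounds(1)[OF zD(1)] by simp
     moreover have "B * br <= B * (- (1/8) * (T^2 * (- G2 z)))"
      using br1[OF True] B by (intro mult_left_mono) (auto simp: z_def)
     ultimately have "B * ((1/8) * (T^2 * (- G2 z))) <= A * (T / tau) * N * e z0 - B * br" by simp
     then show ?thesis using kap by (intro mult_left_mono) auto
    qed
    finally show ?thesis by (simp add: lV)
   next
    case False
    then have sd: "s > de" by simp
    \<comment> \<open>Away from the boundary the logarithmic term is at least
      \<open>A * N * c * de * k * Lam q (T powr phi)\<close>. One half pays for the bracket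
      \<open>br\<close>, the other for the singular term of \<open>Vb\<close>, by the choice of
      \<open>A\<close>.\<close>
    have cs: "c * de <= e z0"
    proof -
     have "c * de <= c * s" using sd Hb(1) by (intro mult_left_mono) auto
     also have "... <= e z0" using e_bounds(3)[OF zD(1)] by (simp add: s_def S0 d_def)
     finally show ?thesis .
    qed
    have "kap * T * r powr phi * (A * c * de) <= kap * T * r powr phi * (A * c * s)"
     using sd Hb(1) A0 kap T0 by (intro mult_left_mono) auto
    also have "... <= Vb z0" using V_ge2[OF zD(1,3)] by (simp add: s_def S0 r_def)
    finally have "Vb z0 >= (kap * T) * r powr phi * (A * c * de)" .
    moreover have "(kap * T) * r powr phi * (A * c * de) > 0" using kap r A0 Hb(1) de(1) T0 by simp
    ultimately have "Vb z0 powr (-ga) <= ((kap * T) * r powr phi * (A * c * de)) powr (-ga)"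
     using ga by (intro powr_mono2') auto
    also have "... = (kap * T) powr (-ga) * r powr (phi - 2) * (A * c * de) powr (-ga)"
     using kap T0 r A0 Hb(1) de(1) by (simp add: powr_mult rg)
    also have "(kap * T) powr (-ga) = T powr (- ga * (1 - phi))"
     unfolding kapT[symmetric] powr_powr by (simp add: mult.commute)
    also have "T powr (- ga * (1 - phi)) * r powr (phi - 2) * (A * c * de) powr (-ga)
     <= T powr (- ga * (1 - phi)) * r powr (phi - 2) * (A * N * c * de * k / 2 * 2 powr (q - 1))"
     using A(3) by (intro mult_left_mono) auto
    also have "... = (2 powr (q - 1) * T powr (- ga * (1 - phi))) * (r powr (phi - 2) * (A * N * c * de * k / 2))"
     by (simp only: mult_ac)
    also have "... <= (kap * L1) * (r powr (phi - 2) * (A * N * c * de * k / 2))"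
     using LamT_ge[OF T(1)] A0 N Hb(1) de(1) T(2) by (intro mult_right_mono) (auto simp: kap_def L1_def)
    also have "... = kap * r powr (phi - 2) * (A * N * c * de * k / 2 * L1)" by (simp only: mult_ac)
    also have "... <= kap * r powr (phi - 2) * (A * (T / tau) * N * e z0 - B * br)"
    proof -
     have "A * N * c * de * k * L1 = (A * N) * ((k * L1) * (c * de))" by (simp only: mult_ac)
     also have "... <= (A * N) * ((T / tau) * e z0)"
      using T(2,3) cs A0 N Hb(1) de(1) L1 T0 tau by (intro mult_left_mono mult_mono) (auto simp: L1_def)
     finally have "A * N * c * de * k * L1 <= A * (T / tau) * N * e z0" by (simp add: mult_ac)
     moreover have "B * br <= B * (2 * (lam + (CS + 4) / de) * L1)"
      using br2[OF sd] B by (intro mult_left_mono) auto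
     moreover have "4 * B * (lam + (CS + 4) / de) * L1 <= A * N * c * de * k * L1"
      using A(2) L1 by (intro mult_right_mono) auto
     moreover have "B * (2 * (lam + (CS + 4) / de) * L1) = (4 * B * (lam + (CS + 4) / de) * L1) / 2" by simp
     moreover have "A * N * c * de * k / 2 * L1 = (A * N * c * de * k * L1) / 2" by simp
     ultimately have "A * N * c * de * k / 2 * L1 <= A * (T / tau) * N * e z0 - B * br" by argo
     then show ?thesis using kap by (intro mult_left_mono) auto
    qed
    finally show ?thesis by (simp add: lV)
   qed
   then show False using Upow lU U(2)[OF zD(2)] by simp
  qed
 qed
 have xW: "x : W" using x by (simp add: W_def)
 have "Vb x <= 2 * A * T powr (1 - phi) * H x + 2 * B * d x powr phi"
 proof -
  have "ln (norm x) = - tau" using x(2) by simp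
  then have l: "1 - (1 / tau) * ln (norm x) = 2" using tau by simp
  define s where "s = d x / norm x"
  have s: "0 < s" using d[OF x(1)] nx[OF x(1)] by (simp add: s_def)
  have "kap * gs T s <= kap * ((T * s) powr phi + L1 * s powr phi)"
   using kap G_le by (intro mult_left_mono) (auto simp: gs_def L1_def)
  also have "... = (kap * T powr phi) * s powr phi + (kap * L1) * s powr phi"
   using T0 s by (simp add: powr_mult algebra_simps)
  also have "kap * T powr phi = 1" using T0 by (simp add: kap_def powr_add[symmetric])
  also have "(kap * L1) * s powr phi <= 1 * s powr phi"
   using LamT_le[OF T0] by (intro mult_right_mono) (auto simp: kap_def L1_def)
  finally have g: "kap * gs T s <= 2 * s powr phi" by simp
  have "Vb x = 2 * A * T powr (1 - phi) * H x + (B * norm x powr phi) * (kap * gs T s)"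
   unfolding Vb_def V_def l kapT s_def by simp
  also have "(B * norm x powr phi) * (kap * gs T s) <= (B * norm x powr phi) * (2 * s powr phi)"
   using g B by (intro mult_left_mono) auto
  also have "(B * norm x powr phi) * (2 * s powr phi) = 2 * B * d x powr phi"
   using d[OF x(1)] nx[OF x(1)] by (simp add: s_def powr_divide)
  finally show ?thesis by simp
 qed
 then show ?thesis using main[OF xW] by (simp add: d_def)
qed

end

context exponents
begin

text \<open>The solution of \<open>T / t \<approx> Lam q (T powr phi)\<close>; \<open>1 / Tsc t\<close> is the angular threshold.\<close>

definition Tsc :: "real => real" where
 "Tsc t = (if ga < 2 then t powr (1 / (ga - 1)) else if ga = 2 then t * ln t else t)"

lemma Lam_case_lt2:
 assumes g: "ga < 2" and y: "y >= 1"
 shows "y powr q <= 2 powr (1 - q) * Lam q y" "q / 2 powr q * Lam q y <= y powr q" "q > 0"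
proof -
 show q: "q > 0" using g phi by (simp add: q_def)
 have "(2 * y) powr (q - 1) <= (1 + y) powr (q - 1)" using q1 y by (intro powr_mono2') auto
 then have "y * (2 * y) powr (q - 1) <= y * (1 + y) powr (q - 1)" using y by (intro mult_left_mono) auto
 also have "... <= Lam q y" using q1 y by (intro Lam_concave) auto
 finally have "y * (2 * y) powr (q - 1) <= Lam q y" .
 then have "2 powr (1 - q) * (y * (2 * y) powr (q - 1)) <= 2 powr (1 - q) * Lam q y" by (intro mult_left_mono) auto
 moreover have "2 powr (1 - q) * (y * (2 * y) powr (q - 1)) = y powr q"
  using y by (simp add: powr_mult powr_diff)
 ultimately show "y powr q <= 2 powr (1 - q) * Lam q y" by simp
 have "(1 + y) powr q <= (2 * y) powr q" using q y by (intro powr_mono2) auto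
 then have "Lam q y <= (2 * y) powr q / q" using q by (simp add: Lam_def divide_right_mono)
 then have "q / 2 powr q * Lam q y <= q / 2 powr q * ((2 * y) powr q / q)" using q by (intro mult_left_mono) auto
 also have "... = y powr q" using q y by (simp add: powr_mult)
 finally show "q / 2 powr q * Lam q y <= y powr q" .
qed

text \<open>The balance is an exact identity: \<open>T powr (phi * q) = T powr (2 - ga)\<close>, and
  \<open>T powr (ga - 1) = tau\<close>.\<close>

lemma T_case_lt2:
 assumes g: "ga < 2" and tau: "tau >= 1"
 shows "tau powr (1 / (ga - 1)) >= 1" "tau powr (1 / (ga - 1)) / tau = ((tau powr (1 / (ga - 1))) powr phi) powr q"
  "(tau powr (1 / (ga - 1))) powr phi >= 1"
proof -
 show a: "tau powr (1 / (ga - 1)) >= 1" using tau ga by (intro ge_one_powr_ge_zero) auto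
 show "(tau powr (1 / (ga - 1))) powr phi >= 1" using ge_one_powr_ge_zero[OF a, of phi] phi by simp
 have "tau powr (1 / (ga - 1)) / tau = tau powr (1 / (ga - 1) - 1)" using tau by (simp add: powr_diff)
 also have "1 / (ga - 1) - 1 = (1 / (ga - 1)) * (phi * q)" unfolding q_eq(2) using ga by (simp add: field_simps)
 finally show "tau powr (1 / (ga - 1)) / tau = ((tau powr (1 / (ga - 1))) powr phi) powr q" by (simp add: powr_powr mult.assoc)
qed

lemma Tsc_eq2: "ga = 2 ==> Tsc t = t * ln t"
 using Tsc_def[of t] by simp

lemma ln_ge_two_thirds: "t >= 2 ==> ln t >= (2/3 :: real)"
proof -
 assume "t >= 2"
 then have "ln 2 <= ln t" by simp
 then show ?thesis using ln2_ge_two_thirds by linarith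
qed

lemma case_eq2: assumes "ga = 2" shows "phi = 2/3" "q = 0"
 using assms by (auto simp: phi_def q_def)

text \<open>Here \<open>q = 0\<close> and \<open>phi = 2/3\<close>, so the claim is that
  \<open>ln t\<close> and \<open>ln (1 + T powr (2/3))\<close> are comparable. With
  \<open>y = T powr (2/3)\<close> one has \<open>T = y powr (3/2) <= y + y^2\<close>, hence
  \<open>t <= 3 * T <= (1 + y)^3\<close>; conversely \<open>1 + T powr phi <= t^3\<close> for the
  full \<open>T = t * ln t\<close>.\<close>

lemma T_case_eq2:
 assumes g: "ga = 2" and t: "t >= 8/3"
 shows "ln t <= 3 * Lam q ((t * ln t / 2) powr phi)" "Lam q ((t * ln t) powr phi) <= 3 * ln t"
proof -
 have L: "Lam q y = ln (1 + y)" for y using case_eq2[OF g] by (simp add: Lam_def)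
 have lt: "ln t >= 2/3" using t by (intro ln_ge_two_thirds) simp
 have lt2: "ln t <= t" using t ln_le_minus_one[of t] by simp
 define T where "T = t * ln t / 2"
 have T: "T >= t / 3" using mult_left_mono[OF lt, of t] t by (simp add: T_def)
 have T0: "T > 0" using T t by linarith
 define y where "y = T powr phi"
 have y: "y > 0" using T0 by (simp add: y_def)
 have Ty: "T <= y + y^2"
 proof -
  have "T = y powr (3/2)" using T0 by (simp add: y_def powr_powr case_eq2[OF g])
  also have "... <= y + y^2"
  proof (cases "y <= 1")
   case True
   then have "y powr (3/2) <= y powr 1" using y by (intro powr_mono') auto
   then show ?thesis using y by (simp add: add_increasing2)
  next
   case False
   then have "y powr (3/2) <= y powr 2" by (intro powr_mono) auto
   then show ?thesis using y by (simp add: powr_numeral)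
  qed
  finally show ?thesis .
 qed
 have "t <= 3 * T" using T by simp
 also have "... <= 3 * (y + y^2)" using Ty by simp
 also have "... <= (1 + y) ^ 3"
 proof -
  have "(1 + y) ^ 3 = 3 * (y + y^2) + (1 + y ^ 3)" by (simp add: power3_eq_cube power2_eq_square algebra_simps)
  moreover have "0 <= 1 + y ^ 3" using y by simp
  ultimately show ?thesis by linarith
 qed
 finally have "ln t <= ln ((1 + y) ^ 3)" using t y by simp
 also have "... = 3 * ln (1 + y)" using y ln_realpow[of "1 + y" 3] by simp
 finally show "ln t <= 3 * Lam q ((t * ln t / 2) powr phi)" by (simp add: L y_def T_def)
 have tp: "t * ln t > 0" using t lt by simp
 have "(t * ln t) powr phi <= (t * t) powr phi" using t lt lt2 phi by (intro powr_mono2 mult_left_mono) auto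
 also have "... <= (t * t) powr 1" using t phi mult_mono[of 1 t 1 t] by (intro powr_mono) auto
 also have "... = t * t" using t by simp
 finally have "1 + (t * ln t) powr phi <= 1 + t * t" by simp
 also have "... <= t ^ 3"
 proof -
  have "1 * 1 <= t * t" using t by (intro mult_mono) auto
  moreover have "2 * (t * t) <= t * (t * t)" using t by (intro mult_right_mono) auto
  ultimately show ?thesis by (simp add: power3_eq_cube mult.assoc)
 qed
 finally have "ln (1 + (t * ln t) powr phi) <= ln (t ^ 3)" using t by (subst ln_le_cancel_iff) (auto intro: add_pos_nonneg)
 also have "... = 3 * ln t" using t ln_realpow[of t 3] by simp
 finally show "Lam q ((t * ln t) powr phi) <= 3 * ln t" by (simp add: L)
qed

lemma Lam_case_gt2:
 assumes g: "ga > 2" and y: "y >= 1"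
 shows "1 <= (- q) / (1 - 2 powr q) * Lam q y" "(- q) * Lam q y <= 1" "q < 0" "2 powr q < 1"
proof -
 show q: "q < 0" using g phi by (simp add: q_def divide_neg_pos)
 show q2: "2 powr q < 1" using powr_less_mono[of q 0 2] q by simp
 have L: "(- q) * Lam q y = 1 - (1 + y) powr q" using q by (simp add: Lam_def)
 show "(- q) * Lam q y <= 1" unfolding L by simp
 have "(1 + y) powr q <= 2 powr q" using q y by (intro powr_mono2') auto
 then have "1 - 2 powr q <= (- q) * Lam q y" unfolding L by simp
 then have "1 <= ((- q) * Lam q y) / (1 - 2 powr q)" using q2 by (subst pos_le_divide_eq) auto
 then show "1 <= (- q) / (1 - 2 powr q) * Lam q y" by simp
qed

text \<open>The subsolution reaches level \<open>t\<close> from a window starting at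
  \<open>t / 2\<close>, so the balance is needed with \<open>tau = t / 2\<close>. Division by
  \<open>m\<close> adapts the scale: for \<open>ga < 2\<close> it gives exactly
  \<open>Tsc (t / 2)\<close>, otherwise \<open>Tsc t / 2\<close>.\<close>

lemma Tsc_sub:
 obtains k m where "k > 0" "m > 0" "!!t. t >= 8/3 ==> Tsc t / m / (t / 2) <= k * Lam q ((Tsc t / m) powr phi)"
proof -
 consider "ga < 2" | "ga = 2" | "ga > 2" by linarith
 then show ?thesis
 proof cases
  case 1
  show ?thesis
  proof (rule that[of "2 powr (1 - q)" "2 powr (1 / (ga - 1))"])
   fix t :: real assume t: "t >= 8/3"
   have m: "Tsc t / 2 powr (1 / (ga - 1)) = (t / 2) powr (1 / (ga - 1))" using t 1 by (simp add: Tsc_def powr_divide)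
   have t2: "t / 2 >= 1" using t by simp
   show "Tsc t / 2 powr (1 / (ga - 1)) / (t / 2) <= 2 powr (1 - q) * Lam q ((Tsc t / 2 powr (1 / (ga - 1))) powr phi)"
    unfolding m T_case_lt2(2)[OF 1 t2] by (rule Lam_case_lt2(1)[OF 1 T_case_lt2(3)[OF 1 t2]])
  qed auto
 next
  case 2
  show ?thesis
  proof (rule that[of 3 2])
   fix t :: real assume t: "t >= 8/3"
   then show "Tsc t / 2 / (t / 2) <= 3 * Lam q ((Tsc t / 2) powr phi)"
    using T_case_eq2(1)[OF 2 t] unfolding Tsc_eq2[OF 2] by simp
  qed auto
 next
  case 3
  show ?thesis
  proof (rule that[of "(- q) / (1 - 2 powr q)" 2])
   show "(- q) / (1 - 2 powr q) > 0" using Lam_case_gt2(3,4)[OF 3, of 1] by (intro divide_pos_pos) auto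
   fix t :: real assume t: "t >= 8/3"
   then have "(t / 2) powr phi >= 1" using phi by (intro ge_one_powr_ge_zero) auto
   from Lam_case_gt2(1)[OF 3 this] t 3
   show "Tsc t / 2 / (t / 2) <= (- q) / (1 - 2 powr q) * Lam q ((Tsc t / 2) powr phi)" by (simp add: Tsc_def)
  qed auto
 qed
qed

lemma Tsc_ge_1: assumes "t >= 8/3" shows "Tsc t >= 1"
proof -
 consider "ga < 2" | "ga = 2" | "ga > 2" by linarith
 then show ?thesis
 proof cases
  case 2
  have "8/3 * (2/3) <= t * ln t" using assms ln_ge_two_thirds[of t] by (intro mult_mono) auto
  then show ?thesis unfolding Tsc_eq2[OF 2] by simp
 qed (use assms T_case_lt2(1)[of t] in "auto simp: Tsc_def")
qed

lemma Tsc_super: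
 obtains k where "k > 0" "!!t. t >= 8/3 ==> k * Lam q (Tsc t powr phi) <= Tsc t / t"
proof -
 consider "ga < 2" | "ga = 2" | "ga > 2" by linarith
 then show ?thesis
 proof cases
  case 1
  show ?thesis
  proof (rule that[of "q / 2 powr q"])
   show "q / 2 powr q > 0" using Lam_case_lt2(3)[OF 1, of 1] by simp
   fix t :: real assume t: "t >= 8/3"
   then have t1: "t >= 1" by simp
   have m: "Tsc t = t powr (1 / (ga - 1))" using 1 by (simp add: Tsc_def)
   show "q / 2 powr q * Lam q (Tsc t powr phi) <= Tsc t / t"
    unfolding m T_case_lt2(2)[OF 1 t1] by (rule Lam_case_lt2(2)[OF 1 T_case_lt2(3)[OF 1 t1]])
  qed
 next
  case 2
  show ?thesis
  proof (rule that[of "1/3"])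
   fix t :: real assume t: "t >= 8/3"
   then show "1/3 * Lam q (Tsc t powr phi) <= Tsc t / t"
    using T_case_eq2(2)[OF 2 t] unfolding Tsc_eq2[OF 2] by simp
  qed auto
 next
  case 3
  show ?thesis
  proof (rule that[of "- q"])
   show "- q > 0" using Lam_case_gt2(3)[OF 3, of 1] by simp
   fix t :: real assume t: "t >= 8/3"
   then have "t powr phi >= 1" using phi by (intro ge_one_powr_ge_zero) auto
   from Lam_case_gt2(2)[OF 3 this] t 3
   show "- q * Lam q (Tsc t powr phi) <= Tsc t / t" by (simp add: Tsc_def)
  qed
 qed
qed

end

text \<open>The left-hand side decreases and the right-hand side increases with \<open>A\<close>.
  This is how the self-referential conditions on \<open>A\<close> and \<open>B\<close> are
  met.\<close>

lemma powr_neg_le_linear: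
 fixes m K ga :: real
 assumes "m > 0" "K > 0" "ga > 0" "A >= 1" "A >= m powr (-ga) / K"
 shows "(A * m) powr (-ga) <= A * K"
proof -
 have "(A * m) powr (-ga) <= (1 * m) powr (-ga)" using assms by (intro powr_mono2' mult_right_mono) auto
 also have "... <= A * K" using assms by (simp add: pos_divide_le_eq)
 finally show ?thesis .
qed

text \<open>The number \<open>8/3\<close> comes from \<open>16 = 2^4\<close> and
  \<open>ln 2 >= 2/3\<close>. It keeps \<open>t\<close> above 2, so that \<open>ln t\<close> is
  bounded below in the case \<open>ga = 2\<close>.\<close>

lemma ln_inverse_ge: assumes "0 < (r::real)" "r < 1/16" shows "ln (1 / r) >= 8/3"
proof -
 have "16 <= 1 / r" using assms by (simp add: field_simps)
 then have "ln 16 <= ln (1 / r)" using assms by (subst ln_le_cancel_iff) auto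
 moreover have "ln 16 = 4 * ln (2::real)" using ln_realpow[of 2 4] by simp
 ultimately show ?thesis using ln2_ge_two_thirds by linarith
qed

text \<open>All constants are chosen from the numerical parameters before a cone or a solution is
  introduced. The lower bound is used with \<open>tau = t / 2\<close> and the upper bound with
  \<open>tau = t\<close>, where \<open>t = ln (1 / norm x)\<close>.\<close>

lemma vertex_bounds:
 fixes ga phi q rho c C cU CU :: real
 assumes "exponents ga phi q" and rho: "rho > 0" and pos: "c > 0" "C > 0" "cU > 0" "CU > 0" and dim: "DIM('a::euclidean_space) >= 2"
 obtains M where "M > 0"
  "!!(D::'a set) H EH U EU lU x. cone_profile ga phi q D H EH U EU lU rho c C cU CU ==> x : D ==> norm x < 1/16 ==>
   U x >= M * (exponents.Tsc ga (ln (1 / norm x)) powr (1 - phi) * H x) &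
   M * U x <= exponents.Tsc ga (ln (1 / norm x)) powr (1 - phi) * H x + infdist x (- D) powr phi"
proof -
 interpret exponents ga phi q by fact
 obtain k m where km: "k > 0" "m > 0" "!!t. t >= 8/3 ==> Tsc t / m / (t / 2) <= k * Lam q ((Tsc t / m) powr phi)"
  using Tsc_sub by blast
 obtain k' where k': "k' > 0" "!!t. t >= 8/3 ==> k' * Lam q (Tsc t powr phi) <= Tsc t / t"
  using Tsc_super by blast
 define n where "n = real DIM('a)"
 define lam where "lam = phi * (phi + n - 2)"
 define N where "N = n - 2 + 2 * phi"
 define CS where "CS = n + 5 + n / rho"
 have n: "n >= 2" using dim by (simp add: n_def)
 have lam: "lam > 0" and N: "N > 0" using n phi by (auto simp: lam_def N_def)
 have CS: "CS > 0" using n rho by (simp add: CS_def add_pos_nonneg)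
 define be where "be = min 1 (lam * (1 - phi) / (k * (1 + N)))"
 have be: "be > 0" "be <= 1" "be * k * (1 + N) <= lam * (1 - phi)"
 proof -
  have kN: "k * (1 + N) > 0" using km N by simp
  show "be > 0" "be <= 1" using kN lam phi by (auto simp: be_def)
  have "be * (k * (1 + N)) <= lam * (1 - phi) / (k * (1 + N)) * (k * (1 + N))" using kN by (intro mult_right_mono) (auto simp: be_def)
  then show "be * k * (1 + N) <= lam * (1 - phi)" using kN km N by (simp add: mult.assoc)
 qed
 define X where "X = (C + 1)^2 * (phi * (1 - phi) + phi * phi * (1 - q)) * 2 powr ga"
 have X: "X > 0" using pos phi q1 by (auto simp: X_def intro!: mult_pos_pos add_pos_nonneg)
 define b where "b = min (min 1 (1 / X)) (cU / C powr phi)"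
 have b: "b > 0" "b powr (1 + ga) * X <= 1" "b * C powr phi <= cU"
 proof -
  have Cp: "C powr phi > 0" using pos by simp
  show b0: "b > 0" using X pos by (simp add: b_def)
  have "b powr (1 + ga) <= b powr 1" using b0 ga by (intro powr_mono') (auto simp: b_def)
  also have "... <= 1 / X" using b0 by (simp add: b_def)
  finally show "b powr (1 + ga) * X <= 1" using X by (simp add: pos_le_divide_eq)
  have "b <= cU / C powr phi" by (simp add: b_def)
  then show "b * C powr phi <= cU" using Cp by (simp add: pos_le_divide_eq)
 qed
 define de where "de = min (min (1/4) ((1 - phi) / (4 * (CS + 4)))) (phi * (1 - phi) / (16 * lam))"
 have de: "0 < de" "de <= 1/4" "de <= (1 - phi) / (4 * (CS + 4))" "de <= phi * (1 - phi) / (16 * lam)"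
 proof -
  have "(1 - phi) / (4 * (CS + 4)) > 0" "phi * (1 - phi) / (16 * lam) > 0" using CS lam phi by auto
  then show "0 < de" "de <= 1/4" "de <= (1 - phi) / (4 * (CS + 4))" "de <= phi * (1 - phi) / (16 * lam)"
   unfolding de_def by linarith+
 qed
 define K1 where "K1 = phi * (1 - phi) * 2 powr (q - 1) / 8"
 have K1: "K1 > 0" using phi by (simp add: K1_def)
 define B where "B = 1 + CU / cG + cG powr (-ga) / K1"
 have B: "B > 0" "B * cG >= CU" "(B * cG) powr (-ga) <= B * (phi * (1 - phi) * 2 powr (q - 1)) / 8"
 proof -
  have nn: "CU / cG > 0" "cG powr (-ga) / K1 > 0" using cG_pos pos K1 by auto
  then have ge: "B >= 1" "B >= CU / cG" "B >= cG powr (-ga) / K1" by (auto simp: B_def)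
  show "B > 0" using ge by simp
  show "B * cG >= CU" using ge(2) cG_pos by (simp add: pos_divide_le_eq)
  show "(B * cG) powr (-ga) <= B * (phi * (1 - phi) * 2 powr (q - 1)) / 8"
   using powr_neg_le_linear[OF cG_pos(1) K1 _ ge(1,3)] ga by (simp add: K1_def)
 qed
 define K2 where "K2 = N * c * de * k' / 2 * 2 powr (q - 1)"
 have K2: "K2 > 0" using N pos de(1) k' by (simp add: K2_def)
 define Q where "Q = 4 * B * (lam + (CS + 4) / de)"
 have Q: "Q > 0" using B lam CS de(1) by (simp add: Q_def add_pos_pos)
 \<comment> \<open>The sum of the thresholds replaces their maximum: each summand secures one of the
   conditions in \<open>A\<close> below.\<close>
 define A where "A = 1 + B / c + Q / (N * c * de * k') + (c * de) powr (-ga) / K2"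
 have A: "A >= 1" "A * c >= B" "A * N * c * de * k' >= Q" "(A * c * de) powr (-ga) <= A * N * c * de * k' / 2 * 2 powr (q - 1)"
 proof -
  have Nc: "N * c * de * k' > 0" using N pos de(1) k' by simp
  have nn: "B / c > 0" "Q / (N * c * de * k') > 0" "(c * de) powr (-ga) / K2 > 0" using B Q Nc K2 pos de(1) by auto
  then have ge: "A >= B / c" "A >= Q / (N * c * de * k')" "A >= (c * de) powr (-ga) / K2" unfolding A_def by linarith+
  show ge1: "A >= 1" using nn unfolding A_def by linarith
  show "A * c >= B" using ge(1) pos by (simp add: pos_divide_le_eq)
  show "A * N * c * de * k' >= Q" using ge(2) Nc by (simp add: pos_divide_le_eq mult.assoc)
  have "(A * (c * de)) powr (-ga) <= A * K2" by (rule powr_neg_le_linear[OF _ K2 _ ge1 ge(3)]) (use pos de(1) ga in auto)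
  then show "(A * c * de) powr (-ga) <= A * N * c * de * k' / 2 * 2 powr (q - 1)" by (simp add: K2_def mult.assoc)
 qed
 define M1 where "M1 = b * (be / 2) * (1 / m) powr (1 - phi)"
 have M1: "M1 > 0" using b be km by (simp add: M1_def)
 define M2 where "M2 = 1 / (2 * A + 2 * B)"
 have M2: "M2 > 0" using A B by (simp add: M2_def)
 show ?thesis
 proof (rule that[of "min M1 M2"])
  show "min M1 M2 > 0" using M1 M2 by simp
  fix D :: "'a set" and H EH U EU lU x
  assume P: "cone_profile ga phi q D H EH U EU lU rho c C cU CU" and x: "x : D" "norm x < 1/16"
  interpret cp: cone_profile ga phi q D H EH U EU lU rho c C cU CU by fact
  have ld: "cp.n = n" "cp.lam = lam" "cp.N = N" "cp.CS = CS"
   by (simp_all add: cp.n_def n_def cp.lam_def lam_def cp.N_def N_def cp.CS_def CS_def)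
  define t where "t = ln (1 / norm x)"
  note nx = cp.nx[OF x(1)]
  have t: "t >= 8/3" unfolding t_def by (rule ln_inverse_ge[OF nx x(2)])
  have ext: "norm x = exp (- t)" using nx by (simp add: t_def ln_div)
  have Tge: "Tsc t >= 1" by (rule Tsc_ge_1[OF t])
  have H: "H x > 0" by (rule cp.Hpos[OF x(1)])
  have "b * (be / 2) * (Tsc t / m) powr (1 - phi) * H x <= U x"
   by (rule cp.subsolution_bound[of "t / 2", unfolded ld, OF _ _ km(1) km(3)[OF t] be b(1) b(2)[unfolded X_def] b(3) x(1)])
    (use t Tge km ext in auto)
  also have "b * (be / 2) * (Tsc t / m) powr (1 - phi) * H x = M1 * (Tsc t powr (1 - phi) * H x)"
   using Tge km by (simp add: M1_def powr_divide)
  finally have 1: "M1 * (Tsc t powr (1 - phi) * H x) <= U x" .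
  have "U x <= 2 * A * Tsc t powr (1 - phi) * H x + 2 * B * infdist x (- D) powr phi"
   by (rule cp.supersolution_bound[of t "Tsc t", unfolded ld, OF _ Tge k'(1) k'(2)[OF t] de B A(2) A(3)[unfolded Q_def] A(4) x(1) ext x(2)])
    (use t in simp)
  also have "... <= (2 * A + 2 * B) * (Tsc t powr (1 - phi) * H x) + (2 * A + 2 * B) * infdist x (- D) powr phi"
  proof (rule add_mono)
   have "0 <= Tsc t powr (1 - phi) * H x" using H by simp
   then have "(2 * A) * (Tsc t powr (1 - phi) * H x) <= (2 * A + 2 * B) * (Tsc t powr (1 - phi) * H x)"
    using B by (intro mult_right_mono) auto
   then show "2 * A * Tsc t powr (1 - phi) * H x <= (2 * A + 2 * B) * (Tsc t powr (1 - phi) * H x)" by (simp add: mult.assoc)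
   show "2 * B * infdist x (- D) powr phi <= (2 * A + 2 * B) * infdist x (- D) powr phi"
    using A by (intro mult_right_mono) auto
  qed
  finally have 2: "M2 * U x <= Tsc t powr (1 - phi) * H x + infdist x (- D) powr phi"
   using A B by (simp add: M2_def pos_divide_le_eq algebra_simps)
  have U0: "U x > 0" using cp.U(3)[of x] x by auto
  show "U x >= min M1 M2 * (Tsc (ln (1 / norm x)) powr (1 - phi) * H x) &
   min M1 M2 * U x <= Tsc (ln (1 / norm x)) powr (1 - phi) * H x + infdist x (- D) powr phi"
   unfolding t_def[symmetric]
  proof
   have "min M1 M2 * (Tsc t powr (1 - phi) * H x) <= M1 * (Tsc t powr (1 - phi) * H x)"
    using H by (intro mult_right_mono) auto
   then show "U x >= min M1 M2 * (Tsc t powr (1 - phi) * H x)" using 1 by linarith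
   have "min M1 M2 * U x <= M2 * U x" using U0 by (intro mult_right_mono) auto
   then show "min M1 M2 * U x <= Tsc t powr (1 - phi) * H x + infdist x (- D) powr phi" using 2 by linarith
  qed
 qed
qed

section \<open>Geometry of epigraphical cones\<close>

lemma GDERIV_grad: "GDERIV f x :> p ==> grad f x = p"
proof -
 assume p: "GDERIV f x :> p"
 have "p' = p" if "GDERIV f x :> p'" for p'
 proof -
  have "(%h. h \<bullet> p') = (%h. h \<bullet> p)"
   using that p unfolding gderiv_def by (rule has_derivative_unique)
  then have "(p' - p) \<bullet> p' = (p' - p) \<bullet> p" by metis
  then have "(p' - p) \<bullet> (p' - p) = 0" by (simp add: inner_diff_right)
  then show ?thesis by simp
 qed
 then show ?thesis unfolding grad_def using p by blast
qed

lemma differentiable_GDERIV: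
 fixes f :: "'a::euclidean_space => real"
 assumes "f differentiable (at x)"
 shows "GDERIV f x :> grad f x"
proof -
 obtain f' where f: "(f has_derivative f') (at x)" using assms unfolding differentiable_def by blast
 then interpret bounded_linear f' by (rule has_derivative_bounded_linear)
 have "f' h = h \<bullet> (SUM b:Basis. f' b *R b)" for h
 proof -
  have "f' h = f' (SUM b:Basis. (h \<bullet> b) *R b)" by (simp add: euclidean_representation)
  also have "... = (SUM b:Basis. (h \<bullet> b) * f' b)" by (simp add: sum scaleR)
  also have "... = h \<bullet> (SUM b:Basis. f' b *R b)" by (simp add: inner_sum_right mult.commute)
  finally show ?thesis .
 qed
 then have "f' = (%h. h \<bullet> (SUM b:Basis. f' b *R b))" by (rule ext)
 then have "GDERIV f x :> (SUM b:Basis. f' b *R b)" using f unfolding gderiv_def by metis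
 then show ?thesis using GDERIV_grad by metis
qed

text \<open>Adding 1 avoids the question whether the infimum of the Lipschitz constants is
  attained.\<close>

lemma lip_seminorm_less:
 assumes "EX M. M-lipschitz_on A f"
 shows "0 <= lip_seminorm A f" "(lip_seminorm A f + 1)-lipschitz_on A f"
proof -
 have ne: "{M. M-lipschitz_on A f} ~= {}" using assms by blast
 show "0 <= lip_seminorm A f" unfolding lip_seminorm_def by (rule cInf_greatest[OF ne]) (auto dest: lipschitz_on_nonneg)
 have "Inf {M. M-lipschitz_on A f} < lip_seminorm A f + 1" by (simp add: lip_seminorm_def)
 from cInf_lessD[OF ne this] obtain M where "M-lipschitz_on A f" "M < lip_seminorm A f + 1" by blast
 then show "(lip_seminorm A f + 1)-lipschitz_on A f" by (meson less_imp_le lipschitz_on_le)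
qed

locale epigraph =
 fixes g :: "'b::euclidean_space => real" and L K :: real
 assumes hom: "!!l y. l >= 0 ==> g (l *R y) = l * g y"
  and reg: "C11_on annulus g" and norms: "cone_norms g L K"
begin

definition D :: "('b \<times> real) set" where "D = {x. snd x > g (fst x)}"
text \<open>The gradient of \<open>g\<close>, continued from the sphere of radius \<open>3/2\<close>
  in the middle of the annulus as a function homogeneous of degree 0.\<close>

definition P :: "'b => 'b" where "P w = grad g ((3 / 2 / norm w) *R w)"
definition La :: real where "La = 2 * (L + 1)"
text \<open>The constant of the quadratic Taylor bound; the factor \<open>3/2\<close> comes from
  rescaling the base point to norm \<open>3/2\<close>.\<close>

definition Q :: real where "Q = 3 / 2 * (K + 1 + 4 * La)"

lemma g0: "g 0 = 0" using hom[of 0 0] by simp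

lemma gderiv: assumes "w ~= 0" shows "GDERIV g w :> P w"
proof -
 define l where "l = 3 / 2 / norm w"
 have l: "l > 0" using assms by (simp add: l_def)
 have "norm (l *R w) = 3 / 2" using assms by (simp add: l_def)
 then have "l *R w : annulus" by simp
 then have "GDERIV g (l *R w) :> P w"
  using reg differentiable_GDERIV unfolding C11_on_def P_def l_def by blast
 then have d: "(g has_derivative (%h. h \<bullet> P w)) (at (l *R w))" by (simp add: gderiv_def)
 have s: "((%z. l *R z) has_derivative (%h. l *R h)) (at w)" by (auto intro!: derivative_eq_intros)
 have "((%z. g (l *R z)) has_derivative (%h. (l *R h) \<bullet> P w)) (at w)"
  by (rule has_derivative_compose[OF s d])
 then have "((%z. (1 / l) * g (l *R z)) has_derivative (%h. (1 / l) * ((l *R h) \<bullet> P w))) (at w)"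
  by (rule has_derivative_mult_right)
 moreover have "(1 / l) * g (l *R z) = g z" for z using l hom[of l z] by simp
 ultimately show ?thesis using l by (simp add: gderiv_def)
qed

lemma P_grad: "w ~= 0 ==> P w = grad g w"
 using GDERIV_grad[OF gderiv] by simp

lemma mvt_bound:
 assumes S: "convex S" "0 ~: S" "x : S" "y : S" and B: "!!z. z : S ==> norm (P z - p) <= B"
 shows "\<bar>g x - g y - (x - y) \<bullet> p\<bar> <= B * norm (x - y)"
proof -
 have "norm ((g x - x \<bullet> p) - (g y - y \<bullet> p)) <= B * norm (x - y)"
 proof (rule differentiable_bound[OF S(1) _ _ S(3,4)])
  fix z assume z: "z : S"
  have "(g has_derivative (%h. h \<bullet> P z)) (at z within S)"
   using gderiv[of z] z S(2) has_derivative_at_withinI unfolding gderiv_def by metis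
  then show "((%z. g z - z \<bullet> p) has_derivative (%h. h \<bullet> P z - h \<bullet> p)) (at z within S)"
   by (intro has_derivative_diff) (auto intro!: derivative_eq_intros)
  show "onorm (%h. h \<bullet> P z - h \<bullet> p) <= B"
  proof (rule onorm_le)
   fix h show "norm (h \<bullet> P z - h \<bullet> p) <= B * norm h"
    using Cauchy_Schwarz_ineq2[of h "P z - p"] mult_right_mono[OF B[OF z], of "norm h"]
    by (simp add: inner_diff_right mult.commute)
  qed
 qed
 then show ?thesis by (simp add: inner_diff_left algebra_simps)
qed

lemma sup_g: "x : annulus ==> \<bar>g x\<bar> <= (SUP x\<in>annulus. \<bar>g x\<bar>)" "(SUP x\<in>annulus. \<bar>g x\<bar>) >= 0"
proof -
 have "bounded (g ` annulus)" using reg by (simp add: C11_on_def)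
 then obtain B where "ALL x:g ` annulus. norm x <= B" unfolding bounded_iff by blast
 then have bdd: "bdd_above ((%x. \<bar>g x\<bar>) ` annulus)" by (intro bdd_aboveI[of _ B]) auto
 then show a: "x : annulus ==> \<bar>g x\<bar> <= (SUP x\<in>annulus. \<bar>g x\<bar>)" for x by (intro cSUP_upper)
 obtain b :: 'b where "b : Basis" using nonempty_Basis by blast
 then have "b : annulus" by simp
 from a[OF this] show "(SUP x\<in>annulus. \<bar>g x\<bar>) >= 0" by linarith
qed

text \<open>The regularity class provides a bounded gradient, but the annulus is not convex. Points
  at distance below 1 are joined inside a ball that misses the origin; for the others the supremum
  of \<open>g\<close> is enough.\<close>

lemma lip_ex: "EX M. M-lipschitz_on annulus g"
proof -
 have "bounded (grad g ` annulus)" using reg by (simp add: C11_on_def)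
 then obtain B where B: "!!x. x : annulus ==> norm (grad g x) <= B" unfolding bounded_iff by blast
 have PB: "norm (P w) <= B" if "w ~= 0" for w unfolding P_def using that by (intro B) simp
 define S where "S = (SUP x\<in>annulus. \<bar>g x\<bar>)"
 have "(max B 0 + 4 * S)-lipschitz_on annulus g"
 proof (rule lipschitz_onI)
  show "0 <= max B 0 + 4 * S" using sup_g(2) by (simp add: S_def)
  fix x y :: 'b assume xy: "x : annulus" "y : annulus"
  show "dist (g x) (g y) <= (max B 0 + 4 * S) * dist x y"
  proof (cases "dist x y < 1")
   case True
   have z: "0 ~: ball x 1" using xy by simp
   have "\<bar>g x - g y - (x - y) \<bullet> 0\<bar> <= max B 0 * norm (x - y)"
   proof (rule mvt_bound[OF convex_ball z])
    show "norm (P w - 0) <= max B 0" if "w : ball x 1" for w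
     using PB[of w] that z by (cases "w = 0") auto
   qed (use True in auto)
   also have "... <= (max B 0 + 4 * S) * norm (x - y)" using sup_g(2) by (intro mult_right_mono) (auto simp: S_def)
   finally show ?thesis by (simp add: dist_norm)
  next
   case False
   have "\<bar>g x - g y\<bar> <= 2 * S" using sup_g(1)[OF xy(1)] sup_g(1)[OF xy(2)] by (simp add: S_def)
   also have "... <= (max B 0 + 4 * S) * 1" using sup_g(2) by (simp add: S_def)
   also have "... <= (max B 0 + 4 * S) * dist x y" using False sup_g(2) by (intro mult_left_mono) (auto simp: S_def)
   finally show ?thesis by (simp add: dist_norm)
  qed
 qed
 then show ?thesis by blast
qed

lemma LK:
 shows "L >= 0" "K >= 0" "(L + 1)-lipschitz_on annulus g" "(K + 1)-lipschitz_on annulus (grad g)"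
  "!!x. x : annulus ==> \<bar>g x\<bar> <= L"
proof -
 have L: "L = (SUP x\<in>annulus. \<bar>g x\<bar>) + lip_seminorm annulus g" and K: "K = lip_seminorm annulus (grad g)"
  using norms by (auto simp: cone_norms_def C01_norm_def C11_seminorm_def)
 have Kex: "EX M. M-lipschitz_on annulus (grad g)" using reg by (simp add: C11_on_def)
 show "K >= 0" "(K + 1)-lipschitz_on annulus (grad g)" unfolding K using lip_seminorm_less[OF Kex] by auto
 show "L >= 0" unfolding L using lip_seminorm_less[OF lip_ex] sup_g(2) by simp
 show "(L + 1)-lipschitz_on annulus g" unfolding L
  by (rule lipschitz_on_le[OF lip_seminorm_less(2)[OF lip_ex]]) (use sup_g(2) in simp)
 show "\<bar>g x\<bar> <= L" if "x : annulus" for x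
  unfolding L using sup_g(1)[OF that] lip_seminorm_less(1)[OF lip_ex] by linarith
qed

lemma g_abs: "\<bar>g x\<bar> <= L * norm x"
proof (cases "x = 0")
 case False
 define l where "l = 1 / norm x"
 have l: "l > 0" using False by (simp add: l_def)
 have "l *R x : annulus" using False by (simp add: l_def)
 from LK(5)[OF this] have "l * \<bar>g x\<bar> <= L" using l hom[of l x] by (simp add: abs_mult)
 then show ?thesis using False by (simp add: l_def field_simps)
qed (simp add: g0)

lemma P_bound: assumes "w ~= 0" shows "norm (P w) <= L + 1"
proof -
 define a where "a = (3 / 2 / norm w) *R w"
 have na: "norm a = 3 / 2" using assms by (simp add: a_def)
 have a0: "a ~= 0" using na by auto
 have "P w = P a" unfolding P_grad[OF a0] by (simp add: P_def a_def)
 moreover have "norm (P a) <= L + 1"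
 proof (rule lipschitz_grad_bound[of g _ a "1/2"])
  show "(g has_derivative (%k. P a \<bullet> k)) (at a)" using gderiv[OF a0] by (simp add: gderiv_def inner_commute)
  fix x assume "x : ball a (1/2)"
  then have "x : annulus" using na norm_triangle_ineq2[of a x] norm_triangle_ineq2[of x a] by (auto simp: dist_norm norm_minus_commute)
  moreover have "a : annulus" using na by simp
  ultimately show "\<bar>g x - g a\<bar> <= (L + 1) * norm (x - a)" using lipschitz_onD[OF LK(3)] by (simp add: dist_norm)
 qed simp
 ultimately show ?thesis by simp
qed

lemma La1: "La >= 2" using LK(1) by (simp add: La_def)
lemma Q1: "Q >= 1" using LK(2) La1 by (simp add: Q_def)

text \<open>If the points are closer than the larger norm, the segment lies in a ball missing the
  origin and the gradient bound applies. Otherwise both norms are at most the distance, and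
  \<open>\<bar>g x\<bar> <= L * norm x\<close> is used twice.\<close>

lemma g_lipschitz: "\<bar>g x - g y\<bar> <= La * norm (x - y)"
proof -
 have main: "\<bar>g x - g y\<bar> <= La * norm (x - y)" if le: "norm y <= norm x" for x y
 proof (cases "norm (x - y) < norm x")
  case True
  have z: "0 ~: ball x (norm x)" by simp
  have "\<bar>g x - g y - (x - y) \<bullet> 0\<bar> <= (L + 1) * norm (x - y)"
  proof (rule mvt_bound[OF convex_ball z])
   show "x : ball x (norm x)" using True by (metis centre_in_ball le_less_trans norm_ge_zero)
   show "norm (P w - 0) <= L + 1" if "w : ball x (norm x)" for w using that z P_bound[of w] by (cases "w = 0") auto
  qed (use True in "simp add: dist_norm")
  also have "... <= La * norm (x - y)" using LK(1) by (intro mult_right_mono) (auto simp: La_def)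
  finally show ?thesis by simp
 next
  case False
  have "\<bar>g x - g y\<bar> <= L * norm x + L * norm y" using g_abs[of x] g_abs[of y] by linarith
  also have "... <= L * norm (x - y) + L * norm (x - y)" using False le LK(1) by (intro add_mono mult_left_mono) auto
  also have "... <= La * norm (x - y)" by (simp add: La_def algebra_simps)
  finally show ?thesis .
 qed
 show ?thesis
 proof (cases "norm y <= norm x")
  case False
  then show ?thesis using main[of x y] by (simp add: abs_minus_commute norm_minus_commute)
 qed (rule main)
qed

text \<open>By homogeneity \<open>norm y = 3/2\<close>. For \<open>z\<close> within 1/2 of
  \<open>y\<close> the segment stays in the annulus, where the gradient is Lipschitz; for the others
  the linear bounds suffice, the distance being at least 1/2.\<close>

lemma quadratic:
 assumes y: "y ~= 0"
 shows "\<bar>g z - g y - (z - y) \<bullet> P y\<bar> <= Q / norm y * (norm (z - y))^2"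
proof -
 have base: "\<bar>g z - g y - (z - y) \<bullet> P y\<bar> <= (K + 1 + 4 * La) * (norm (z - y))^2" if y: "norm y = 3 / 2" for y z
 proof (cases "norm (z - y) < 1/2")
  case True
  have an: "w : annulus" if "norm (w - y) < 1/2" for w
   using that y norm_triangle_ineq2[of y w] norm_triangle_ineq2[of w y] by (auto simp: norm_minus_commute)
  have cs: "norm (w - y) <= norm (z - y)" if "w : closed_segment z y" for w
   using segment_bound(2)[OF that] by (simp add: norm_minus_commute)
  have z: "0 ~: closed_segment z y" using cs[of 0] True y by auto
  have "\<bar>g z - g y - (z - y) \<bullet> P y\<bar> <= ((K + 1) * norm (z - y)) * norm (z - y)"
  proof (rule mvt_bound[OF convex_closed_segment z])
   fix w assume w: "w : closed_segment z y"
   then have "w : annulus" using cs[OF w] True by (intro an) simp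
   moreover have "y : annulus" using y by simp
   ultimately have "norm (grad g w - grad g y) <= (K + 1) * norm (w - y)" using lipschitz_onD[OF LK(4)] by (simp add: dist_norm)
   also have "... <= (K + 1) * norm (z - y)" using cs[OF w] LK(2) by (intro mult_left_mono) auto
   finally show "norm (P w - P y) <= (K + 1) * norm (z - y)"
    using P_grad[of w] P_grad[of y] w z y by (cases "w = 0"; cases "y = 0") auto
  qed auto
  also have "... = (K + 1) * (norm (z - y))^2" by (simp add: power2_eq_square)
  also have "... <= (K + 1 + 4 * La) * (norm (z - y))^2" using La1 by (intro mult_right_mono) auto
  finally show ?thesis .
 next
  case False
  have "\<bar>(z - y) \<bullet> P y\<bar> <= norm (z - y) * (L + 1)"
  proof -
   have "y ~= 0" using y by auto
   then have "norm (z - y) * norm (P y) <= norm (z - y) * (L + 1)" by (intro mult_left_mono P_bound) auto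
   then show ?thesis using Cauchy_Schwarz_ineq2[of "z - y" "P y"] by linarith
  qed
  also have "... <= norm (z - y) * La" using LK(1) by (intro mult_left_mono) (auto simp: La_def)
  finally have "\<bar>g z - g y - (z - y) \<bullet> P y\<bar> <= 2 * La * norm (z - y)"
   using g_lipschitz[of z y] unfolding mult.commute[of "norm (z - y)" La] mult.assoc by linarith
  also have "... <= 2 * La * (2 * (norm (z - y) * norm (z - y)))"
   using False La1 mult_right_mono[of "1/2" "norm (z - y)" "norm (z - y)"] by (intro mult_left_mono) auto
  also have "... = 4 * La * (norm (z - y))^2" by (simp add: power2_eq_square)
  also have "... <= (K + 1 + 4 * La) * (norm (z - y))^2" using LK(2) by (intro mult_right_mono) auto
  finally show ?thesis .
 qed
 define l where "l = 3 / 2 / norm y"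
 have l: "l > 0" using y by (simp add: l_def)
 have nl: "norm (l *R y) = 3 / 2" using y by (simp add: l_def)
 have Pl: "P (l *R y) = P y" using P_grad[of "l *R y"] y l by (simp add: P_def l_def)
 have "\<bar>g (l *R z) - g (l *R y) - (l *R z - l *R y) \<bullet> P y\<bar> = l * \<bar>g z - g y - (z - y) \<bullet> P y\<bar>"
 proof -
  have "g (l *R z) - g (l *R y) - (l *R z - l *R y) \<bullet> P y = l * (g z - g y - (z - y) \<bullet> P y)"
   using hom[of l] l by (simp add: inner_diff_left algebra_simps)
  then show ?thesis using l by (simp add: abs_mult)
 qed
 moreover have "norm (l *R z - l *R y) = l * norm (z - y)" using l by (simp add: scaleR_diff_right[symmetric])
 ultimately have "l * \<bar>g z - g y - (z - y) \<bullet> P y\<bar> <= (K + 1 + 4 * La) * (l * norm (z - y))^2"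
  using base[OF nl, of "l *R z"] Pl by simp
 also have "... = l * ((K + 1 + 4 * La) * l * (norm (z - y))^2)" by (simp add: power2_eq_square)
 finally have "\<bar>g z - g y - (z - y) \<bullet> P y\<bar> <= (K + 1 + 4 * La) * l * (norm (z - y))^2" using l by simp
 also have "(K + 1 + 4 * La) * l = Q / norm y" by (simp add: Q_def l_def)
 finally show ?thesis .
qed

text \<open>Small enough for two purposes: interior and exterior balls of radius up to
  \<open>2 * rho * norm x\<close> at a boundary point \<open>x\<close>, and vertical balls above a
  graph with Lipschitz constant \<open>La\<close>.\<close>

definition rho :: real where "rho = 1 / (4 * Q * (1 + La) + 4)"

lemma rho: "0 < rho" "rho <= 1/4" "rho * (4 * Q * (1 + La)) <= 1" "rho * (1 + La) <= 1"
proof -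
 have q: "4 * Q * (1 + La) >= 0" using Q1 La1 by simp
 show "0 < rho" unfolding rho_def using q by simp
 show "rho <= 1/4" unfolding rho_def using q by (intro divide_left_mono) auto
 show 3: "rho * (4 * Q * (1 + La)) <= 1" unfolding rho_def using q by (simp add: divide_le_eq)
 have "1 * (1 + La) <= (4 * Q) * (1 + La)" using Q1 La1 by (intro mult_right_mono) auto
 then have "rho * (1 + La) <= rho * (4 * Q * (1 + La))" using `0 < rho` by (intro mult_left_mono) auto
 then show "rho * (1 + La) <= 1" using 3 by linarith
qed

definition nrm :: "'b => 'b \<times> real" where "nrm y = (1 / sqrt (1 + (norm (P y))^2)) *R (- P y, 1)"

lemma nrm: "norm (nrm y) = 1" "sig * (v \<bullet> nrm y) > B ==> B >= 0 ==> sig * (snd v - fst v \<bullet> P y) > B"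
proof -
 define w where "w = sqrt (1 + (norm (P y))^2)"
 have w: "w >= 1" by (simp add: w_def)
 have "norm (- P y, 1::real) = w" by (simp add: norm_Pair w_def add.commute)
 then show "norm (nrm y) = 1" using w unfolding nrm_def w_def[symmetric] norm_scaleR by simp
 assume a: "sig * (v \<bullet> nrm y) > B" "B >= 0"
 have "v \<bullet> nrm y = (snd v - fst v \<bullet> P y) / w"
  by (simp add: nrm_def w_def[symmetric] inner_prod_def diff_divide_distrib)
 then have "B < (sig * (snd v - fst v \<bullet> P y)) / w" using a by simp
 then have "B * w < sig * (snd v - fst v \<bullet> P y)" using w by (simp add: pos_less_divide_eq)
 moreover have "B * 1 <= B * w" using a w by (intro mult_left_mono) auto
 ultimately show "sig * (snd v - fst v \<bullet> P y) > B" by simp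
qed

text \<open>For \<open>X\<close> in the ball, \<open>v = X - (y, g y)\<close> satisfies
  \<open>(norm v)^2 / (2 * R) < sig * (v \<bullet> nrm y)\<close>. The deviation of the graph from
  its tangent plane is at most \<open>Q / norm y * (norm v)^2\<close>, which is no larger. So both
  tangent balls stay on their sides of the graph.\<close>

lemma one_sided:
 assumes y: "y ~= 0" and R: "R > 0" "R <= norm y / (2 * Q)" and sig: "\<bar>sig\<bar> = 1"
  and X: "X : ball ((y, g y) + (sig * R) *R nrm y) R"
 shows "sig * (snd X - g (fst X)) > 0"
proof -
 define v where "v = X - (y, g y)"
 have "norm (v - (sig * R) *R nrm y) < R" using X by (simp add: v_def dist_norm norm_minus_commute algebra_simps)
 then have "(norm (v - (sig * R) *R nrm y))^2 < R^2" using R by (intro power_strict_mono) auto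
 also have "(norm (v - (sig * R) *R nrm y))^2 = (norm v)^2 - 2 * ((sig * R) * (v \<bullet> nrm y)) + (sig * R)^2"
 proof -
  have "nrm y \<bullet> nrm y = 1" using nrm(1)[of y] by (simp add: power2_norm_eq_inner[symmetric])
  then show ?thesis unfolding power2_norm_eq_inner
   by (simp add: inner_diff_left inner_diff_right inner_commute[of "nrm y" v] power2_eq_square algebra_simps)
 qed
 also have "(sig * R)^2 = R^2"
 proof -
  have "sig^2 = 1" using sig by (metis one_power2 power2_abs)
  then show ?thesis by (simp add: power_mult_distrib)
 qed
 finally have "(norm v)^2 < 2 * R * (sig * (v \<bullet> nrm y))" by (simp add: mult_ac)
 then have "(norm v)^2 / (2 * R) < sig * (v \<bullet> nrm y)" using R by (simp add: pos_divide_less_eq mult_ac)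
 then have 1: "sig * (snd v - fst v \<bullet> P y) > (norm v)^2 / (2 * R)" using R by (intro nrm(2)) auto
 have ny: "norm y > 0" using y by simp
 have "Q / norm y <= 1 / (2 * R)" using R Q1 ny by (simp add: field_simps)
 moreover have "(norm (fst v))^2 <= (norm v)^2" using norm_fst_le[of "fst v" "snd v"] by (intro power_mono) auto
 ultimately have "Q / norm y * (norm (fst v))^2 <= 1 / (2 * R) * (norm v)^2" using R by (intro mult_mono) auto
 then have 2: "Q / norm y * (norm (fst X - y))^2 <= (norm v)^2 / (2 * R)" by (simp add: v_def)
 have "\<bar>sig * (g (fst X) - g y - (fst X - y) \<bullet> P y)\<bar> <= Q / norm y * (norm (fst X - y))^2"
  unfolding abs_mult sig using quadratic[OF y, of "fst X"] by simp
 then have "sig * (g (fst X) - g y - (fst X - y) \<bullet> P y) < sig * (snd v - fst v \<bullet> P y)" using 1 2 by linarith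
 then show ?thesis by (simp add: v_def algebra_simps)
qed

lemma open_D: "open D"
proof -
 have "La-lipschitz_on UNIV g" using g_lipschitz La1 by (intro lipschitz_onI) (auto simp: dist_norm)
 then have c: "continuous_on UNIV g" by (rule lipschitz_on_continuous_on)
 show ?thesis unfolding D_def
  by (intro open_Collect_less continuous_intros continuous_on_compose2[OF c]) auto
qed

lemma frontier_D: assumes "x : frontier D" shows "x ~: D" "snd x = g (fst x)"
proof -
 have "La-lipschitz_on UNIV g" using g_lipschitz La1 by (intro lipschitz_onI) (auto simp: dist_norm)
 then have c: "continuous_on UNIV g" by (rule lipschitz_on_continuous_on)
 have "closed {x. snd x >= g (fst x)}"
  by (intro closed_Collect_le continuous_intros continuous_on_compose2[OF c]) auto
 then have "closure D <= {x. snd x >= g (fst x)}" by (intro closure_minimal) (auto simp: D_def)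
 moreover show "x ~: D" using assms open_D by (simp add: frontier_def interior_open)
 ultimately show "snd x = g (fst x)" using assms by (force simp: frontier_def D_def)
qed

lemma frontier_D_norm:
 assumes x: "x : frontier D" "x ~= 0"
 shows "fst x ~= 0" "norm x <= (1 + La) * norm (fst x)" "x = (fst x, g (fst x))"
proof -
 show 3: "x = (fst x, g (fst x))" using frontier_D(2)[OF x(1)] by (simp add: prod_eq_iff)
 show "fst x ~= 0" using 3 x(2) g0 by (auto simp: prod_eq_iff)
 have "norm x <= norm (fst x) + norm (g (fst x))" by (subst 3) (rule norm_Pair_le)
 also have "... <= (1 + La) * norm (fst x)" using g_lipschitz[of "fst x" 0] g0 by (simp add: algebra_simps)
 finally show "norm x <= (1 + La) * norm (fst x)" .
qed

lemma radius_le: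
 assumes x: "x : frontier D" "x ~= 0" and R: "R <= 2 * rho * norm x"
 shows "R <= norm (fst x) / (2 * Q)"
proof -
 have "2 * Q * R <= 2 * Q * (2 * rho * norm x)" using R Q1 by (intro mult_left_mono) auto
 also have "... <= 2 * Q * (2 * rho * ((1 + La) * norm (fst x)))"
  using frontier_D_norm(2)[OF x] Q1 rho(1) by (intro mult_left_mono) auto
 also have "... = (rho * (4 * Q * (1 + La))) * norm (fst x)" by simp
 also have "... <= 1 * norm (fst x)" using rho(3) by (intro mult_right_mono) auto
 finally show ?thesis using Q1 by (simp add: pos_le_divide_eq mult_ac)
qed

text \<open>The delicate clause places the centre of an interior ball relative to \<open>x\<close>.
  If \<open>x\<close> is near the boundary, the nearest point \<open>y\<close> carries tangent balls
  on both sides, and \<open>x\<close> has to lie on the normal at \<open>y\<close>; its distance to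
  the interior centre is then \<open>R - d\<close>.\<close>

lemma good_cone_D: "good_cone rho D"
 unfolding good_cone_def
proof (intro conjI ballI impI allI)
 show "0 < rho" "rho <= 1/4" "open D" using rho open_D by auto
 have "(0, 1) : D" by (simp add: D_def g0)
 then show "D ~= {}" by blast
 show D0: "0 ~: D" by (simp add: D_def g0)
 show "s *R x : D" if "x : D" "s > 0" for x s using that hom[of s "fst x"] by (simp add: D_def)
 show "EX c. dist y c = rho * norm y & ball c (rho * norm y) Int D = {}" if y: "y : frontier D" "y ~= 0" for y
 proof -
  define R where "R = rho * norm y"
  have R: "R > 0" "R <= norm (fst y) / (2 * Q)" using y rho(1) radius_le[OF y, of R] by (auto simp: R_def)
  define c where "c = y + ((-1) * R) *R nrm (fst y)"
  have "dist y c = R" using R nrm(1)[of "fst y"] by (simp add: c_def dist_norm)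
  moreover have "X ~: D" if "X : ball c R" for X
   using one_sided[OF frontier_D_norm(1)[OF y] R, of "-1" X] that frontier_D_norm(3)[OF y] by (simp add: c_def D_def)
  ultimately show ?thesis unfolding R_def[symmetric] by blast
 qed
 show "EX c. ball c (rho * norm x) <= D & dist x c + rho * infdist x (- D) <= rho * norm x" if x: "x : D" for x
 proof -
  define d where "d = infdist x (- D)"
  define R where "R = rho * norm x"
  have x0: "norm x > 0" using x D0 by auto
  have dx: "0 <= d" "d <= norm x" using infdist_le[of 0 "- D" x] D0 by (auto simp: d_def infdist_nonneg)
  have R: "R > 0" using x0 rho(1) by (simp add: R_def)
  have sub: "ball x d <= D" using ball_infdist_subset[OF D0] by (simp add: d_def)
  show ?thesis
  proof (cases "d < R")
   case False
   then have "ball x R <= ball x d" by (intro subset_ball) simp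
   then have "ball x R <= D" using sub by blast
   moreover have "rho * d <= rho * norm x" using dx rho(1) by (intro mult_left_mono) auto
   ultimately show ?thesis by (intro exI[of _ x]) (simp add: R_def d_def)
  next
   case True
   have "closed (- D)" using open_D by (simp add: closed_Compl)
   then obtain y where y: "y : - D" "d = dist x y" unfolding d_def using infdist_attains_inf D0 by blast
   have xy: "x ~= y" using x y by auto
   have "closure (ball x d) <= closure D" using sub by (rule closure_mono)
   then have "y : closure D" using y xy by auto
   then have yf: "y : frontier D" using y open_D by (simp add: frontier_def interior_open)
   have ny: "norm x <= 2 * norm y"
   proof -
    have "norm x - norm y <= d" using norm_triangle_ineq2[of x y] y by (simp add: dist_norm)
    moreover have "d <= 1/4 * norm x" using True rho(2) mult_right_mono[of rho "1/4" "norm x"] by (simp add: R_def)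
    ultimately show ?thesis using norm_ge_zero[of x] by linarith
   qed
   then have y0: "y ~= 0" using x0 by auto
   have "rho * norm x <= rho * (2 * norm y)" using ny rho(1) by (intro mult_left_mono) auto
   then have Rr: "R <= norm (fst y) / (2 * Q)" by (intro radius_le[OF yf y0]) (simp add: R_def)
   define nu where "nu = nrm (fst y)"
   have nu: "norm nu = 1" by (simp add: nu_def nrm)
   have ext: "ball (y + ((-1) * R) *R nu) R Int D = {}"
    using one_sided[OF frontier_D_norm(1)[OF yf y0] R Rr, of "-1"] frontier_D_norm(3)[OF yf y0] by (force simp: D_def nu_def)
   have int: "ball (y + R *R nu) R <= D"
    using one_sided[OF frontier_D_norm(1)[OF yf y0] R Rr, of 1] frontier_D_norm(3)[OF yf y0] by (force simp: D_def nu_def)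
   \<comment> \<open>The exterior ball also bounds the distance of \<open>x\<close> from the
     complement. With \<open>d = dist x y\<close> this forces equality in the triangle inequality,
     so \<open>x - y\<close> is a positive multiple of the normal.\<close>
   have "d <= norm (x - (y + ((-1) * R) *R nu)) - R"
    unfolding d_def by (rule exterior_ball_infdist[OF open_D R ext x])
   then have "norm ((x - y) + R *R nu) >= norm (x - y) + norm (R *R nu)"
    using y R nu by (simp add: dist_norm algebra_simps)
   then have "norm ((x - y) + R *R nu) = norm (x - y) + norm (R *R nu)"
    using norm_triangle_ineq[of "x - y" "R *R nu"] by linarith
   then have "norm (x - y) *R (R *R nu) = norm (R *R nu) *R (x - y)" unfolding norm_triangle_eq .
   then have "R *R (d *R nu) = R *R (x - y)" using R nu y by (simp add: dist_norm mult.commute)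
   then have "x - y = d *R nu" using R scaleR_cancel_left[of R "x - y" "d *R nu"] by simp
   then have "x - (y + R *R nu) = (d - R) *R nu" by (simp add: algebra_simps)
   then have "dist x (y + R *R nu) = R - d" using True nu by (simp add: dist_norm)
   moreover have "rho * d <= 1 * d" using rho(2) dx by (intro mult_right_mono) auto
   ultimately have "dist x (y + R *R nu) + rho * d <= R" by simp
   then show ?thesis using int unfolding R_def d_def by blast
  qed
 qed
 show "EX e. norm e = 1 & (ALL x:D. ALL s>=0. ball (x + s *R e) (rho * s) <= D)"
 proof (intro exI conjI ballI allI impI subsetI)
  show "norm (0::'b, 1::real) = 1" by (simp add: norm_Pair)
  fix x and s :: real and X assume x: "x : D" "0 <= s" "X : ball (x + s *R (0, 1)) (rho * s)"
  define v where "v = X - (x + s *R (0, 1))"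
  have v: "norm v < rho * s" using x(3) by (simp add: v_def dist_norm norm_minus_commute)
  have vf: "norm (fst v) < rho * s" and vs: "\<bar>snd v\<bar> < rho * s"
   using v norm_fst_le[of "fst v" "snd v"] norm_snd_le[of "snd v" "fst v"] by auto
  have "g (fst X) <= g (fst x) + La * norm (fst v)" using g_lipschitz[of "fst X" "fst x"] by (simp add: v_def)
  also have "... <= g (fst x) + La * (rho * s)" using vf La1 by (intro add_left_mono mult_left_mono) auto
  finally have "g (fst X) < snd x + La * (rho * s)" using x(1) by (simp add: D_def)
  moreover have "snd X > snd x + s - rho * s" using vs by (simp add: v_def)
  moreover have "(rho * (1 + La)) * s <= 1 * s" using rho(4) x(2) by (intro mult_right_mono) auto
  ultimately show "X : D" by (simp add: D_def algebra_simps)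
 qed
qed

end

section \<open>Eigenfunctions and homogeneous harmonic functions\<close>

lemma partial_mult:
 assumes "f differentiable (at x)" "g differentiable (at x)"
 shows "partial b (%x. f x * g x) x = f x * partial b g x + partial b f x * g x"
 using partial_eqI[OF has_derivative_mult[OF assms[THEN differentiable_partial]]] .

lemma Ck_on_cong:
 assumes "Ck_on k f S" "open S" "!!x. x : S ==> f x = g x"
 shows "Ck_on k g S"
 using assms(1,3)
proof (induction k arbitrary: f g)
 case 0
 then show ?case using continuous_on_cong[of S S f g] by auto
next
 case (Suc k)
 have d: "(g has_derivative (%b. partial b f x)) (at x)" if "x : S" for x
  using has_derivative_transform_within_open[OF differentiable_partial assms(2) that] Suc.prems that by auto
 have e: "partial b f x = partial b g x" if "x : S" for b x using partial_eqI[OF d[OF that]] by simp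
 have "Ck_on k (partial b g) S" if "b : Basis" for b
  by (rule Suc.IH[of "partial b f"]) (use Suc.prems that e in auto)
 moreover have "g differentiable (at x)" if "x : S" for x using d[OF that] unfolding differentiable_def by blast
 ultimately show ?case by simp
qed

lemma Ck_on_Suc_imp: "Ck_on (Suc k) f S ==> Ck_on k f S"
proof (induction k arbitrary: f)
 case 0
 then show ?case by (auto intro: continuous_at_imp_continuous_on differentiable_imp_continuous_within)
next
 case (Suc k)
 then show ?case by (metis Ck_on.simps(2))
qed

lemma Ck_on_add: "open S ==> Ck_on k f S ==> Ck_on k g S ==> Ck_on k (%x. f x + g x) S"
proof (induction k arbitrary: f g)
 case 0
 then show ?case by (simp add: continuous_on_add)
next
 case (Suc k)
 have "Ck_on k (partial b (%x. f x + g x)) S" if "b : Basis" for b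
  by (rule Ck_on_cong[OF Suc.IH[of "partial b f" "partial b g"]]) (use Suc.prems that in "auto simp: partial_add")
 then show ?case using Suc.prems by auto
qed

lemma Ck_on_mult: "open S ==> Ck_on k f S ==> Ck_on k g S ==> Ck_on k (%x. f x * g x) S"
proof (induction k arbitrary: f g)
 case 0
 then show ?case by (simp add: continuous_on_mult)
next
 case (Suc k)
 have "Ck_on k (partial b (%x. f x * g x)) S" if b: "b : Basis" for b
 proof (rule Ck_on_cong)
  show "Ck_on k (%x. f x * partial b g x + partial b f x * g x) S"
   using Suc.prems b Ck_on_Suc_imp[OF Suc.prems(2)] Ck_on_Suc_imp[OF Suc.prems(3)]
   by (intro Ck_on_add Suc.IH) auto
 qed (use Suc.prems in "auto simp: partial_mult")
 then show ?case using Suc.prems by auto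
qed

lemma Ck_on_norm_powr:
 fixes S :: "'a::euclidean_space set"
 assumes "open S" "0 ~: S"
 shows "Ck_on k (%x. norm x powr a) S"
proof (induction k arbitrary: a)
 case 0
 then show ?case using assms by (auto intro!: continuous_intros)
next
 case (Suc k)
 have d: "((%x. norm x powr a) has_derivative (%h. ((a * norm x powr (a - 2)) *R x) \<bullet> h)) (at x)" if "x : S" for x
  using has_lap_norm_powr0[OF assms(2), of a] that unfolding has_lap_def by blast
 have "Ck_on k (partial b (%x. norm x powr a)) S" if "b : Basis" for b :: 'a
 proof (rule Ck_on_cong)
  show "Ck_on k (%x. norm x powr (a - 2) * (a * (b \<bullet> x))) S"
   by (intro Ck_on_mult assms Suc.IH pol_Ck pol_mult pol_const pol_inner)
  show "norm x powr (a - 2) * (a * (b \<bullet> x)) = partial b (%x. norm x powr a) x" if "x : S" for x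
   using partial_eqI[OF d[OF that]] by (simp add: inner_commute)
 qed (rule assms)
 moreover have "(%x. norm x powr a) differentiable (at x)" if "x : S" for x
  using d[OF that] unfolding differentiable_def by blast
 ultimately show ?case by simp
qed

text \<open>Shifts the degree of homogeneity from \<open>b\<close> to \<open>a + b\<close>. It leads
  from the degree-0 extension of an eigenfunction to a homogeneous harmonic function, and
  back.\<close>

lemma has_lap_homogeneous_shift:
 fixes D :: "'a::euclidean_space set"
 assumes D: "open D" "0 ~: D" and f: "has_lap D f Df lf" and rad: "!!x. x : D ==> x \<bullet> Df x = b * f x"
 obtains E where "has_lap D (%x. norm x powr a * f x) E
  (%x. norm x powr a * lf x + a * (a + 2 * b + real DIM('a) - 2) * norm x powr (a - 2) * f x)"
proof -
 have h: "has_lap D (%x. norm x powr a * f x) (%x. norm x powr a *R Df x + f x *R ((a * norm x powr (a - 2)) *R x))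
  (%x. norm x powr a * lf x + f x * (a * (a + real DIM('a) - 2) * norm x powr (a - 2))
   + 2 * (((a * norm x powr (a - 2)) *R x) \<bullet> Df x))"
  by (intro has_lap_mult has_lap_norm_powr0 D f)
 show ?thesis
  by (rule that, rule has_lap_cong[OF h D(1) refl refl]) (simp add: rad algebra_simps)
qed

locale cone_trace =
 fixes S D :: "'a::euclidean_space set" and rho :: real
 assumes S: "S <= sphere 0 1" "Cone S = D" and gD: "good_cone rho D"
begin

lemma D0: "open D" "0 ~: D"
 using good_coneD[OF gD] by auto

lemma mem_S: "norm p = 1 ==> p : S \<longleftrightarrow> p : D"
 using S(2) unfolding Cone_def by auto

lemma S_D: "p : S ==> p : D & norm p = 1"
 using S mem_S by auto

lemma normalise_D: "x : D ==> x /\<^sub>R norm x : S"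
 using S(2) unfolding Cone_def by auto

lemma S_eq: "S = sphere 0 1 Int D"
 using S_D mem_S by auto

lemma closure_S: "closure S <= sphere 0 1"
 using S(1) by (intro closure_minimal) auto

lemma sph_frontier_eq: "sph_frontier S = closure S - S"
proof -
 have "openin (top_of_set (sphere 0 1)) S" unfolding S_eq using D0 by (intro openin_open_Int)
 then have "top_of_set (sphere 0 1) interior_of S = S" by (rule interior_of_openin)
 moreover have "top_of_set (sphere 0 1) closure_of S = closure S"
  using S(1) closure_S by (simp add: closure_of_subtopology Int_absorb1)
 ultimately show ?thesis by (simp add: frontier_of_def)
qed

lemma normalise_closure: "x : closure D ==> x ~= 0 ==> x /\<^sub>R norm x : closure S"
proof -
 assume x: "x : closure D" "x ~= 0"
 obtain u where u: "!!n. u n : D" "u \<longlonglongrightarrow> x" using x(1) unfolding closure_sequential by blast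
 have "(%n. u n /\<^sub>R norm (u n)) \<longlonglongrightarrow> x /\<^sub>R norm x" using u(2) x(2) by (intro tendsto_intros) auto
 then show ?thesis unfolding closure_sequential
  using normalise_D[OF u(1)] by (intro exI[of _ "%n. u n /\<^sub>R norm (u n)"]) auto
qed

lemma sph_frontier_frontier: "sph_frontier S = sphere 0 1 Int frontier D"
proof -
 have "frontier D = closure D - D" using D0 by (simp add: frontier_def interior_open)
 moreover have "q : closure D" if "q : closure S" for q using that closure_mono[of S D] S_D by blast
 moreover have "q : closure S" if "q : closure D" "norm q = 1" for q using normalise_closure[of q] that by (cases "q = 0") auto
 ultimately show ?thesis unfolding sph_frontier_eq using closure_S mem_S by auto
qed

lemma normalise_frontier: "x : frontier D ==> x ~= 0 ==> x /\<^sub>R norm x : sph_frontier S"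
 unfolding sph_frontier_frontier using frontier_cone_scale[OF gD, of "inverse (norm x)" x] by simp

end

text \<open>The Perron construction provides a positive \<open>H\<close>, homogeneous of some degree \<open>psi \<le> phi\<close>; its trace on the sphere is an
 eigenfunction, so minimality of the eigenvalue forces \<open>psi = phi\<close>.\<close>

lemma (in cone_solution) frequency_cone_harmonic:
 assumes ct: "cone_trace S D rho" and freq: "is_frequency S phi" and dim: "DIM('a) >= 2"
 shows "EX H. cone_harmonic D phi H"
proof -
 interpret ct: cone_trace S D rho by fact
 have D0: "0 ~: D" by (rule ct.D0)
 have nx: "norm x > 0" if "x : D" for x using that D0 by auto
 define n where "n = real DIM('a)"
 have n: "n >= 2" using dim by (simp add: n_def)
 define lam where "lam = phi * (phi + n - 2)"
 have ev: "dirichlet_eigenvalue S lam" and ev_min: "!!mu. dirichlet_eigenvalue S mu ==> lam <= mu"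
  using freq by (auto simp: is_frequency_def first_dirichlet_eigenvalue_def lam_def n_def)
 obtain v where v: "Ck_on 2 (extend0 v) D" "continuous_on (closure S) v" "!!p. p : sph_frontier S ==> v p = 0"
  "EX p:S. v p ~= 0" "!!p. p : S ==> - sph_laplacian v p = lam * v p"
  using ev ct.S(2) unfolding dirichlet_eigenvalue_def by blast
 define f where "f = extend0 v"
 have f_scale: "f (s *R x) = f x" if s: "s > 0" for s x
 proof -
  have "(s *R x) /\<^sub>R norm (s *R x) = x /\<^sub>R norm x" using s by (simp add: divide_inverse)
  then show ?thesis by (simp only: f_def extend0_def)
 qed
 obtain Df where Df: "has_lap D f Df (laplacian f)" using Ck_on_2_has_lap(1)[OF v(1)] f_def by blast
 \<comment> \<open>The eigenvalue equation is given on the sphere only; invariance of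
   \<open>f\<close> under dilations extends it to the cone.\<close>
 have lf: "laplacian f x = - lam * f x / (norm x)^2" if x: "x : D" for x
 proof -
  define s where "s = 1 / norm x"
  have s: "s > 0" using nx[OF x] by (simp add: s_def)
  have "has_lap {x. s *R x : D} (%x. f (s *R x)) (%x. s *R Df (s *R x)) (%x. s^2 * laplacian f (s *R x))"
   by (rule has_lap_scale[OF Df])
  then have "has_lap D (%x. f (s *R x)) (%x. s *R Df (s *R x)) (%x. s^2 * laplacian f (s *R x))"
   by (rule has_lap_subset) (use scaleD s in auto)
  then have h: "has_lap D f (%x. s *R Df (s *R x)) (%x. s^2 * laplacian f (s *R x))"
   by (rule has_lap_cong[OF _ oD(1)]) (auto simp: f_scale s)
  have "laplacian f x = s^2 * laplacian f (s *R x)" by (rule has_lap_laplacian[OF h oD(1) x])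
  also have "laplacian f (s *R x) = - lam * v (s *R x)"
  proof -
   have "s *R x : S" using ct.normalise_D[OF x] by (simp add: s_def inverse_eq_divide)
   from v(5)[OF this] show ?thesis by (simp add: sph_laplacian_def f_def)
  qed
  also have "v (s *R x) = f x" by (simp add: f_def extend0_def s_def inverse_eq_divide)
  finally show ?thesis by (simp add: s_def power_divide)
 qed
 have rad0: "x \<bullet> Df x = 0 * f x" if x: "x : D" for x
 proof -
  have "Df x \<bullet> x = 0 * f x"
   by (rule homogeneous_grad[of f _ _ 1]) (use Df x f_scale in "auto simp: has_lap_def")
  then show ?thesis by (simp add: inner_commute)
 qed
 obtain Ew where "has_lap D (%x. norm x powr phi * f x) Ew
  (%x. norm x powr phi * laplacian f x + phi * (phi + 2 * 0 + real DIM('a) - 2) * norm x powr (phi - 2) * f x)"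
  using has_lap_homogeneous_shift[OF oD(1) D0 Df rad0] by blast
 then have "has_lap D (%x. norm x powr phi * f x) Ew (%x. 0)"
 proof (rule has_lap_cong[OF _ oD(1) refl refl])
  fix x assume x: "x : D"
  have "norm x powr (phi - 2) = norm x powr phi / (norm x)^2" using nx[OF x] by (simp add: powr_diff powr_numeral)
  then show "norm x powr phi * laplacian f x + phi * (phi + 2 * 0 + real DIM('a) - 2) * norm x powr (phi - 2) * f x = 0"
   by (simp add: lf[OF x] lam_def n_def)
 qed
 then have w: "harmonic_on D (%x. norm x powr phi * f x)" unfolding harmonic_on_def by blast
 have cS: "compact (closure S)" using ct.closure_S by (meson bounded_sphere bounded_subset closed_closure compact_eq_bounded_closed)
 obtain Mv where Mv: "!!p. p : closure S ==> \<bar>v p\<bar> <= Mv"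
 proof -
  have "bounded (v ` closure S)" by (rule compact_imp_bounded[OF compact_continuous_image[OF v(2) cS]])
  then show ?thesis using that unfolding bounded_iff by auto
 qed
 have fM: "\<bar>f x\<bar> <= Mv" if "x : D" for x
  using Mv[of "x /\<^sub>R norm x"] ct.normalise_D[OF that] closure_subset[of S] by (auto simp: f_def extend0_def)
 have f0: "(f \<longlongrightarrow> 0) (at xi within D)" if xi: "xi : frontier D" "xi ~= 0" for xi
 proof -
  have "continuous_on (closure D - {0}) (%x. v (x /\<^sub>R norm x))"
   by (rule continuous_on_compose2[OF v(2)]) (use ct.normalise_closure in "auto intro!: continuous_intros")
  then have "((%x. v (x /\<^sub>R norm x)) \<longlongrightarrow> v (xi /\<^sub>R norm xi)) (at xi within (closure D - {0}))"
   using xi by (auto simp: continuous_on_def frontier_def)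
  then have "((%x. v (x /\<^sub>R norm x)) \<longlongrightarrow> v (xi /\<^sub>R norm xi)) (at xi within D)"
   by (rule tendsto_within_subset) (use closure_subset[of D] D0 in auto)
  moreover have "v (xi /\<^sub>R norm xi) = 0" using v(3)[OF ct.normalise_frontier[OF xi]] .
  ultimately show ?thesis by (simp add: f_def extend0_def[abs_def])
 qed
 obtain p where p: "p : S" "v p ~= 0" using v(4) by blast
 \<comment> \<open>The eigenfunction may change sign. The factor makes it positive at one point,
   which is all that \<open>adm_exists\<close> asks for.\<close>
 define sig where "sig = sgn (v p)"
 have sig: "sig * v p > 0" "\<bar>sig\<bar> = 1" using p by (auto simp: sig_def sgn_if)
 have pD: "p : D" "norm p = 1" using ct.S_D[OF p(1)] by auto
 have ad: "EX h. adm phi h"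
 proof (rule adm_exists[of "%x. sig * (norm x powr phi * f x)" "max Mv 1" p])
  show "harmonic_on D (%x. sig * (norm x powr phi * f x))" by (rule harmonic_on_cmult[OF w])
  show "sig * (norm (s *R x) powr phi * f (s *R x)) = s powr phi * (sig * (norm x powr phi * f x))" if "x : D" "s > 0" for x s
   using that by (simp add: f_scale powr_mult)
  show "sig * (norm x powr phi * f x) <= max Mv 1 * norm x powr phi" if x: "x : D" for x
  proof -
   have "sig * f x <= \<bar>sig\<bar> * \<bar>f x\<bar>" using abs_ge_self[of "sig * f x"] by (simp add: abs_mult)
   also have "... <= max Mv 1" using fM[OF x] sig(2) by simp
   finally have "norm x powr phi * (sig * f x) <= norm x powr phi * max Mv 1" by (intro mult_left_mono) auto
   then show ?thesis by (simp add: mult_ac)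
  qed
  show "p : D" by (rule pD)
  show "0 < sig * (norm p powr phi * f p)" using sig(1) pD by (simp add: f_def extend0_def)
  fix xi and e :: real assume xi: "xi : frontier D" "xi ~= 0" "0 < e"
  have "((%x. sig * (norm x powr phi * f x)) \<longlongrightarrow> sig * (norm xi powr phi * 0)) (at xi within D)"
   using xi(2) by (intro tendsto_intros f0[OF xi(1,2)]) auto
  then show "\<forall>\<^sub>F x in at xi within D. sig * (norm x powr phi * f x) < e" using xi(3) by (intro order_tendstoD(2)) auto
 qed auto
 obtain psi H where psi: "0 < psi" "psi <= phi" and H: "harmonic_on D H" "!!x. x : D ==> H x > 0"
  "!!x s. x : D ==> s > 0 ==> H (s *R x) = s powr psi * H x"
  "!!xi e. xi : frontier D ==> xi ~= 0 ==> 0 < e ==> \<forall>\<^sub>F x in at xi within D. H x < e"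
  using exists_homogeneous_harmonic[OF ad] by blast
 define u where "u p = (if p : D then H p else 0)" for p
 have u_ext: "extend0 u x = norm x powr (-psi) * H x" if x: "x : D" for x
 proof -
  have "x /\<^sub>R norm x : D" using scaleD[OF x, of "inverse (norm x)"] nx[OF x] by simp
  then have "extend0 u x = H (inverse (norm x) *R x)" by (simp add: extend0_def u_def)
  also have "... = inverse (norm x) powr psi * H x" using H(3)[OF x] nx[OF x] by simp
  also have "inverse (norm x) powr psi = norm x powr (-psi)" using nx[OF x] by (simp add: powr_minus inverse_powr)
  finally show ?thesis .
 qed
 obtain EH where EH: "has_lap D H EH (%x. 0)" using H(1) unfolding harmonic_on_def by blast
 have radH: "x \<bullet> EH x = psi * H x" if x: "x : D" for x
 proof -
  have "EH x \<bullet> x = psi * H x" by (rule homogeneous_grad[of H _ _ 1]) (use EH x H(3) in "auto simp: has_lap_def")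
  then show ?thesis by (simp add: inner_commute)
 qed
 obtain Eu where "has_lap D (%x. norm x powr (-psi) * H x) Eu
  (%x. norm x powr (-psi) * 0 + (-psi) * ((-psi) + 2 * psi + real DIM('a) - 2) * norm x powr ((-psi) - 2) * H x)"
  using has_lap_homogeneous_shift[OF oD(1) D0 EH radH] by blast
 then have lu: "has_lap D (extend0 u) Eu
  (%x. norm x powr (-psi) * 0 + (-psi) * ((-psi) + 2 * psi + real DIM('a) - 2) * norm x powr ((-psi) - 2) * H x)"
  by (rule has_lap_cong[OF _ oD(1)]) (auto simp: u_ext)
 have "dirichlet_eigenvalue S (psi * (psi + n - 2))"
  unfolding dirichlet_eigenvalue_def
 proof (intro exI[of _ u] conjI ballI)
  have "Ck_on 2 (%x. norm x powr (-psi) * H x) D"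
   by (intro Ck_on_mult Ck_on_norm_powr oD D0 harmonic_Ck H(1))
  then have "Ck_on 2 (extend0 u) D" by (rule Ck_on_cong[OF _ oD(1)]) (simp add: u_ext)
  then show "Ck_on 2 (extend0 u) (Cone S)" by (simp add: ct.S(2))
  show "u p = 0" if "p : sph_frontier S" for p
   using that ct.D0 unfolding ct.sph_frontier_frontier by (auto simp: u_def frontier_def interior_open)
  show "EX p:S. u p ~= 0" using p(1) pD H(2)[OF pD(1)] by (intro bexI[of _ p]) (auto simp: u_def)
  show "- sph_laplacian u q = psi * (psi + n - 2) * u q" if q: "q : S" for q
  proof -
   have qD: "q : D" "norm q = 1" using ct.S_D[OF q] by auto
   show ?thesis unfolding sph_laplacian_def has_lap_laplacian[OF lu oD(1) qD(1)]
    using qD by (simp add: u_def n_def)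
  qed
  show "continuous_on (closure S) u"
   unfolding continuous_on_eq_continuous_within
  proof
   fix q assume q: "q : closure S"
   show "continuous (at q within closure S) u"
   proof (cases "q : D")
    case True
    have "isCont H q" using harmonic_on_continuous[OF H(1)] oD(1) True continuous_on_eq_continuous_at by blast
    moreover have "\<forall>\<^sub>F z in nhds q. H z = u z"
     using eventually_nhds_in_open[OF oD(1) True] by eventually_elim (simp add: u_def)
    ultimately have "isCont u q" using isCont_cong by blast
    then show ?thesis by (rule continuous_at_imp_continuous_at_within)
   next
    case False
    have nq: "norm q = 1" using q ct.closure_S by auto
    have "q ~: S" using False ct.S_D by blast
    then have "q : sph_frontier S" using q ct.sph_frontier_eq by simp
    then have qf: "q : frontier D" by (simp add: ct.sph_frontier_frontier)
    have "(u \<longlongrightarrow> 0) (at q within closure S)"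
    proof (rule tendstoI)
     fix e :: real assume e: "0 < e"
     have "q ~= 0" using nq by auto
     from H(4)[OF qf this e] have "\<forall>\<^sub>F x in at q. x : D --> H x < e" by (simp add: eventually_at_filter)
     then have "\<forall>\<^sub>F x in at q. dist (u x) 0 < e"
      by eventually_elim (use e H(2) in "force simp: u_def dist_real_def abs_if")
     then show "\<forall>\<^sub>F x in at q within closure S. dist (u x) 0 < e" by (simp add: eventually_at_filter eventually_mono)
    qed
    then show ?thesis using False by (simp add: continuous_within u_def)
   qed
  qed
 qed
 then have "lam <= psi * (psi + n - 2)" by (rule ev_min)
 \<comment> \<open>\<open>psi * (psi + n - 2)\<close> is strictly increasing in
   \<open>psi > 0\<close> because \<open>n >= 2\<close>.\<close>
 moreover have "psi * (psi + n - 2) < lam" if "psi < phi"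
  unfolding lam_def using that n psi by (intro mult_strict_mono) auto
 ultimately have "psi = phi" using psi(2) by fastforce
 then show ?thesis using H unfolding cone_harmonic_def by blast
qed

section \<open>Comparison with the defining function and conclusion\<close>

text \<open>The nearest point of the cone's frontier is projected radially to the sphere, which
  costs at most its distance to \<open>p\<close> once more. If that distance exceeds 1/2, the
  diameter bound 2 is used instead.\<close>

lemma (in cone_trace) infdist_sph_frontier:
 assumes ne: "sph_frontier S ~= {}" and p: "p : S"
 shows "infdist p (- D) <= infdist p (sph_frontier S)" "infdist p (sph_frontier S) <= 4 * infdist p (- D)"
  "infdist p (sph_frontier S) <= 2"
proof -
 have pD: "p : D" "norm p = 1" using S_D[OF p] by auto
 have "sph_frontier S <= - D" using D0 by (auto simp: sph_frontier_frontier frontier_def interior_open)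
 then show "infdist p (- D) <= infdist p (sph_frontier S)" using ne by (rule infdist_mono)
 obtain q where q: "q : sph_frontier S" using ne by blast
 then have nq: "norm q = 1" by (simp add: sph_frontier_frontier)
 have "infdist p (sph_frontier S) <= dist p q" using q by (rule infdist_le)
 also have "... <= norm p + norm q" by (simp add: dist_norm norm_triangle_ineq4)
 finally show 2: "infdist p (sph_frontier S) <= 2" using nq pD by simp
 show "infdist p (sph_frontier S) <= 4 * infdist p (- D)"
 proof (cases "infdist p (- D) <= 1/2")
  case True
  obtain Y where Y: "Y : frontier D" "dist p Y = infdist p (- D)" using cone_nearest[OF gD pD(1)] .
  have nY: "\<bar>norm Y - 1\<bar> <= dist p Y" using norm_triangle_ineq3[of Y p] pD by (simp add: dist_norm norm_minus_commute)
  then have Y0: "Y ~= 0" using True Y(2) by auto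
  have "infdist p (sph_frontier S) <= dist p (Y /\<^sub>R norm Y)" by (rule infdist_le[OF normalise_frontier[OF Y(1) Y0]])
  also have "... <= dist p Y + dist Y (Y /\<^sub>R norm Y)" by (rule dist_triangle)
  also have "dist Y (Y /\<^sub>R norm Y) = \<bar>norm Y - 1\<bar>"
  proof -
   have "Y - Y /\<^sub>R norm Y = (1 - inverse (norm Y)) *R Y" by (simp add: algebra_simps)
   then have "dist Y (Y /\<^sub>R norm Y) = \<bar>1 - inverse (norm Y)\<bar> * \<bar>norm Y\<bar>" by (simp add: dist_norm)
   also have "... = \<bar>norm Y - 1\<bar>" using Y0 unfolding abs_mult[symmetric] by (simp add: left_diff_distrib)
   finally show ?thesis .
  qed
  finally show ?thesis using nY Y(2) infdist_nonneg[of p "- D"] by linarith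
 next
  case False
  then show ?thesis using 2 by simp
 qed
qed

text \<open>Within \<open>d0\<close> of the boundary this is the comparability of \<open>eta\<close>
  with the distance. Further away the distance lies between \<open>d0\<close> and 2 and
  \<open>eta\<close> between \<open>h0\<close> and its norm bound \<open>C0\<close>; hence the
  quotients in \<open>E\<close>.\<close>

lemma (in cone_trace) defining_function_bounds:
 assumes ne: "sph_frontier S ~= {}" and df: "defining_function S d0 h0 C0 eta"
  and pos: "d0 > 0" "h0 > 0" "C0 > 0" and x: "x : D"
 defines "E \<equiv> 4 * (C0 + C0 / d0 + 2 / h0)"
 shows "extend0 eta x <= E * (infdist x (- D) / norm x)" "infdist x (- D) / norm x <= E * extend0 eta x"
proof -
 define p where "p = x /\<^sub>R norm x"
 have p: "p : S" using normalise_D[OF x] by (simp add: p_def)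
 have pc: "p : closure S" using p closure_subset by blast
 have nx: "norm x > 0" using x D0 by auto
 define s where "s = infdist p (sph_frontier S)"
 have s: "0 <= s" "s <= 2" using infdist_sph_frontier(3)[OF ne p] by (auto simp: s_def infdist_nonneg)
 have d: "infdist p (- D) = infdist x (- D) / norm x"
  using infdist_scale[OF gD, of "inverse (norm x)" x] nx by (simp add: p_def divide_inverse mult.commute)
 have c11: "sph_C11 (closure S) eta" and cn: "sph_C11_norm (closure S) eta <= C0"
  and far: "d0 <= s ==> h0 <= eta p" and near: "s <= d0 ==> comparable C0 (eta p) s"
  using df pc unfolding defining_function_def comparable_def s_def by auto
 have eta_le: "eta p <= C0"
 proof -
  have b: "bounded (eta ` closure S)" "bounded (sph_grad (closure S) eta ` closure S)"
   "EX M. M-lipschitz_on (closure S) (sph_grad (closure S) eta)" using c11 by (auto simp: sph_C11_def)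
  obtain B1 where "ALL z:eta ` closure S. norm z <= B1" using b(1) unfolding bounded_iff by blast
  then have "bdd_above ((%p. \<bar>eta p\<bar>) ` closure S)" by (intro bdd_aboveI[of _ B1]) auto
  then have 1: "\<bar>eta p\<bar> <= (SUP p\<in>closure S. \<bar>eta p\<bar>)" using pc by (intro cSUP_upper)
  obtain B2 where "ALL z:sph_grad (closure S) eta ` closure S. norm z <= B2" using b(2) unfolding bounded_iff by blast
  then have "bdd_above ((%p. norm (sph_grad (closure S) eta p)) ` closure S)" by (intro bdd_aboveI[of _ B2]) auto
  then have "norm (sph_grad (closure S) eta p) <= (SUP p\<in>closure S. norm (sph_grad (closure S) eta p))" using pc by (intro cSUP_upper)
  then have 2: "0 <= (SUP p\<in>closure S. norm (sph_grad (closure S) eta p))" by (rule order_trans[OF norm_ge_zero])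
  show ?thesis using 1 2 lip_seminorm_less(1)[OF b(3)] cn unfolding sph_C11_norm_def by linarith
 qed
 define F where "F = C0 + C0 / d0 + 2 / h0"
 have F: "F > 0" "C0 <= F" "C0 / d0 <= F" "2 / h0 <= F"
 proof -
  have "C0 / d0 > 0" "2 / h0 > 0" using pos by auto
  then show "F > 0" "C0 <= F" "C0 / d0 <= F" "2 / h0 <= F" using pos unfolding F_def by linarith+
 qed
 have "eta p <= F * s & s <= F * eta p"
 proof (cases "s <= d0")
  case True
  then have c: "eta p <= C0 * s" "s <= C0 * eta p" using near by (auto simp: comparable_def)
  have "eta p >= 0" using c(2) s pos by (smt (verit) mult_pos_neg)
  then have "C0 * s <= F * s" "C0 * eta p <= F * eta p" using F s by (auto intro: mult_right_mono)
  then show ?thesis using c by linarith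
 next
  case False
  then have h: "h0 <= eta p" using far by simp
  have "C0 = C0 / d0 * d0" using pos by simp
  also have "... <= F * s" using F False pos by (intro mult_mono) auto
  finally have 1: "eta p <= F * s" using eta_le by linarith
  have "2 = 2 / h0 * h0" using pos by simp
  also have "... <= F * eta p" using F h pos by (intro mult_mono) auto
  finally show ?thesis using 1 s by linarith
 qed
 then have a: "eta p <= F * s" "s <= F * eta p" by auto
 have "F * s <= F * (4 * infdist p (- D))" using infdist_sph_frontier(2)[OF ne p] F by (intro mult_left_mono) (auto simp: s_def)
 then show "extend0 eta x <= E * (infdist x (- D) / norm x)"
  using a(1) unfolding d by (simp add: extend0_def p_def[symmetric] E_def F_def mult_ac)
 have "0 <= F * eta p" using a(2) s by linarith
 then have "F * eta p <= 4 * (F * eta p)" by simp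
 then show "infdist x (- D) / norm x <= E * extend0 eta x"
  using a(2) infdist_sph_frontier(1)[OF ne p] unfolding d
  by (simp add: extend0_def p_def[symmetric] E_def F_def[symmetric] s_def)
qed

lemma infdist_frontier_open:
 fixes W :: "'a::euclidean_space set"
 assumes W: "open W" "x : W" "y ~: W"
 shows "infdist x (frontier W) = infdist x (- W)" "ball x (infdist x (frontier W)) <= W"
  "infdist x (frontier W) > 0"
proof -
 have cl: "closed (- W)" using W by (simp add: closed_Compl)
 have ne: "- W ~= {}" using W by blast
 obtain z where z: "z : - W" "infdist x (- W) = dist x z" using infdist_attains_inf[OF cl ne] by blast
 have b: "ball x (infdist x (- W)) <= W"
 proof
  fix a assume a: "a : ball x (infdist x (- W))"
  show "a : W"
  proof (rule ccontr)
   assume "a ~: W"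
   then have "infdist x (- W) <= dist x a" by (intro infdist_le) simp
   then show False using a by simp
  qed
 qed
 have xz: "dist x z > 0" using W z by auto
 have "closure (ball x (dist x z)) <= closure W" using b z by (intro closure_mono) simp
 then have "z : closure W" using xz by auto
 then have zf: "z : frontier W" using z W by (simp add: frontier_def interior_open)
 have "frontier W <= - W" using W by (auto simp: frontier_def interior_open)
 then have "infdist x (- W) <= infdist x (frontier W)" using zf by (intro infdist_mono) auto
 moreover have "infdist x (frontier W) <= dist x z" by (rule infdist_le[OF zf])
 ultimately show e: "infdist x (frontier W) = infdist x (- W)" using z by simp
 show "ball x (infdist x (frontier W)) <= W" using b e by simp
 show "infdist x (frontier W) > 0" using e z xz by simp
qed

text \<open>The unit sphere is at distance at least \<open>1 - norm x >= norm x\<close>, so it is no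
  closer than the vertex.\<close>

lemma infdist_cone_ball:
 assumes D: "good_cone rho D" and x: "x : D" "norm x <= 1/2"
 shows "infdist x (- (D Int ball 0 1)) = infdist x (- D)"
proof (rule antisym)
 have z: "0 : - D" using good_coneD(5)[OF D] by simp
 show "infdist x (- (D Int ball 0 1)) <= infdist x (- D)" using z by (intro infdist_mono) auto
 have "infdist x (- D) <= dist x a" if a: "a : - (D Int ball 0 1)" for a
 proof (cases "a : D")
  case True
  then have "norm a >= 1" using a by auto
  then have "dist x a >= norm x" using x(2) norm_triangle_ineq2[of a x] by (simp add: dist_norm norm_minus_commute)
  then show ?thesis using infdist_cone_bounds(2)[OF D x(1)] by linarith
 qed (simp add: infdist_le)
 moreover have "- (D Int ball 0 1) ~= {}" using z by auto
 ultimately show "infdist x (- D) <= infdist x (- (D Int ball 0 1))"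
  by (metis (mono_tags, lifting) cINF_greatest infdist_notempty)
qed

text \<open>Ensures that the relative boundary on the sphere is nonempty; \<open>infdist\<close> to
  the empty set is 0 by convention and would carry no information.\<close>

lemma (in epigraph) frontier_D_nontrivial: "EX xi:frontier D. xi ~= 0"
proof -
 obtain b :: 'b where b: "b : Basis" using nonempty_Basis by blast
 have "(%n. (b, g b + inverse (real (Suc n)))) \<longlonglongrightarrow> (b, g b + 0)"
  by (intro tendsto_intros LIMSEQ_inverse_real_of_nat)
 moreover have "(b, g b + inverse (real (Suc n))) : D" for n by (simp add: D_def)
 ultimately have "(b, g b) : closure D" unfolding closure_sequential by (intro exI[of _ "%n. (b, g b + inverse (real (Suc n)))"]) simp
 moreover have "(b, g b) ~: D" by (simp add: D_def)
 ultimately have "(b, g b) : frontier D" using open_D by (simp add: frontier_def interior_open)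
 then show ?thesis using b by (intro bexI[of _ "(b, g b)"]) (auto simp: zero_prod_def)
qed

text \<open>The two lower lines in each of the three cases of the theorem, with \<open>1 / T\<close>
  as the common form of the threshold.\<close>

definition two_regimes :: "real => real => real => real => real => real => real => bool" where
 "two_regimes phi K T r et d U \<longleftrightarrow>
   (et <= 1 / T --> comparable K U (r powr phi * et powr phi) & comparable K (r powr phi * et powr phi) (d powr phi)) &
   (et >= 1 / T --> comparable K U (r powr phi * T powr (1 - phi) * et))"

lemma le_const_mult: "x <= a * y ==> a <= K ==> 0 <= y ==> x <= K * (y::real)"
 by (meson mult_right_mono order_trans)

text \<open>With \<open>s = d / r\<close> the two-sided bound is \<open>U \<approx> r powr phi * max (s powr phi) (T powr (1 - phi) * s)\<close>.\<close>

lemma threshold_comparison: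
 fixes phi c1 M c C E :: real
 assumes phi: "0 < phi" "phi < 1" and pos: "c1 > 0" "M > 0" "c > 0" "C > 0" "E > 0"
 obtains K where "K > 0"
  "!!r d U T et. r > 0 ==> d > 0 ==> T > 0 ==> et <= E * (d / r) ==> d / r <= E * et ==>
   c1 * d powr phi <= U ==> M * (T powr (1 - phi) * (c * d * r powr (phi - 1))) <= U ==>
   M * U <= T powr (1 - phi) * (C * d * r powr (phi - 1)) + d powr phi ==>
   two_regimes phi K T r et d U"
proof -
 define F where "F = E + 1"
 have F: "F >= 1" "F > 0" "E <= F" using pos by (auto simp: F_def)
 define K where "K = F + F / c1 + (C * F + 1) * F / M + F / (M * c) + (C + F) * F / M"
 have Kp: "F / c1 > 0" "(C * F + 1) * F / M > 0" "F / (M * c) > 0" "(C + F) * F / M > 0"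
  using F pos by (auto intro!: divide_pos_pos mult_pos_pos add_pos_pos)
 have K: "K > 0" "F <= K" "F / c1 <= K" "(C * F + 1) * F / M <= K" "F / (M * c) <= K" "(C + F) * F / M <= K"
  using Kp F unfolding K_def by linarith+
 have Fp: "F powr a <= F" if "a <= 1" for a using powr_mono[OF that F(1)] F by simp
 show ?thesis
 proof (rule that[OF K(1)])
  fix r d U T et :: real
  assume p: "r > 0" "d > 0" "T > 0" and e: "et <= E * (d / r)" "d / r <= E * et" and
   U: "c1 * d powr phi <= U" "M * (T powr (1 - phi) * (c * d * r powr (phi - 1))) <= U"
   "M * U <= T powr (1 - phi) * (C * d * r powr (phi - 1)) + d powr phi"
  define s where "s = d / r"
  have s: "s > 0" using p by (simp add: s_def)
  have ds: "d = s * r" using p by (simp add: s_def)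
  have et0: "et > 0" using e(2) s pos by (metis (no_types) less_le_trans s_def zero_less_mult_pos)
  have e': "et <= F * s" "s <= F * et"
   using e[folded s_def] mult_right_mono[OF F(3), of s] mult_right_mono[OF F(3), of et] s et0 by linarith+
  define R where "R = r powr phi"
  have R: "R > 0" using p by (simp add: R_def)
  have dp: "d powr phi = R * s powr phi" using p s by (simp add: ds powr_mult R_def)
  have dr: "d * r powr (phi - 1) = R * s" using p by (simp add: R_def ds powr_diff)
  define V where "V = T powr (1 - phi) * s"
  have V: "V > 0" using p s by (simp add: V_def)
  have U1: "c1 * (R * s powr phi) <= U" using U(1) by (simp add: dp)
  have U2: "M * c * (R * V) <= U" using U(2) dr by (simp add: V_def mult_ac)
  have U3: "M * U <= R * (C * V + s powr phi)"
  proof -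
   have "T powr (1 - phi) * (C * d * r powr (phi - 1)) = C * T powr (1 - phi) * (d * r powr (phi - 1))" by (simp only: mult_ac)
   also have "... = R * (C * V)" unfolding dr by (simp add: V_def mult_ac)
   finally have eq: "T powr (1 - phi) * (C * d * r powr (phi - 1)) = R * (C * V)" .
   show ?thesis using U(3) unfolding dp eq by (simp only: distrib_left)
  qed
  have U0: "U > 0" using U1 pos R s by (smt (verit) mult_pos_pos powr_gt_zero)
  \<comment> \<open>The two competing terms differ by the factor
    \<open>(T * s) powr (1 - phi)\<close>, so the change of regime happens at \<open>T * s\<close>
    of order 1.\<close>
  have Vs: "V = (T * s) powr (1 - phi) * s powr phi"
  proof -
   have "s powr (1 - phi) * s powr phi = s" using s by (simp add: powr_add[symmetric])
   then show ?thesis using p s by (simp add: V_def powr_mult mult.assoc)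
  qed
  have es: "et powr phi <= F * s powr phi" "s powr phi <= F * et powr phi"
  proof -
   have "et powr phi <= (F * s) powr phi" using e' et0 phi by (intro powr_mono2) auto
   also have "... = F powr phi * s powr phi" using F s by (simp add: powr_mult)
   also have "... <= F * s powr phi" using phi by (intro mult_right_mono Fp) auto
   finally show "et powr phi <= F * s powr phi" .
   have "s powr phi <= (F * et) powr phi" using e' s phi by (intro powr_mono2) auto
   also have "... = F powr phi * et powr phi" using F et0 by (simp add: powr_mult)
   also have "... <= F * et powr phi" using phi by (intro mult_right_mono Fp) auto
   finally show "s powr phi <= F * et powr phi" .
  qed
  have 1: "comparable K U (R * et powr phi) & comparable K (R * et powr phi) (R * s powr phi)" if t: "et <= 1 / T"
  proof -
   have "T * s <= T * (F * et)" using e' p by (intro mult_left_mono) auto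
   also have "... = F * (T * et)" by simp
   also have "... <= F * 1" using t p F by (intro mult_left_mono) (auto simp: field_simps)
   finally have "(T * s) powr (1 - phi) <= F powr (1 - phi)" using p s phi by (intro powr_mono2) auto
   also have "... <= F" using phi by (intro Fp) auto
   finally have "V <= F * s powr phi" unfolding Vs by (intro mult_right_mono) auto
   then have "C * V <= C * (F * s powr phi)" using pos by (intro mult_left_mono) auto
   then have "C * V + s powr phi <= (C * F + 1) * s powr phi" by (simp add: algebra_simps)
   also have "... <= (C * F + 1) * (F * et powr phi)" using es pos F by (intro mult_left_mono) auto
   finally have "R * (C * V + s powr phi) <= R * ((C * F + 1) * (F * et powr phi))" using R by (intro mult_left_mono) auto
   then have "U * M <= (C * F + 1) * F * (R * et powr phi)" using U3 by (simp add: mult_ac)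
   then have "U <= (C * F + 1) * F / M * (R * et powr phi)" using pos by (simp add: pos_le_divide_eq)
   then have a: "U <= K * (R * et powr phi)" by (rule le_const_mult[OF _ K(4)]) (use R in simp)
   have c: "R * et powr phi <= F * (R * s powr phi)" "R * s powr phi <= F * (R * et powr phi)"
    using es R by (simp_all add: mult.left_commute)
   note c(1)
   also have "F * (R * s powr phi) = F / c1 * (c1 * (R * s powr phi))" using pos by simp
   also have "... <= F / c1 * U" using U1 Kp by (intro mult_left_mono) auto
   finally show ?thesis using le_const_mult[OF _ K(3)] U0 a c[THEN le_const_mult[OF _ K(2)]] R by (simp add: comparable_def)
  qed
  have 2: "comparable K U (R * T powr (1 - phi) * et)" if t: "et >= 1 / T"
  proof -
   have "1 <= T * et" using t p by (simp add: field_simps)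
   also have "... <= T * (F * s)" using e' p by (intro mult_left_mono) auto
   finally have Ts: "1 / F <= T * s" using F by (simp add: field_simps)
   have "(T * s) powr (phi - 1) <= (1 / F) powr (phi - 1)" using Ts F phi by (intro powr_mono2') auto
   also have "... = F powr (1 - phi)" using F by (simp add: powr_divide powr_minus_divide[symmetric])
   also have "... <= F" using phi by (intro Fp) auto
   finally have "(T * s) powr (phi - 1) * V <= F * V" using V by (intro mult_right_mono) auto
   moreover have "(T * s) powr (phi - 1) * V = s powr phi"
   proof -
    have "(T * s) powr (phi - 1) * (T * s) powr (1 - phi) = 1" using p s by (simp add: powr_add[symmetric])
    then show ?thesis unfolding Vs by (simp add: mult.assoc[symmetric])
   qed
   ultimately have sV: "s powr phi <= F * V" by simp
   have "V <= T powr (1 - phi) * (F * et)" unfolding V_def using e' by (intro mult_left_mono) auto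
   then have Vet: "V <= F * (T powr (1 - phi) * et)" by (simp add: mult_ac)
   have "C * V + s powr phi <= (C + F) * V" using sV by (simp add: algebra_simps)
   also have "... <= (C + F) * (F * (T powr (1 - phi) * et))" using Vet pos F by (intro mult_left_mono) auto
   finally have "R * (C * V + s powr phi) <= R * ((C + F) * (F * (T powr (1 - phi) * et)))" using R by (intro mult_left_mono) auto
   then have "U * M <= (C + F) * F * (R * T powr (1 - phi) * et)" using U3 by (simp add: mult_ac)
   then have "U <= (C + F) * F / M * (R * T powr (1 - phi) * et)" using pos by (simp add: pos_le_divide_eq)
   then have a: "U <= K * (R * T powr (1 - phi) * et)" by (rule le_const_mult[OF _ K(6)]) (use R et0 in simp)
   have "T powr (1 - phi) * et <= T powr (1 - phi) * (F * s)" using e' by (intro mult_left_mono) auto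
   then have "R * (T powr (1 - phi) * et) <= R * (F * V)" using R by (intro mult_left_mono) (auto simp: V_def mult_ac)
   also have "... = F / (M * c) * (M * c * (R * V))" using pos by simp
   also have "... <= F / (M * c) * U" using U2 Kp by (intro mult_left_mono) auto
   finally show ?thesis using a le_const_mult[OF _ K(5)] U0 by (simp add: comparable_def mult.assoc)
  qed
  show "two_regimes phi K T r et d U" using 1 2 unfolding two_regimes_def dp R_def[symmetric] by blast
 qed
qed

lemma comparable_mono: "comparable C a b ==> C <= C' ==> 0 <= a ==> 0 <= b ==> comparable C' (a::real) b"
 unfolding comparable_def by (meson mult_right_mono order_trans)

text \<open>Feeds the solution into the Perron argument and then into the profiles: the paraboloid
  bound supplies the constant \<open>c1\<close>, the exterior barrier supplies \<open>C2\<close>,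
  and \<open>frequency_cone_harmonic\<close> supplies \<open>H\<close>.\<close>

lemma (in cone_trace) solution_estimates:
 fixes ga phi q c C C2 :: real
 defines "c1 \<equiv> (1 / (2 * real DIM('a))) powr (1 / (1 + ga))"
 assumes ex: "exponents ga phi q" and dim: "DIM('a) >= 2" and pos: "c > 0" "C > 0" "C2 > 0"
  and freq: "is_frequency S phi" and sol: "is_solution ga (D Int ball 0 1) U"
  and Hb: "cone_bounds phi c C D" and up: "upper_away ga C2 (D Int ball 0 1)"
 defines "Om \<equiv> D Int ball 0 1"
 shows "x : Om ==> c1 * infdist x (frontier Om) powr phi <= U x"
  "x : Om ==> norm x >= 1/16 ==> U x <= C2 * infdist x (frontier Om) powr phi"
  "x : D ==> norm x <= 1/2 ==> infdist x (frontier Om) = infdist x (- D)"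
  "EX H EH EU lU. cone_profile ga phi q D H EH U EU lU rho c C c1 C2"
proof -
 interpret exponents ga phi q by fact
 have op: "open Om" and zOm: "0 ~: Om" using D0 by (auto simp: Om_def)
 have c1: "c1 > 0" unfolding c1_def using DIM_positive[where 'a='a] by simp
 have U: "continuous_on (closure Om) U" "!!x. x : Om ==> U x > 0" "!!x. x : Om ==> - laplacian U x = U x powr (-ga)"
  "!!x. x : frontier Om ==> U x = 0" and "Ck_on 2 U Om"
  using sol by (auto simp: is_solution_def Om_def Cinf_on_def)
 then obtain EU where EU: "has_lap Om U EU (laplacian U)" using Ck_on_2_has_lap(1) by blast
 have lU: "laplacian U x = - (U x powr (-ga))" if "x : Om" for x using U(3)[OF that] by simp
 have fr: "infdist x (frontier Om) = infdist x (- Om)" if "x : Om" for x by (rule infdist_frontier_open[OF op that zOm])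
 have bd: "\<forall>\<^sub>F x in at xi within Om. U x < e" if "xi : frontier Om" "0 < e" for xi e
 proof -
  have "(U \<longlongrightarrow> U xi) (at xi within closure Om)" using U(1) that by (auto simp: continuous_on_def frontier_def)
  then have "(U \<longlongrightarrow> U xi) (at xi within Om)" by (rule tendsto_within_subset) (rule closure_subset)
  then show ?thesis using U(4)[OF that(1)] that(2) by (intro order_tendstoD(2)) auto
 qed
 show low: "c1 * infdist x (frontier Om) powr phi <= U x" if x: "x : Om" for x
  using solution_lower_ball[OF ga EU lU U(2) infdist_frontier_open(2,3)[OF op x zOm]] by (simp add: c1_def phi_def)
 show upp: "U x <= C2 * infdist x (frontier Om) powr phi" if x: "x : Om" "norm x >= 1/16" for x
  using up[folded Om_def, unfolded upper_away_def] EU lU bd x unfolding fr[OF x(1)] phi_def by blast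
 show dd: "infdist x (frontier Om) = infdist x (- D)" if x: "x : D" "norm x <= 1/2" for x
  using fr[of x] infdist_cone_ball[OF gD x] x by (simp add: Om_def)
 have U0: "\<forall>\<^sub>F x in at xi within D. U x < e" if xi: "xi : frontier D" "norm xi < 1" "0 < e" for xi e
 proof -
  have "xi : closure D" "xi ~: D" using xi(1) D0 by (auto simp: frontier_def interior_open)
  moreover have "xi : closure Om"
   using open_Int_closure_subset[of "ball 0 1" D] xi(2) `xi : closure D` by (auto simp: Om_def Int_commute)
  ultimately have "xi : frontier Om" unfolding frontier_def interior_open[OF op] by (simp add: Om_def)
  then have "\<forall>\<^sub>F x in at xi within Om. U x < e" using bd xi(3) by blast
  moreover have "at xi within Om = at xi within D"
   by (rule at_within_nhd[of xi "ball 0 1"]) (use xi(2) in "auto simp: Om_def")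
  ultimately show ?thesis by simp
 qed
 have Ulow: "c1 * infdist x (- D) powr phi <= U x" if "x : D" "norm x <= 1/2" for x
  using low[of x] dd[OF that] that by (simp add: Om_def)
 interpret cs: cone_solution D U EU "laplacian U" rho phi c1 2
 proof
  show "laplacian U x <= 0" if "x : D Int ball 0 1" for x using lU[of x] that by (simp add: Om_def)
  show "U x <= 2" if "x : D Int ball 0 1" for x
   by (rule solution_le_2[OF ga op _ EU lU bd]) (use that in "auto simp: Om_def")
 qed (use gD EU U(2) U0 Ulow c1 phi in "auto simp: Om_def less_imp_le")
 obtain H0 where "cone_harmonic D phi H0"
  using cs.frequency_cone_harmonic[OF cone_trace_axioms freq dim] by blast
 then obtain H EH where H: "cone_harmonic D phi H" "has_lap D H EH (%x. 0)"
  "ALL x:D. c * infdist x (- D) * norm x powr (phi - 1) <= H x & H x <= C * infdist x (- D) * norm x powr (phi - 1) &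
     H x <= norm x powr phi & norm (EH x) <= C * norm x powr (phi - 1)" using Hb unfolding cone_bounds_def by meson
 have "cone_profile ga phi q D H EH U EU (laplacian U) rho c C c1 C2"
 proof
  show "U x <= C2 * infdist x (- D) powr phi" if "x : D" "norm x = 1/16" for x
   using upp[of x] dd[of x] that by (simp add: Om_def)
 qed (use dim gD H pos EU lU U(2) U0 Ulow c1 in "auto simp: Om_def")
 then show "EX H EH EU lU. cone_profile ga phi q D H EH U EU lU rho c C c1 C2" by blast
qed

text \<open>\<open>CC\<close> is obtained before the cone, the defining function and the solution
  are fixed; uniformity is this order of quantifiers.\<close>

lemma main_estimate:
 fixes ga phi q L K d0 h0 C0 :: real
 assumes ex: "exponents ga phi q" and pos: "d0 > 0" "h0 > 0" "C0 > 0"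
 obtains CC where "CC > 0"
  "!!(S :: ('b::euclidean_space \<times> real) set) g eta U Om x. C11_epigraphical_cone S g ==> cone_norms g L K ==>
   is_frequency S phi ==> defining_function S d0 h0 C0 eta ==> Om = Cone S Int ball 0 1 ==> is_solution ga Om U ==> x : Om ==>
   (norm x >= 1/16 --> comparable CC (U x) (infdist x (frontier Om) powr phi)) &
   (norm x < 1/16 --> two_regimes phi CC (exponents.Tsc ga (ln (1 / norm x))) (norm x) (extend0 eta x) (infdist x (frontier Om)) (U x))"
proof -
 interpret exponents ga phi q by fact
 \<comment> \<open>\<open>epigraph.rho L K\<close> is a formula in \<open>L\<close> and
   \<open>K\<close> alone, so it can be used before any cone exists. Its bounds are known only
   inside the locale; the fallback \<open>1/4\<close> makes them available here, and for an actual
   cone the first branch is taken.\<close>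
 define rho where "rho = (let r = epigraph.rho L K in if 0 < r & r <= 1/4 then r else 1/4)"
 have rho: "0 < rho" "rho <= 1/4" by (auto simp: rho_def Let_def)
 have dim: "DIM('b \<times> real) >= 2" using DIM_positive[where 'a='b] by simp
 define c1 where "c1 = (1 / (2 * real DIM('b \<times> real))) powr (1 / (1 + ga))"
 have c1: "c1 > 0" unfolding c1_def using DIM_positive[where 'a="'b \<times> real"] by simp
 obtain c C where cC: "c > 0" "C > 0" and
  Hb: "!!D::('b \<times> real) set. good_cone rho D ==> cone_bounds phi c C D"
  using cone_harmonic_bounds[OF rho phi] by blast
 obtain C2 where C2: "C2 > 0" and
  up: "!!D::('b \<times> real) set. good_cone rho D ==> upper_away ga C2 (D Int ball 0 1)"
  using solution_upper_away[OF ga rho] by blast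
 obtain M where M: "M > 0" and
  vb: "!!(D::('b \<times> real) set) H EH U EU lU x. cone_profile ga phi q D H EH U EU lU rho c C c1 C2 ==> x : D ==> norm x < 1/16 ==>
   U x >= M * (Tsc (ln (1 / norm x)) powr (1 - phi) * H x) &
   M * U x <= Tsc (ln (1 / norm x)) powr (1 - phi) * H x + infdist x (- D) powr phi"
  using vertex_bounds[OF ex rho(1) cC c1 C2 dim] by blast
 define E where "E = 4 * (C0 + C0 / d0 + 2 / h0)"
 have E: "E > 0" using pos by (auto simp: E_def intro!: add_pos_pos divide_pos_pos)
 obtain KK where KK: "KK > 0" and th: "!!r d U T et. r > 0 ==> d > 0 ==> T > 0 ==> et <= E * (d / r) ==> d / r <= E * et ==>
   c1 * d powr phi <= U ==> M * (T powr (1 - phi) * (c * d * r powr (phi - 1))) <= U ==>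
   M * U <= T powr (1 - phi) * (C * d * r powr (phi - 1)) + d powr phi ==>
   two_regimes phi KK T r et d U"
  using threshold_comparison[OF phi c1 M cC E] by blast
 define CC where "CC = KK + 1 / c1 + C2"
 have CC: "CC > 0" "KK <= CC" "1 / c1 <= CC" "C2 <= CC"
 proof -
  have "1 / c1 > 0" using c1 by simp
  then show "CC > 0" "KK <= CC" "1 / c1 <= CC" "C2 <= CC" using KK C2 unfolding CC_def by linarith+
 qed
 show ?thesis
 proof (rule that[OF CC(1)])
  fix S :: "('b \<times> real) set" and g eta U Om x
  assume S: "C11_epigraphical_cone S g" and gn: "cone_norms g L K" and freq: "is_frequency S phi"
   and df: "defining_function S d0 h0 C0 eta" and Om: "Om = Cone S Int ball 0 1" and sol: "is_solution ga Om U" and x: "x : Om"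
  interpret ep: epigraph g L K using S gn by unfold_locales (auto simp: C11_epigraphical_cone_def)
  have CS: "S <= sphere 0 1" "Cone S = ep.D" using S by (auto simp: C11_epigraphical_cone_def ep.D_def)
  have "rho = ep.rho" using ep.rho by (simp add: rho_def)
  then have gD: "good_cone rho ep.D" using ep.good_cone_D by simp
  interpret ct: cone_trace S ep.D rho using CS gD by unfold_locales
  have ne: "sph_frontier S ~= {}" using ep.frontier_D_nontrivial ct.normalise_frontier by blast
  have OmD: "Om = ep.D Int ball 0 1" using Om CS by simp
  note est = ct.solution_estimates[OF ex dim cC C2 freq sol[unfolded OmD] Hb[OF gD] up[OF gD], folded c1_def OmD]
  have xD: "x : ep.D" using x by (simp add: OmD)
  have nx: "norm x > 0" and dx: "infdist x (- ep.D) > 0" using infdist_cone_bounds[OF gD xD] by auto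
  have Ux: "U x > 0" using sol x by (simp add: is_solution_def)
  have low: "c1 * infdist x (frontier Om) powr phi <= U x" by (rule est(1)[OF x])
  show "(norm x >= 1/16 --> comparable CC (U x) (infdist x (frontier Om) powr phi)) &
   (norm x < 1/16 --> two_regimes phi CC (Tsc (ln (1 / norm x))) (norm x) (extend0 eta x) (infdist x (frontier Om)) (U x))"
  proof (cases "norm x >= 1/16")
   case True
   have "U x <= CC * infdist x (frontier Om) powr phi" by (rule le_const_mult[OF est(2)[OF x True] CC(4)]) simp
   moreover have "infdist x (frontier Om) powr phi <= 1 / c1 * U x" using low c1 by (simp add: pos_le_divide_eq mult.commute)
   ultimately show ?thesis using True le_const_mult[OF _ CC(3)] Ux by (simp add: comparable_def)
  next
   case False
   define T where "T = Tsc (ln (1 / norm x))"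
   have T: "T >= 1" unfolding T_def using False nx by (intro Tsc_ge_1 ln_inverse_ge) auto
   have dd: "infdist x (frontier Om) = infdist x (- ep.D)" using est(3)[OF xD] False by simp
   obtain H EH EU lU where cp: "cone_profile ga phi q ep.D H EH U EU lU rho c C c1 C2" using est(4) by blast
   have Hx: "c * infdist x (- ep.D) * norm x powr (phi - 1) <= H x" "H x <= C * infdist x (- ep.D) * norm x powr (phi - 1)"
    by (rule cone_profile.Hb(3)[OF cp xD] cone_profile.Hb(4)[OF cp xD])+
   have v: "M * (T powr (1 - phi) * H x) <= U x" "M * U x <= T powr (1 - phi) * H x + infdist x (- ep.D) powr phi"
    using vb[OF cp xD] False by (auto simp: T_def)
   have "M * (T powr (1 - phi) * (c * infdist x (- ep.D) * norm x powr (phi - 1))) <= M * (T powr (1 - phi) * H x)"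
    using Hx M by (intro mult_left_mono) auto
   then have v1: "M * (T powr (1 - phi) * (c * infdist x (- ep.D) * norm x powr (phi - 1))) <= U x" using v by linarith
   have "T powr (1 - phi) * H x <= T powr (1 - phi) * (C * infdist x (- ep.D) * norm x powr (phi - 1))"
    using Hx by (intro mult_left_mono) auto
   then have v2: "M * U x <= T powr (1 - phi) * (C * infdist x (- ep.D) * norm x powr (phi - 1)) + infdist x (- ep.D) powr phi"
    using v by linarith
   have et: "extend0 eta x <= E * (infdist x (- ep.D) / norm x)" "infdist x (- ep.D) / norm x <= E * extend0 eta x"
    using ct.defining_function_bounds[OF ne df pos xD] by (simp_all add: E_def)
   have "0 < infdist x (- ep.D) / norm x" using dx nx by simp
   then have et0: "extend0 eta x >= 0" using et(2) E by (smt (verit) mult_pos_neg)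
   have "two_regimes phi KK T (norm x) (extend0 eta x) (infdist x (- ep.D)) (U x)"
    by (rule th[OF nx dx _ et _ v1 v2]) (use T low dd in auto)
   then show ?thesis unfolding T_def[symmetric] dd using False Ux et0
    by (auto simp: two_regimes_def intro!: comparable_mono[OF _ CC(2)])
  qed
 qed
qed

theorem theorem1p1:
  fixes \<gamma> L K d0 h0 C0 :: real
  assumes "\<gamma> > 1" and "d0 > 0" and "h0 > 0" and "C0 > 0"
  shows "\<exists>C>0. \<forall>(S :: ((real ^ 'm) \<times> real) set) g eta U \<Omega>.
    C11_epigraphical_cone S g \<and> cone_norms g L K \<and>
    is_frequency S (2 / (1 + \<gamma>)) \<and>
    defining_function S d0 h0 C0 eta \<and>
    \<Omega> = Cone S \<inter> ball 0 1 \<and>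
    is_solution \<gamma> \<Omega> U
    \<longrightarrow>
    (1 < \<gamma> \<and> \<gamma> < 2 \<longrightarrow>
      (\<forall>x \<in> \<Omega> - ball 0 (1/16).
         comparable C (U x) (infdist x (frontier \<Omega>) powr (2 / (1 + \<gamma>)))) \<and>
      (\<forall>x \<in> \<Omega> \<inter> ball 0 (1/16). extend0 eta x \<le> ln (1 / norm x) powr (1 / (1 - \<gamma>)) \<longrightarrow>
         comparable C (U x) (norm x powr (2 / (1 + \<gamma>)) * extend0 eta x powr (2 / (1 + \<gamma>))) \<and>
         comparable C (norm x powr (2 / (1 + \<gamma>)) * extend0 eta x powr (2 / (1 + \<gamma>)))
           (infdist x (frontier \<Omega>) powr (2 / (1 + \<gamma>)))) \<and>
      (\<forall>x \<in> \<Omega> \<inter> ball 0 (1/16). extend0 eta x \<ge> ln (1 / norm x) powr (1 / (1 - \<gamma>)) \<longrightarrow>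
         comparable C (U x)
           (norm x powr (2 / (1 + \<gamma>)) * ln (1 / norm x) powr (1 / (1 + \<gamma>)) * extend0 eta x)))
    \<and>
    (\<gamma> = 2 \<longrightarrow>
      (\<forall>x \<in> \<Omega> - ball 0 (1/16).
         comparable C (U x) (infdist x (frontier \<Omega>) powr (2 / 3))) \<and>
      (\<forall>x \<in> \<Omega> \<inter> ball 0 (1/16).
         extend0 eta x \<le> inverse (ln (1 / norm x) * ln (ln (1 / norm x))) \<longrightarrow>
         comparable C (U x) (norm x powr (2 / 3) * extend0 eta x powr (2 / 3)) \<and>
         comparable C (norm x powr (2 / 3) * extend0 eta x powr (2 / 3))
           (infdist x (frontier \<Omega>) powr (2 / 3))) \<and>
      (\<forall>x \<in> \<Omega> \<inter> ball 0 (1/16).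
         extend0 eta x \<ge> inverse (ln (1 / norm x) * ln (ln (1 / norm x))) \<longrightarrow>
         comparable C (U x)
           (norm x powr (2 / 3) * (ln (1 / norm x) * ln (ln (1 / norm x))) powr (1 / 3)
             * extend0 eta x)))
    \<and>
    (\<gamma> > 2 \<longrightarrow>
      (\<forall>x \<in> \<Omega> - ball 0 (1/16).
         comparable C (U x) (infdist x (frontier \<Omega>) powr (2 / (1 + \<gamma>)))) \<and>
      (\<forall>x \<in> \<Omega> \<inter> ball 0 (1/16). extend0 eta x \<le> inverse (ln (1 / norm x)) \<longrightarrow>
         comparable C (U x) (norm x powr (2 / (1 + \<gamma>)) * extend0 eta x powr (2 / (1 + \<gamma>))) \<and>
         comparable C (norm x powr (2 / (1 + \<gamma>)) * extend0 eta x powr (2 / (1 + \<gamma>)))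
           (infdist x (frontier \<Omega>) powr (2 / (1 + \<gamma>)))) \<and>
      (\<forall>x \<in> \<Omega> \<inter> ball 0 (1/16). extend0 eta x \<ge> inverse (ln (1 / norm x)) \<longrightarrow>
         comparable C (U x)
           (norm x powr (2 / (1 + \<gamma>)) * ln (1 / norm x) powr ((\<gamma> - 1) / (1 + \<gamma>))
             * extend0 eta x)))"
proof -
 define \<phi> where "\<phi> = 2 / (1 + \<gamma>)"
 define q where "q = (2 - \<gamma>) / \<phi>"
 have ex: "exponents \<gamma> \<phi> q" using assms(1) by unfold_locales (simp_all add: \<phi>_def q_def)
 interpret exponents \<gamma> \<phi> q by fact
 have \<phi>': "1 - \<phi> = (\<gamma> - 1) / (1 + \<gamma>)" using assms(1) by (simp add: \<phi>_def field_simps)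
 \<comment> \<open>The exponent is
   \<open>(1 - \<phi>) / (\<gamma> - 1) = 1 / (1 + \<gamma>)\<close>, which explains why the power
   of the logarithm differs in form from the case \<open>\<gamma> > 2\<close>.\<close>
 have T1: "1 / Tsc t = t powr (1 / (1 - \<gamma>))" "Tsc t powr (1 - \<phi>) = t powr (1 / (1 + \<gamma>))" if "\<gamma> < 2" for t
 proof -
  have "1 / (1 - \<gamma>) = - (1 / (\<gamma> - 1))" using minus_divide_right[of 1 "\<gamma> - 1"] by simp
  then show "1 / Tsc t = t powr (1 / (1 - \<gamma>))" using that by (simp add: Tsc_def powr_minus_divide)
  have "1 / (\<gamma> - 1) * (1 - \<phi>) = 1 / (1 + \<gamma>)" using assms(1) unfolding \<phi>' by simp
  then show "Tsc t powr (1 - \<phi>) = t powr (1 / (1 + \<gamma>))" using that by (simp add: Tsc_def powr_powr)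
 qed
 have T2: "1 / Tsc t = inverse (t * ln t)" "Tsc t powr (1 - \<phi>) = (t * ln t) powr (1 / 3)" "\<phi> = 2 / 3" if "\<gamma> = 2" for t
 proof -
  show "\<phi> = 2 / 3" using case_eq2[OF that] by simp
  then have "1 - \<phi> = 1 / 3" by simp
  then show "1 / Tsc t = inverse (t * ln t)" "Tsc t powr (1 - \<phi>) = (t * ln t) powr (1 / 3)"
   using Tsc_eq2[OF that, of t] by (simp_all only: inverse_eq_divide)
 qed
 have T3: "1 / Tsc t = inverse t" "Tsc t powr (1 - \<phi>) = t powr ((\<gamma> - 1) / (1 + \<gamma>))" if "\<gamma> > 2" for t
  using that by (simp_all add: Tsc_def \<phi>' inverse_eq_divide)
 obtain C where C: "C > 0" and main:
  "!!(S :: ((real ^ 'm) \<times> real) set) g eta U \<Omega> x. C11_epigraphical_cone S g ==> cone_norms g L K ==>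
   is_frequency S \<phi> ==> defining_function S d0 h0 C0 eta ==> \<Omega> = Cone S Int ball 0 1 ==> is_solution \<gamma> \<Omega> U ==> x : \<Omega> ==>
   (norm x >= 1/16 --> comparable C (U x) (infdist x (frontier \<Omega>) powr \<phi>)) &
   (norm x < 1/16 --> two_regimes \<phi> C (Tsc (ln (1 / norm x))) (norm x) (extend0 eta x) (infdist x (frontier \<Omega>)) (U x))"
  using main_estimate[OF ex assms(2-4)] by blast
 show ?thesis
 proof (intro exI[of _ C] conjI[OF C] allI impI, elim conjE, goal_cases)
  case (1 S g eta U \<Omega>)
  note m = main[OF 1(1,2) 1(3)[folded \<phi>_def] 1(4-6), unfolded two_regimes_def]
  consider "\<gamma> < 2" | "\<gamma> = 2" | "\<gamma> > 2" by linarith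
  then show ?case
  proof cases
   case 1
   then show ?thesis using m[unfolded T1[OF 1], unfolded \<phi>_def] by auto
  next
   case 2
   then show ?thesis using m[unfolded T2(1,2)[OF 2], unfolded T2(3)[OF 2]] by auto
  next
   case 3
   then show ?thesis using m[unfolded T3[OF 3], unfolded \<phi>_def] by auto
  qed
 qed
qed

end
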